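(* Let $B$ be a Banach space that does not have the Radon-Nikod\'ym property. Then $B$ contains a biLipschitz copy of a metric measure space $(X_\infty,d_\infty,\mu_\infty)$ satisfying the differentiation nonembeddability criterion. The metric measure space $(X_\infty,d_\infty,\mu_\infty)$ is an inverse limit of an admissible inverse system of graphs and has non-Euclidean tangent cones at almost every point, i.e. for $\mu_\infty$-almost every $x\in X_\infty$ there is a tangent cone of $X_\infty$ at $x$ which is not biLipschitz equivalent to any $\mathbb R^k$.
   Context: RNP. A Banach space $B$ has the Radon-Nikod\'ym property (RNP) if every Lipschitz map $\mathbb R\to B$ is differentiable Lebesgue-almost everywhere. Tangent cones. A tangent cone of a metric space $(X,d)$ at $x$ is the ultralimit, along a nonprincipal ultrafilter on $\mathbb N$, of pointed metric spaces $(X,\frac1{r_i}d,x)$ for some sequence $r_i$ decreasing to $0$. Differentiation nonembeddability criterion. A metric measure space $(X,d,\mu)$ admits an RNP Lipschitz differentiable structure if there are countably many measurable sets $U_\alpha$ covering $X$ up to a $\mu$-null set and Lipschitz maps (charts) $\phi_\alpha:X\to\mathbb R^{k_\alpha}$ such that for every RNP Banach space $V$, every Lipschitz $f:X\to V$ and every $\alpha$, for $\mu$-a.e. $x\in U_\alpha$ there is a unique linear map $D_xf:\mathbb R^{k_\alpha}\to V$ with $\|f(y)-f(x)-D_xf(\phi_\alpha(y)-\phi_\alpha(x))\|=o(d(x,y))$ as $y\to x$. $(X,d,\mu)$ satisfies the differentiation nonembeddability criterion if it admits an RNP Lipschitz differentiable structure and it is not the case that for almost every point $x$ every tangent cone at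 $x$ is biLipschitz equivalent to $\mathbb R^k$ (where $k$ is the dimension of the target of the chart containing $x$). Admissible inverse systems (Cheeger-Kleiner). An admissible inverse system is a sequence of maps $X_0\xleftarrow{\pi_0}X_1\xleftarrow{\pi_1}X_2\leftarrow\cdots$ between nonempty connected graphs $X_i$, with path metrics $d_i$ and measures $\mu_i$, for which there are constants $m\in\{2,3,\dots\}$ and $\Delta,\theta,C\in[1,\infty)$ such that for all $i$: (1) all vertices of $X_i$ have valence at most $\Delta$ and every edge is isometric to an interval of length $m^{-i}$ with respect to $d_i$; (2) if $X_i'$ is the graph obtained by subdividing each edge of $X_i$ into $m$ edges of length $m^{-(i+1)}$, then $\pi_i:(X_{i+1},d_{i+1})\to(X_i',d_i)$ is open, simplicial, and an isometry on every edge; (3) every fiber $\pi_i^{-1}(x)$ has $d_{i+1}$-diameter at most $\theta m^{-(i+1)}$; (4) $\mu_i$ restricts to a constant multiple of arclength on each edge, and $\mu_i(e_1)/\mu_i(e_2)\in[C^{-1},C]$ for adjacent edges $e_1,e_2$; (5) $(\pi_i)_\#\mu_{i+1}=\mu_i$; (6) for every vertex $v$ of $X_i'$ and every $w\in\pi_i^{-1}(v)$, the ratio of the $\mu_{i+1}$-measure of the union of the edges of $X_{i+1}$ at $w$ that map onto $e'$ to $\mu_i(e')$ is the same for all edges $e'$ of $X_i'$ containing $v$. Its inverse limit is the metric measure space $(X_\infty,d_\infty,\mu_\infty)$ with $X_\infty$ the inverse limit set, $d_\infty=\lim_i d_i$ (of projections), and $\mu_\infty$ the measure whose pushforward to each $X_i$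 is $\mu_i$. *)

theory Defs
  imports
    "HOL-Analysis.Analysis"
    "HOL-Probability.Discrete_Topology"
    "HOL-Library.Landau_Symbols"
begin

section \<open>Metric notions\<close>

definition bilipschitz_embedding :: "'a metric \<Rightarrow> 'b metric \<Rightarrow> ('a \<Rightarrow> 'b) \<Rightarrow> bool" where
  "bilipschitz_embedding m1 m2 F \<longleftrightarrow>
     F \<in> mspace m1 \<rightarrow> mspace m2 \<and>
     (\<exists>L>0. \<forall>x\<in>mspace m1. \<forall>y\<in>mspace m1.
        mdist m1 x y / L \<le> mdist m2 (F x) (F y) \<and> mdist m2 (F x) (F y) \<le> L * mdist m1 x y)"

definition bilipschitz_equivalent :: "'a metric \<Rightarrow> 'b metric \<Rightarrow> bool" where
  "bilipschitz_equivalent m1 m2 \<longleftrightarrow>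
     (\<exists>F. bilipschitz_embedding m1 m2 F \<and> F ` mspace m1 = mspace m2)"

definition scale_metric :: "real \<Rightarrow> 'a metric \<Rightarrow> 'a metric" where
  "scale_metric c m = metric (mspace m, \<lambda>x y. c * mdist m x y)"

lemma Metric_space_scale:
  assumes "c > 0"
  shows "Metric_space (mspace m) (\<lambda>x y. c * mdist m x y)"
proof -
  interpret Metric_space "mspace m" "mdist m" by (rule Metric_space_mspace_mdist)
  show ?thesis
  proof
    show "c * mdist m x z \<le> c * mdist m x y + c * mdist m y z"
      if "x \<in> mspace m" "y \<in> mspace m" "z \<in> mspace m" for x y z
      using triangle[OF that] assms by (simp add: distrib_left[symmetric])
  qed (use assms in \<open>auto simp: commute\<close>)
qed

definition borel_of_metric :: "'a metric \<Rightarrow> 'a measure" where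
  "borel_of_metric m = sigma (mspace m) {U. openin (mtopology_of m) U}"

text \<open>The point set of \<open>\<real>\<^sup>k\<close> is that of \<^const>\<open>Euclidean_space\<close>: real sequences that vanish from
  index \<open>k\<close> on.\<close>

definition euclidean_k :: "nat \<Rightarrow> (nat \<Rightarrow> real) metric" where
  "euclidean_k k = metric (topspace (Euclidean_space k), \<lambda>u v. L2_set (\<lambda>i. u i - v i) {..<k})"

lemma Metric_space_euclidean_k:
  "Metric_space (topspace (Euclidean_space k)) (\<lambda>u v. L2_set (\<lambda>i. u i - v i) {..<k})"
proof
  show "L2_set (\<lambda>i. u i - v i) {..<k} = L2_set (\<lambda>i. v i - u i) {..<k}" for u v :: "nat \<Rightarrow> real"
    by (simp add: L2_set_def power2_commute)
  show "L2_set (\<lambda>i. u i - v i) {..<k} = 0 \<longleftrightarrow> u = v"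
    if "u \<in> topspace (Euclidean_space k)" "v \<in> topspace (Euclidean_space k)" for u v
    using that by (auto simp: topspace_Euclidean_space L2_set_eq_0_iff fun_eq_iff)
      (metis lessThan_iff linorder_not_le)
  show "L2_set (\<lambda>i. u i - w i) {..<k} \<le> L2_set (\<lambda>i. u i - v i) {..<k} + L2_set (\<lambda>i. v i - w i) {..<k}"
    for u v w :: "nat \<Rightarrow> real"
    using L2_set_triangle_ineq[of "\<lambda>i. u i - v i" "\<lambda>i. v i - w i" "{..<k}"] by simp
qed simp

lemma mspace_euclidean_k [simp]: "mspace (euclidean_k k) = {u. \<forall>i\<ge>k. u i = 0}"
  unfolding euclidean_k_def
  using Metric_space.mspace_metric[OF Metric_space_euclidean_k] by (simp add: topspace_Euclidean_space)

section \<open>Tangent cones\<close>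

definition nonprincipal_ultrafilter :: "nat filter \<Rightarrow> bool" where
  "nonprincipal_ultrafilter \<omega> \<longleftrightarrow>
     \<omega> \<noteq> bot \<and>
     (\<forall>P. eventually P \<omega> \<or> eventually (\<lambda>i. \<not> P i) \<omega>) \<and>
     (\<forall>n. \<not> eventually (\<lambda>i. i = n) \<omega>)"

definition bounded_seqs :: "(nat \<Rightarrow> 'a metric) \<Rightarrow> (nat \<Rightarrow> 'a) \<Rightarrow> (nat \<Rightarrow> 'a) set" where
  "bounded_seqs M p = {y. (\<forall>i. y i \<in> mspace (M i)) \<and> (\<exists>C. \<forall>i. mdist (M i) (p i) (y i) \<le> C)}"

definition ultra_dist :: "nat filter \<Rightarrow> (nat \<Rightarrow> 'a metric) \<Rightarrow> (nat \<Rightarrow> 'a) \<Rightarrow> (nat \<Rightarrow> 'a) \<Rightarrow> real" where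
  "ultra_dist \<omega> M y z = Lim \<omega> (\<lambda>i. mdist (M i) (y i) (z i))"

definition ultra_points ::
  "nat filter \<Rightarrow> (nat \<Rightarrow> 'a metric) \<Rightarrow> (nat \<Rightarrow> 'a) \<Rightarrow> (nat \<Rightarrow> 'a) set set" where
  "ultra_points \<omega> M p =
     bounded_seqs M p //
       {(y, z). y \<in> bounded_seqs M p \<and> z \<in> bounded_seqs M p \<and> ultra_dist \<omega> M y z = 0}"

text \<open>Points of the ultralimit of \<open>(M i, p i)\<close> are equivalence classes of sequences. The value \<open>0\<close>
  off the carrier is only there because \<^const>\<open>Metric_space\<close> asks for nonnegativity and symmetry
  on the whole type.\<close>

definition ultralimit ::
  "nat filter \<Rightarrow> (nat \<Rightarrow> 'a metric) \<Rightarrow> (nat \<Rightarrow> 'a) \<Rightarrow> (nat \<Rightarrow> 'a) set metric" where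
  "ultralimit \<omega> M p = metric (ultra_points \<omega> M p,
     \<lambda>A B. if A \<in> ultra_points \<omega> M p \<and> B \<in> ultra_points \<omega> M p
           then ultra_dist \<omega> M (SOME y. y \<in> A) (SOME z. z \<in> B) else 0)"

definition tangent_cone :: "'a metric \<Rightarrow> 'a \<Rightarrow> (nat \<Rightarrow> 'a) set metric \<Rightarrow> bool" where
  "tangent_cone m x T \<longleftrightarrow>
     (\<exists>\<omega> r. nonprincipal_ultrafilter \<omega> \<and> (\<forall>i. r i > 0) \<and> decseq r \<and> r \<longlonglongrightarrow> 0 \<and>
        T = ultralimit \<omega> (\<lambda>i. scale_metric (1 / r i) m) (\<lambda>_. x))"

lemma ultrafilter_convergent:
  fixes a :: "nat \<Rightarrow> real"
  assumes \<omega>: "nonprincipal_ultrafilter \<omega>" and bd: "\<And>i. \<bar>a i\<bar> \<le> C"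
  shows "(a \<longlongrightarrow> Lim \<omega> a) \<omega>"
proof -
  have ne: "\<omega> \<noteq> bot" using \<omega> by (simp add: nonprincipal_ultrafilter_def)
  have "eventually (\<lambda>x. x \<in> {-C..C}) (filtermap a \<omega>)"
    unfolding eventually_filtermap using bd by (intro always_eventually) (auto simp: abs_le_iff minus_le_iff)
  moreover have "filtermap a \<omega> \<noteq> bot" using ne by (simp add: filtermap_bot_iff)
  ultimately obtain x where x: "inf (nhds x) (filtermap a \<omega>) \<noteq> bot"
    using compact_filter[of "{-C..C}"] by (meson compact_Icc)
  have "(a \<longlongrightarrow> x) \<omega>"
  proof (rule topological_tendstoI)
    fix S assume S: "open S" "x \<in> S"
    show "eventually (\<lambda>i. a i \<in> S) \<omega>"
    proof (rule ccontr)
      assume "\<not> eventually (\<lambda>i. a i \<in> S) \<omega>"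
      then have "eventually (\<lambda>i. a i \<notin> S) \<omega>"
        using \<omega> unfolding nonprincipal_ultrafilter_def by blast
      then have "eventually (\<lambda>z. False) (inf (nhds x) (filtermap a \<omega>))"
        unfolding eventually_inf using S
        by (intro exI[of _ "\<lambda>z. z \<in> S"] exI[of _ "\<lambda>z. z \<notin> S"])
           (auto simp: eventually_filtermap eventually_nhds)
      with x show False by (simp add: trivial_limit_def)
    qed
  qed
  then show ?thesis using tendsto_Lim[OF ne] by blast
qed

lemma Metric_space_ultralimit:
  assumes \<omega>: "nonprincipal_ultrafilter \<omega>" and p: "\<And>i. p i \<in> mspace (M i)"
  shows "Metric_space (ultra_points \<omega> M p)
     (\<lambda>A B. if A \<in> ultra_points \<omega> M p \<and> B \<in> ultra_points \<omega> M p
           then ultra_dist \<omega> M (SOME y. y \<in> A) (SOME z. z \<in> B) else 0)"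
proof -
  let ?S = "bounded_seqs M p" and ?Q = "ultra_points \<omega> M p"
  let ?R = "{(y, z). y \<in> ?S \<and> z \<in> ?S \<and> ultra_dist \<omega> M y z = 0}"
  let ?r = "\<lambda>A :: (nat \<Rightarrow> 'a) set. SOME y. y \<in> A"
  have ne: "\<omega> \<noteq> bot" using \<omega> by (simp add: nonprincipal_ultrafilter_def)
  have met: "Metric_space (mspace (M i)) (mdist (M i))" for i by (rule Metric_space_mspace_mdist)
  note nn = Metric_space.nonneg[OF met] and cm = Metric_space.commute[OF met]
    and tri = Metric_space.triangle[OF met]
  have inS: "y i \<in> mspace (M i)" if "y \<in> ?S" for y i
    using that by (simp add: bounded_seqs_def)
  have lim: "((\<lambda>i. mdist (M i) (y i) (z i)) \<longlongrightarrow> ultra_dist \<omega> M y z) \<omega>" if "y \<in> ?S" "z \<in> ?S" for y z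
  proof -
    have "\<exists>C. \<forall>i. mdist (M i) (p i) (y i) \<le> C" "\<exists>D. \<forall>i. mdist (M i) (p i) (z i) \<le> D"
      using that by (simp_all add: bounded_seqs_def)
    then obtain C D where "\<And>i. mdist (M i) (p i) (y i) \<le> C" "\<And>i. mdist (M i) (p i) (z i) \<le> D"
      by metis
    then have "\<bar>mdist (M i) (y i) (z i)\<bar> \<le> C + D" for i
      using tri[OF inS[OF that(1)] p inS[OF that(2)], of i] cm[of i "y i" "p i"] nn
      by (simp add: abs_of_nonneg) (smt (verit))
    then show ?thesis unfolding ultra_dist_def by (rule ultrafilter_convergent[OF \<omega>])
  qed
  have d0: "0 \<le> ultra_dist \<omega> M y z" if "y \<in> ?S" "z \<in> ?S" for y z
    using lim[OF that] nn by (intro tendsto_lowerbound[OF _ _ ne]) auto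
  have dc: "ultra_dist \<omega> M y z = ultra_dist \<omega> M z y" for y z
    unfolding ultra_dist_def by (simp add: cm)
  have dt: "ultra_dist \<omega> M x z \<le> ultra_dist \<omega> M x y + ultra_dist \<omega> M y z"
    if "x \<in> ?S" "y \<in> ?S" "z \<in> ?S" for x y z
    by (rule tendsto_le[OF ne tendsto_add[OF lim lim] lim]) (use that tri inS in auto)
  have dr: "ultra_dist \<omega> M y y = 0" if "y \<in> ?S" for y
  proof -
    have "mdist (M i) (y i) (y i) = 0" for i
      using Metric_space.zero[OF met inS[OF that] inS[OF that]] by blast
    then have "((\<lambda>i. 0) \<longlongrightarrow> ultra_dist \<omega> M y y) \<omega>" using lim[OF that that] by simp
    then show ?thesis by (rule tendsto_unique[OF ne _ tendsto_const])
  qed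
  have eq: "equiv ?S ?R"
  proof (rule equivI)
    show "trans ?R"
    proof (rule transI)
      fix x y z assume *: "(x, y) \<in> ?R" "(y, z) \<in> ?R"
      then have "ultra_dist \<omega> M x z \<le> 0" using dt[of x y z] by auto
      then show "(x, z) \<in> ?R" using * d0[of x z] by auto
    qed
  qed (auto simp: refl_on_def sym_def dc dr)
  have Q: "?Q = ?S // ?R" by (simp add: ultra_points_def)
  have rep: "?r A \<in> A" "?r A \<in> ?S" if "A \<in> ?Q" for A
  proof -
    have "A \<noteq> {}" "A \<subseteq> ?S"
      using that in_quotient_imp_non_empty[OF eq] in_quotient_imp_subset[OF eq] unfolding Q by blast+
    then show "?r A \<in> A" "?r A \<in> ?S" using some_in_eq by blast+
  qed
  have zero: "ultra_dist \<omega> M (?r A) (?r B) = 0 \<longleftrightarrow> A = B" if "A \<in> ?Q" "B \<in> ?Q" for A B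
    using quotient_eq_iff[OF eq that[unfolded Q] rep(1)[OF that(1)] rep(1)[OF that(2)]]
      rep(2)[OF that(1)] rep(2)[OF that(2)] by auto
  show ?thesis
    by unfold_locales (use rep d0 dc dt zero in auto)
qed

section \<open>RNP and Lipschitz differentiable structures\<close>

text \<open>The predicate is about a closed linear subspace \<open>V\<close> of a Banach space; a Banach space that is
  given as a type is covered by \<open>V = UNIV\<close>.\<close>

definition RNP :: "'v::banach set \<Rightarrow> bool" where
  "RNP V \<longleftrightarrow>
     (\<forall>f::real \<Rightarrow> 'v. Lipschitz_continuous_map euclidean_metric (submetric euclidean_metric V) f \<longrightarrow>
        (AE t in lebesgue. f differentiable (at t)))"

text \<open>Linear maps \<open>\<real>\<^sup>k \<rightarrow> V\<close>; \<open>\<rightarrow>\<^sub>E\<close> makes such a map unique as a function on the whole type.\<close>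

definition linear_k :: "nat \<Rightarrow> 'v::real_normed_vector set \<Rightarrow> ((nat \<Rightarrow> real) \<Rightarrow> 'v) \<Rightarrow> bool" where
  "linear_k k V D \<longleftrightarrow>
     D \<in> mspace (euclidean_k k) \<rightarrow>\<^sub>E V \<and>
     (\<forall>u\<in>mspace (euclidean_k k). \<forall>v\<in>mspace (euclidean_k k). D (\<lambda>i. u i + v i) = D u + D v) \<and>
     (\<forall>c. \<forall>u\<in>mspace (euclidean_k k). D (\<lambda>i. c * u i) = c *\<^sub>R D u)"

definition chart_derivative ::
  "'a metric \<Rightarrow> nat \<Rightarrow> ('a \<Rightarrow> nat \<Rightarrow> real) \<Rightarrow> 'v::real_normed_vector set \<Rightarrow> ('a \<Rightarrow> 'v) \<Rightarrow> 'a \<Rightarrow>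
   ((nat \<Rightarrow> real) \<Rightarrow> 'v) \<Rightarrow> bool" where
  "chart_derivative m k \<phi> V f x D \<longleftrightarrow>
     linear_k k V D \<and>
     (\<lambda>y. norm (f y - f x - D (\<lambda>i. \<phi> y i - \<phi> x i))) \<in> o[atin (mtopology_of m) x](\<lambda>y. mdist m x y)"

definition differentiable_in_charts ::
  "'a metric \<Rightarrow> 'a measure \<Rightarrow> (nat \<Rightarrow> 'a set) \<Rightarrow> (nat \<Rightarrow> nat) \<Rightarrow> (nat \<Rightarrow> 'a \<Rightarrow> nat \<Rightarrow> real) \<Rightarrow>
   'v::banach set \<Rightarrow> bool" where
  "differentiable_in_charts m \<mu> U k \<phi> V \<longleftrightarrow>
     (\<forall>f. Lipschitz_continuous_map m (submetric euclidean_metric V) f \<longrightarrow>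
        (\<forall>\<alpha>. AE x in \<mu>. x \<in> U \<alpha> \<longrightarrow> (\<exists>!D. chart_derivative m (k \<alpha>) (\<phi> \<alpha>) V f x D)))"

text \<open>A definition cannot quantify over all Banach spaces at once, since these live on arbitrary
  types. It is enough to let \<open>V\<close> run over the closed subspaces of one Banach space \<open>\<ell>\<^sup>\<infinity>(J)\<close> with \<open>J\<close>
  the set of all functions \<open>X \<rightarrow> \<real>\<close> (think of coefficient families of finite linear combinations),
  because the closed linear span of a Lipschitz image of \<open>X\<close> embeds there linearly and
  isometrically. The lemma \<open>RNP_structure_every_Banach_space\<close> below proves that the structure
  defined here differentiates Lipschitz maps into every RNP Banach space on every type.\<close>

instance bcontfun :: (metric_space, banach) banach ..

type_synonym 'a universal_banach = "('a \<Rightarrow> real) discrete \<Rightarrow>\<^sub>C real"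

definition RNP_Lipschitz_differentiable_structure ::
  "'a metric \<Rightarrow> 'a measure \<Rightarrow> (nat \<Rightarrow> 'a set) \<Rightarrow> (nat \<Rightarrow> nat) \<Rightarrow> (nat \<Rightarrow> 'a \<Rightarrow> nat \<Rightarrow> real) \<Rightarrow> bool" where
  "RNP_Lipschitz_differentiable_structure m \<mu> U k \<phi> \<longleftrightarrow>
     sets \<mu> = sets (borel_of_metric m) \<and>
     (\<forall>\<alpha>. U \<alpha> \<in> sets \<mu>) \<and> (AE x in \<mu>. \<exists>\<alpha>. x \<in> U \<alpha>) \<and>
     (\<forall>\<alpha>. Lipschitz_continuous_map m (euclidean_k (k \<alpha>)) (\<phi> \<alpha>)) \<and>
     (\<forall>V::'a universal_banach set.
        closed V \<and> subspace V \<and> RNP V \<longrightarrow> differentiable_in_charts m \<mu> U k \<phi> V)"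

definition differentiation_nonembeddability_criterion :: "'a metric \<Rightarrow> 'a measure \<Rightarrow> bool" where
  "differentiation_nonembeddability_criterion m \<mu> \<longleftrightarrow>
     (\<exists>U k \<phi>. RNP_Lipschitz_differentiable_structure m \<mu> U k \<phi> \<and>
        \<not> (AE x in \<mu>. \<forall>T. tangent_cone m x T \<longrightarrow>
              (\<forall>\<alpha>. x \<in> U \<alpha> \<longrightarrow> bilipschitz_equivalent T (euclidean_k (k \<alpha>)))))"

section \<open>Metric graphs\<close>

text \<open>An edge is the set of its points, endpoints included. Since edges are isometric to intervals
  for the path metric there are no loops, but several edges may share both endpoints.\<close>

record 'a metric_graph =
  gmetric :: "'a metric"
  verts :: "'a set"
  edges :: "'a set set"

definition edge_param :: "real \<Rightarrow> 'a metric_graph \<Rightarrow> 'a set \<Rightarrow> (real \<Rightarrow> 'a) \<Rightarrow> bool" where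
  "edge_param l G e \<gamma> \<longleftrightarrow>
     e \<subseteq> mspace (gmetric G) \<and> bij_betw \<gamma> {0..l} e \<and>
     (\<forall>s\<in>{0..l}. \<forall>t\<in>{0..l}. mdist (gmetric G) (\<gamma> s) (\<gamma> t) = \<bar>s - t\<bar>) \<and>
     (\<forall>t\<in>{0..l}. \<gamma> t \<in> verts G \<longleftrightarrow> t = 0 \<or> t = l)"

text \<open>Paths are given by finite chains of points in which consecutive points lie on a common edge.\<close>

definition chains :: "'a metric_graph \<Rightarrow> 'a \<Rightarrow> 'a \<Rightarrow> 'a list set" where
  "chains G x y = {ps. ps \<noteq> [] \<and> hd ps = x \<and> last ps = y \<and>
                       successively (\<lambda>p q. \<exists>e\<in>edges G. p \<in> e \<and> q \<in> e) ps}"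

definition chain_length :: "'a metric_graph \<Rightarrow> 'a list \<Rightarrow> real" where
  "chain_length G ps = (\<Sum>i<length ps - 1. mdist (gmetric G) (ps ! i) (ps ! Suc i))"

definition connected_metric_graph :: "real \<Rightarrow> 'a metric_graph \<Rightarrow> bool" where
  "connected_metric_graph l G \<longleftrightarrow>
     mspace (gmetric G) \<noteq> {} \<and>
     mspace (gmetric G) = verts G \<union> \<Union>(edges G) \<and>
     (\<forall>e\<in>edges G. \<exists>\<gamma>. edge_param l G e \<gamma>) \<and>
     (\<forall>e\<in>edges G. \<forall>e'\<in>edges G. e \<noteq> e' \<longrightarrow> e \<inter> e' \<subseteq> verts G) \<and>
     (\<forall>x\<in>mspace (gmetric G). \<forall>y\<in>mspace (gmetric G).
        chains G x y \<noteq> {} \<and> mdist (gmetric G) x y = Inf (chain_length G ` chains G x y))"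

text \<open>Points of an edge are located by their distance from an endpoint \<open>v\<close>.\<close>

definition subdivide :: "real \<Rightarrow> nat \<Rightarrow> 'a metric_graph \<Rightarrow> 'a metric_graph" where
  "subdivide l n G =
     \<lparr>gmetric = gmetric G,
      verts = verts G \<union> {y. \<exists>e\<in>edges G. \<exists>v\<in>e \<inter> verts G. \<exists>j\<le>n.
                             y \<in> e \<and> mdist (gmetric G) v y = real j * (l / real n)},
      edges = {{y\<in>e. real j * (l / real n) \<le> mdist (gmetric G) v y \<and>
                     mdist (gmetric G) v y \<le> real (Suc j) * (l / real n)} | e v j.
               e \<in> edges G \<and> v \<in> e \<inter> verts G \<and> j < n}\<rparr>"

section \<open>Admissible inverse systems\<close>

text \<open>The bonding maps are isometric on edges, so an edge is never collapsed and a simplicial map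
  takes edges onto edges. As there are no loops, the valence of a vertex is the number of edges that
  contain it, and since distinct edges meet only in vertices, edges are adjacent iff they intersect.
  Arclength on an edge is Lebesgue measure in an isometric parametrization.\<close>

definition admissible_inverse_system ::
  "(nat \<Rightarrow> 'a metric_graph) \<Rightarrow> (nat \<Rightarrow> 'a \<Rightarrow> 'a) \<Rightarrow> (nat \<Rightarrow> 'a measure) \<Rightarrow> bool" where
  "admissible_inverse_system X \<pi> \<mu> \<longleftrightarrow>
   (\<exists>(m::nat) (\<Delta>::real) (\<theta>::real) (C::real).
     m \<ge> 2 \<and> \<Delta> \<ge> 1 \<and> \<theta> \<ge> 1 \<and> C \<ge> 1 \<and>
     (\<forall>i.
       let l = 1 / real m ^ i;
           X' = subdivide l m (X i)
       in
       connected_metric_graph l (X i) \<and>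
       (\<forall>v\<in>verts (X i). finite {e\<in>edges (X i). v \<in> e} \<and> real (card {e\<in>edges (X i). v \<in> e}) \<le> \<Delta>) \<and>
       open_map (mtopology_of (gmetric (X (Suc i)))) (mtopology_of (gmetric X')) (\<pi> i) \<and>
       \<pi> i ` verts (X (Suc i)) \<subseteq> verts X' \<and>
       (\<forall>e\<in>edges (X (Suc i)). \<pi> i ` e \<in> edges X') \<and>
       (\<forall>e\<in>edges (X (Suc i)). \<forall>y\<in>e. \<forall>z\<in>e.
          mdist (gmetric X') (\<pi> i y) (\<pi> i z) = mdist (gmetric (X (Suc i))) y z) \<and>
       (\<forall>y\<in>mspace (gmetric (X (Suc i))). \<forall>z\<in>mspace (gmetric (X (Suc i))).
          \<pi> i y = \<pi> i z \<longrightarrow> mdist (gmetric (X (Suc i))) y z \<le> \<theta> / real m ^ Suc i) \<and>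
       sets (\<mu> i) = sets (borel_of_metric (gmetric (X i))) \<and>
       (\<forall>e\<in>edges (X i). \<exists>c>0. \<exists>\<gamma>. edge_param l (X i) e \<gamma> \<and>
          (\<forall>A\<in>sets (\<mu> i). A \<subseteq> e \<longrightarrow>
             emeasure (\<mu> i) A = ennreal c * emeasure lborel {t\<in>{0..l}. \<gamma> t \<in> A})) \<and>
       (\<forall>e1\<in>edges (X i). \<forall>e2\<in>edges (X i). e1 \<inter> e2 \<noteq> {} \<longrightarrow>
          measure (\<mu> i) e1 / measure (\<mu> i) e2 \<in> {1 / C..C}) \<and>
       distr (\<mu> (Suc i)) (\<mu> i) (\<pi> i) = \<mu> i \<and>
       (\<forall>v\<in>verts X'. \<forall>w\<in>mspace (gmetric (X (Suc i))). \<pi> i w = v \<longrightarrow>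
          (\<exists>q. \<forall>e'\<in>edges X'. v \<in> e' \<longrightarrow>
             measure (\<mu> (Suc i)) (\<Union>{e\<in>edges (X (Suc i)). w \<in> e \<and> \<pi> i ` e = e'})
               / measure (\<mu> i) e' = q))))"

definition inverse_limit_set ::
  "(nat \<Rightarrow> 'a metric_graph) \<Rightarrow> (nat \<Rightarrow> 'a \<Rightarrow> 'a) \<Rightarrow> (nat \<Rightarrow> 'a) set" where
  "inverse_limit_set X \<pi> = {x. \<forall>i. x i \<in> mspace (gmetric (X i)) \<and> \<pi> i (x (Suc i)) = x i}"

definition inverse_limit_metric ::
  "(nat \<Rightarrow> 'a metric_graph) \<Rightarrow> (nat \<Rightarrow> 'a \<Rightarrow> 'a) \<Rightarrow> (nat \<Rightarrow> 'a) metric" where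
  "inverse_limit_metric X \<pi> = metric (inverse_limit_set X \<pi>,
     \<lambda>x y. if x \<in> inverse_limit_set X \<pi> \<and> y \<in> inverse_limit_set X \<pi>
           then lim (\<lambda>i. mdist (gmetric (X i)) (x i) (y i)) else 0)"

definition inverse_limit_measure ::
  "(nat \<Rightarrow> 'a metric_graph) \<Rightarrow> (nat \<Rightarrow> 'a \<Rightarrow> 'a) \<Rightarrow> (nat \<Rightarrow> 'a measure) \<Rightarrow> (nat \<Rightarrow> 'a) measure \<Rightarrow> bool" where
  "inverse_limit_measure X \<pi> \<mu> \<mu>inf \<longleftrightarrow>
     sets \<mu>inf = sets (borel_of_metric (inverse_limit_metric X \<pi>)) \<and>
     (\<forall>i. distr \<mu>inf (\<mu> i) (\<lambda>x. x i) = \<mu> i)"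

section \<open>Every RNP Banach space is covered\<close>

lemma norming_functional:
  fixes u :: "'v::real_normed_vector"
  obtains \<psi> where "linear \<psi>" "\<And>v. \<bar>\<psi> v\<bar> \<le> norm v" "\<psi> u = norm u"
proof -
  define \<A> where "\<A> = {G :: ('v \<times> real) set. subspace G \<and> (\<forall>v r. (v, r) \<in> G \<longrightarrow> r \<le> norm v) \<and> (u, norm u) \<in> G}"
  have "range (\<lambda>c. c *\<^sub>R (u, norm u)) \<in> \<A>"
  proof -
    have "subspace (range (\<lambda>c. c *\<^sub>R (u, norm u)))"
      using subspace_span[of "{(u, norm u)}"] by (simp add: span_singleton)
    moreover have "(u, norm u) \<in> range (\<lambda>c. c *\<^sub>R (u, norm u))"
      by (rule range_eqI[of _ _ 1]) simp
    ultimately show ?thesis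
      unfolding \<A>_def by (auto intro!: mult_right_mono)
  qed
  then have "\<A> \<noteq> {}" by blast
  then have "\<exists>M\<in>\<A>. \<forall>X\<in>\<A>. M \<subseteq> X \<longrightarrow> X = M"
  proof (rule subset_Zorn_nonempty)
    fix \<C> assume ne: "\<C> \<noteq> {}" and ch: "subset.chain \<A> \<C>"
    have sub: "\<C> \<subseteq> \<A>" and tot: "\<And>A B. A \<in> \<C> \<Longrightarrow> B \<in> \<C> \<Longrightarrow> A \<subseteq> B \<or> B \<subseteq> A"
      using ch by (auto simp: subset.chain_def)
    have "subspace (\<Union>\<C>)"
      unfolding subspace_def
    proof (intro conjI ballI allI)
      obtain D where D: "D \<in> \<C>" using ne by blast
      then have "subspace D" using sub unfolding \<A>_def by blast
      then show "0 \<in> \<Union>\<C>" using D subspace_0 by blast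
      fix x y assume "x \<in> \<Union>\<C>" "y \<in> \<Union>\<C>"
      then obtain A B where "A \<in> \<C>" "B \<in> \<C>" "x \<in> A" "y \<in> B" by blast
      then obtain D where D: "D \<in> \<C>" "x \<in> D" "y \<in> D" using tot[of A B] by blast
      then have "subspace D" using sub unfolding \<A>_def by blast
      then have "x + y \<in> D" using D by (simp add: subspace_add)
      then show "x + y \<in> \<Union>\<C>" using D(1) by blast
    next
      fix c x assume "x \<in> \<Union>\<C>"
      then obtain D where D: "D \<in> \<C>" "x \<in> D" by blast
      then have "subspace D" using sub unfolding \<A>_def by blast
      then have "c *\<^sub>R x \<in> D" using D by (simp add: subspace_scale)
      then show "c *\<^sub>R x \<in> \<Union>\<C>" using D(1) by blast
    qed
    then show "\<Union>\<C> \<in> \<A>"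
      using ne sub unfolding \<A>_def by blast
  qed
  then obtain M where "M \<in> \<A>" and mx: "\<And>X. X \<in> \<A> \<Longrightarrow> M \<subseteq> X \<Longrightarrow> X = M" by blast
  then have sM: "subspace M" and le: "\<And>v r. (v, r) \<in> M \<Longrightarrow> r \<le> norm v" and uM: "(u, norm u) \<in> M"
    unfolding \<A>_def by auto
  have add: "(v + w, r + s) \<in> M" if "(v, r) \<in> M" "(w, s) \<in> M" for v r w s
    using subspace_add[OF sM that] by simp
  have scl: "(c *\<^sub>R v, c * r) \<in> M" if "(v, r) \<in> M" for v r c
    using subspace_scale[OF sM that, of c] by simp
  have zM: "(0, 0) \<in> M" using subspace_0[OF sM] by (simp add: zero_prod_def)
  have total: "\<exists>c. (v0, c) \<in> M" for v0
  proof -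
    have key: "r - norm (v - v0) \<le> norm (w + v0) - s" if "(v, r) \<in> M" "(w, s) \<in> M" for v r w s
    proof -
      have "r + s \<le> norm (v + w)" using le add that by blast
      also have "\<dots> \<le> norm (v - v0) + norm (w + v0)"
        using norm_triangle_ineq[of "v - v0" "w + v0"] by simp
      finally show ?thesis by simp
    qed
    define c where "c = Sup {r - norm (v - v0) | v r. (v, r) \<in> M}"
    have lo: "r - norm (v - v0) \<le> c" if "(v, r) \<in> M" for v r
      unfolding c_def using that key[OF _ zM]
      by (intro cSup_upper) (auto intro!: bdd_aboveI[where M = "norm (0 + v0) - 0"])
    have up: "c \<le> norm (w + v0) - s" if "(w, s) \<in> M" for w s
      unfolding c_def using zM key[OF _ that] by (intro cSup_least) auto
    define G where "G = {(v + t *\<^sub>R v0, r + t * c) | v r t. (v, r) \<in> M}"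
    have "subspace G"
      unfolding subspace_def
    proof (intro conjI ballI allI)
      show "0 \<in> G" unfolding G_def using zM by (force simp: zero_prod_def)
      fix x y assume "x \<in> G" "y \<in> G"
      then obtain v r t w s t' where "(v, r) \<in> M" "(w, s) \<in> M"
        "x = (v + t *\<^sub>R v0, r + t * c)" "y = (w + t' *\<^sub>R v0, s + t' * c)"
        unfolding G_def by blast
      then show "x + y \<in> G"
        unfolding G_def
        by (intro CollectI exI[of _ "v + w"] exI[of _ "r + s"] exI[of _ "t + t'"])
           (auto simp: add algebra_simps)
    next
      fix a x assume "x \<in> G"
      then obtain v r t where "(v, r) \<in> M" "x = (v + t *\<^sub>R v0, r + t * c)"
        unfolding G_def by blast
      then show "a *\<^sub>R x \<in> G"
        unfolding G_def
        by (intro CollectI exI[of _ "a *\<^sub>R v"] exI[of _ "a * r"] exI[of _ "a * t"])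
           (auto simp: scl algebra_simps)
    qed
    moreover have MG: "M \<subseteq> G"
    proof
      fix x assume "x \<in> M"
      then show "x \<in> G" unfolding G_def
        by (intro CollectI exI[of _ "fst x"] exI[of _ "snd x"] exI[of _ 0]) auto
    qed
    moreover have "b \<le> norm a" if "(a, b) \<in> G" for a b
    proof -
      from that obtain v r t where vr: "(v, r) \<in> M" and a: "a = v + t *\<^sub>R v0" and b: "b = r + t * c"
        unfolding G_def by blast
      consider "t = 0" | "t > 0" | "t < 0" by linarith
      then show ?thesis
      proof cases
        case 1
        then show ?thesis using le vr a b by simp
      next
        case 2
        have eq: "t *\<^sub>R (inverse t *\<^sub>R v + v0) = a" using 2 by (simp add: a scaleR_add_right)
        have "t * c \<le> t * (norm (inverse t *\<^sub>R v + v0) - inverse t * r)"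
          using up[OF scl[OF vr, of "inverse t"]] 2 by (intro mult_left_mono) auto
        also have "\<dots> = norm (t *\<^sub>R (inverse t *\<^sub>R v + v0)) - r"
          using 2 by (simp add: right_diff_distrib)
        finally show ?thesis unfolding eq b by simp
      next
        case 3
        define s where "s = - t"
        have s: "s > 0" "t = - s" using 3 by (auto simp: s_def)
        have eq: "s *\<^sub>R (inverse s *\<^sub>R v - v0) = a" using s by (simp add: a scaleR_diff_right)
        have "s * (inverse s * r - norm (inverse s *\<^sub>R v - v0)) \<le> s * c"
          using lo[OF scl[OF vr, of "inverse s"]] s by (intro mult_left_mono) auto
        moreover have "s * (inverse s * r - norm (inverse s *\<^sub>R v - v0)) =
            r - norm (s *\<^sub>R (inverse s *\<^sub>R v - v0))"
          using s by (simp add: right_diff_distrib)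
        ultimately show ?thesis unfolding eq b using s by simp
      qed
    qed
    ultimately have "G \<in> \<A>" unfolding \<A>_def using uM by blast
    then have "G = M" using mx MG by blast
    moreover have "(v0, c) \<in> G" unfolding G_def
      using zM by (intro CollectI exI[of _ 0] exI[of _ "0::real"] exI[of _ 1]) auto
    ultimately show ?thesis by blast
  qed
  then obtain \<psi> where \<psi>: "\<And>v. (v, \<psi> v) \<in> M" by metis
  have uniq: "r = s" if "(v, r) \<in> M" "(v, s) \<in> M" for v r s
  proof -
    have *: "r \<le> s" if "(v, r) \<in> M" "(v, s) \<in> M" for r s
      using le[OF add[OF that(1) scl[OF that(2), of "-1"]]] by simp
    show ?thesis by (rule antisym[OF *[OF that] *[OF that(2,1)]])
  qed
  have "linear \<psi>"
  proof (rule linearI)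
    show "\<psi> (v + w) = \<psi> v + \<psi> w" for v w by (rule uniq[OF \<psi> add[OF \<psi> \<psi>]])
    show "\<psi> (c *\<^sub>R v) = c *\<^sub>R \<psi> v" for c v
      unfolding real_scaleR_def by (rule uniq[OF \<psi> scl[OF \<psi>]])
  qed
  moreover have "\<bar>\<psi> v\<bar> \<le> norm v" for v
    using le[OF \<psi>] le[OF scl[OF \<psi>[of v], of "-1"]] by (simp add: abs_le_iff)
  moreover have "\<psi> u = norm u" using uniq \<psi> uM by blast
  ultimately show ?thesis using that by blast
qed

lemma span_embedding:
  fixes f :: "'a \<Rightarrow> 'v::real_normed_vector"
  obtains T :: "'v \<Rightarrow> 'a universal_banach" where
    "linear T" "\<And>v. norm (T v) \<le> norm v" "\<And>v. v \<in> closure (span (f ` A)) \<Longrightarrow> norm (T v) = norm v"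
proof -
  define comb where "comb c = (\<Sum>b\<in>f ` {x\<in>A. c x \<noteq> 0}. c (inv_into A f b) *\<^sub>R b)" for c :: "'a \<Rightarrow> real"
  have comb: "\<exists>c. comb c = v" if vs: "v \<in> span (f ` A)" for v
  proof -
    obtain t r where t: "finite t" "t \<subseteq> f ` A" and v: "v = (\<Sum>b\<in>t. r b *\<^sub>R b)"
      using vs unfolding span_explicit by blast
    define c where "c x = (if f x \<in> t \<and> x = inv_into A f (f x) then r (f x) else 0)" for x
    have inv: "f (inv_into A f b) = b" "inv_into A f b \<in> A" if "b \<in> t" for b
      using that t(2) by (auto simp: f_inv_into_f inv_into_into)
    have c: "c (inv_into A f b) = r b" if "b \<in> t" for b
      using inv that by (simp add: c_def)
    have im: "f ` {x\<in>A. c x \<noteq> 0} = {b\<in>t. r b \<noteq> 0}"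
    proof
      show "f ` {x\<in>A. c x \<noteq> 0} \<subseteq> {b\<in>t. r b \<noteq> 0}"
        by (auto simp: c_def split: if_splits)
      show "{b\<in>t. r b \<noteq> 0} \<subseteq> f ` {x\<in>A. c x \<noteq> 0}"
      proof
        fix b assume b: "b \<in> {b\<in>t. r b \<noteq> 0}"
        then show "b \<in> f ` {x\<in>A. c x \<noteq> 0}"
          using inv[of b] c[of b] by (intro image_eqI[of _ _ "inv_into A f b"]) auto
      qed
    qed
    have "comb c = (\<Sum>b\<in>{b\<in>t. r b \<noteq> 0}. r b *\<^sub>R b)"
      unfolding comb_def im by (rule sum.cong) (auto simp: c)
    also have "\<dots> = v"
      unfolding v by (rule sum.mono_neutral_left) (use t in auto)
    finally show ?thesis by blast
  qed
  have "\<exists>\<psi>. linear \<psi> \<and> (\<forall>v::'v. \<bar>\<psi> v\<bar> \<le> norm v) \<and> \<psi> u = norm u" for u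
    by (rule norming_functional[of u]) blast
  then obtain \<psi> where \<psi>: "\<And>u. linear (\<psi> u)" "\<And>u v::'v. \<bar>\<psi> u v\<bar> \<le> norm v" "\<And>u. \<psi> u u = norm u"
    by metis
  have bc: "(\<lambda>J. \<psi> (comb (of_discrete J)) v) \<in> bcontfun" for v
    by (rule bcontfun_normI[where b = "norm v"]) (auto simp: continuous_on_open_vimage open_discrete \<psi>)
  define T where "T v = Bcontfun (\<lambda>J. \<psi> (comb (of_discrete J)) v)" for v
  have T: "apply_bcontfun (T v) J = \<psi> (comb (of_discrete J)) v" for v J
    unfolding T_def by (simp add: Bcontfun_inverse[OF bc])
  have lin: "linear T"
    by (rule linearI; rule bcontfun_eqI)
       (simp_all add: T plus_bcontfun.rep_eq scaleR_bcontfun.rep_eq linear_add[OF \<psi>(1)] linear_scale[OF \<psi>(1)])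
  have le: "norm (T v) \<le> norm v" for v
    by (rule norm_bound) (simp add: T \<psi>)
  have bl: "bounded_linear T"
    using lin le by (intro bounded_linear_intro[where K = 1]) (auto simp: linear_add linear_scale)
  have span: "norm (T v) = norm v" if v: "v \<in> span (f ` A)" for v
  proof -
    obtain c where c: "comb c = v" using comb[OF v] by blast
    have "norm v = norm (apply_bcontfun (T v) (discrete c))"
      by (simp add: T discrete_inverse c \<psi>)
    also have "\<dots> \<le> norm (T v)" by (rule norm_bounded)
    finally show ?thesis using le[of v] by simp
  qed
  have "norm (T v) = norm v" if v: "v \<in> closure (span (f ` A))" for v
  proof -
    obtain s where s: "\<And>n. s n \<in> span (f ` A)" "s \<longlonglongrightarrow> v"
      using v unfolding closure_sequential by blast
    have "(\<lambda>n. norm (T (s n))) \<longlonglongrightarrow> norm (T v)"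
      by (intro tendsto_norm bounded_linear.tendsto[OF bl] s)
    moreover have "(\<lambda>n. norm (T (s n))) \<longlonglongrightarrow> norm v"
      using tendsto_norm[OF s(2)] by (simp add: span s(1))
    ultimately show ?thesis by (rule LIMSEQ_unique)
  qed
  with lin le show ?thesis using that by blast
qed

lemma subspace_closure:
  fixes S :: "'v::real_normed_vector set"
  assumes "subspace S"
  shows "subspace (closure S)"
  unfolding subspace_def
proof (intro conjI ballI allI)
  show "0 \<in> closure S" using assms closure_subset subspace_0 by blast
  fix x y assume "x \<in> closure S" "y \<in> closure S"
  then obtain s t where "\<And>n. s n \<in> S" "s \<longlonglongrightarrow> x" "\<And>n. t n \<in> S" "t \<longlonglongrightarrow> y"
    unfolding closure_sequential by blast
  then show "x + y \<in> closure S"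
    unfolding closure_sequential
    by (intro exI[of _ "\<lambda>n. s n + t n"]) (auto intro: tendsto_add subspace_add assms)
next
  fix c x assume "x \<in> closure S"
  then obtain s where "\<And>n. s n \<in> S" "s \<longlonglongrightarrow> x"
    unfolding closure_sequential by blast
  then show "c *\<^sub>R x \<in> closure S"
    unfolding closure_sequential
    by (intro exI[of _ "\<lambda>n. c *\<^sub>R s n"]) (auto intro: tendsto_scaleR subspace_scale assms)
qed

lemma smallo_norm_le:
  assumes "(\<lambda>y. norm (h1 y)) \<in> o[F](g)" "(\<lambda>y. norm (h2 y)) \<in> o[F](g)"
    and "eventually (\<lambda>y. norm (h y) \<le> norm (h1 y) + C * norm (h2 y)) F"
  shows "(\<lambda>y. norm (h y)) \<in> o[F](g :: 'a \<Rightarrow> real)"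
proof -
  have "(\<lambda>y. norm (h1 y) + C * norm (h2 y)) \<in> o[F](g)"
    using assms(1,2) by (intro sum_in_smallo) auto
  moreover have "(\<lambda>y. norm (h y)) \<in> O[F](\<lambda>y. norm (h1 y) + C * norm (h2 y))"
    using assms(3) by (intro bigoI[where c = 1]) (auto elim!: eventually_mono)
  ultimately show ?thesis by (rule landau_o.big_small_trans[rotated])
qed

lemma eventually_atin_mspace: "eventually (\<lambda>y. y \<in> mspace m) (atin (mtopology_of m) x)"
  by (auto simp: eventually_atin intro!: exI[of _ "mspace m"] dest: openin_subset)
     (metis openin_topspace topspace_mtopology_of)

lemma RNP_structure_every_Banach_space:
  fixes V :: "'v::banach set"
  assumes str: "RNP_Lipschitz_differentiable_structure m \<mu> U k \<phi>"
    and V: "closed V" "subspace V" "RNP V"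
  shows "differentiable_in_charts m \<mu> U k \<phi> V"
  unfolding differentiable_in_charts_def
proof (intro allI impI)
  fix f \<alpha>
  assume f: "Lipschitz_continuous_map m (submetric euclidean_metric V) f"
  then have fV: "f x \<in> V" if "x \<in> mspace m" for x
    using that by (auto simp: Lipschitz_continuous_map_into_submetric)
  have \<phi>: "(\<lambda>i. \<phi> \<alpha> y i - \<phi> \<alpha> x i) \<in> mspace (euclidean_k (k \<alpha>))"
    if "x \<in> mspace m" "y \<in> mspace m" for x y
  proof -
    have "\<phi> \<alpha> \<in> mspace m \<rightarrow> mspace (euclidean_k (k \<alpha>))"
      using str unfolding RNP_Lipschitz_differentiable_structure_def Lipschitz_continuous_map_def by blast
    with that show ?thesis by (auto simp: Pi_iff)
  qed
  have UX: "U \<alpha> \<subseteq> mspace m"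
  proof -
    have "U \<alpha> \<in> sets (borel_of_metric m)"
      using str unfolding RNP_Lipschitz_differentiable_structure_def by blast
    then have "U \<alpha> \<subseteq> space (borel_of_metric m)" by (rule sets.sets_into_space)
    then show ?thesis by (simp add: borel_of_metric_def space_measure_of_conv)
  qed
  show "AE x in \<mu>. x \<in> U \<alpha> \<longrightarrow> (\<exists>!D. chart_derivative m (k \<alpha>) (\<phi> \<alpha>) V f x D)"
  proof (cases "V = {0}")
    case True
    have "\<exists>!D. chart_derivative m (k \<alpha>) (\<phi> \<alpha>) V f x D" if x: "x \<in> U \<alpha>" for x
    proof (rule ex1I)
      let ?D = "\<lambda>u\<in>mspace (euclidean_k (k \<alpha>)). 0::'v"
      have lin: "linear_k (k \<alpha>) V ?D" by (auto simp: linear_k_def True)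
      have "eventually (\<lambda>y. norm (f y - f x - ?D (\<lambda>i. \<phi> \<alpha> y i - \<phi> \<alpha> x i)) = 0) (atin (mtopology_of m) x)"
        using eventually_atin_mspace
      proof (rule eventually_mono)
        fix y assume "y \<in> mspace m"
        then show "norm (f y - f x - ?D (\<lambda>i. \<phi> \<alpha> y i - \<phi> \<alpha> x i)) = 0"
          using fV[of x] fV[of y] x UX \<phi>[of x y] True by auto
      qed
      from landau_o.small.in_cong[OF this] lin
      show "chart_derivative m (k \<alpha>) (\<phi> \<alpha>) V f x ?D"
        unfolding chart_derivative_def by simp
      fix D assume "chart_derivative m (k \<alpha>) (\<phi> \<alpha>) V f x D"
      then have "D \<in> mspace (euclidean_k (k \<alpha>)) \<rightarrow>\<^sub>E V"
        unfolding chart_derivative_def linear_k_def by blast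
      then show "D = ?D" using True by (auto simp: PiE_iff extensional_def fun_eq_iff)
    qed
    then show ?thesis by auto
  next
    case False
    then obtain b where b: "b \<in> V" "b \<noteq> 0" using subspace_0[OF V(2)] by blast
    \<comment> \<open>a translate of \<open>f\<close> whose image is not \<open>{0}\<close>\<close>
    obtain v0 where v0: "v0 \<in> V" "\<And>x. x \<in> mspace m \<Longrightarrow> \<exists>z\<in>mspace m. f z + v0 \<noteq> 0"
    proof (cases "\<exists>z\<in>mspace m. f z \<noteq> 0")
      case True
      then show ?thesis using that[of 0] subspace_0[OF V(2)] by auto
    next
      case False
      then show ?thesis using that[of b] b by auto
    qed
    define f' where "f' x = f x + v0" for x
    define S where "S = closure (span (f' ` mspace m))"
    have "span (f' ` mspace m) \<subseteq> V"
      using V(2) fV v0(1) by (intro span_minimal) (auto simp: f'_def subspace_add)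
    then have SV: "S \<subseteq> V" unfolding S_def using V(1) by (rule closure_minimal)
    have sS: "subspace S" unfolding S_def by (rule subspace_closure[OF subspace_span])
    have cS: "complete S" unfolding S_def by (simp add: complete_eq_closed)
    have f'S: "f' x \<in> S" if "x \<in> mspace m" for x
      proof -
      have "f' x \<in> span (f' ` mspace m)" using that by (intro span_base imageI)
      then show ?thesis unfolding S_def by (rule subsetD[OF closure_subset])
    qed
    obtain T :: "'v \<Rightarrow> 'a universal_banach" where T: "linear T" "\<And>v. norm (T v) \<le> norm v"
      "\<And>v. v \<in> S \<Longrightarrow> norm (T v) = norm v"
      using span_embedding[of f' "mspace m"] unfolding S_def by metis
    have blT: "bounded_linear T"
      using T(1,2) by (intro bounded_linear_intro[where K = 1]) (auto simp: linear_add linear_scale)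
    define W where "W = T ` S"
    have injT: "inj_on T S"
    proof (rule inj_onI)
      fix v w assume vw: "v \<in> S" "w \<in> S" "T v = T w"
      then have "norm (T (v - w)) = norm (v - w)" using T(3) subspace_diff[OF sS] by blast
      then show "v = w" using vw by (simp add: linear_diff[OF T(1)])
    qed
    define R where "R = inv_into S T"
    have RT: "R (T v) = v" if "v \<in> S" for v using that injT by (simp add: R_def)
    have TR: "T (R w) = w" "R w \<in> S" if "w \<in> W" for w
      using that by (auto simp: R_def W_def f_inv_into_f inv_into_into)
    have sW: "subspace W" unfolding W_def by (rule linear_subspace_image[OF T(1) sS])
    have "complete W" unfolding W_def
      by (rule complete_isometric_image[of 1, OF _ sS blT _ cS]) (auto simp: T(3))
    then have cW: "closed W" by (rule complete_imp_closed)
    have normR: "norm (R w) = norm w" if "w \<in> W" for w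
      using T(3)[OF TR(2)[OF that]] TR(1)[OF that] by simp
    have Radd: "R (v + w) = R v + R w" and Rdiff: "R (v - w) = R v - R w" if "v \<in> W" "w \<in> W" for v w
    proof -
      have "T (R v + R w) = v + w" "T (R v - R w) = v - w"
        using that TR by (simp_all add: linear_add[OF T(1)] linear_diff[OF T(1)])
      moreover have "R v + R w \<in> S" "R v - R w \<in> S"
        using that TR sS by (auto simp: subspace_add subspace_diff)
      ultimately show "R (v + w) = R v + R w" "R (v - w) = R v - R w"
        using RT by metis+
    qed
    have Rscl: "R (c *\<^sub>R w) = c *\<^sub>R R w" if "w \<in> W" for c w
    proof -
      have "T (c *\<^sub>R R w) = c *\<^sub>R w" using that TR by (simp add: linear_scale[OF T(1)])
      moreover have "c *\<^sub>R R w \<in> S" using that TR sS by (auto simp: subspace_scale)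
      ultimately show ?thesis using RT by metis
    qed
    have "RNP W"
      unfolding RNP_def
    proof (intro allI impI)
      fix h :: "real \<Rightarrow> 'a universal_banach"
      assume h: "Lipschitz_continuous_map euclidean_metric (submetric euclidean_metric W) h"
      then have hW: "h t \<in> W" for t by (auto simp: Lipschitz_continuous_map_into_submetric)
      have "dist (R (h s)) (R (h t)) = dist (h s) (h t)" for s t
        using Rdiff[OF hW hW, of s t] normR[OF subspace_diff[OF sW hW hW], of s t] by (simp add: dist_norm)
      then have "Lipschitz_continuous_map euclidean_metric (submetric euclidean_metric V) (\<lambda>t. R (h t))"
        using h TR(2)[OF hW] SV unfolding Lipschitz_continuous_map_def by auto
      then have "AE t in lebesgue. (\<lambda>t. R (h t)) differentiable (at t)"
        using V(3) unfolding RNP_def by blast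
      then show "AE t in lebesgue. h differentiable (at t)"
      proof (rule AE_mp, intro AE_I2 impI)
        fix t assume "(\<lambda>t. R (h t)) differentiable (at t)"
        then obtain D where "((\<lambda>t. R (h t)) has_derivative D) (at t)"
          unfolding differentiable_def by blast
        from bounded_linear.has_derivative[OF blT this]
        show "h differentiable (at t)"
          unfolding differentiable_def using TR(1)[OF hW] by auto
      qed
    qed
    then have diffW: "differentiable_in_charts m \<mu> U k \<phi> W"
      using str cW sW unfolding RNP_Lipschitz_differentiable_structure_def by blast
    define g where "g x = T (f' x)" for x
    have gW: "g x \<in> W" if "x \<in> mspace m" for x
      using f'S[OF that] by (simp add: g_def W_def)
    have Rg: "R (g x) = f' x" if "x \<in> mspace m" for x
      using RT f'S[OF that] by (simp add: g_def)
    have "dist (g x) (g y) \<le> dist (f x) (f y)" for x y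
    proof -
      have "norm (g x - g y) = norm (T (f' x - f' y))" by (simp add: g_def linear_diff[OF T(1)])
      also have "\<dots> \<le> norm (f' x - f' y)" by (rule T(2))
      finally show ?thesis by (simp add: dist_norm f'_def)
    qed
    then have "Lipschitz_continuous_map m (submetric euclidean_metric W) g"
      using f gW unfolding Lipschitz_continuous_map_def by simp (meson order_trans)
    then have "AE x in \<mu>. x \<in> U \<alpha> \<longrightarrow> (\<exists>!D. chart_derivative m (k \<alpha>) (\<phi> \<alpha>) W g x D)"
      using diffW unfolding differentiable_in_charts_def by blast
    then show ?thesis
    proof (rule AE_mp, intro AE_I2 impI)
      fix x assume "x \<in> U \<alpha> \<longrightarrow> (\<exists>!D. chart_derivative m (k \<alpha>) (\<phi> \<alpha>) W g x D)" "x \<in> U \<alpha>"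
      then obtain D where D: "chart_derivative m (k \<alpha>) (\<phi> \<alpha>) W g x D"
        and uniq: "\<And>D'. chart_derivative m (k \<alpha>) (\<phi> \<alpha>) W g x D' \<Longrightarrow> D' = D" by blast
      have x: "x \<in> mspace m" using \<open>x \<in> U \<alpha>\<close> UX by blast
      let ?K = "mspace (euclidean_k (k \<alpha>))" and ?F = "atin (mtopology_of m) x"
      let ?p = "\<lambda>y i. \<phi> \<alpha> y i - \<phi> \<alpha> x i"
      have Kadd: "(\<lambda>i. u i + v i) \<in> ?K" and Kscl: "(\<lambda>i. c * u i) \<in> ?K" if "u \<in> ?K" "v \<in> ?K" for u v c
        using that by auto
      have DW: "D u \<in> W" if "u \<in> ?K" for u
        using D that unfolding chart_derivative_def linear_k_def by blast
      have Dext: "D \<in> extensional ?K"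
        using D unfolding chart_derivative_def linear_k_def PiE_def by blast
      have Dadd: "D (\<lambda>i. u i + v i) = D u + D v" if "u \<in> ?K" "v \<in> ?K" for u v
        using D that unfolding chart_derivative_def linear_k_def by blast
      have Dscl: "D (\<lambda>i. c * u i) = c *\<^sub>R D u" if "u \<in> ?K" for u c
        using D that unfolding chart_derivative_def linear_k_def by blast
      have Do: "(\<lambda>y. norm (g y - g x - D (?p y))) \<in> o[?F](\<lambda>y. mdist m x y)"
        using D unfolding chart_derivative_def by blast
      let ?E = "restrict (\<lambda>u. R (D u)) ?K"
      show "\<exists>!D. chart_derivative m (k \<alpha>) (\<phi> \<alpha>) V f x D"
      proof (rule ex1I)
        have "linear_k (k \<alpha>) V ?E"
          unfolding linear_k_def
        proof (intro conjI ballI allI)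
          show "?E \<in> ?K \<rightarrow>\<^sub>E V" using DW TR(2) SV by (intro restrict_PiE_iff[THEN iffD2]) blast
          fix u v assume "u \<in> ?K" "v \<in> ?K"
          then show "?E (\<lambda>i. u i + v i) = ?E u + ?E v"
            using Kadd[of u v] by (simp del: mspace_euclidean_k add: Dadd Radd DW)
        next
          fix c u assume "u \<in> ?K"
          then show "?E (\<lambda>i. c * u i) = c *\<^sub>R ?E u"
            using Kscl[of u u c] by (simp del: mspace_euclidean_k add: Dscl Rscl DW)
        qed
        moreover have "(\<lambda>y. norm (f y - f x - ?E (?p y))) \<in> o[?F](\<lambda>y. mdist m x y)"
        proof (rule smallo_norm_le[OF Do Do, where C = 0])
          show "eventually (\<lambda>y. norm (f y - f x - ?E (?p y)) \<le>
              norm (g y - g x - D (?p y)) + 0 * norm (g y - g x - D (?p y))) ?F"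
            using eventually_atin_mspace
          proof (rule eventually_mono)
            fix y assume y: "y \<in> mspace m"
            note p = \<phi>[OF x y]
            have gd: "g y - g x \<in> W" using gW x y sW by (simp add: subspace_diff)
            have "f y - f x - ?E (?p y) = f' y - f' x - R (D (?p y))"
              using p by (simp del: mspace_euclidean_k add: f'_def)
            also have "\<dots> = R (g y - g x - D (?p y))"
              using gW x y gd DW[OF p] by (simp add: Rdiff Rg)
            finally show "norm (f y - f x - ?E (?p y)) \<le>
              norm (g y - g x - D (?p y)) + 0 * norm (g y - g x - D (?p y))"
              using normR[OF subspace_diff[OF sW gd DW[OF p]]] by simp
          qed
        qed
        ultimately show "chart_derivative m (k \<alpha>) (\<phi> \<alpha>) V f x ?E"
          unfolding chart_derivative_def by blast
        then have E: "linear_k (k \<alpha>) V ?E"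
          "(\<lambda>y. norm (f y - f x - ?E (?p y))) \<in> o[?F](\<lambda>y. mdist m x y)"
          unfolding chart_derivative_def by blast+
        fix E' assume "chart_derivative m (k \<alpha>) (\<phi> \<alpha>) V f x E'"
        then have E': "linear_k (k \<alpha>) V E'"
          "(\<lambda>y. norm (f y - f x - E' (?p y))) \<in> o[?F](\<lambda>y. mdist m x y)"
          unfolding chart_derivative_def by blast+
        show "E' = ?E"
        proof (rule ccontr)
          assume "E' \<noteq> ?E"
          then obtain u where u: "u \<in> ?K" "E' u \<noteq> ?E u"
            using E(1) E'(1) PiE_ext[of E' ?K "\<lambda>_. V" ?E] unfolding linear_k_def by metis
          obtain \<psi> where \<psi>: "linear \<psi>" "\<And>v. \<bar>\<psi> v\<bar> \<le> norm v" "\<psi> (E' u - ?E u) = norm (E' u - ?E u)"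
            using norming_functional by blast
          obtain z where z: "z \<in> mspace m" "f' z \<noteq> 0" using v0(2)[OF x] unfolding f'_def by blast
          define w where "w = g z"
          have w: "w \<in> W" "w \<noteq> 0"
            using z gW[OF z(1)] T(3)[OF f'S[OF z(1)]] by (auto simp: w_def g_def)
          define L where "L v = \<psi> (E' v - ?E v)" for v
          have Ladd: "L (\<lambda>i. a i + b i) = L a + L b" if "a \<in> ?K" "b \<in> ?K" for a b
          proof -
            have "E' (\<lambda>i. a i + b i) = E' a + E' b" "?E (\<lambda>i. a i + b i) = ?E a + ?E b"
              using E(1) E'(1) that unfolding linear_k_def by blast+
            then show ?thesis
              unfolding L_def by (simp del: mspace_euclidean_k add: linear_diff[OF \<psi>(1)] linear_add[OF \<psi>(1)])
          qed
          have Lscl: "L (\<lambda>i. c * a i) = c * L a" if "a \<in> ?K" for a c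
          proof -
            have "E' (\<lambda>i. c * a i) = c *\<^sub>R E' a" "?E (\<lambda>i. c * a i) = c *\<^sub>R ?E a"
              using E(1) E'(1) that unfolding linear_k_def by blast+
            then show ?thesis
              unfolding L_def
              by (simp del: mspace_euclidean_k add: linear_diff[OF \<psi>(1)] linear_scale[OF \<psi>(1)] right_diff_distrib)
          qed
          have Lo: "(\<lambda>y. norm (L (?p y))) \<in> o[?F](\<lambda>y. mdist m x y)"
          proof (rule smallo_norm_le[OF E(2) E'(2), where C = 1], intro always_eventually allI)
            fix y
            have "norm (L (?p y)) \<le> norm (E' (?p y) - ?E (?p y))"
              unfolding L_def using \<psi>(2) by simp
            also have "\<dots> = norm ((f y - f x - ?E (?p y)) - (f y - f x - E' (?p y)))"
              by (rule arg_cong[where f = norm]) (simp add: algebra_simps)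
            also have "\<dots> \<le> norm (f y - f x - ?E (?p y)) + 1 * norm (f y - f x - E' (?p y))"
              unfolding mult_1 by (rule norm_triangle_ineq4)
            finally show "norm (L (?p y)) \<le> norm (f y - f x - ?E (?p y)) + 1 * norm (f y - f x - E' (?p y))" .
          qed
          let ?D = "restrict (\<lambda>v. D v + L v *\<^sub>R w) ?K"
          have "linear_k (k \<alpha>) W ?D"
            unfolding linear_k_def
          proof (intro conjI ballI allI)
            show "?D \<in> ?K \<rightarrow>\<^sub>E W"
              using DW w(1) sW by (intro restrict_PiE_iff[THEN iffD2]) (blast intro: subspace_add subspace_scale)
            fix a b assume "a \<in> ?K" "b \<in> ?K"
            then show "?D (\<lambda>i. a i + b i) = ?D a + ?D b"
              using Kadd[of a b] by (simp del: mspace_euclidean_k add: Dadd Ladd algebra_simps)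
          next
            fix c a assume "a \<in> ?K"
            then show "?D (\<lambda>i. c * a i) = c *\<^sub>R ?D a"
              using Kscl[of a a c] by (simp del: mspace_euclidean_k add: Dscl Lscl algebra_simps)
          qed
          moreover have "(\<lambda>y. norm (g y - g x - ?D (?p y))) \<in> o[?F](\<lambda>y. mdist m x y)"
          proof (rule smallo_norm_le[OF Do Lo, where C = "norm w"])
            show "eventually (\<lambda>y. norm (g y - g x - ?D (?p y)) \<le>
                norm (g y - g x - D (?p y)) + norm w * norm (L (?p y))) ?F"
              using eventually_atin_mspace
            proof (rule eventually_mono)
              fix y assume y: "y \<in> mspace m"
              have eq: "g y - g x - ?D (?p y) = (g y - g x - D (?p y)) - L (?p y) *\<^sub>R w"
                using \<phi>[OF x y] by (simp del: mspace_euclidean_k add: algebra_simps)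
              show "norm (g y - g x - ?D (?p y)) \<le>
                norm (g y - g x - D (?p y)) + norm w * norm (L (?p y))"
                unfolding eq using norm_triangle_ineq4[of "g y - g x - D (?p y)" "L (?p y) *\<^sub>R w"]
                by (simp only: norm_scaleR real_norm_def mult.commute)
            qed
          qed
          ultimately have "?D = D" using uniq unfolding chart_derivative_def by blast
          then have "?D u = D u" by simp
          then have "L u *\<^sub>R w = 0" using u(1) by (simp del: mspace_euclidean_k)
          then show False using w(2) u(2) \<psi>(3) by (simp del: mspace_euclidean_k add: L_def)
        qed
      qed
    qed
  qed
qed

end

theory Submission imports Defs "HOL-Probability.Probability"
begin

text \<open>A nondifferentiable Lipschitz curve in \<open>B\<close> can be chosen such that some functional is the identity
  along it. Its increments extend to an atomless vector measure \<open>G\<close>. Where the difference quotients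
  oscillate, no set of positive measure carries a nearly constant density of \<open>G\<close>, so by a Hahn
  decomposition it contains two sets of equal measure whose subsets have mean values separated by a
  functional. Exhaustion by such pairs yields a 4-adic tree of sets such that, at the infinitely many
  levels in a set \<open>S\<close>, the second and the third of the four children are always separated.

  Permuting these two children independently at the levels in \<open>S\<close> rearranges the curve. All
  rearranged curves together are the image of an inverse limit of graphs in which, at every level in
  \<open>S\<close>, the middle half of each edge is doubled. The separation is the lower Lipschitz bound of this map.

  At the scales \<open>1 / 4 ^ s\<close> with \<open>s \<in> S\<close> every point of the limit sees a doubled middle half, and so does
  a tangent cone; but in a Euclidean space two points cannot cut off two bounded pieces. A Lipschitz
  map to an RNP space is differentiable along almost every path. By a density argument, at almost
  every point the derivative of one path is nearly the slope on all edges of a comparable scale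
  nearby, and summation along geodesics shows that it is the derivative of the map.\<close>

section \<open>Vector measures\<close>

text \<open>The curve has no derivative to work with; what survives is the set function
  \<open>G\<close>, and separation is demanded of all subsets so that every descendant in the tree
  inherits it. Exhaustion leaves a remainder, and cutting into equal pieces involves rounding. Both
  losses are harmless because separated pairs have to supply only two of four children, while the
  remainder supplies the outer two. Rounding is small only after many subdivisions, which is why
  separation is obtained on an infinite set of levels and not on all.

  The outer children are never moved. In the grid of level \<open>j + 1\<close> the ends of a
  doubled piece of level \<open>j\<close> have odd index, so ends of different levels are different
  points and a vertex leaves at most one bit open. Valences, ratios of measures and the measures of
  neighbourhoods of edges are controlled by this.

  The functional that is the identity along the curve does not notice the swaps, since it only sees
  measures. It is the height of a point, and it gives the lower Lipschitz bound wherever no doubling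
  separates two points.\<close>

locale vector_measure = finite_measure M for M :: "'a measure" +
  fixes G :: "'a set \<Rightarrow> 'b::banach" and L :: real
  assumes G_Un: "A \<in> sets M \<Longrightarrow> B \<in> sets M \<Longrightarrow> A \<inter> B = {} \<Longrightarrow> G (A \<union> B) = G A + G B"
    and G_norm: "A \<in> sets M \<Longrightarrow> norm (G A) \<le> L * measure M A"
    and L_nonneg: "L \<ge> 0"
    and nonatomic: "A \<in> sets M \<Longrightarrow> 0 \<le> s \<Longrightarrow> s \<le> measure M A \<Longrightarrow>
      \<exists>B\<in>sets M. B \<subseteq> A \<and> measure M B = s"
begin

lemma G_empty [simp]: "G {} = 0"
  using G_Un[of "{}" "{}"] by simp

lemma G_UN:
  assumes "finite I" "\<And>i. i \<in> I \<Longrightarrow> A i \<in> sets M" "disjoint_family_on A I"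
  shows "G (\<Union>i\<in>I. A i) = (\<Sum>i\<in>I. G (A i))"
  using assms
proof (induction I)
  case (insert i I)
  have "A i \<inter> (\<Union>j\<in>I. A j) = {}"
    using insert.hyps insert.prems(2) by (auto simp: disjoint_family_on_def)
  moreover have "disjoint_family_on A I"
    using insert.prems(2) by (auto simp: disjoint_family_on_def)
  ultimately show ?case using insert by (simp add: G_Un sets.finite_UN)
qed simp

text \<open>Adding \<open>L * measure M A\<close> to \<open>\<psi> (G A)\<close> makes it
  nonnegative, and domination by a multiple of the measure gives continuity at the empty set. The
  result is a finite measure, to which the Hahn decomposition of two measures applies. Levels
  \<open>a < - L\<close> are treated apart, since a measure can only be scaled by a nonnegative
  factor.\<close>

lemma Hahn_split:
  fixes \<psi> :: "'b \<Rightarrow> real"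
  assumes \<psi>: "linear \<psi>" "\<And>v. \<bar>\<psi> v\<bar> \<le> norm v"
  obtains Y where "Y \<in> sets M" "\<And>X. X \<in> sets M \<Longrightarrow> X \<subseteq> Y \<Longrightarrow> \<psi> (G X) \<le> a * measure M X"
    "\<And>X. X \<in> sets M \<Longrightarrow> X \<inter> Y = {} \<Longrightarrow> a * measure M X \<le> \<psi> (G X)"
proof -
  have bd: "\<bar>\<psi> (G A)\<bar> \<le> L * measure M A" if "A \<in> sets M" for A
    using \<psi>(2)[of "G A"] G_norm[OF that] by linarith
  show ?thesis
  proof (cases "a + L < 0")
    case True
    show ?thesis
    proof (rule that[of "{}"])
      fix X assume X: "X \<in> sets M" "X \<inter> {} = {}"
      have "a * measure M X \<le> (- L) * measure M X"
        using True by (intro mult_right_mono) auto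
      then show "a * measure M X \<le> \<psi> (G X)" using bd[OF X(1)] by linarith
    qed (auto simp: linear_0[OF \<psi>(1)])
  next
    case False
    define h where "h A = \<psi> (G A) + L * measure M A" for A
    have h0: "0 \<le> h A" and h1: "h A \<le> 2 * L * measure M A" if "A \<in> sets M" for A
      using bd[OF that] by (auto simp: h_def abs_le_iff)
    have hU: "h (A \<union> B) = h A + h B" if "A \<in> sets M" "B \<in> sets M" "A \<inter> B = {}" for A B
      using that by (simp add: h_def G_Un linear_add[OF \<psi>(1)] finite_measure_Union algebra_simps)
    define N where "N = measure_of (space M) (sets M) (\<lambda>A. ennreal (h A))"
    have setsN: "sets N = sets M" unfolding N_def by (simp add: sets.sets_measure_of_eq)
    have "countably_additive (sets M) (\<lambda>A. ennreal (h A))"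
    proof (rule sets.empty_continuous_imp_countably_additive)
      show "positive (sets M) (\<lambda>A. ennreal (h A))"
        by (simp add: positive_def h_def linear_0[OF \<psi>(1)])
      show "additive (sets M) (\<lambda>A. ennreal (h A))"
        by (auto simp: additive_def hU h0)
      fix A :: "nat \<Rightarrow> 'a set" assume A: "range A \<subseteq> sets M" "decseq A" "(\<Inter>i. A i) = {}"
      have "(\<lambda>i. measure M (A i)) \<longlonglongrightarrow> measure M (\<Inter>i. A i)"
        by (rule finite_Lim_measure_decseq) (use A in auto)
      then have "(\<lambda>i. 2 * L * measure M (A i)) \<longlonglongrightarrow> 2 * L * 0"
        using A by (intro tendsto_mult tendsto_const) auto
      then have "(\<lambda>i. h (A i)) \<longlonglongrightarrow> 0"
        by (rule_tac tendsto_sandwich[of "\<lambda>_. 0" _ _ "\<lambda>i. 2 * L * measure M (A i)"])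
           (use A h0 h1 in \<open>auto intro!: always_eventually\<close>)
      then show "(\<lambda>i. ennreal (h (A i))) \<longlonglongrightarrow> 0"
        using tendsto_ennrealI by force
    qed auto
    then have N: "emeasure N A = ennreal (h A)" if "A \<in> sets M" for A
      unfolding N_def using that
      by (intro emeasure_measure_of_sigma) (auto simp: positive_def h_def linear_0[OF \<psi>(1)] sets.sigma_algebra_axioms)
    define M' where "M' = scale_measure (ennreal (a + L)) M"
    have M': "emeasure M' A = ennreal ((a + L) * measure M A)" for A
      using False by (simp add: M'_def emeasure_eq_measure ennreal_mult')
    have "\<exists>Y\<in>sets M'. Y \<subseteq> space M \<and> (\<forall>X\<in>sets M'. X \<subseteq> Y \<longrightarrow> N X \<le> M' X) \<and>
       (\<forall>X\<in>sets M'. X \<subseteq> space M \<longrightarrow> X \<inter> Y = {} \<longrightarrow> M' X \<le> N X)"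
    proof (rule unsigned_Hahn_decomposition)
      show "sets N = sets M'" "space M \<in> sets M'" by (simp_all add: setsN M'_def)
      show "emeasure M' (space M) \<noteq> top" "emeasure N (space M) \<noteq> top" by (simp_all add: M' N)
    qed
    then obtain Y where Y: "Y \<in> sets M" "\<And>X. X \<in> sets M \<Longrightarrow> X \<subseteq> Y \<Longrightarrow> N X \<le> M' X"
      "\<And>X. X \<in> sets M \<Longrightarrow> X \<inter> Y = {} \<Longrightarrow> M' X \<le> N X"
      using sets.sets_into_space[of _ M] by (metis M'_def sets_scale_measure)
    show ?thesis
    proof (rule that[OF Y(1)])
      fix X assume X: "X \<in> sets M" "X \<subseteq> Y"
      then have "h X \<le> (a + L) * measure M X"
        using Y(2)[OF X] False by (simp add: N M')
      then show "\<psi> (G X) \<le> a * measure M X" by (simp add: h_def algebra_simps)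
    next
      fix X assume X: "X \<in> sets M" "X \<inter> Y = {}"
      then have "(a + L) * measure M X \<le> h X"
        using Y(3)[OF X] False h0 by (simp add: N M')
      then show "a * measure M X \<le> \<psi> (G X)" by (simp add: h_def algebra_simps)
    qed
  qed
qed

text \<open>In terms of a density of \<open>G\<close>, which need not exist, this says that the
  density is within \<epsilon> of the constant \<open>w\<close> on \<open>A\<close>. The bound on
  all subsets replaces the pointwise bound.\<close>

definition concentrated :: "real \<Rightarrow> 'a set \<Rightarrow> bool" where
  "concentrated \<epsilon> A \<longleftrightarrow> (\<exists>w. \<forall>A'\<in>sets M. A' \<subseteq> A \<longrightarrow>
     norm (G A' - measure M A' *\<^sub>R w) \<le> \<epsilon> * measure M A')"

text \<open>The bounds are required of all subsets of \<open>P\<close> and \<open>Q\<close>, not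
  only of the two sets. This makes the property pass to pieces, and thereby to all later generations
  of the tree, with the same \<open>\<psi>\<close> and \<open>a\<close>.\<close>

definition separated_pair :: "real \<Rightarrow> 'a set \<Rightarrow> 'a set \<Rightarrow> bool" where
  "separated_pair \<epsilon> P Q \<longleftrightarrow> (\<exists>\<psi> a. linear \<psi> \<and> (\<forall>v. \<bar>\<psi> v\<bar> \<le> norm v) \<and>
     (\<forall>A\<in>sets M. A \<subseteq> P \<longrightarrow> (a + \<epsilon>) * measure M A \<le> \<psi> (G A)) \<and>
     (\<forall>A\<in>sets M. A \<subseteq> Q \<longrightarrow> \<psi> (G A) \<le> a * measure M A))"

lemma separated_pair_mono:
  "separated_pair \<epsilon> P Q \<Longrightarrow> P' \<subseteq> P \<Longrightarrow> Q' \<subseteq> Q \<Longrightarrow> separated_pair \<epsilon> P' Q'"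
  unfolding separated_pair_def by (meson order_trans)

lemma separated_pair_empty: "separated_pair \<epsilon> {} {}"
  unfolding separated_pair_def by (intro exI[of _ "\<lambda>_. 0"] exI[of _ 0]) (auto simp: linear_iff)

text \<open>The mean values of \<open>G\<close> over \<open>A\<close> and over a badly deviating
  subset \<open>A'\<close> are on different sides of the strip between \<open>a\<close> and
  \<open>a + \<epsilon>\<close> of a norming functional. A Hahn decomposition at each of the two
  levels therefore has a part of positive measure on its side of the strip, and these parts are
  trimmed to equal measure.\<close>

lemma separated_pair_exists:
  assumes A: "A \<in> sets M" "measure M A > 0" and nc: "\<not> concentrated (2 * \<epsilon>) A" and \<epsilon>: "\<epsilon> > 0"
  obtains P Q where "P \<in> sets M" "Q \<in> sets M" "P \<subseteq> A" "Q \<subseteq> A" "P \<inter> Q = {}"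
    "measure M P > 0" "measure M Q = measure M P" "separated_pair \<epsilon> P Q"
proof -
  define w where "w = G A /\<^sub>R measure M A"
  obtain A' where A': "A' \<in> sets M" "A' \<subseteq> A" "norm (G A' - measure M A' *\<^sub>R w) > 2 * \<epsilon> * measure M A'"
    using nc unfolding concentrated_def by (meson not_le)
  obtain \<psi> where \<psi>: "linear \<psi>" "\<And>v. \<bar>\<psi> v\<bar> \<le> norm v"
    "\<psi> (G A' - measure M A' *\<^sub>R w) = norm (G A' - measure M A' *\<^sub>R w)"
    using norming_functional by blast
  \<comment> \<open>\<open>A'\<close> deviates from the mean \<open>w\<close> by more than
    \<open>2 * \<epsilon>\<close>. Half of this puts the mean over \<open>A\<close> strictly below
    \<open>a\<close>; the other half is the width of the strip.\<close>
  define a where "a = \<psi> w + \<epsilon>"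
  have \<psi>w: "\<psi> (G A') > (a + \<epsilon>) * measure M A'"
    using A'(3) \<psi>(3) by (simp add: a_def linear_diff[OF \<psi>(1)] linear_scale[OF \<psi>(1)] algebra_simps)
  have \<psi>A: "\<psi> (G A) < a * measure M A"
    using A(2) \<epsilon> by (simp add: a_def w_def linear_scale[OF \<psi>(1)] field_simps)
  obtain Y where Y: "Y \<in> sets M" "\<And>X. X \<in> sets M \<Longrightarrow> X \<subseteq> Y \<Longrightarrow> \<psi> (G X) \<le> (a + \<epsilon>) * measure M X"
    "\<And>X. X \<in> sets M \<Longrightarrow> X \<inter> Y = {} \<Longrightarrow> (a + \<epsilon>) * measure M X \<le> \<psi> (G X)"
    using Hahn_split[OF \<psi>(1,2)] by metis
  obtain Z where Z: "Z \<in> sets M" "\<And>X. X \<in> sets M \<Longrightarrow> X \<subseteq> Z \<Longrightarrow> \<psi> (G X) \<le> a * measure M X"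
    "\<And>X. X \<in> sets M \<Longrightarrow> X \<inter> Z = {} \<Longrightarrow> a * measure M X \<le> \<psi> (G X)"
    using Hahn_split[OF \<psi>(1,2)] by metis
  have null: "\<psi> (G X) = 0" if "X \<in> sets M" "measure M X = 0" for X
    using G_norm[OF that(1)] that(2) \<psi>(2)[of "G X"] by simp
  have split: "\<psi> (G X) = \<psi> (G (X \<inter> W)) + \<psi> (G (X - W))" "measure M X = measure M (X \<inter> W) + measure M (X - W)"
    if "X \<in> sets M" "W \<in> sets M" for X W
  proof -
    have "G X = G (X \<inter> W) + G (X - W)"
      using G_Un[of "X \<inter> W" "X - W"] that by (simp add: Int_Diff_disjoint Int_Diff_Un)
    then show "\<psi> (G X) = \<psi> (G (X \<inter> W)) + \<psi> (G (X - W))" by (simp add: linear_add[OF \<psi>(1)])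
    show "measure M X = measure M (X \<inter> W) + measure M (X - W)"
      using finite_measure_Union[of "X \<inter> W" "X - W"] that by (simp add: Int_Diff_disjoint Int_Diff_Un)
  qed
  have "measure M (A' - Y) > 0"
  proof (rule ccontr)
    assume "\<not> measure M (A' - Y) > 0"
    then have m0: "measure M (A' - Y) = 0" using measure_nonneg[of M "A' - Y"] by linarith
    have "\<psi> (G A') \<le> (a + \<epsilon>) * measure M A'"
      using split[OF A'(1) Y(1)] Y(2)[of "A' \<inter> Y"] null[of "A' - Y"] m0 A'(1) Y(1) by simp
    then show False using \<psi>w by simp
  qed
  then have P0: "measure M (A - Y) > 0"
    using finite_measure_mono[of "A' - Y" "A - Y"] A' A Y(1) by (smt (verit) Diff_mono order_refl sets.Diff)
  have Q0: "measure M (A \<inter> Z) > 0"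
  proof (rule ccontr)
    assume "\<not> measure M (A \<inter> Z) > 0"
    then have m0: "measure M (A \<inter> Z) = 0" using measure_nonneg[of M "A \<inter> Z"] by linarith
    have "(A - Z) \<inter> Z = {}" by blast
    then have "\<psi> (G A) \<ge> a * measure M A"
      using split[OF A(1) Z(1)] Z(3)[of "A - Z"] null[of "A \<inter> Z"] m0 A(1) Z(1) by simp
    then show False using \<psi>A by simp
  qed
  define s where "s = min (measure M (A - Y)) (measure M (A \<inter> Z))"
  have s: "0 < s" "s \<le> measure M (A - Y)" "s \<le> measure M (A \<inter> Z)" using P0 Q0 by (auto simp: s_def)
  obtain P where P: "P \<in> sets M" "P \<subseteq> A - Y" "measure M P = s"
    using nonatomic[of "A - Y" s] s A Y(1) by auto
  obtain Q where Q: "Q \<in> sets M" "Q \<subseteq> A \<inter> Z" "measure M Q = s"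
    using nonatomic[of "A \<inter> Z" s] s A Z(1) by auto
  have sep1: "(a + \<epsilon>) * measure M X \<le> \<psi> (G X)" if "X \<in> sets M" "X \<subseteq> P" for X
    using Y(3)[of X] that P(2) by blast
  have sep2: "\<psi> (G X) \<le> a * measure M X" if "X \<in> sets M" "X \<subseteq> Q" for X
    using Z(2)[of X] that Q(2) by blast
  have "separated_pair \<epsilon> P Q"
    unfolding separated_pair_def using \<psi>(1,2) sep1 sep2 by blast
  \<comment> \<open>On the intersection both bounds hold, which only a null set allows. Removing it
    from \<open>Q\<close> keeps the measures equal.\<close>
  moreover have "measure M (P \<inter> Q) = 0"
  proof -
    have "(a + \<epsilon>) * measure M (P \<inter> Q) \<le> a * measure M (P \<inter> Q)"
      using sep1[of "P \<inter> Q"] sep2[of "P \<inter> Q"] P(1) Q(1) by force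
    then have "\<epsilon> * measure M (P \<inter> Q) \<le> 0" by (simp add: algebra_simps)
    then show ?thesis using \<epsilon> measure_nonneg[of M "P \<inter> Q"] by (simp add: mult_le_0_iff)
  qed
  moreover have "measure M (Q - P) = measure M Q - measure M (P \<inter> Q)"
    using finite_measure_Diff'[of Q P] P(1) Q(1) by (simp add: Int_commute)
  ultimately show ?thesis
    using P Q s(1) that[of P "Q - P"] separated_pair_mono[of \<epsilon> P Q P "Q - P"] by auto
qed

lemma equal_partition:
  assumes "A \<in> sets M" "N > 0"
  shows "\<exists>B. (\<forall>i<N. B i \<in> sets M \<and> measure M (B i) = measure M A / real N) \<and>
    disjoint_family_on B {..<N} \<and> (\<Union>i<N. B i) = A"
  using assms
proof (induction N arbitrary: A)
  case (Suc N)
  show ?case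
  proof (cases "N = 0")
    case True
    then show ?thesis using Suc.prems by (intro exI[of _ "\<lambda>_. A"]) (auto simp: disjoint_family_on_def)
  next
    case False
    obtain C where C: "C \<in> sets M" "C \<subseteq> A" "measure M C = measure M A / real (Suc N)"
      using nonatomic[OF Suc.prems(1), of "measure M A / real (Suc N)"]
        mult_right_mono[of 1 "real (Suc N)" "measure M A"] by (auto simp: divide_le_eq field_simps)
    obtain B where B: "\<forall>i<N. B i \<in> sets M \<and> measure M (B i) = measure M (A - C) / real N"
      "disjoint_family_on B {..<N}" "(\<Union>i<N. B i) = A - C"
      using Suc.IH[of "A - C"] Suc.prems C False by auto
    have m: "measure M (A - C) / real N = measure M A / real (Suc N)"
      using finite_measure_Diff[OF Suc.prems(1) C(1,2)] C(3) False by (simp add: field_simps)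
    show ?thesis
    proof (intro exI[of _ "B(N := C)"] conjI allI impI)
      fix i assume "i < Suc N"
      then show "(B(N := C)) i \<in> sets M" "measure M ((B(N := C)) i) = measure M A / real (Suc N)"
        using B(1) C m by (auto simp: less_Suc_eq)
    next
      have "B i \<inter> C = {}" if "i < N" for i using B(3) that by blast
      then show "disjoint_family_on (B(N := C)) {..<Suc N}"
        using B(2) unfolding disjoint_family_on_def by (auto simp: less_Suc_eq; blast)
      have "(\<Union>i<Suc N. (B(N := C)) i) = C \<union> (\<Union>i<N. B i)"
        unfolding lessThan_Suc UN_insert by (intro arg_cong2[where f = "(\<union>)"] SUP_cong) auto
      then show "(\<Union>i<Suc N. (B(N := C)) i) = A" using B(3) C(2) by auto
    qed
  qed
qed simp

lemma equal_pieces: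
  assumes "A \<in> sets M" "0 \<le> \<delta>" "real N * \<delta> \<le> measure M A"
  shows "\<exists>B. (\<forall>i<N. B i \<in> sets M \<and> B i \<subseteq> A \<and> measure M (B i) = \<delta>) \<and> disjoint_family_on B {..<N}"
proof (cases "N = 0")
  case False
  obtain C where C: "C \<in> sets M" "C \<subseteq> A" "measure M C = real N * \<delta>"
    using nonatomic[OF assms(1) _ assms(3)] assms(2) by auto
  then show ?thesis using equal_partition[OF C(1), of N] False by (auto simp: field_simps)
qed (auto simp: disjoint_family_on_def)

end

section \<open>Separated trees\<close>

lemma div_eq_iff_atLeastLessThan: "0 < (c::nat) \<Longrightarrow> {j. j div c = k} = {k * c..<k * c + c}"
  using div_nat_eqI dividend_less_div_times div_times_less_eq_dividend by (auto simp: mult.commute add.commute set_eq_iff mem_Collect_eq atLeastLessThan_iff simp_thms)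

locale splittable_measure = vector_measure M G L for M :: "'a measure" and G :: "'a set \<Rightarrow> 'b::banach" and L +
  fixes E :: "'a set" and \<epsilon> :: real
  assumes E: "E \<in> sets M" "measure M E > 0" and eps: "\<epsilon> > 0"
    and not_concentrated: "A \<in> sets M \<Longrightarrow> A \<subseteq> E \<Longrightarrow> measure M A > 0 \<Longrightarrow> \<not> concentrated (2 * \<epsilon>) A"
begin

definition good :: "'a set \<Rightarrow> 'a set \<Rightarrow> 'a set \<Rightarrow> bool" where
  "good A P Q \<longleftrightarrow> P \<in> sets M \<and> Q \<in> sets M \<and> P \<subseteq> A \<and> Q \<subseteq> A \<and> P \<inter> Q = {} \<and>
     measure M Q = measure M P \<and> separated_pair \<epsilon> P Q"

text \<open>Greedy exhaustion: each step takes a pair of at least half the supremum of the possible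
  measures. If a remainder of positive measure survived all steps, it would contain a pair of fixed
  positive measure, whereas the measures of the chosen pairs are summable. The fraction
  \<open>3 / 4\<close> could be any number above one half: half of \<open>A\<close> will be used,
  and the rest is room for rounding.\<close>

lemma good_exhaustion:
  assumes A: "A \<in> sets M" "A \<subseteq> E" "measure M A > 0"
  obtains n :: nat and P where
    "\<forall>i<n. (\<forall>b. P i b \<in> sets M \<and> P i b \<subseteq> A) \<and> measure M (P i False) = measure M (P i True) \<and>
       separated_pair \<epsilon> (P i True) (P i False)"
    "disjoint_family_on (\<lambda>(i, b). P i b) ({..<n} \<times> UNIV)"
    "2 * (\<Sum>i<n. measure M (P i True)) \<ge> 3 / 4 * measure M A"
proof -
  define V where "V R = {measure M P | P Q. good R P Q}" for R
  define c where "c R = Sup (V R)" for R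
  have bdd: "bdd_above (V R)" for R
    unfolding V_def bdd_above_def by (intro exI[of _ "measure M (space M)"]) (auto intro: bounded_measure)
  have emp: "good R {} {}" for R by (simp add: good_def separated_pair_empty)
  have "\<exists>PQ. good R (fst PQ) (snd PQ) \<and> c R \<le> 2 * measure M (fst PQ)" for R
    using emp less_cSup_iff[OF _ bdd, of R "c R / 2"] exI[of _ "({}, {})"] by (fastforce simp: V_def c_def)
  then obtain pq where pq: "\<And>R. good R (fst (pq R)) (snd (pq R))" "\<And>R. c R \<le> 2 * measure M (fst (pq R))"
    by metis
  define R where "R = rec_nat A (\<lambda>_ R. R - (fst (pq R) \<union> snd (pq R)))"
  have R0: "R 0 = A" and RS: "R (Suc k) = R k - (fst (pq (R k)) \<union> snd (pq (R k)))" for k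
    by (simp_all add: R_def)
  define P where "P k b = (if b then fst (pq (R k)) else snd (pq (R k)))" for k b
  have g: "good (R k) (P k True) (P k False)" for k using pq(1) by (simp add: P_def)
  have Rm: "R k \<in> sets M" for k
    by (induction k) (use A R0 pq(1) in \<open>auto simp: good_def RS intro!: sets.Diff sets.Un\<close>)
  have dec: "decseq R" by (rule decseq_SucI) (auto simp: RS)
  have RA: "R k \<subseteq> A" for k using decseqD[OF dec, of 0 k] R0 by simp
  have PR: "P k b \<in> sets M" "P k b \<subseteq> R k" "P k b \<inter> R (Suc k) = {}" for k b
    using g[of k] by (cases b; auto simp: good_def RS P_def)+
  have mR: "measure M (R k) = measure M A - 2 * (\<Sum>i<k. measure M (P i True))" for k
  proof (induction k)
    case (Suc k)
    have "measure M (R (Suc k)) = measure M (R k) - measure M (P k True \<union> P k False)"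
      unfolding RS P_def using finite_measure_Diff[of "R k"] PR(1,2)[of k True] PR(1,2)[of k False] Rm[of k]
      by (simp add: P_def)
    also have "measure M (P k True \<union> P k False) = 2 * measure M (P k True)"
      using finite_measure_Union[of "P k True" "P k False"] g[of k] by (simp add: good_def)
    finally show ?case using Suc by simp
  qed (simp add: R0)
  have "summable (\<lambda>k. measure M (P k True))"
  proof (rule summableI_nonneg_bounded[where x = "measure M A / 2"])
    show "(\<Sum>i<n. measure M (P i True)) \<le> measure M A / 2" for n
      using mR[of n] measure_nonneg[of M "R n"] by linarith
  qed simp
  then have P0: "(\<lambda>k. 2 * measure M (P k True)) \<longlonglongrightarrow> 0"
    using tendsto_mult[OF tendsto_const[of 2] summable_LIMSEQ_zero] by fastforce
  define R' where "R' = (\<Inter>k. R k)"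
  have R': "R' \<in> sets M" unfolding R'_def using Rm by auto
  have "measure M R' = 0"
  proof (rule ccontr)
    assume "measure M R' \<noteq> 0"
    then have pos: "measure M R' > 0" using measure_nonneg[of M R'] by linarith
    have sub: "R' \<subseteq> R k" for k unfolding R'_def by blast
    obtain P' Q' where P': "P' \<in> sets M" "Q' \<in> sets M" "P' \<subseteq> R'" "Q' \<subseteq> R'" "P' \<inter> Q' = {}"
      "measure M P' > 0" "measure M Q' = measure M P'" "separated_pair \<epsilon> P' Q'"
      using separated_pair_exists[OF R' pos not_concentrated[OF R' _ pos] eps] sub[of 0] R0 A(2) by blast
    have "measure M P' \<le> 2 * measure M (P k True)" for k
    proof -
      have "good (R k) P' Q'" using P' sub[of k] unfolding good_def by blast
      then have "measure M P' \<le> c (R k)"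
        unfolding c_def V_def by (intro cSup_upper[OF _ bdd[unfolded V_def]]) blast
      then show ?thesis using pq(2)[of "R k"] by (simp add: P_def)
    qed
    then have "measure M P' \<le> 0" by (intro LIMSEQ_le_const[OF P0]) auto
    then show False using P'(6) by simp
  qed
  moreover have "(\<lambda>k. measure M (R k)) \<longlonglongrightarrow> measure M R'"
    unfolding R'_def by (rule finite_Lim_measure_decseq) (use Rm dec in auto)
  ultimately have "eventually (\<lambda>k. measure M (R k) < measure M A / 4) sequentially"
    using A(3) by (intro order_tendstoD) auto
  then obtain n where n: "measure M (R n) < measure M A / 4" by (auto simp: eventually_sequentially)
  show ?thesis
  proof (rule that[of n P])
    have "P i b \<in> sets M \<and> P i b \<subseteq> A" for i b using PR(1,2)[of i b] RA[of i] by blast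
    then show "\<forall>i<n. (\<forall>b. P i b \<in> sets M \<and> P i b \<subseteq> A) \<and> measure M (P i False) = measure M (P i True) \<and>
       separated_pair \<epsilon> (P i True) (P i False)"
      using g by (auto simp: good_def)
    have d1: "P i b \<inter> P j b' = {}" if "i < j" for i j b b'
      using PR(3)[of i b] PR(2)[of j b'] decseqD[OF dec, of "Suc i" j] that by fastforce
    have d2: "P i b \<inter> P i b' = {}" if "b \<noteq> b'" for i b b'
      using g[of i] that by (cases b; cases b') (auto simp: good_def)
    show "disjoint_family_on (\<lambda>(i, b). P i b) ({..<n} \<times> UNIV)"
      unfolding disjoint_family_on_def
    proof (intro ballI impI)
      fix x y :: "nat \<times> bool" assume "x \<noteq> y"
      then consider "fst x < fst y" | "fst y < fst x" | "fst x = fst y" "snd x \<noteq> snd y"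
        using linorder_less_linear[of "fst x" "fst y"] prod_eqI[of x y] by blast
      then show "(case x of (i, b) \<Rightarrow> P i b) \<inter> (case y of (i, b) \<Rightarrow> P i b) = {}"
        using d1[of "fst x" "fst y" "snd x" "snd y"] d1[of "fst y" "fst x" "snd y" "snd x"]
          d2[of "snd x" "snd y" "fst x"] by cases (auto simp: case_prod_unfold)
    qed
    show "3 / 4 * measure M A \<le> 2 * (\<Sum>i<n. measure M (P i True))" using mR[of n] n by simp
  qed
qed

text \<open>Each block of four consecutive sets has a separated pair in the positions 1 and 2 and
  two pieces of the remainder in the positions 0 and 3. All sets must have the same measure, so the
  pairs of the exhaustion are cut into pieces of measure \<open>\<delta>\<close>, and a large
  \<open>q\<close> makes rounding cheap enough to leave \<open>4 ^ q\<close> pairs of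
  pieces.\<close>

lemma good_partition:
  assumes A: "A \<in> sets M" "A \<subseteq> E" "measure M A > 0"
  shows "\<exists>q0. \<forall>q\<ge>q0. \<exists>B :: nat \<Rightarrow> 'a set. (\<forall>k<4 * 4 ^ q. B k \<in> sets M \<and> measure M (B k) = measure M A / (4 * 4 ^ q)) \<and>
    disjoint_family_on B {..<4 * 4 ^ q} \<and> (\<Union>k<4 * 4 ^ q. B k) = A \<and>
    (\<forall>p<4 ^ q. separated_pair \<epsilon> (B (4 * p + 1)) (B (4 * p + 2)))"
proof -
  obtain n :: nat and P where P0: "\<forall>i<n. (\<forall>b. P i b \<in> sets M \<and> P i b \<subseteq> A) \<and>
      measure M (P i False) = measure M (P i True) \<and> separated_pair \<epsilon> (P i True) (P i False)"
    and P4: "disjoint_family_on (\<lambda>(i, b). P i b) ({..<n} \<times> UNIV)"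
    and P5: "2 * (\<Sum>i<n. measure M (P i True)) \<ge> 3 / 4 * measure M A"
    using good_exhaustion[OF A] by blast
  have P: "\<And>i b. i < n \<Longrightarrow> P i b \<in> sets M \<and> P i b \<subseteq> A"
    "\<And>i. i < n \<Longrightarrow> measure M (P i False) = measure M (P i True)"
    "\<And>i. i < n \<Longrightarrow> separated_pair \<epsilon> (P i True) (P i False)"
    using P0 by auto
  show ?thesis
  proof (intro exI[of _ "2 * n"] allI impI)
    fix q assume q: "2 * n \<le> q"
    define N :: nat where "N = 4 ^ q"
    have N: "N > 0" by (simp add: N_def)
    have "q < 2 ^ q" by (rule less_exp)
    also have "(2::nat) ^ q \<le> 4 ^ q" by (rule power_mono) auto
    finally have nN: "2 * n \<le> N" using q by (simp add: N_def)
    define \<delta> where "\<delta> = measure M A / (4 * real N)"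
    have \<delta>: "\<delta> > 0" using A(3) N by (simp add: \<delta>_def)
    define c where "c i = nat \<lfloor>measure M (P i True) / \<delta>\<rfloor>" for i
    have c1: "real (c i) * \<delta> \<le> measure M (P i True)" for i
    proof -
      have "real (c i) \<le> measure M (P i True) / \<delta>" unfolding c_def using \<delta> by simp
      then show ?thesis using \<delta> by (simp add: field_simps)
    qed
    have c2: "measure M (P i True) / \<delta> \<le> real (c i) + 1" for i
      unfolding c_def using \<delta> by linarith
    \<comment> \<open>Rounding down loses at most one piece for each of the \<open>n\<close> pairs,
      and \<open>n\<close> is at most half of \<open>N\<close>. Hence at least \<open>N\<close> of
      the \<open>3 / 2 * N\<close> pieces remain.\<close>
    have "3 / 2 * real N = (3 / 4 * measure M A) / (2 * \<delta>)"
      using A(3) N by (simp add: \<delta>_def field_simps)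
    also have "\<dots> \<le> (2 * (\<Sum>i<n. measure M (P i True))) / (2 * \<delta>)"
      using P5 \<delta> by (intro divide_right_mono) auto
    also have "\<dots> = (\<Sum>i<n. measure M (P i True) / \<delta>)" by (simp add: sum_divide_distrib)
    also have "\<dots> \<le> (\<Sum>i<n. real (c i) + 1)" by (intro sum_mono c2)
    also have "\<dots> = real (\<Sum>i<n. c i) + real n" by (simp add: sum.distrib)
    finally have cN: "N \<le> (\<Sum>i<n. c i)" using nN by linarith
    define I where "I = Sigma {..<n} (\<lambda>i. {..<c i})"
    have I: "finite I" "card I = (\<Sum>i<n. c i)" unfolding I_def by simp_all
    obtain h0 where h0: "bij_betw h0 {0..<card I} I" using ex_bij_betw_nat_finite[OF I(1)] by blast
    have h: "inj_on h0 {..<N}" "\<And>p. p < N \<Longrightarrow> h0 p \<in> I"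
      using bij_betw_imp_inj_on[OF h0] bij_betwE[OF h0] cN I(2) inj_on_subset[of h0 "{0..<card I}" "{..<N}"]
      by (simp_all add: subset_iff)
    have "\<forall>i b. \<exists>B. i < n \<longrightarrow> (\<forall>j<c i. B j \<in> sets M \<and> B j \<subseteq> P i b \<and> measure M (B j) = \<delta>) \<and> disjoint_family_on B {..<c i}"
    proof (intro allI)
      fix i b
      show "\<exists>B. i < n \<longrightarrow> (\<forall>j<c i. B j \<in> sets M \<and> B j \<subseteq> P i b \<and> measure M (B j) = \<delta>) \<and> disjoint_family_on B {..<c i}"
      proof (cases "i < n")
        case True
        have "real (c i) * \<delta> \<le> measure M (P i b)" using c1[of i] P(2)[OF True] by (cases b) auto
        then show ?thesis using equal_pieces[of "P i b" \<delta> "c i"] P(1)[OF True] \<delta> by auto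
      qed auto
    qed
    then obtain BB where BB: "\<And>i b j. i < n \<Longrightarrow> j < c i \<Longrightarrow> BB i b j \<in> sets M \<and> BB i b j \<subseteq> P i b \<and> measure M (BB i b j) = \<delta>"
      "\<And>i b. i < n \<Longrightarrow> disjoint_family_on (BB i b) {..<c i}"
      by metis
    define D where "D p b = BB (fst (h0 p)) b (snd (h0 p))" for p b
    have hI: "fst (h0 p) < n" "snd (h0 p) < c (fst (h0 p))" if "p < N" for p
      using h(2)[OF that] by (auto simp: I_def)
    have D: "D p b \<in> sets M" "D p b \<subseteq> P (fst (h0 p)) b" "measure M (D p b) = \<delta>" "D p b \<subseteq> A" if "p < N" for p b
      using BB(1)[OF hI[OF that], of b] P(1)[OF hI(1)[OF that], of b] unfolding D_def by auto
    have Dd: "D p b \<inter> D p' b' = {}" if "p < N" "p' < N" "(p, b) \<noteq> (p', b')" for p p' b b'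
    proof (cases "fst (h0 p) = fst (h0 p') \<and> b = b'")
      case True
      then have "p \<noteq> p'" using that by auto
      then have "snd (h0 p) \<noteq> snd (h0 p')" using True h(1) that(1,2) by (metis inj_on_def lessThan_iff prod_eqI)
      then show ?thesis
        using BB(2)[OF hI(1)[OF that(1)], of b] hI(2)[OF that(1)] hI(2)[OF that(2)] True
        unfolding D_def disjoint_family_on_def by auto
    next
      case False
      then have "P (fst (h0 p)) b \<inter> P (fst (h0 p')) b' = {}"
        using P4 hI(1)[OF that(1)] hI(1)[OF that(2)] unfolding disjoint_family_on_def
        by (metis (no_types, lifting) UNIV_I case_prod_conv lessThan_iff mem_Sigma_iff prod.inject)
      then show ?thesis using D(2)[OF that(1), of b] D(2)[OF that(2), of b'] by blast
    qed
    define U where "U = (\<Union>x\<in>{..<N} \<times> UNIV. D (fst x) (snd x))"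
    have Us: "U \<in> sets M" unfolding U_def using D(1) by (intro sets.finite_UN) auto
    have UA: "U \<subseteq> A" unfolding U_def using D(4) by fastforce
    have "measure M U = (\<Sum>x\<in>{..<N} \<times> (UNIV :: bool set). measure M (D (fst x) (snd x)))"
      unfolding U_def
    proof (rule finite_measure_finite_Union)
      show "disjoint_family_on (\<lambda>x. D (fst x) (snd x)) ({..<N} \<times> UNIV)"
        unfolding disjoint_family_on_def by (auto simp: Dd simp del: prod.inject)
    qed (use D in auto)
    also have "\<dots> = (\<Sum>x\<in>{..<N} \<times> (UNIV :: bool set). \<delta>)"
      by (rule sum.cong) (use D in auto)
    also have "\<dots> = 2 * real N * \<delta>"
      by (simp add: card_cartesian_product)
    finally have mU: "measure M (A - U) = 2 * real N * \<delta>"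
      using finite_measure_Diff[OF A(1) Us UA] N by (simp add: \<delta>_def)
    obtain RR where RR: "\<And>j. j < 2 * N \<Longrightarrow> RR j \<in> sets M \<and> measure M (RR j) = \<delta>"
      "disjoint_family_on RR {..<2 * N}" "(\<Union>j<2 * N. RR j) = A - U"
      using equal_partition[of "A - U" "2 * N"] A(1) Us N mU by auto
    let ?J = "({..<N} \<times> (UNIV :: bool set)) <+> {..<2 * N}"
    define X where "X = case_sum (\<lambda>(p, b). D p b) RR"
    have X: "X (Inl x) = D (fst x) (snd x)" "X (Inr j) = RR j" for x j by (simp_all add: X_def case_prod_beta)
    have J: "Inl x \<in> ?J \<longleftrightarrow> fst x < N" "Inr j \<in> ?J \<longleftrightarrow> j < 2 * N" for x j by (cases x; auto)+
    \<comment> \<open>\<open>e\<close> fills the places: 1 and 2 of a block go to the two members of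
      a pair, 0 and 3 to two consecutive pieces of the remainder. \<open>e'\<close> is its
      inverse.\<close>
    define e :: "nat \<Rightarrow> (nat \<times> bool) + nat" where
      "e k = (if k mod 4 = 1 then Inl (k div 4, True) else if k mod 4 = 2 then Inl (k div 4, False)
        else if k mod 4 = 0 then Inr (2 * (k div 4)) else Inr (2 * (k div 4) + 1))" for k
    define e' :: "(nat \<times> bool) + nat \<Rightarrow> nat" where
      "e' = case_sum (\<lambda>(p, b). 4 * p + (if b then 1 else 2)) (\<lambda>j. 4 * (j div 2) + 3 * (j mod 2))"
    define B where "B k = X (e k)" for k
    have e: "bij_betw e {..<4 * N} ?J"
    proof (rule bij_betw_byWitness[where f' = e'])
      show "\<forall>k\<in>{..<4 * N}. e' (e k) = k"
      proof
        fix k :: nat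
        show "e' (e k) = k" by (simp add: e_def e'_def) presburger
      qed
      have q: "(4 * p + 1) div 4 = p" "(4 * p + 2) div 4 = p" "(4 * p + 3) div 4 = p" "(4 * p + 1) mod 4 = 1"
        "(4 * p + 2) mod 4 = 2" "(4 * p + 3) mod 4 = 3" for p :: nat by presburger+
      show "\<forall>x\<in>?J. e (e' x) = x"
      proof
        fix x assume "x \<in> ?J"
        show "e (e' x) = x"
        proof (cases x)
          case (Inl y)
          then show ?thesis by (cases y) (auto simp: e_def e'_def q simp del: One_nat_def)
        next
          case (Inr j)
          have "j = 2 * (j div 2) \<and> j mod 2 = 0 \<or> j = 2 * (j div 2) + 1 \<and> j mod 2 = 1" by presburger
          then show ?thesis using Inr q[of "j div 2"] by (elim disjE) (simp_all add: e_def e'_def)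
        qed
      qed
      show "e ` {..<4 * N} \<subseteq> ?J"
      proof
        fix x assume "x \<in> e ` {..<4 * N}"
        then obtain k where k: "x = e k" "k div 4 < N" by auto
        then show "x \<in> ?J" by (auto simp: e_def)
      qed
      have "4 * (j div 2) + 3 * (j mod 2) < 4 * N" if "j < 2 * N" for j
      proof -
        have "j div 2 < N" "j mod 2 \<le> 1" using that by auto
        then show ?thesis by linarith
      qed
      then show "e' ` ?J \<subseteq> {..<4 * N}" by (auto simp: e'_def)
    qed
    have B1: "B (4 * p + 1) = D p True" "B (4 * p + 2) = D p False" for p
    proof -
      have "(4 * p + 1) div 4 = p" "(4 * p + 2) div 4 = p" "(4 * p + 1) mod 4 = 1" "(4 * p + 2) mod 4 = 2" by presburger+
      then show "B (4 * p + 1) = D p True" "B (4 * p + 2) = D p False" by (simp_all add: B_def e_def X_def)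
    qed
    have "(\<Union>x\<in>?J. X x) = U \<union> (\<Union>j<2 * N. RR j)" unfolding Plus_def UN_Un U_def by (simp add: X)
    then have XU: "(\<Union>x\<in>?J. X x) = A" using RR(3) UA by auto
    have "disjoint_family_on X ?J"
      unfolding disjoint_family_on_def
    proof (intro ballI impI)
      have DR: "D (fst x) (snd x) \<inter> RR j = {}" if "fst x < N" "j < 2 * N" for x j using RR(3) that unfolding U_def by fastforce
      fix x y assume xy: "x \<in> ?J" "y \<in> ?J" "x \<noteq> y"
      show "X x \<inter> X y = {}"
      proof (cases x; cases y)
        fix a b assume "x = Inl a" "y = Inl b"
        then show ?thesis using Dd[of "fst a" "fst b" "snd a" "snd b"] xy by (auto simp: X)
      next
        fix a b assume "x = Inr a" "y = Inr b"
        then show ?thesis using RR(2) xy unfolding disjoint_family_on_def by (auto simp: X simp del: disjoint_iff)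
      next
        fix a b assume "x = Inl a" "y = Inr b"
        then show ?thesis using DR[of a b] xy(1,2) by (simp add: X J)
      next
        fix a b assume "x = Inr a" "y = Inl b"
        then show ?thesis using DR[of b a] xy(1,2) by (simp add: X J Int_commute)
      qed
    qed
    then have Bd: "disjoint_family_on B {..<4 * N}"
      using bij_betw_imp_inj_on[OF e] bij_betwE[OF e] unfolding disjoint_family_on_def B_def inj_on_def by metis
    have BU: "(\<Union>k<4 * N. B k) = A" using bij_betw_imp_surj_on[OF e] XU unfolding B_def by (metis image_image)
    have Bm: "B k \<in> sets M \<and> measure M (B k) = \<delta>" if "k < 4 * N" for k
    proof (cases "e k")
      case (Inl x)
      then have "fst x < N" using bij_betwE[OF e] that J(1)[of x] by force
      then show ?thesis using D[of "fst x" "snd x"] Inl unfolding B_def by (simp add: X)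
    next
      case (Inr j)
      then have "j < 2 * N" using bij_betwE[OF e] that J(2)[of j] by force
      then show ?thesis using RR(1)[of j] Inr unfolding B_def by (simp add: X)
    qed
    have "separated_pair \<epsilon> (B (4 * p + 1)) (B (4 * p + 2))" if "p < N" for p
      unfolding B1
      using separated_pair_mono[OF P(3)[OF hI(1)[OF that]] D(2)[OF that] D(2)[OF that]] .
    then show "\<exists>B :: nat \<Rightarrow> 'a set. (\<forall>k<4 * 4 ^ q. B k \<in> sets M \<and> measure M (B k) = measure M A / (4 * 4 ^ q)) \<and>
      disjoint_family_on B {..<4 * 4 ^ q} \<and> (\<Union>k<4 * 4 ^ q. B k) = A \<and>
      (\<forall>p<4 ^ q. separated_pair \<epsilon> (B (4 * p + 1)) (B (4 * p + 2)))"
      using Bm Bd BU unfolding N_def \<delta>_def by (intro exI[of _ B]) auto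
  qed
qed

definition stage :: "nat \<times> (nat \<Rightarrow> 'a set) \<Rightarrow> bool" where
  "stage = (\<lambda>(n, T). (\<forall>k<4 ^ n. T k \<in> sets M \<and> T k \<subseteq> E \<and> measure M (T k) = measure M E / 4 ^ n) \<and>
     disjoint_family_on T {..<4 ^ n})"

text \<open>\<open>good_partition\<close> separates only after sufficiently many subdivisions, so a
  refinement may pass several levels at once, and only its last one is separated. Division of the
  indices recovers the levels in between as unions of consecutive sets.\<close>

definition refines :: "nat \<times> (nat \<Rightarrow> 'a set) \<Rightarrow> nat \<times> (nat \<Rightarrow> 'a set) \<Rightarrow> bool" where
  "refines = (\<lambda>(n, T) (n', T'). n < n' \<and> (\<forall>k<4 ^ n. T k = \<Union> (T' ` {j. j div 4 ^ (n' - n) = k})) \<and>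
     (\<forall>p<4 ^ (n' - 1). separated_pair \<epsilon> (T' (4 * p + 1)) (T' (4 * p + 2))))"

lemma stage_step:
  assumes "stage (n, T)"
  shows "\<exists>s'. stage s' \<and> refines (n, T) s'"
proof -
  have T: "\<And>k. k < 4 ^ n \<Longrightarrow> T k \<in> sets M \<and> T k \<subseteq> E \<and> measure M (T k) = measure M E / 4 ^ n"
    "disjoint_family_on T {..<4 ^ n}"
    using assms by (auto simp: stage_def)
  have pos: "measure M (T k) > 0" if "k < 4 ^ n" for k using T(1)[OF that] E(2) by simp
  have "\<forall>k. \<exists>q0. k < 4 ^ n \<longrightarrow> (\<forall>q\<ge>q0. \<exists>B :: nat \<Rightarrow> 'a set. (\<forall>r<4 * 4 ^ q. B r \<in> sets M \<and> measure M (B r) = measure M (T k) / (4 * 4 ^ q)) \<and>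
    disjoint_family_on B {..<4 * 4 ^ q} \<and> (\<Union>r<4 * 4 ^ q. B r) = T k \<and>
    (\<forall>p<4 ^ q. separated_pair \<epsilon> (B (4 * p + 1)) (B (4 * p + 2))))"
    by (metis good_partition T(1) pos simp_thms)
  then obtain q0 where q0: "\<And>k q. k < 4 ^ n \<Longrightarrow> q \<ge> q0 k \<Longrightarrow> \<exists>B :: nat \<Rightarrow> 'a set. (\<forall>r<4 * 4 ^ q. B r \<in> sets M \<and> measure M (B r) = measure M (T k) / (4 * 4 ^ q)) \<and>
    disjoint_family_on B {..<4 * 4 ^ q} \<and> (\<Union>r<4 * 4 ^ q. B r) = T k \<and>
    (\<forall>p<4 ^ q. separated_pair \<epsilon> (B (4 * p + 1)) (B (4 * p + 2)))"
    by metis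
  \<comment> \<open>All sets of the stage have to be cut into the same number of pieces, so the
    largest of the finitely many thresholds is taken.\<close>
  define q where "q = Max (q0 ` {..<4 ^ n})"
  define N :: nat where "N = 4 ^ q"
  have N: "N > 0" by (simp add: N_def)
  have "\<forall>k. \<exists>B :: nat \<Rightarrow> 'a set. k < 4 ^ n \<longrightarrow> (\<forall>r<4 * N. B r \<in> sets M \<and> measure M (B r) = measure M (T k) / (4 * N)) \<and>
    disjoint_family_on B {..<4 * N} \<and> (\<Union>r<4 * N. B r) = T k \<and>
    (\<forall>p<N. separated_pair \<epsilon> (B (4 * p + 1)) (B (4 * p + 2)))"
    using Max_ge q0 by (simp add: q_def N_def)
  then obtain B where B: "\<And>k r. k < 4 ^ n \<Longrightarrow> r < 4 * N \<Longrightarrow> B k r \<in> sets M \<and> measure M (B k r) = measure M (T k) / (4 * N)"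
    "\<And>k. k < 4 ^ n \<Longrightarrow> disjoint_family_on (B k) {..<4 * N}" "\<And>k. k < 4 ^ n \<Longrightarrow> (\<Union>r<4 * N. B k r) = T k"
    "\<And>k p. k < 4 ^ n \<Longrightarrow> p < N \<Longrightarrow> separated_pair \<epsilon> (B k (4 * p + 1)) (B k (4 * p + 2))"
    by metis
  define T' :: "nat \<Rightarrow> 'a set" where "T' k = B (k div (4 * N)) (k mod (4 * N))" for k
  define n' where "n' = n + Suc q"
  have pow: "(4::nat) ^ n' = 4 ^ n * (4 * N)" "4 ^ (n' - 1) = 4 ^ n * N"
    by (simp_all add: n'_def N_def power_add)
  have dl: "k div (4 * N) < 4 ^ n" if "k < 4 ^ n'" for k :: nat
    using that unfolding pow by (simp add: less_mult_imp_div_less)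
  have ml: "k mod (4 * N) < 4 * N" for k :: nat using N by simp
  have sub: "B k r \<subseteq> T k" if "k < 4 ^ n" "r < 4 * N" for k r using B(3)[OF that(1)] that(2) by blast
  have "stage (n', T')"
    unfolding stage_def prod.case
  proof (intro conjI allI impI)
    fix k :: nat assume k: "k < 4 ^ n'"
    show "T' k \<in> sets M" "T' k \<subseteq> E" "measure M (T' k) = measure M E / 4 ^ n'"
      using B(1)[OF dl[OF k] ml, of k] sub[OF dl[OF k] ml, of k] T(1)[OF dl[OF k]]
      by (auto simp: T'_def n'_def N_def power_add)
  next
    show "disjoint_family_on T' {..<4 ^ n'}"
      unfolding disjoint_family_on_def
    proof (intro ballI impI)
      fix j k :: nat assume jk: "j \<in> {..<4 ^ n'}" "k \<in> {..<4 ^ n'}" "j \<noteq> k"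
      then have d: "j div (4 * N) < 4 ^ n" "k div (4 * N) < 4 ^ n" using dl by auto
      show "T' j \<inter> T' k = {}"
      proof (cases "j div (4 * N) = k div (4 * N)")
        case True
        then have "j mod (4 * N) \<noteq> k mod (4 * N)" using jk(3) by (metis div_mult_mod_eq)
        then show ?thesis using B(2)[OF d(1)] True ml unfolding T'_def disjoint_family_on_def by auto
      next
        case False
        then have "T (j div (4 * N)) \<inter> T (k div (4 * N)) = {}"
          using T(2) d unfolding disjoint_family_on_def by auto
        then show ?thesis using sub[OF d(1) ml] sub[OF d(2) ml] unfolding T'_def by blast
      qed
    qed
  qed
  moreover have "refines (n, T) (n', T')"
    unfolding refines_def prod.case
  proof (intro conjI allI impI)
    show "n < n'" by (simp add: n'_def)
    have e: "4 ^ (n' - n) = 4 * N" by (simp add: n'_def N_def)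
    fix k :: nat assume k: "k < 4 ^ n"
    show "T k = \<Union> (T' ` {j. j div 4 ^ (n' - n) = k})"
      unfolding e B(3)[OF k, symmetric]
    proof (intro equalityI subsetI)
      fix x assume "x \<in> (\<Union>r<4 * N. B k r)"
      then obtain r where r: "r < 4 * N" "x \<in> B k r" by auto
      have "(k * (4 * N) + r) div (4 * N) = k" "(k * (4 * N) + r) mod (4 * N) = r"
        using r(1) N by simp_all
      then show "x \<in> \<Union> (T' ` {j. j div (4 * N) = k})"
        using r(2) by (intro UN_I[of "k * (4 * N) + r"]) (auto simp: T'_def)
    next
      fix x assume "x \<in> \<Union> (T' ` {j. j div (4 * N) = k})"
      then show "x \<in> (\<Union>r<4 * N. B k r)" using ml unfolding T'_def by blast
    qed
  next
    fix p :: nat assume p: "p < 4 ^ (n' - 1)"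
    have "p div N < 4 ^ n" "p mod N < N" using N p unfolding pow by (simp_all add: less_mult_imp_div_less)
    moreover have e: "(4 * p + r) div (4 * N) = p div N \<and> (4 * p + r) mod (4 * N) = 4 * (p mod N) + r" if "r < 4" for r
    proof -
      have "(4 * p + r) div 4 = p" "(4 * p + r) mod 4 = r" using that by auto
      then show ?thesis by (simp add: div_mult2_eq mod_mult2_eq)
    qed
    ultimately show "separated_pair \<epsilon> (T' (4 * p + 1)) (T' (4 * p + 2))"
      unfolding T'_def conjunct1[OF e[of 1, simplified]] conjunct2[OF e[of 1, simplified]]
        conjunct1[OF e[of 2, simplified]] conjunct2[OF e[of 2, simplified]]
      using B(4)[of "p div N" "p mod N"] e[of 1] e[of 2] by (simp only:)
  qed
  ultimately show ?thesis by blast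
qed

text \<open>The stages occupy a subsequence of the levels. \<open>blk j i k\<close> is a set of
  level \<open>i\<close> as seen from stage \<open>j\<close>; it does not depend on \<open>j\<close>
  once the stage is fine enough, and stage \<open>i\<close> always is, because the levels of the
  stages increase strictly.\<close>

theorem separated_tree:
  obtains T :: "nat \<Rightarrow> nat \<Rightarrow> 'a set" and S :: "nat set" where "infinite S" "T 0 0 = E"
    "\<And>i k. k < 4 ^ i \<Longrightarrow> T i k \<in> sets M" "\<And>i k. k < 4 ^ i \<Longrightarrow> measure M (T i k) = measure M E / 4 ^ i"
    "\<And>i k. k < 4 ^ i \<Longrightarrow> T i k = (\<Union>d<4. T (Suc i) (4 * k + d))"
    "\<And>i k. k < 4 ^ i \<Longrightarrow> disjoint_family_on (\<lambda>d. T (Suc i) (4 * k + d)) {..<4}"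
    "\<And>i k. i \<in> S \<Longrightarrow> k < 4 ^ i \<Longrightarrow> separated_pair \<epsilon> (T (Suc i) (4 * k + 1)) (T (Suc i) (4 * k + 2))"
proof -
  have "stage (0, \<lambda>_. E)" using E by (auto simp: stage_def disjoint_family_on_def)
  then have "\<exists>s. \<forall>j. (stage (s j) \<and> (j = 0 \<longrightarrow> s j = (0, \<lambda>_. E))) \<and> refines (s j) (s (Suc j))"
    using stage_step by (intro dependent_nat_choice[of "\<lambda>j s. stage s \<and> (j = 0 \<longrightarrow> s = (0, \<lambda>_. E))" "\<lambda>_. refines"]) auto
  then obtain s where s: "\<And>j. stage (s j)" "s 0 = (0, \<lambda>_. E)" "\<And>j. refines (s j) (s (Suc j))" by blast
  define n where "n j = fst (s j)" for j
  define U where "U j = snd (s j)" for j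
  have sm: "U j k \<in> sets M" "U j k \<subseteq> E" "measure M (U j k) = measure M E / 4 ^ n j" if "k < 4 ^ n j" for j k
    using s(1)[of j] that by (auto simp: stage_def n_def U_def case_prod_unfold)
  have sd: "disjoint_family_on (U j) {..<4 ^ n j}" for j
    using s(1)[of j] by (auto simp: stage_def n_def U_def case_prod_unfold)
  have n0: "n 0 = 0" "U 0 = (\<lambda>_. E)" using s(2) by (auto simp: n_def U_def)
  have nS: "n j < n (Suc j)" for j using s(3)[of j] by (auto simp: refines_def n_def case_prod_unfold)
  have ref: "U j k = \<Union> (U (Suc j) ` {l. l div 4 ^ (n (Suc j) - n j) = k})" if "k < 4 ^ n j" for j k
    using s(3)[of j] that by (auto simp: refines_def n_def U_def case_prod_unfold)
  have sep: "separated_pair \<epsilon> (U (Suc j) (4 * p + 1)) (U (Suc j) (4 * p + 2))" if "p < 4 ^ (n (Suc j) - 1)" for j p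
    using s(3)[of j] that by (auto simp: refines_def n_def U_def case_prod_unfold)
  have mono: "strict_mono n" using nS by (simp add: strict_mono_Suc_iff)
  have nj: "j \<le> n j" for j using strict_mono_imp_increasing[OF mono] .
  define blk where "blk j i k = \<Union> (U j ` {l. l div 4 ^ (n j - i) = k})" for j i k
  have lt: "l < 4 ^ n j" if "i \<le> n j" "k < 4 ^ i" "l div 4 ^ (n j - i) = k" for j i k l :: nat
  proof -
    have "l < 4 ^ i * 4 ^ (n j - i)" using that(2,3) div_less_iff_less_mult[of "4 ^ (n j - i)" l "4 ^ i"] by simp
    also have "\<dots> = 4 ^ n j" using that(1) by (simp add: power_add[symmetric])
    finally show ?thesis .
  qed
  have blk_Suc: "blk j i k = blk (Suc j) i k" if "i \<le> n j" "k < 4 ^ i" for j i k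
  proof -
    have e: "4 ^ (n (Suc j) - i) = 4 ^ (n (Suc j) - n j) * (4::nat) ^ (n j - i)"
      using that(1) nS[of j] by (simp add: power_add[symmetric])
    have "blk j i k = (\<Union>l\<in>{l. l div 4 ^ (n j - i) = k}. \<Union> (U (Suc j) ` {l'. l' div 4 ^ (n (Suc j) - n j) = l}))"
      unfolding blk_def using ref lt[OF that] by (intro SUP_cong) auto
    also have "\<dots> = blk (Suc j) i k" unfolding blk_def e div_mult2_eq by blast
    finally show ?thesis .
  qed
  have blk_le: "blk j i k = blk (j + r) i k" if "i \<le> n j" "k < 4 ^ i" for j i k r
  proof (induction r)
    case (Suc r)
    have "n j \<le> n (j + r)" using mono by (simp add: strict_mono_less_eq)
    then show ?case using Suc blk_Suc[of i "j + r" k] that by simp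
  qed simp
  have blk_sub: "blk j i k = (\<Union>d<4. blk j (Suc i) (4 * k + d))" if "i < n j" for j i k
  proof -
    have e: "(4::nat) ^ (n j - i) = 4 ^ (n j - Suc i) * 4"
      using that by (simp flip: power_Suc2 add: Suc_diff_Suc)
    have "{l. l div 4 ^ (n j - i) = k} = (\<Union>d<4. {l. l div 4 ^ (n j - Suc i) = 4 * k + d})"
      unfolding e div_mult2_eq
    proof (intro equalityI subsetI)
      fix l assume "l \<in> {l. l div 4 ^ (n j - Suc i) div 4 = k}"
      then have "l div 4 ^ (n j - Suc i) = 4 * k + l div 4 ^ (n j - Suc i) mod 4" by auto
      then show "l \<in> (\<Union>d<4. {l. l div 4 ^ (n j - Suc i) = 4 * k + d})"
        by (intro UN_I[of "l div 4 ^ (n j - Suc i) mod 4"]) auto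
    qed auto
    then show ?thesis unfolding blk_def by blast
  qed
  have blk_sets: "blk j i k \<in> sets M" "measure M (blk j i k) = measure M E / 4 ^ i" if "i \<le> n j" "k < 4 ^ i" for j i k
  proof -
    have S: "{l. l div 4 ^ (n j - i) = k} = {k * 4 ^ (n j - i)..<k * 4 ^ (n j - i) + 4 ^ (n j - i)}"
      by (rule div_eq_iff_atLeastLessThan) simp
    have fin: "finite {l. l div 4 ^ (n j - i) = k}" unfolding S by simp
    show "blk j i k \<in> sets M" unfolding blk_def using fin sm lt[OF that] by (intro sets.finite_UN) auto
    have "measure M (blk j i k) = (\<Sum>l\<in>{l. l div 4 ^ (n j - i) = k}. measure M (U j l))"
      unfolding blk_def
    proof (rule finite_measure_finite_Union[OF fin])
      show "U j ` {l. l div 4 ^ (n j - i) = k} \<subseteq> sets M" using sm lt[OF that] by auto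
      show "disjoint_family_on (U j) {l. l div 4 ^ (n j - i) = k}"
        by (rule disjoint_family_on_mono[OF _ sd]) (use lt[OF that] in auto)
    qed
    also have "\<dots> = (\<Sum>l\<in>{l. l div 4 ^ (n j - i) = k}. measure M E / 4 ^ n j)"
      using sm lt[OF that] by (intro sum.cong) auto
    also have "\<dots> = 4 ^ (n j - i) * (measure M E / 4 ^ n j)" unfolding S by simp
    also have "\<dots> = measure M E / 4 ^ i" using that(1) by (simp add: power_diff)
    finally show "measure M (blk j i k) = measure M E / 4 ^ i" .
  qed
  define T where "T i k = blk i i k" for i k
  have TSuc: "T i k = blk (Suc i) i k" if "k < 4 ^ i" for i k
    unfolding T_def using blk_Suc[OF nj that] .
  \<comment> \<open>A refinement to level \<open>n (Suc j)\<close> separates sets of that level, so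
    their parents are one level higher up.\<close>
  define S where "S = (\<lambda>j. n (Suc j) - 1) ` UNIV"
  have lt4: "4 * k + d < 4 ^ Suc i" if "k < 4 ^ i" "d < 4" for k d i :: nat
    using that by auto
  show ?thesis
  proof (rule that[of S T])
    have "inj (\<lambda>j. n (Suc j) - 1)"
    proof (rule injI)
      fix x y assume "n (Suc x) - 1 = n (Suc y) - 1"
      then have "n (Suc x) = n (Suc y)" using nS[of x] nS[of y] by linarith
      then show "x = y" using strict_mono_eq[OF mono, of "Suc x" "Suc y"] by simp
    qed
    then show "infinite S" unfolding S_def by (rule range_inj_infinite)
    show "T 0 0 = E" by (simp add: T_def blk_def n0)
    fix i k :: nat assume k: "k < 4 ^ i"
    show "T i k \<in> sets M" "measure M (T i k) = measure M E / 4 ^ i" unfolding T_def using blk_sets[OF nj k] .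
    have i: "i < n (Suc i)" using nj[of "Suc i"] by simp
    show "T i k = (\<Union>d<4. T (Suc i) (4 * k + d))"
      unfolding TSuc[OF k] unfolding T_def by (rule blk_sub[OF i])
    show "disjoint_family_on (\<lambda>d. T (Suc i) (4 * k + d)) {..<4}"
      unfolding disjoint_family_on_def
    proof (intro ballI impI)
      fix d d' :: nat assume d: "d \<in> {..<4}" "d' \<in> {..<4}" "d \<noteq> d'"
      have "U (Suc i) l \<inter> U (Suc i) l' = {}"
        if "l div 4 ^ (n (Suc i) - Suc i) = 4 * k + d" "l' div 4 ^ (n (Suc i) - Suc i) = 4 * k + d'" for l l'
      proof -
        have "l < 4 ^ n (Suc i)" "l' < 4 ^ n (Suc i)"
          using lt[OF nj lt4[OF k]] that d by auto
        moreover have "l \<noteq> l'" using that d(3) by auto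
        ultimately show ?thesis using sd[of "Suc i"] unfolding disjoint_family_on_def by blast
      qed
      then show "T (Suc i) (4 * k + d) \<inter> T (Suc i) (4 * k + d') = {}" unfolding T_def blk_def by blast
    qed
    show "separated_pair \<epsilon> (T (Suc i) (4 * k + 1)) (T (Suc i) (4 * k + 2))" if "i \<in> S"
    proof -
      obtain j where j: "i = n (Suc j) - 1" using \<open>i \<in> S\<close> unfolding S_def by blast
      then have i': "Suc i = n (Suc j)" using nS[of j] by linarith
      have "Suc j \<le> Suc i" using nj[of "Suc j"] i' by simp
      then obtain r where r: "Suc i = Suc j + r" by (metis le_Suc_ex)
      have "T (Suc i) l = U (Suc j) l" if "l < 4 ^ Suc i" for l
      proof -
        have "T (Suc i) l = blk (Suc j + r) (Suc i) l" unfolding T_def r ..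
        also have "\<dots> = blk (Suc j) (Suc i) l"
          using blk_le[of "Suc i" "Suc j" l r] that i' by simp
        also have "\<dots> = U (Suc j) l" unfolding blk_def i' by simp
        finally show ?thesis .
      qed
      then show ?thesis using sep[of k j] k j lt4[OF k, of 1] lt4[OF k, of 2] by simp
    qed
  qed
qed

end

section \<open>The vector measure of a Lipschitz curve\<close>

text \<open>Around each bad point there are arbitrarily small balls that lie in an open
  \<open>U\<close> close to \<open>A\<close> and have a definite proportion outside of
  \<open>A\<close>. A disjoint Vitali subfamily covers almost all bad points, and its total measure
  is at most \<open>2 / \<eta>\<close> times that of \<open>U - A\<close>. Outer covers avoid the
  question whether the set of bad points is measurable.\<close>

lemma density_points:
  fixes A :: "real set"
  assumes A: "A \<in> sets lebesgue" and \<eta>: "\<eta> > 0"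
  shows "negligible {t \<in> A. \<forall>\<delta>>0. \<exists>r. 0 < r \<and> r < \<delta> \<and> measure lebesgue (ball t r - A) > \<eta> * r}"
    (is "negligible ?P")
  unfolding negligible_outer_le
proof (intro allI impI)
  fix e :: real assume e: "e > 0"
  obtain U where U: "open U" "A \<subseteq> U" "U - A \<in> lmeasurable" "emeasure lebesgue (U - A) < ennreal (e * \<eta> / 2)"
    using sets_lebesgue_outer_open[OF A, of "e * \<eta> / 2"] e \<eta> by auto
  define K where "K = {(t, r). t \<in> ?P \<and> 0 < r \<and> ball t r \<subseteq> U \<and> measure lebesgue (ball t r - A) > \<eta> * r}"
  have cov: "\<exists>i. i \<in> K \<and> x \<in> ball (fst i) (snd i) \<and> snd i < d" if x: "x \<in> ?P" "0 < d" for x d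
  proof -
    obtain r0 where r0: "r0 > 0" "ball x r0 \<subseteq> U" using U(1,2) x(1) open_contains_ball by blast
    obtain r where r: "0 < r" "r < min d r0" "measure lebesgue (ball x r - A) > \<eta> * r"
    proof -
      have "0 < min d r0" using x(2) r0(1) by simp
      then show ?thesis using x(1) that by blast
    qed
    have "ball x r \<subseteq> U" using subset_ball[of r r0 x] r(2) r0(2) by auto
    then have "(x, r) \<in> K" using r x(1) unfolding K_def by blast
    then show ?thesis using r by (intro exI[of _ "(x, r)"]) auto
  qed
  obtain C where C: "countable C" "C \<subseteq> K"
    "pairwise (\<lambda>i j. disjnt (ball (fst i) (snd i)) (ball (fst j) (snd j))) C"
    "negligible (?P - (\<Union>i\<in>C. ball (fst i) (snd i)))"
    using Vitali_covering_theorem_balls[of ?P K fst snd, OF cov] by auto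
  define W where "W = (\<Union>i\<in>C. ball (fst i) (snd i))"
  have disj: "disjoint_family_on (\<lambda>i. ball (fst i) (snd i)) C"
    using C(3) unfolding disjoint_family_on_def pairwise_def disjnt_def by blast
  have disj': "disjoint_family_on (\<lambda>i. ball (fst i) (snd i) - A) C"
    using disj unfolding disjoint_family_on_def by blast
  have Bs: "ball (fst i) (snd i) - A \<in> sets lebesgue" for i :: "real \<times> real" using A by (intro sets.Diff) auto
  have le: "emeasure lebesgue (ball (fst i) (snd i)) \<le> ennreal (2 / \<eta>) * emeasure lebesgue (ball (fst i) (snd i) - A)" if "i \<in> C" for i
  proof -
    obtain t r where i: "i = (t, r)" by (metis surj_pair)
    have r: "0 < r" "measure lebesgue (ball t r - A) > \<eta> * r" using that C(2) by (auto simp: K_def i)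
    have "emeasure lebesgue (ball t r - A) = ennreal (measure lebesgue (ball t r - A))"
    proof (rule emeasure_eq_ennreal_measure)
      have "emeasure lebesgue (ball t r - A) \<le> emeasure lebesgue (ball t r)" by (intro emeasure_mono) auto
      also have "\<dots> < \<infinity>" using r(1) by (simp add: ball_eq_greaterThanLessThan)
      finally show "emeasure lebesgue (ball t r - A) \<noteq> top" by simp
    qed
    moreover have "emeasure lebesgue (ball t r) = ennreal (2 * r)"
      using r(1) by (simp add: ball_eq_greaterThanLessThan)
    moreover have "2 * r \<le> 2 / \<eta> * measure lebesgue (ball t r - A)"
      using r(2) \<eta> by (simp add: field_simps)
    ultimately show ?thesis unfolding i using \<eta> by (simp add: ennreal_mult[symmetric] ennreal_leI)
  qed
  have "emeasure lebesgue W = (\<integral>\<^sup>+i. emeasure lebesgue (ball (fst i) (snd i)) \<partial>count_space C)"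
    unfolding W_def by (rule emeasure_UN_countable[OF _ C(1) disj]) auto
  also have "\<dots> \<le> (\<integral>\<^sup>+i. ennreal (2 / \<eta>) * emeasure lebesgue (ball (fst i) (snd i) - A) \<partial>count_space C)"
    using le by (intro nn_integral_mono) auto
  also have "\<dots> = ennreal (2 / \<eta>) * (\<integral>\<^sup>+i. emeasure lebesgue (ball (fst i) (snd i) - A) \<partial>count_space C)"
    by (rule nn_integral_cmult) auto
  also have "(\<integral>\<^sup>+i. emeasure lebesgue (ball (fst i) (snd i) - A) \<partial>count_space C) =
      emeasure lebesgue (\<Union>i\<in>C. ball (fst i) (snd i) - A)"
    by (rule emeasure_UN_countable[OF Bs C(1) disj', symmetric])
  also have "\<dots> \<le> emeasure lebesgue (U - A)"
  proof (rule emeasure_mono)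
    show "(\<Union>i\<in>C. ball (fst i) (snd i) - A) \<subseteq> U - A" using C(2) unfolding K_def by fastforce
  qed (use U(3) in \<open>auto intro: fmeasurableD\<close>)
  also have "\<dots> \<le> ennreal (e * \<eta> / 2)" using U(4) by simp
  finally have "emeasure lebesgue W \<le> ennreal (2 / \<eta>) * ennreal (e * \<eta> / 2)"
    by (simp add: mult_left_mono)
  also have "\<dots> = ennreal e" using \<eta> e by (simp add: ennreal_mult[symmetric])
  finally have We: "emeasure lebesgue W \<le> ennreal e" .
  have Ws: "W \<in> sets lebesgue" unfolding W_def using C(1) by (intro sets.countable_UN'') auto
  define N where "N = ?P - W"
  have N: "negligible N" "N \<in> null_sets lebesgue"
    using C(4) unfolding N_def W_def by (auto simp: negligible_iff_null_sets)
  have NW: "emeasure lebesgue (N \<union> W) = emeasure lebesgue W"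
    by (subst Un_commute) (rule emeasure_Un_null_set[OF Ws N(2)])
  show "\<exists>T. ?P \<subseteq> T \<and> T \<in> lmeasurable \<and> measure lebesgue T \<le> e"
  proof (intro exI conjI)
    show "?P \<subseteq> N \<union> W" unfolding N_def by blast
    have "N \<union> W \<in> sets lebesgue" using N(2) Ws by auto
    moreover have "emeasure lebesgue (N \<union> W) < \<infinity>" unfolding NW using We by (simp add: le_less_trans)
    ultimately show "N \<union> W \<in> lmeasurable" by (rule fmeasurableI)
    show "measure lebesgue (N \<union> W) \<le> e"
      unfolding measure_def NW using We e by (simp add: enn2real_leI)
  qed
qed

definition unit_lborel :: "real measure" where
  "unit_lborel = uniform_measure lborel {0..<1}"

lemma unit_lborel: "prob_space unit_lborel" "sets unit_lborel = sets borel" "space unit_lborel = UNIV"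
  by (auto simp: unit_lborel_def intro!: prob_space_uniform_measure)

lemma emeasure_unit_lborel: "A \<in> sets borel \<Longrightarrow> emeasure unit_lborel A = emeasure lborel ({0..<1} \<inter> A)"
  unfolding unit_lborel_def by (subst emeasure_uniform_measure) (auto simp: divide_ennreal_def)

lemma measure_unit_lborel: "A \<in> sets borel \<Longrightarrow> measure unit_lborel A = measure lborel ({0..<1} \<inter> A)"
  unfolding measure_def by (simp add: emeasure_unit_lborel)

lemma measure_unit_lborel_atLeastLessThan:
  "0 \<le> a \<Longrightarrow> a \<le> b \<Longrightarrow> b \<le> 1 \<Longrightarrow> measure unit_lborel {a..<b} = b - a"
  by (simp add: measure_unit_lborel)

text \<open>The measure of the part of \<open>A\<close> below \<open>x\<close> is a Lipschitz
  function of \<open>x\<close>, so it takes every intermediate value.\<close>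

lemma unit_lborel_nonatomic:
  assumes A: "A \<in> sets borel" and s: "0 \<le> s" "s \<le> measure unit_lborel A"
  shows "\<exists>B\<in>sets borel. B \<subseteq> A \<and> measure unit_lborel B = s"
proof -
  interpret prob_space unit_lborel by (rule unit_lborel(1))
  define g where "g x = measure unit_lborel (A \<inter> {..<x})" for x
  have sp [simp]: "sets unit_lborel = sets borel" by (rule unit_lborel(2))
  have lip: "\<bar>g y - g x\<bar> \<le> \<bar>y - x\<bar>" for x y
  proof -
    have *: "0 \<le> g y - g x \<and> g y - g x \<le> y - x" if "x \<le> y" for x y
    proof -
      have eq: "A \<inter> {..<y} - A \<inter> {..<x} = A \<inter> {x..<y}" using that by auto
      have "g y - g x = measure unit_lborel (A \<inter> {x..<y})"
        unfolding g_def eq[symmetric] by (rule finite_measure_Diff[symmetric]) (use A that in auto)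
      moreover have "\<dots> \<le> measure unit_lborel {x..<y}" using A by (intro finite_measure_mono) auto
      moreover have "measure unit_lborel {x..<y} \<le> measure lborel {x..y}"
        by (subst measure_unit_lborel, simp, intro measure_mono_fmeasurable fmeasurable_compact, auto)
      moreover have "measure lborel {x..y} = y - x" using that by simp
      ultimately show ?thesis by auto
    qed
    show ?thesis using *[of x y] *[of y x] by (cases "x \<le> y") auto
  qed
  have "continuous_on {0..1} g"
    unfolding continuous_on_iff dist_real_def
    by (metis ballI allI impI lip exI le_less_trans)
  moreover have "g 0 = 0"
  proof -
    have "{0..<1} \<inter> (A \<inter> {..<0::real}) = {}" by auto
    then show ?thesis unfolding g_def using A by (subst measure_unit_lborel) auto
  qed
  moreover have "g 1 = measure unit_lborel A"
  proof -
    have "{0..<1} \<inter> (A \<inter> {..<1::real}) = {0..<1} \<inter> A" by auto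
    then show ?thesis unfolding g_def using A by (simp add: measure_unit_lborel)
  qed
  ultimately obtain x where "0 \<le> x" "x \<le> 1" "g x = s"
    using IVT'[of g 0 s 1] s by auto
  then show ?thesis unfolding g_def using A by (intro bexI[of _ "A \<inter> {..<x}"]) auto
qed

section \<open>The set function generated by the increments of a Lipschitz curve\<close>

locale lipschitz_curve =
  fixes f :: "real \<Rightarrow> 'b::banach" and L :: real
  assumes lip: "norm (f s - f t) \<le> L * \<bar>s - t\<bar>"
begin

lemma L_nonneg: "L \<ge> 0"
  using lip[of 1 0] by (simp add: order_trans[OF norm_ge_zero])

sublocale prob_space unit_lborel by (rule unit_lborel(1))

lemmas [simp] = unit_lborel(2,3)

abbreviation "mu \<equiv> measure unit_lborel"

definition cell :: "nat \<Rightarrow> nat \<Rightarrow> real set" where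
  "cell n k = {real k / 2 ^ n..<real (Suc k) / 2 ^ n}"

definition incr :: "nat \<Rightarrow> nat \<Rightarrow> 'b" where
  "incr n k = f (real (Suc k) / 2 ^ n) - f (real k / 2 ^ n)"

text \<open>The integral over \<open>A\<close> of the derivative of the piecewise linear interpolation of \<open>f\<close>; it
  converges as \<open>n\<close> grows, also where \<open>f\<close> has no derivative.\<close>

definition curve_sum :: "nat \<Rightarrow> real set \<Rightarrow> 'b" where
  "curve_sum n A = (\<Sum>k<2 ^ n. (2 ^ n * mu (A \<inter> cell n k)) *\<^sub>R incr n k)"

lemma cell_sets [simp]: "cell n k \<in> sets borel" by (simp add: cell_def)

lemma norm_incr: "norm (incr n k) \<le> L / 2 ^ n"
  using lip[of "real (Suc k) / 2 ^ n" "real k / 2 ^ n"] by (simp add: field_simps incr_def)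

lemma cell_disjoint: "disjoint_family (cell n)"
proof -
  have "cell n j \<inter> cell n k = {}" if "j < k" for j k
  proof -
    have "real (Suc j) / 2 ^ n \<le> real k / 2 ^ n" using that by (intro divide_right_mono) auto
    then show ?thesis unfolding cell_def by auto
  qed
  then show ?thesis unfolding disjoint_family_on_def by (metis Int_commute linorder_neqE_nat)
qed

lemma curve_sum_Un:
  assumes "A \<in> sets borel" "B \<in> sets borel" "A \<inter> B = {}"
  shows "curve_sum n (A \<union> B) = curve_sum n A + curve_sum n B"
proof -
  have "mu ((A \<union> B) \<inter> cell n k) = mu (A \<inter> cell n k) + mu (B \<inter> cell n k)" for k
    unfolding Int_Un_distrib2 by (rule finite_measure_Union) (use assms in auto)
  then show ?thesis by (simp add: curve_sum_def distrib_left scaleR_add_left sum.distrib)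
qed

lemma norm_curve_sum:
  assumes A: "A \<in> sets borel"
  shows "norm (curve_sum n A) \<le> L * mu A"
proof -
  have "norm (curve_sum n A) \<le> (\<Sum>k<2 ^ n. norm ((2 ^ n * mu (A \<inter> cell n k)) *\<^sub>R incr n k))"
    unfolding curve_sum_def by (rule norm_sum)
  also have "\<dots> \<le> (\<Sum>k<2 ^ n. L * mu (A \<inter> cell n k))"
  proof (rule sum_mono)
    fix k
    have "norm ((2 ^ n * mu (A \<inter> cell n k)) *\<^sub>R incr n k) = (2 ^ n * mu (A \<inter> cell n k)) * norm (incr n k)" by simp
    also have "\<dots> \<le> (2 ^ n * mu (A \<inter> cell n k)) * (L / 2 ^ n)" by (rule mult_left_mono[OF norm_incr]) simp
    finally show "norm ((2 ^ n * mu (A \<inter> cell n k)) *\<^sub>R incr n k) \<le> L * mu (A \<inter> cell n k)" by (simp add: mult.commute)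
  qed
  also have "\<dots> = L * mu (\<Union>k<2 ^ n. A \<inter> cell n k)"
  proof -
    have "mu (\<Union>k<2 ^ n. A \<inter> cell n k) = (\<Sum>k<2 ^ n. mu (A \<inter> cell n k))"
      by (rule finite_measure_finite_Union)
         (use A cell_disjoint[of n] in \<open>auto simp: disjoint_family_on_def\<close>)
    then show ?thesis by (simp add: sum_distrib_left)
  qed
  also have "\<dots> \<le> L * mu A"
    using A L_nonneg by (intro mult_left_mono finite_measure_mono) auto
  finally show ?thesis .
qed

text \<open>Over the dyadic cells below \<open>a\<close> the sum telescopes. The cell that contains
  \<open>a\<close> enters with the fraction \<open>\<theta>\<close>; both its contribution and the
  error of replacing \<open>a\<close> by the preceding grid point are at most
  \<open>L / 2 ^ n\<close>.\<close>

lemma curve_sum_lessThan: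
  assumes a: "0 \<le> a" "a \<le> 1"
  shows "norm (curve_sum n {..<a} - (f a - f 0)) \<le> 2 * L / 2 ^ n"
proof -
  define N :: nat where "N = 2 ^ n"
  have N: "N > 0" "2 ^ n = real N" by (simp_all add: N_def)
  define k0 where "k0 = nat \<lfloor>a * N\<rfloor>"
  define \<theta> where "\<theta> = a * N - real k0"
  have k0: "real k0 \<le> a * N" "a * N < real k0 + 1" using a(1) N by (auto simp: k0_def)
  have \<theta>: "0 \<le> \<theta>" "\<theta> < 1" using k0 by (auto simp: \<theta>_def)
  have "real k0 \<le> real N" using k0(1) a(2) N mult_right_mono[of a 1 "real N"] by linarith
  then have k0N: "k0 \<le> N" by simp
  have c: "real N * mu ({..<a} \<inter> cell n k) = (if k < k0 then 1 else if k = k0 then \<theta> else 0)" if k: "k < N" for k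
  proof -
    have k1: "real (Suc k) / N \<le> 1" using k N by simp
    consider "k < k0" | "k = k0" | "k > k0" by linarith
    then show ?thesis
    proof cases
      case 1
      then have "real (Suc k) \<le> a * N" using k0(1) by linarith
      then have "real (Suc k) / N \<le> a" using N(1) by (simp add: pos_divide_le_eq)
      then have "{..<a} \<inter> cell n k = {real k / N..<real (Suc k) / N}"
        unfolding cell_def N(2) by (auto intro: less_le_trans)
      moreover have "mu {real k / N..<real (Suc k) / N} = real (Suc k) / N - real k / N"
        using k1 N by (intro measure_unit_lborel_atLeastLessThan) (auto simp: divide_right_mono)
      ultimately show ?thesis using 1 N by (simp add: field_simps)
    next
      case 2
      have "a \<le> real (Suc k) / N" "real k / N \<le> a" using 2 k0 N(1) by (auto simp: field_simps)
      then have "{..<a} \<inter> cell n k = {real k / N..<a}" unfolding cell_def N(2) by auto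
      moreover have "mu {real k / N..<a} = a - real k / N"
        using a \<open>real k / N \<le> a\<close> N by (intro measure_unit_lborel_atLeastLessThan) auto
      ultimately show ?thesis using 2 N by (simp add: \<theta>_def field_simps)
    next
      case 3
      then have "a * N \<le> real k" using k0(2) by linarith
      then have "a \<le> real k / N" using N(1) by (simp add: field_simps)
      then have "{..<a} \<inter> cell n k = {}" unfolding cell_def N(2) by auto
      then show ?thesis using 3 by simp
    qed
  qed
  have "curve_sum n {..<a} = (\<Sum>k<N. (if k < k0 then 1 else if k = k0 then \<theta> else 0) *\<^sub>R incr n k)"
    unfolding curve_sum_def N(2) N_def[symmetric] using c by (intro sum.cong) auto
  also have "\<dots> = (\<Sum>k<N. (if k < k0 then incr n k else 0) + (if k = k0 then \<theta> *\<^sub>R incr n k else 0))"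
    by (intro sum.cong) auto
  also have "\<dots> = (\<Sum>k<k0. incr n k) + (if k0 < N then \<theta> *\<^sub>R incr n k0 else 0)"
  proof -
    have "{k. k < N \<and> k < k0} = {..<k0}" using k0N by auto
    then have "(\<Sum>k<N. if k < k0 then incr n k else 0) = (\<Sum>k<k0. incr n k)"
      by (simp add: sum.If_cases Int_def)
    moreover have "(\<Sum>k<N. if k = k0 then \<theta> *\<^sub>R incr n k else 0) = (if k0 < N then \<theta> *\<^sub>R incr n k0 else 0)"
      by (simp add: sum.delta')
    ultimately show ?thesis by (simp add: sum.distrib)
  qed
  also have "(\<Sum>k<k0. incr n k) = f (real k0 / N) - f 0"
    unfolding incr_def N(2) using sum_lessThan_telescope[of "\<lambda>k. f (real k / N)" k0] by simp
  finally have eq: "curve_sum n {..<a} - (f a - f 0) = (f (real k0 / N) - f a) + (if k0 < N then \<theta> *\<^sub>R incr n k0 else 0)"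
    by simp
  have "real k0 / N \<le> a" "a \<le> (real k0 + 1) / N"
    using k0 N(1) by (simp_all add: pos_divide_le_eq pos_le_divide_eq)
  then have "\<bar>real k0 / N - a\<bar> \<le> 1 / N" by (simp add: add_divide_distrib)
  then have "norm (f (real k0 / N) - f a) \<le> L * (1 / N)"
    using lip[of "real k0 / N" a] L_nonneg by (meson mult_left_mono order_trans)
  moreover have "norm (if k0 < N then \<theta> *\<^sub>R incr n k0 else 0) \<le> L / N"
    using norm_incr[of n k0] \<theta> L_nonneg N mult_mono[of \<theta> 1 "norm (incr n k0)" "L / N"] by auto
  ultimately show ?thesis unfolding eq N(2)
    using norm_triangle_ineq[of "f (real k0 / N) - f a" "if k0 < N then \<theta> *\<^sub>R incr n k0 else 0"] by simp
qed

lemma curve_sum_cong: "A \<inter> {0..<1} = B \<inter> {0..<1} \<Longrightarrow> A \<in> sets borel \<Longrightarrow> B \<in> sets borel \<Longrightarrow> curve_sum n A = curve_sum n B"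
proof -
  assume *: "A \<inter> {0..<1} = B \<inter> {0..<1}" "A \<in> sets borel" "B \<in> sets borel"
  have e: "{0..<1} \<inter> (A \<inter> cell n k) = {0..<1} \<inter> (B \<inter> cell n k)" for k using *(1) by blast
  have "mu (A \<inter> cell n k) = mu (B \<inter> cell n k)" for k
    unfolding measure_unit_lborel[OF sets.Int[OF *(2) cell_sets]] measure_unit_lborel[OF sets.Int[OF *(3) cell_sets]] e ..
  then show ?thesis unfolding curve_sum_def by simp
qed

lemma curve_sum_lessThan_limit:
  "(\<lambda>n. curve_sum n {..<a}) \<longlonglongrightarrow> f (max 0 (min 1 a)) - f 0"
proof -
  define b where "b = max 0 (min 1 a)"
  have eq: "curve_sum n {..<a} = curve_sum n {..<b}" for n
    by (rule curve_sum_cong) (auto simp: b_def)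
  have "\<forall>n. norm (curve_sum n {..<a} - (f b - f 0)) \<le> 2 * L / 2 ^ n"
    unfolding eq by (intro allI curve_sum_lessThan) (auto simp: b_def)
  moreover have "(\<lambda>n. 2 * L / 2 ^ n) \<longlonglongrightarrow> 0"
    by (rule LIMSEQ_divide_realpow_zero) auto
  ultimately have "(\<lambda>n. curve_sum n {..<a} - (f b - f 0)) \<longlonglongrightarrow> 0"
    by (rule Lim_null_comparison[OF always_eventually])
  then show ?thesis unfolding b_def[symmetric] by (simp add: LIM_zero_iff)
qed

text \<open>The sets with convergent sums include the half-lines, which are stable under
  intersection, and are closed under complements and countable disjoint unions. The latter holds
  because the bound \<open>L * mu A\<close> is uniform in \<open>n\<close>, so the tail of a union
  is uniformly small.\<close>

lemma convergent_curve_sum: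
  assumes "A \<in> sets borel"
  shows "convergent (\<lambda>n. curve_sum n A)"
proof -
  have "{..<a} \<inter> {..<b} = {..<min a b}" for a b :: real by auto
  then have "Int_stable (range (lessThan :: real \<Rightarrow> _))" unfolding Int_stable_def by auto
  moreover have "range (lessThan :: real \<Rightarrow> _) \<subseteq> Pow UNIV" by simp
  moreover have "A \<in> sigma_sets UNIV (range lessThan)"
    using assms by (simp add: borel_Iio sets_measure_of_conv)
  ultimately show ?thesis
  proof (induction A rule: sigma_sets_induct_disjoint)
    case (basic A)
    then show ?case using curve_sum_lessThan_limit by (auto simp: convergent_def)
  next
    case empty
    then show ?case by (simp add: curve_sum_def convergent_const)
  next
    case (compl A)
    have A: "A \<in> sets borel" using compl(1) by (simp add: borel_Iio sets_measure_of_conv)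
    have "curve_sum n (UNIV - A) = curve_sum n {..<1} - curve_sum n A" for n
    proof -
      have "curve_sum n {..<1} = curve_sum n (A \<union> (UNIV - A))" by (rule curve_sum_cong) auto
      also have "\<dots> = curve_sum n A + curve_sum n (UNIV - A)" by (rule curve_sum_Un) (use A in auto)
      finally show ?thesis by simp
    qed
    moreover have "convergent (\<lambda>n. curve_sum n {..<1})" using curve_sum_lessThan_limit by (auto simp: convergent_def)
    ultimately show ?case using compl(2) by (simp add: convergent_diff)
  next
    case (union A)
    have A: "A i \<in> sets borel" for i using union(2) by (auto simp: borel_Iio sets_measure_of_conv)
    define B where "B m = (\<Union>i<m. A i)" for m
    define U where "U = (\<Union>i. A i)"
    have U: "U \<in> sets borel" and B: "B m \<in> sets borel" for m unfolding U_def B_def using A by auto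
    have cB: "convergent (\<lambda>n. curve_sum n (B m))" for m
    proof (induction m)
      case (Suc m)
      have "B (Suc m) = B m \<union> A m" by (auto simp: B_def less_Suc_eq)
      moreover have "A i \<inter> A m = {}" if "i < m" for i
        using union(1) that by (auto simp: disjoint_family_on_def)
      then have "B m \<inter> A m = {}" unfolding B_def by blast
      ultimately show ?case using Suc union(3)[of m] curve_sum_Un[OF B A] by (simp add: convergent_add)
    qed (simp add: B_def curve_sum_def convergent_const)
    have "incseq B" unfolding B_def by (intro incseq_SucI) (auto simp: less_Suc_eq)
    moreover have "(\<Union>m. B m) = U" unfolding U_def B_def by blast
    ultimately have "(\<lambda>m. mu (B m)) \<longlonglongrightarrow> mu U"
      using finite_Lim_measure_incseq[of B] B by auto
    then have lim: "(\<lambda>m. L * (mu U - mu (B m))) \<longlonglongrightarrow> L * (mu U - mu U)"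
      by (intro tendsto_intros)
    have "Cauchy (\<lambda>n. curve_sum n U)"
      unfolding Cauchy_iff
    proof (intro allI impI)
      fix e :: real assume e: "0 < e"
      then have "eventually (\<lambda>m. L * (mu U - mu (B m)) < e / 3) sequentially"
        using lim by (intro order_tendstoD) auto
      then obtain m where m: "L * (mu U - mu (B m)) < e / 3" by (auto simp: eventually_sequentially)
      have close: "norm (curve_sum n U - curve_sum n (B m)) < e / 3" for n
      proof -
        have sub: "B m \<subseteq> U" unfolding U_def B_def by blast
        then have "U = B m \<union> (U - B m)" by blast
        then have "curve_sum n U = curve_sum n (B m) + curve_sum n (U - B m)"
          using curve_sum_Un[of "B m" "U - B m" n] U B by auto
        moreover have "norm (curve_sum n (U - B m)) \<le> L * mu (U - B m)" using U B by (intro norm_curve_sum) auto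
        moreover have "mu (U - B m) = mu U - mu (B m)" using finite_measure_Diff[of U "B m"] U B sub by simp
        ultimately show ?thesis using m by simp
      qed
      obtain K where K: "\<And>i j. K \<le> i \<Longrightarrow> K \<le> j \<Longrightarrow> norm (curve_sum i (B m) - curve_sum j (B m)) < e / 3"
        using convergent_Cauchy[OF cB[of m]] e unfolding Cauchy_iff by (meson divide_pos_pos zero_less_numeral)
      have "norm (curve_sum i U - curve_sum j U) < e" if "K \<le> i" "K \<le> j" for i j
      proof -
        have "curve_sum i U - curve_sum j U = (curve_sum i U - curve_sum i (B m)) +
          (curve_sum i (B m) - curve_sum j (B m)) - (curve_sum j U - curve_sum j (B m))" by simp
        also have "norm \<dots> \<le> norm (curve_sum i U - curve_sum i (B m)) + norm (curve_sum i (B m) - curve_sum j (B m)) +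
            norm (curve_sum j U - curve_sum j (B m))"
          by (intro order_trans[OF norm_triangle_ineq4] add_right_mono norm_triangle_ineq)
        finally show ?thesis using close[of i] close[of j] K[OF that] by linarith
      qed
      then show "\<exists>M. \<forall>i\<ge>M. \<forall>j\<ge>M. norm (curve_sum i U - curve_sum j U) < e" by blast
    qed
    then show ?case unfolding U_def[symmetric] by (rule Cauchy_convergent)
  qed
qed

definition G :: "real set \<Rightarrow> 'b" where
  "G A = lim (\<lambda>n. curve_sum n A)"

lemma G_limit: "A \<in> sets borel \<Longrightarrow> (\<lambda>n. curve_sum n A) \<longlonglongrightarrow> G A"
  unfolding G_def using convergent_curve_sum by (simp add: convergent_LIMSEQ_iff)

sublocale vector_measure unit_lborel G L
proof
  fix A B assume A: "A \<in> sets unit_lborel"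
  then have A': "A \<in> sets borel" by simp
  show "norm (G A) \<le> L * mu A"
    using norm_curve_sum[OF A'] by (intro LIMSEQ_le_const2[OF tendsto_norm[OF G_limit[OF A']]]) auto
  show "\<exists>B\<in>sets unit_lborel. B \<subseteq> A \<and> mu B = s" if "0 \<le> s" "s \<le> mu A" for s
    using unit_lborel_nonatomic[OF A' that] by simp
  assume B: "B \<in> sets unit_lborel" "A \<inter> B = {}"
  then have B': "B \<in> sets borel" by simp
  have "(\<lambda>n. curve_sum n A + curve_sum n B) \<longlonglongrightarrow> G (A \<union> B)"
    using G_limit[of "A \<union> B"] curve_sum_Un[OF A' B' B(2)] A' B' by simp
  moreover have "(\<lambda>n. curve_sum n A + curve_sum n B) \<longlonglongrightarrow> G A + G B"
    using G_limit[OF A'] G_limit[OF B'] by (rule tendsto_add)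
  ultimately show "G (A \<union> B) = G A + G B" by (rule LIMSEQ_unique)
qed (rule L_nonneg)

lemma G_atLeastLessThan:
  assumes "0 \<le> a" "a \<le> b" "b \<le> 1"
  shows "G {a..<b} = f b - f a"
proof -
  have lt: "G {..<c} = f c - f 0" if "0 \<le> c" "c \<le> 1" for c
    using LIMSEQ_unique[OF G_limit[of "{..<c}"] curve_sum_lessThan_limit[of c]] that by simp
  have "G {..<b} = G ({..<a} \<union> {a..<b})" using assms by (intro arg_cong[where f = G]) auto
  also have "\<dots> = G {..<a} + G {a..<b}" by (rule G_Un) auto
  finally show ?thesis using lt[of a] lt[of b] assms by (simp add: algebra_simps)
qed

end

section \<open>Oscillation of difference quotients\<close>

definition eps_differentiable :: "(real \<Rightarrow> 'b::real_normed_vector) \<Rightarrow> real \<Rightarrow> real \<Rightarrow> bool" where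
  "eps_differentiable f c t \<longleftrightarrow>
     (\<exists>w. \<exists>\<delta>>0. \<forall>s. \<bar>s\<bar> < \<delta> \<longrightarrow> norm (f (t + s) - f t - s *\<^sub>R w) \<le> c * \<bar>s\<bar>)"

text \<open>Strict inequalities and a countable family of scales make this set a countable
  intersection of open sets when \<open>f\<close> is continuous, which settles measurability. Up to
  a factor 2 in the constant it is the complement of \<open>eps_differentiable\<close>.\<close>

definition oscillating :: "(real \<Rightarrow> 'b::real_normed_vector) \<Rightarrow> real \<Rightarrow> real set" where
  "oscillating f c = {t. \<forall>n::nat. \<exists>s s'. 0 < \<bar>s\<bar> \<and> \<bar>s\<bar> < 1 / real (Suc n) \<and> 0 < \<bar>s'\<bar> \<and> \<bar>s'\<bar> < 1 / real (Suc n) \<and>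
     norm ((f (t + s) - f t) /\<^sub>R s - (f (t + s') - f t) /\<^sub>R s') > c}"

lemma not_oscillating_imp_eps_differentiable:
  assumes "t \<notin> oscillating f c"
  shows "eps_differentiable f c t"
proof -
  obtain n :: nat where n: "\<And>s s'. 0 < \<bar>s\<bar> \<Longrightarrow> \<bar>s\<bar> < 1 / real (Suc n) \<Longrightarrow> 0 < \<bar>s'\<bar> \<Longrightarrow> \<bar>s'\<bar> < 1 / real (Suc n) \<Longrightarrow>
     norm ((f (t + s) - f t) /\<^sub>R s - (f (t + s') - f t) /\<^sub>R s') \<le> c"
    using assms unfolding oscillating_def by (fastforce simp: not_less)
  define s0 where "s0 = 1 / (2 * real (Suc n))"
  have s0: "0 < \<bar>s0\<bar>" "\<bar>s0\<bar> < 1 / real (Suc n)" by (auto simp: s0_def field_simps)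
  define w where "w = (f (t + s0) - f t) /\<^sub>R s0"
  show ?thesis
    unfolding eps_differentiable_def
  proof (intro exI[of _ w] exI[of _ "1 / real (Suc n)"] conjI allI impI)
    fix s :: real assume s: "\<bar>s\<bar> < 1 / real (Suc n)"
    show "norm (f (t + s) - f t - s *\<^sub>R w) \<le> c * \<bar>s\<bar>"
    proof (cases "s = 0")
      case False
      have "norm ((f (t + s) - f t) /\<^sub>R s - w) \<le> c" unfolding w_def using n[OF _ s s0] False by simp
      then have "\<bar>s\<bar> * norm ((f (t + s) - f t) /\<^sub>R s - w) \<le> \<bar>s\<bar> * c" by (intro mult_left_mono) auto
      also have "\<bar>s\<bar> * norm ((f (t + s) - f t) /\<^sub>R s - w) = norm (s *\<^sub>R ((f (t + s) - f t) /\<^sub>R s - w))" by simp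
      also have "s *\<^sub>R ((f (t + s) - f t) /\<^sub>R s - w) = f (t + s) - f t - s *\<^sub>R w"
        using False by (simp add: scaleR_diff_right)
      finally show ?thesis by (simp add: mult.commute)
    qed simp
  qed simp
qed

lemma eps_differentiable_imp_not_oscillating:
  assumes "eps_differentiable f c' t" "2 * c' \<le> c"
  shows "t \<notin> oscillating f c"
proof
  assume t: "t \<in> oscillating f c"
  obtain w \<delta> where w: "\<delta> > 0" "\<And>s. \<bar>s\<bar> < \<delta> \<Longrightarrow> norm (f (t + s) - f t - s *\<^sub>R w) \<le> c' * \<bar>s\<bar>"
    using assms(1) unfolding eps_differentiable_def by blast
  obtain n :: nat where n: "1 / real (Suc n) < \<delta>" using w(1) nat_approx_posE by blast
  have close: "norm ((f (t + s) - f t) /\<^sub>R s - w) \<le> c'" if "0 < \<bar>s\<bar>" "\<bar>s\<bar> < 1 / real (Suc n)" for s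
  proof -
    have "(f (t + s) - f t) /\<^sub>R s - w = (f (t + s) - f t - s *\<^sub>R w) /\<^sub>R s"
      using that(1) by (simp add: scaleR_diff_right)
    then have "norm ((f (t + s) - f t) /\<^sub>R s - w) = norm (f (t + s) - f t - s *\<^sub>R w) / \<bar>s\<bar>"
      by (simp add: divide_inverse mult.commute)
    also have "\<dots> \<le> c'" using w(2)[of s] that n by (simp add: divide_le_eq)
    finally show ?thesis .
  qed
  obtain s s' where s: "0 < \<bar>s\<bar>" "\<bar>s\<bar> < 1 / real (Suc n)" "0 < \<bar>s'\<bar>" "\<bar>s'\<bar> < 1 / real (Suc n)"
     "norm ((f (t + s) - f t) /\<^sub>R s - (f (t + s') - f t) /\<^sub>R s') > c"
    using t unfolding oscillating_def by blast
  have "norm ((f (t + s) - f t) /\<^sub>R s - (f (t + s') - f t) /\<^sub>R s') \<le> c' + c'"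
    using norm_triangle_ineq4[of "(f (t + s) - f t) /\<^sub>R s - w" "(f (t + s') - f t) /\<^sub>R s' - w"]
      close[OF s(1,2)] close[OF s(3,4)] by simp
  then show False using s(5) assms(2) by simp
qed

text \<open>Two approximate slopes at \<open>t\<close> are compared by an increment that is short
  enough for both. They form a Cauchy sequence, whose limit is the derivative.\<close>

lemma eps_differentiable_imp_differentiable:
  fixes f :: "real \<Rightarrow> 'b::banach"
  assumes "\<And>n::nat. eps_differentiable f (1 / real (Suc n)) t"
  shows "f differentiable (at t)"
proof -
  have "\<forall>n. \<exists>w \<delta>. \<delta> > 0 \<and> (\<forall>s. \<bar>s\<bar> < \<delta> \<longrightarrow> norm (f (t + s) - f t - s *\<^sub>R w) \<le> 1 / real (Suc n) * \<bar>s\<bar>)"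
    using assms unfolding eps_differentiable_def by blast
  then obtain w \<delta> where w: "\<And>n. \<delta> n > (0::real)"
    "\<And>n s. \<bar>s\<bar> < \<delta> n \<Longrightarrow> norm (f (t + s) - f t - s *\<^sub>R w n) \<le> 1 / real (Suc n) * \<bar>s\<bar>" by metis
  have wd: "norm (w m - w n) \<le> 1 / real (Suc m) + 1 / real (Suc n)" for m n
  proof -
    define s where "s = min (\<delta> m) (\<delta> n) / 2"
    have s: "s > 0" "\<bar>s\<bar> < \<delta> m" "\<bar>s\<bar> < \<delta> n" using w(1)[of m] w(1)[of n] by (auto simp: s_def)
    have "s * norm (w m - w n) = norm (s *\<^sub>R w m - s *\<^sub>R w n)" using s(1) by (simp flip: scaleR_diff_right)
    also have "\<dots> = norm ((f (t + s) - f t - s *\<^sub>R w n) - (f (t + s) - f t - s *\<^sub>R w m))" by simp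
    also have "\<dots> \<le> s * (1 / real (Suc m) + 1 / real (Suc n))"
      using norm_triangle_ineq4[of "f (t + s) - f t - s *\<^sub>R w n" "f (t + s) - f t - s *\<^sub>R w m"]
        w(2)[OF s(2)] w(2)[OF s(3)] s(1) by (simp add: algebra_simps)
    finally show ?thesis using s(1) by simp
  qed
  have "Cauchy w"
    unfolding Cauchy_iff
  proof (intro allI impI)
    fix e :: real assume "0 < e"
    then obtain N :: nat where N: "1 / real (Suc N) < e / 2" using nat_approx_posE[of "e / 2"] by auto
    have "norm (w m - w n) < e" if "N \<le> m" "N \<le> n" for m n
    proof -
      have "1 / real (Suc m) \<le> 1 / real (Suc N)" "1 / real (Suc n) \<le> 1 / real (Suc N)"
        using that by (auto intro!: divide_left_mono)
      then show ?thesis using wd[of m n] N by linarith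
    qed
    then show "\<exists>M. \<forall>m\<ge>M. \<forall>n\<ge>M. norm (w m - w n) < e" by blast
  qed
  then obtain v where v: "w \<longlonglongrightarrow> v" using Cauchy_convergent convergent_def by blast
  have vd: "norm (w m - v) \<le> 1 / real (Suc m)" for m
  proof -
    have "(\<lambda>n. norm (w m - w n)) \<longlonglongrightarrow> norm (w m - v)" by (intro tendsto_intros v)
    moreover have "(\<lambda>n. 1 / real (Suc m) + 1 / real (Suc n)) \<longlonglongrightarrow> 1 / real (Suc m) + 0"
      by (intro tendsto_intros LIMSEQ_Suc lim_1_over_n)
    ultimately show ?thesis using wd[of m] by (auto intro: LIMSEQ_le)
  qed
  have "(f has_derivative (\<lambda>s. s *\<^sub>R v)) (at t)"
    unfolding has_derivative_at_alt
  proof (intro conjI allI impI)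
    show "bounded_linear (\<lambda>s. s *\<^sub>R v)" by (rule bounded_linear_scaleR_left)
    fix e :: real assume "0 < e"
    then obtain N :: nat where N: "1 / real (Suc N) < e / 2" using nat_approx_posE[of "e / 2"] by auto
    show "\<exists>d>0. \<forall>y. norm (y - t) < d \<longrightarrow> norm (f y - f t - (y - t) *\<^sub>R v) \<le> e * norm (y - t)"
    proof (intro exI[of _ "\<delta> N"] conjI allI impI w(1))
      fix y assume y: "norm (y - t) < \<delta> N"
      have "f y - f t - (y - t) *\<^sub>R v = (f (t + (y - t)) - f t - (y - t) *\<^sub>R w N) + (y - t) *\<^sub>R (w N - v)"
        by (simp add: algebra_simps)
      then have "norm (f y - f t - (y - t) *\<^sub>R v) \<le>
          norm (f (t + (y - t)) - f t - (y - t) *\<^sub>R w N) + norm ((y - t) *\<^sub>R (w N - v))"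
        by (metis norm_triangle_ineq)
      also have "\<dots> \<le> 1 / real (Suc N) * \<bar>y - t\<bar> + \<bar>y - t\<bar> * (1 / real (Suc N))"
        using w(2)[of "y - t" N] y mult_left_mono[OF vd[of N], of "\<bar>y - t\<bar>"] by (intro add_mono) auto
      also have "\<dots> = (2 * (1 / real (Suc N))) * \<bar>y - t\<bar>" by simp
      also have "\<dots> \<le> e * \<bar>y - t\<bar>" using N by (intro mult_right_mono) auto
      finally show "norm (f y - f t - (y - t) *\<^sub>R v) \<le> e * norm (y - t)" by simp
    qed
  qed
  then show ?thesis unfolding differentiable_def by blast
qed

lemma negligible_measure_unit_lborel:
  assumes "A \<in> sets borel" "A \<subseteq> {0..<1}" "measure unit_lborel A = 0"
  shows "negligible A"
proof -
  interpret prob_space unit_lborel by (rule unit_lborel(1))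
  have "emeasure lborel ({0..<1} \<inter> A) = 0"
    using assms(1,3) by (simp add: emeasure_unit_lborel[symmetric] emeasure_eq_measure)
  moreover have "{0..<1} \<inter> A = A" using assms(2) by blast
  ultimately have "A \<in> null_sets lborel" using assms(1) by auto
  then show ?thesis by (simp add: negligible_iff_null_sets null_sets_completionI)
qed

context lipschitz_curve
begin

lemma continuous: "continuous_on UNIV f"
proof -
  have "L-lipschitz_on UNIV f"
    by (rule lipschitz_onI) (use lip L_nonneg in \<open>auto simp: dist_norm\<close>)
  then show ?thesis by (rule lipschitz_on_continuous_on)
qed

lemma oscillating_borel: "oscillating f c \<in> sets borel"
proof -
  define W where "W s s' = {t. norm ((f (t + s) - f t) /\<^sub>R s - (f (t + s') - f t) /\<^sub>R s') > c}" for s s'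
  have c: "continuous_on UNIV (\<lambda>t. f (t + s))" for s
    by (rule continuous_on_compose2[OF continuous]) (auto intro!: continuous_intros)
  have "open (W s s')" for s s'
    unfolding W_def by (intro open_Collect_less continuous_intros c continuous)
  then have "open (\<Union>(s, s')\<in>{(s, s'). 0 < \<bar>s\<bar> \<and> \<bar>s\<bar> < 1 / real (Suc n) \<and> 0 < \<bar>s'\<bar> \<and> \<bar>s'\<bar> < 1 / real (Suc n)}. W s s')" for n
    by (auto intro!: open_UN)
  then have "(\<Inter>n. \<Union>(s, s')\<in>{(s, s'). 0 < \<bar>s\<bar> \<and> \<bar>s\<bar> < 1 / real (Suc n) \<and> 0 < \<bar>s'\<bar> \<and> \<bar>s'\<bar> < 1 / real (Suc n)}. W s s') \<in> sets borel"
    by (intro sets.countable_INT) auto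
  also have "(\<Inter>n. \<Union>(s, s')\<in>{(s, s'). 0 < \<bar>s\<bar> \<and> \<bar>s\<bar> < 1 / real (Suc n) \<and> 0 < \<bar>s'\<bar> \<and> \<bar>s'\<bar> < 1 / real (Suc n)}. W s s') = oscillating f c"
    unfolding oscillating_def W_def by auto
  finally show ?thesis .
qed

text \<open>At a density point \<open>t\<close> of \<open>A\<close> a short interval with end point
  \<open>t\<close> lies in \<open>A\<close> up to a small proportion. The part in \<open>A\<close>
  contributes nearly its measure times \<open>w\<close>, and the rest is controlled by the norm
  bound of \<open>G\<close>.\<close>

lemma concentrated_imp_eps_differentiable:
  assumes A: "A \<in> sets borel" "A \<subseteq> {0..<1}" and conc: "concentrated \<epsilon> A" and \<epsilon>: "\<epsilon> > 0"
  shows "negligible {t \<in> A. \<not> eps_differentiable f (2 * \<epsilon>) t}"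
proof -
  obtain w where w: "\<And>A'. A' \<in> sets borel \<Longrightarrow> A' \<subseteq> A \<Longrightarrow> norm (G A' - mu A' *\<^sub>R w) \<le> \<epsilon> * mu A'"
    using conc unfolding concentrated_def by auto
  define R where "R = L + norm w"
  have R: "R \<ge> 0" using L_nonneg by (simp add: R_def)
  \<comment> \<open>\<open>R\<close> bounds \<open>G X - mu X *\<^sub>R w\<close> relative to the
    measure of \<open>X\<close>, and \<eta> makes the part of an interval outside of
    \<open>A\<close> cost at most another \<epsilon>. The factor 2 arises because an interval of
    length \<open>\<bar>s\<bar>\<close> is put into a ball of radius
    \<open>2 * \<bar>s\<bar>\<close>.\<close>
  define \<eta> where "\<eta> = \<epsilon> / (2 * (R + 1))"
  have \<eta>: "\<eta> > 0" "2 * (R * \<eta>) \<le> \<epsilon>" using \<epsilon> R by (auto simp: \<eta>_def field_simps)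
  let ?P = "{t \<in> A. \<forall>\<delta>>0. \<exists>r. 0 < r \<and> r < \<delta> \<and> measure lebesgue (ball t r - A) > \<eta> * r}"
  \<comment> \<open>Increments of \<open>f\<close> are values of \<open>G\<close> only inside the
    unit interval; of the points of \<open>A\<close> just 0 has no neighbourhood there.\<close>
  have "negligible (insert 0 ?P)" using density_points[of A \<eta>] A(1) \<eta>(1) by simp
  moreover have "{t \<in> A. \<not> eps_differentiable f (2 * \<epsilon>) t} \<subseteq> insert 0 ?P"
  proof
    fix t assume t: "t \<in> {t \<in> A. \<not> eps_differentiable f (2 * \<epsilon>) t}"
    show "t \<in> insert 0 ?P"
    proof (rule ccontr)
      assume nt: "t \<notin> insert 0 ?P"
      then have t01: "0 < t" "t < 1" "t \<in> A" using t A(2) by force+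
      obtain \<delta>0 where \<delta>0: "\<delta>0 > 0" "\<And>r. 0 < r \<Longrightarrow> r < \<delta>0 \<Longrightarrow> measure lebesgue (ball t r - A) \<le> \<eta> * r"
        using nt t01(3) by (auto simp: not_less) (meson not_le)
      define \<delta> where "\<delta> = min (\<delta>0 / 2) (min t (1 - t))"
      have "norm (f (t + s) - f t - s *\<^sub>R w) \<le> 2 * \<epsilon> * \<bar>s\<bar>" if s: "\<bar>s\<bar> < \<delta>" for s
      proof (cases "s = 0")
        case False
        define a where "a = min t (t + s)"
        define b where "b = max t (t + s)"
        define J where "J = {a..<b}"
        have ab: "0 \<le> a" "a \<le> b" "b \<le> 1" "b - a = \<bar>s\<bar>" using s by (auto simp: \<delta>_def a_def b_def)
        have J: "J \<in> sets borel" "mu J = \<bar>s\<bar>" "G J = f b - f a"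
          using measure_unit_lborel_atLeastLessThan[OF ab(1-3)] G_atLeastLessThan[OF ab(1-3)] ab(4) by (auto simp: J_def)
        have JA: "J \<inter> A \<in> sets borel" "J - A \<in> sets borel" using J(1) A(1) by auto
        have "G J = G (J \<inter> A) + G (J - A)"
          using G_Un[of "J \<inter> A" "J - A"] JA by (simp add: Int_Diff_disjoint Int_Diff_Un)
        moreover have "mu J = mu (J \<inter> A) + mu (J - A)"
          using finite_measure_Union[of "J \<inter> A" "J - A"] JA by (simp add: Int_Diff_disjoint Int_Diff_Un)
        ultimately have "G J - \<bar>s\<bar> *\<^sub>R w = (G (J \<inter> A) - mu (J \<inter> A) *\<^sub>R w) + (G (J - A) - mu (J - A) *\<^sub>R w)"
          using J(2) by (simp add: algebra_simps)
        then have "norm (G J - \<bar>s\<bar> *\<^sub>R w) \<le> norm (G (J \<inter> A) - mu (J \<inter> A) *\<^sub>R w) + norm (G (J - A) - mu (J - A) *\<^sub>R w)"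
          by (metis norm_triangle_ineq)
        also have "norm (G (J \<inter> A) - mu (J \<inter> A) *\<^sub>R w) \<le> \<epsilon> * mu (J \<inter> A)" using w[OF JA(1)] by simp
        also have "\<epsilon> * mu (J \<inter> A) \<le> \<epsilon> * \<bar>s\<bar>"
          unfolding J(2)[symmetric] using \<epsilon> J(1) by (intro mult_left_mono finite_measure_mono) auto
        also have "norm (G (J - A) - mu (J - A) *\<^sub>R w) \<le> R * mu (J - A)"
          using norm_triangle_ineq4[of "G (J - A)" "mu (J - A) *\<^sub>R w"] G_norm[of "J - A"] JA(2)
          by (simp add: R_def algebra_simps)
        also have "mu (J - A) \<le> 2 * \<eta> * \<bar>s\<bar>"
        proof -
          have sub: "{0..<1} \<inter> (J - A) \<subseteq> ball t (2 * \<bar>s\<bar>) - A"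
            using False by (auto simp: J_def a_def b_def dist_real_def)
          have "mu (J - A) = measure lebesgue ({0..<1} \<inter> (J - A))"
            using JA(2) by (simp add: measure_unit_lborel)
          also have "\<dots> \<le> measure lebesgue (ball t (2 * \<bar>s\<bar>) - A)"
            using sub JA(2) A(1) by (intro measure_mono_fmeasurable) (auto intro!: fmeasurable_Diff)
          also have "\<dots> \<le> \<eta> * (2 * \<bar>s\<bar>)" using False s by (intro \<delta>0(2)) (auto simp: \<delta>_def)
          finally show ?thesis by simp
        qed
        then have "R * mu (J - A) \<le> R * (2 * \<eta> * \<bar>s\<bar>)" using R by (rule mult_left_mono)
        also have "\<dots> = (2 * (R * \<eta>)) * \<bar>s\<bar>" by simp
        also have "\<dots> \<le> \<epsilon> * \<bar>s\<bar>" using \<eta>(2) by (intro mult_right_mono) auto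
        finally have "norm (G J - \<bar>s\<bar> *\<^sub>R w) \<le> \<epsilon> * \<bar>s\<bar> + \<epsilon> * \<bar>s\<bar>" by simp
        moreover have "norm (f (t + s) - f t - s *\<^sub>R w) = norm (G J - \<bar>s\<bar> *\<^sub>R w)"
        proof (cases "s > 0")
          case True
          then show ?thesis unfolding J(3) by (simp add: a_def b_def)
        next
          case F: False
          then have "G J - \<bar>s\<bar> *\<^sub>R w = - (f (t + s) - f t - s *\<^sub>R w)"
            unfolding J(3) by (simp add: a_def b_def)
          then show ?thesis by (simp only: norm_minus_cancel)
        qed
        ultimately show ?thesis by simp
      qed simp
      moreover have "\<delta> > 0" using \<delta>0(1) t01 by (simp add: \<delta>_def)
      ultimately have "eps_differentiable f (2 * \<epsilon>) t" unfolding eps_differentiable_def by blast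
      then show False using t by blast
    qed
  qed
  ultimately show ?thesis by (rule negligible_subset)
qed

text \<open>Where \<open>G\<close> is concentrated with constant \<open>c / 4\<close>, almost every
  point is differentiable up to \<open>c / 2\<close>, and such points do not oscillate by more than
  \<open>c\<close>. This determines the constant \<open>c / 8\<close>.\<close>

lemma splittable_oscillating:
  assumes c: "c > 0" and nn: "\<not> negligible (oscillating f c \<inter> {0..<1})"
  shows "splittable_measure unit_lborel G L (oscillating f c \<inter> {0..<1}) (c / 8)"
proof
  let ?E = "oscillating f c \<inter> {0..<1}"
  have E: "?E \<in> sets borel" using oscillating_borel by auto
  then show "?E \<in> sets unit_lborel" by simp
  show "0 < mu ?E"
    using negligible_measure_unit_lborel[OF E] nn measure_nonneg[of unit_lborel ?E]
    by (metis inf.cobounded2 order_less_le)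
  show "0 < c / 8" using c by simp
  show "\<not> concentrated (2 * (c / 8)) A" if A: "A \<in> sets unit_lborel" "A \<subseteq> ?E" "0 < mu A" for A
  proof
    assume "concentrated (2 * (c / 8)) A"
    then have "negligible {t \<in> A. \<not> eps_differentiable f (2 * (2 * (c / 8))) t}"
      using A c by (intro concentrated_imp_eps_differentiable) auto
    moreover have "{t \<in> A. \<not> eps_differentiable f (2 * (2 * (c / 8))) t} = A"
      using A(2) eps_differentiable_imp_not_oscillating[of f "2 * (2 * (c / 8))" _ c] by auto
    ultimately have "A \<in> null_sets lebesgue" by (simp add: negligible_iff_null_sets)
    then have "A \<in> null_sets lborel" using A(1) by (simp add: null_sets_completion_iff)
    then have "emeasure lborel ({0..<1} \<inter> A) = 0"
      using A(1) by (meson Int_lower2 emeasure_eq_0 null_setsD1 null_setsD2)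
    then have "measure lborel ({0..<1} \<inter> A) = 0" by (simp add: measure_def)
    then show False using A(1,3) by (simp add: measure_unit_lborel)
  qed
qed

end

text \<open>For real values, Hahn decompositions at levels with distance \<epsilon> slice the set
  into finitely many parts on which \<open>G\<close> is concentrated. The levels reach beyond
  \<open>- L\<close> and \<open>L\<close>, so the parts below the lowest and above the highest level
  are null.\<close>

lemma real_oscillating_negligible:
  fixes f :: "real \<Rightarrow> real"
  assumes "lipschitz_curve f L" and c: "c > 0"
  shows "negligible (oscillating f c \<inter> {0..<1})"
proof -
  interpret lipschitz_curve f L by (rule assms(1))
  let ?E = "oscillating f c \<inter> {0..<1}"
  define \<epsilon> where "\<epsilon> = c / 4"
  have \<epsilon>: "\<epsilon> > 0" using c by (simp add: \<epsilon>_def)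
  have E: "?E \<in> sets borel" using oscillating_borel by auto
  have "\<exists>Y. Y \<in> sets borel \<and> (\<forall>X\<in>sets borel. X \<subseteq> Y \<longrightarrow> G X \<le> a * mu X) \<and>
    (\<forall>X\<in>sets borel. X \<inter> Y = {} \<longrightarrow> a * mu X \<le> G X)" for a
  proof -
    have l: "linear (\<lambda>x::real. x)" by (simp add: linear_iff)
    show ?thesis by (rule Hahn_split[OF l, of a]) (simp, unfold unit_lborel(2), blast)
  qed
  then obtain Y where Y: "\<And>a. Y a \<in> sets borel" "\<And>a X. X \<in> sets borel \<Longrightarrow> X \<subseteq> Y a \<Longrightarrow> G X \<le> a * mu X"
    "\<And>a X. X \<in> sets borel \<Longrightarrow> X \<inter> Y a = {} \<Longrightarrow> a * mu X \<le> G X"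
    by metis
  obtain K :: nat where K: "L / \<epsilon> < real K" using reals_Archimedean2 by blast
  then have KL: "real K * \<epsilon> > L" using \<epsilon> by (simp add: divide_less_eq)
  define a where "a j = (real j - real K) * \<epsilon>" for j :: nat
  have aS: "a (Suc j) = a j + \<epsilon>" for j by (simp add: a_def algebra_simps)
  have 1: "negligible (?E \<inter> Y (a 0))"
  proof (rule negligible_measure_unit_lborel)
    show b: "?E \<inter> Y (a 0) \<in> sets borel" using E Y(1) by auto
    have "(real K * \<epsilon> - L) * mu (?E \<inter> Y (a 0)) \<le> 0"
      using Y(2)[OF b, of "a 0"] G_norm[of "?E \<inter> Y (a 0)"] b by (simp add: a_def algebra_simps abs_le_iff)
    then show "mu (?E \<inter> Y (a 0)) = 0"
      using KL measure_nonneg[of unit_lborel "?E \<inter> Y (a 0)"] by (simp add: mult_le_0_iff)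
  qed auto
  have 2: "negligible (?E - Y (a (2 * K)))"
  proof (rule negligible_measure_unit_lborel)
    show b: "?E - Y (a (2 * K)) \<in> sets borel" using E Y(1) by auto
    have "(real K * \<epsilon> - L) * mu (?E - Y (a (2 * K))) \<le> 0"
      using Y(3)[OF b, of "a (2 * K)"] G_norm[of "?E - Y (a (2 * K))"] b
      by (simp add: Diff_Int_distrib2 Diff_disjoint Int_commute) (simp add: a_def algebra_simps abs_le_iff)
    then show "mu (?E - Y (a (2 * K))) = 0"
      using KL measure_nonneg[of unit_lborel "?E - Y (a (2 * K))"] by (simp add: mult_le_0_iff)
  qed auto
  have 3: "negligible (?E \<inter> (Y (a (Suc j)) - Y (a j)))" for j
  proof -
    let ?A = "?E \<inter> (Y (a (Suc j)) - Y (a j))"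
    have A: "?A \<in> sets borel" using E Y(1) by auto
    have "concentrated \<epsilon> ?A"
      unfolding concentrated_def
    proof (intro exI[of _ "a j"] ballI impI)
      fix X assume X: "X \<in> sets unit_lborel" "X \<subseteq> ?A"
      have "a j * mu X \<le> G X" using Y(3)[of X "a j"] X by auto
      moreover have "G X \<le> (a j + \<epsilon>) * mu X" using Y(2)[of X "a (Suc j)"] X by (auto simp: aS)
      ultimately show "norm (G X - mu X *\<^sub>R a j) \<le> \<epsilon> * mu X" by (simp add: abs_le_iff algebra_simps)
    qed
    then have "negligible {t \<in> ?A. \<not> eps_differentiable f (2 * \<epsilon>) t}"
      using A \<epsilon> by (intro concentrated_imp_eps_differentiable) auto
    moreover have "{t \<in> ?A. \<not> eps_differentiable f (2 * \<epsilon>) t} = ?A"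
      using eps_differentiable_imp_not_oscillating[of f "2 * \<epsilon>" _ c] by (auto simp: \<epsilon>_def)
    ultimately show ?thesis by simp
  qed
  have "?E \<subseteq> (?E \<inter> Y (a 0)) \<union> (?E - Y (a (2 * K))) \<union> (\<Union>j<2 * K. ?E \<inter> (Y (a (Suc j)) - Y (a j)))"
  proof
    fix x assume x: "x \<in> ?E"
    show "x \<in> (?E \<inter> Y (a 0)) \<union> (?E - Y (a (2 * K))) \<union> (\<Union>j<2 * K. ?E \<inter> (Y (a (Suc j)) - Y (a j)))"
    proof (rule ccontr)
      assume nx: "x \<notin> (?E \<inter> Y (a 0)) \<union> (?E - Y (a (2 * K))) \<union> (\<Union>j<2 * K. ?E \<inter> (Y (a (Suc j)) - Y (a j)))"
      have "x \<notin> Y (a j)" if "j \<le> 2 * K" for j using that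
      proof (induction j)
        case 0
        then show ?case using nx x by blast
      next
        case (Suc j)
        then have "j < 2 * K" "x \<notin> Y (a j)" by auto
        then show ?case using nx x by blast
      qed
      then show False using nx x by blast
    qed
  qed
  then show ?thesis
    by (rule negligible_subset[rotated]) (intro negligible_Un negligible_Union 1 2; use 3 in auto)
qed

section \<open>From the failure of RNP to a separated tree of vectors\<close>

lemma not_negligible_oscillating:
  fixes f :: "real \<Rightarrow> 'b::banach"
  assumes "\<not> negligible {t. \<not> f differentiable (at t)}"
  obtains z :: int and n :: nat where "\<not> negligible (oscillating (\<lambda>t. f (of_int z + t)) (1 / real (Suc n)) \<inter> {0..<1})"
proof -
  have shift: "oscillating f c \<inter> {of_int z..<of_int z + 1} = (+) (of_int z) ` (oscillating (\<lambda>t. f (of_int z + t)) c \<inter> {0..<1})" for c z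
  proof (intro equalityI subsetI)
    fix x assume "x \<in> oscillating f c \<inter> {of_int z..<of_int z + 1}"
    then show "x \<in> (+) (of_int z) ` (oscillating (\<lambda>t. f (of_int z + t)) c \<inter> {0..<1})"
      by (intro image_eqI[of _ _ "x - of_int z"]) (auto simp: oscillating_def)
  qed (auto simp: oscillating_def add.assoc)
  show ?thesis
  proof (rule ccontr)
    assume "\<not> thesis"
    then have neg: "negligible (oscillating (\<lambda>t. f (of_int z + t)) (1 / real (Suc n)) \<inter> {0..<1})" for z n
      using that by blast
    have "{t. \<not> f differentiable (at t)} \<subseteq> (\<Union>n. \<Union>z. oscillating f (1 / real (Suc n)) \<inter> {of_int z..<of_int z + 1})"
    proof
      fix t assume "t \<in> {t. \<not> f differentiable (at t)}"
      then obtain n :: nat where "\<not> eps_differentiable f (1 / real (Suc n)) t"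
        using eps_differentiable_imp_differentiable by blast
      then have "t \<in> oscillating f (1 / real (Suc n))" using not_oscillating_imp_eps_differentiable by blast
      moreover have "t \<in> {of_int \<lfloor>t\<rfloor>..<of_int \<lfloor>t\<rfloor> + 1}" by simp
      ultimately show "t \<in> (\<Union>n. \<Union>z. oscillating f (1 / real (Suc n)) \<inter> {of_int z..<of_int z + 1})" by blast
    qed
    moreover have "negligible (oscillating f (1 / real (Suc n)) \<inter> {of_int z..<of_int z + 1})" for n z
      unfolding shift by (rule negligible_translation[OF neg])
    then have "negligible (\<Union>n. \<Union>z. oscillating f (1 / real (Suc n)) \<inter> {of_int z..<of_int z + 1})"
      by (intro negligible_Union_nat negligible_countable_Union) auto
    ultimately show False using assms negligible_subset by blast
  qed
qed

lemma not_RNP_imp_nondifferentiable_curve: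
  assumes "\<not> RNP (UNIV :: 'b::banach set)"
  obtains f :: "real \<Rightarrow> 'b::banach" and L where "lipschitz_curve f L" "\<not> negligible {t. \<not> f differentiable (at t)}"
proof -
  obtain f :: "real \<Rightarrow> 'b" where f: "Lipschitz_continuous_map euclidean_metric (submetric euclidean_metric UNIV) f"
    "\<not> (AE t in lebesgue. f differentiable (at t))"
    using assms unfolding RNP_def by blast
  obtain L where "\<And>s t. dist (f s) (f t) \<le> L * dist s t"
    using f(1) unfolding Lipschitz_continuous_map_def by auto
  then have "lipschitz_curve f L" by unfold_locales (simp add: dist_norm)
  moreover have "\<not> negligible {t. \<not> f differentiable (at t)}"
  proof
    assume "negligible {t. \<not> f differentiable (at t)}"
    then have "{t. \<not> f differentiable (at t)} \<in> null_sets lebesgue" by (simp add: negligible_iff_null_sets)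
    then have "AE t in lebesgue. f differentiable (at t)" by (rule AE_I') auto
    then show False using f(2) by blast
  qed
  ultimately show ?thesis by (rule that)
qed

lemma real_lipschitz_differentiable:
  fixes f :: "real \<Rightarrow> real"
  assumes "lipschitz_curve f L"
  shows "negligible {t. \<not> f differentiable (at t)}"
  by (metis ccontr not_negligible_oscillating assms add_diff_cancel_left real_oscillating_negligible of_nat_0_less_iff zero_less_Suc zero_less_divide_1_iff lipschitz_curve_def)

text \<open>Adding a scalar correction to a nondifferentiable curve turns it into a section of a linear
  functional without making it differentiable, since Lipschitz functions into the reals are
  differentiable almost everywhere.\<close>

lemma not_RNP_imp_section:
  assumes "\<not> RNP (UNIV :: 'b::banach set)"
  obtains g :: "real \<Rightarrow> 'b::banach" and L \<phi> z c where "lipschitz_curve g L" "linear \<phi>" "\<And>v. \<bar>\<phi> v\<bar> \<le> norm v"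
    "\<And>t. \<phi> (g t) = z + t" "c > 0" "\<not> negligible (oscillating g c \<inter> {0..<1})"
proof -
  obtain f :: "real \<Rightarrow> 'b" and L where f: "lipschitz_curve f L" "\<not> negligible {t. \<not> f differentiable (at t)}"
    by (rule not_RNP_imp_nondifferentiable_curve[OF assms])
  have "\<exists>e::'b. e \<noteq> 0"
  proof (rule ccontr)
    assume "\<nexists>e::'b. e \<noteq> 0"
    then have "f = (\<lambda>_. 0)" by auto
    then show False using f(2) by simp
  qed
  then obtain e0 :: 'b where "e0 \<noteq> 0" by blast
  define e where "e = sgn e0"
  have e: "norm e = 1" using \<open>e0 \<noteq> 0\<close> by (simp add: e_def norm_sgn)
  obtain \<phi> where \<phi>: "linear \<phi>" "\<And>v. \<bar>\<phi> v\<bar> \<le> norm v" "\<phi> e = norm e"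
    using norming_functional by blast
  interpret f: lipschitz_curve f L by (rule f(1))
  \<comment> \<open>The curve is projected to the kernel of \<open>\<phi>\<close> along
    \<open>e\<close>, and \<open>t *\<^sub>R e\<close> is added; \<open>\<phi> e = 1\<close> then
    gives \<open>\<phi> (h t) = t\<close>.\<close>
  define h where "h t = f t - \<phi> (f t) *\<^sub>R e + t *\<^sub>R e" for t
  have \<phi>h: "\<phi> (h t) = t" for t
    by (simp add: h_def linear_add[OF \<phi>(1)] linear_diff[OF \<phi>(1)] linear_scale[OF \<phi>(1)] \<phi>(3) e)
  have \<phi>f: "\<bar>\<phi> (f s) - \<phi> (f t)\<bar> \<le> L * \<bar>s - t\<bar>" for s t
    using \<phi>(2)[of "f s - f t"] f.lip[of s t] by (simp add: linear_diff[OF \<phi>(1)])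
  have hl: "norm (h s - h t) \<le> (2 * L + 1) * \<bar>s - t\<bar>" for s t
  proof -
    have "h s - h t = (f s - f t) - (\<phi> (f s) - \<phi> (f t)) *\<^sub>R e + (s - t) *\<^sub>R e"
      by (simp add: h_def algebra_simps)
    also have "norm \<dots> \<le> norm (f s - f t) + norm ((\<phi> (f s) - \<phi> (f t)) *\<^sub>R e) + norm ((s - t) *\<^sub>R e)"
      by (intro order_trans[OF norm_triangle_ineq] add_right_mono norm_triangle_ineq4)
    also have "\<dots> \<le> L * \<bar>s - t\<bar> + L * \<bar>s - t\<bar> + \<bar>s - t\<bar>"
      using f.lip[of s t] \<phi>f[of s t] e by (intro add_mono) auto
    finally show ?thesis by (simp add: algebra_simps)
  qed
  have "\<not> negligible {t. \<not> h differentiable (at t)}"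
  proof
    assume n1: "negligible {t. \<not> h differentiable (at t)}"
    have "lipschitz_curve (\<lambda>t. \<phi> (f t)) L" by unfold_locales (use \<phi>f in simp)
    then have n2: "negligible {t. \<not> (\<lambda>t. \<phi> (f t)) differentiable (at t)}" by (rule real_lipschitz_differentiable)
    have "f differentiable (at t)" if "h differentiable (at t)" "(\<lambda>t. \<phi> (f t)) differentiable (at t)" for t
    proof -
      have "(\<lambda>t. h t + \<phi> (f t) *\<^sub>R e - t *\<^sub>R e) differentiable (at t)"
        using that by (intro differentiable_add differentiable_diff differentiable_scaleR) auto
      moreover have "(\<lambda>t. h t + \<phi> (f t) *\<^sub>R e - t *\<^sub>R e) = f" by (auto simp: h_def)
      ultimately show ?thesis by simp
    qed
    then have "{t. \<not> f differentiable (at t)} \<subseteq> {t. \<not> h differentiable (at t)} \<union> {t. \<not> (\<lambda>t. \<phi> (f t)) differentiable (at t)}"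
      by blast
    then show False using f(2) negligible_Un[OF n1 n2] negligible_subset by blast
  qed
  then obtain z :: int and n :: nat where
    "\<not> negligible (oscillating (\<lambda>t. h (of_int z + t)) (1 / real (Suc n)) \<inter> {0..<1})"
    by (rule not_negligible_oscillating)
  moreover have "lipschitz_curve (\<lambda>t. h (of_int z + t)) (2 * L + 1)"
    using hl[of "of_int z + _" "of_int z + _"] by unfold_locales simp
  ultimately show ?thesis
    using that[of "\<lambda>t. h (of_int z + t)" "2 * L + 1" \<phi> "of_int z" "1 / real (Suc n)"] \<phi>(1,2) \<phi>h by simp
qed

text \<open>The vectors \<open>u i k\<close> are the values of \<open>G\<close> on the tree,
  normalised by the measure of its root. As \<open>\<phi>\<close> maps increments of the curve to
  lengths, it turns \<open>G\<close> into the measure. The indices in the last clause run through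
  all descendants of the second and of the third child; this is what the bounds on all subsets in
  \<open>separated_pair\<close> yield.\<close>

theorem not_RNP_imp_separated_tree:
  assumes "\<not> RNP (UNIV :: 'b::banach set)"
  obtains u :: "nat \<Rightarrow> nat \<Rightarrow> 'b::banach" and \<phi> L \<epsilon> S where
    "linear \<phi>" "\<And>v. \<bar>\<phi> v\<bar> \<le> norm v" "\<epsilon> > (0::real)" "infinite S"
    "\<And>i k. k < 4 ^ i \<Longrightarrow> \<phi> (u i k) = 1 / 4 ^ i" "\<And>i k. k < 4 ^ i \<Longrightarrow> norm (u i k) \<le> L / 4 ^ i"
    "\<And>i k. k < 4 ^ i \<Longrightarrow> u i k = (\<Sum>d<4. u (Suc i) (4 * k + d))"
    "\<And>i k. i \<in> S \<Longrightarrow> k < 4 ^ i \<Longrightarrow> \<exists>\<psi> a. linear \<psi> \<and> (\<forall>v. \<bar>\<psi> v\<bar> \<le> norm v) \<and>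
       (\<forall>n r. r < 4 ^ n \<longrightarrow> (a + \<epsilon>) / 4 ^ (Suc i + n) \<le> \<psi> (u (Suc i + n) ((4 * k + 1) * 4 ^ n + r))) \<and>
       (\<forall>n r. r < 4 ^ n \<longrightarrow> \<psi> (u (Suc i + n) ((4 * k + 2) * 4 ^ n + r)) \<le> a / 4 ^ (Suc i + n))"
proof -
  obtain g :: "real \<Rightarrow> 'b" and L \<phi> z c where g: "lipschitz_curve g L" "linear \<phi>" "\<And>v. \<bar>\<phi> v\<bar> \<le> norm v"
    "\<And>t. \<phi> (g t) = z + t" "c > 0" "\<not> negligible (oscillating g c \<inter> {0..<1})"
    using not_RNP_imp_section[OF assms] by metis
  interpret lipschitz_curve g L by (rule g(1))
  interpret splittable_measure unit_lborel G L "oscillating g c \<inter> {0..<1}" "c / 8"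
    by (rule splittable_oscillating[OF g(5,6)])
  have bl: "bounded_linear \<phi>"
    using g(2,3) by (intro bounded_linear_intro[where K = 1]) (auto simp: linear_add linear_scale)
  have \<phi>G: "\<phi> (G A) = mu A" if A: "A \<in> sets borel" for A
  proof -
    have "\<phi> (incr n k) = 1 / 2 ^ n" for n k
      by (simp add: incr_def linear_diff[OF g(2)] g(4) diff_divide_distrib[symmetric])
    then have "\<phi> (curve_sum n A) = mu A" for n
    proof -
      assume \<phi>i: "\<And>n k. \<phi> (incr n k) = 1 / 2 ^ n"
      have "\<phi> (curve_sum n A) = (\<Sum>k<2 ^ n. mu (A \<inter> cell n k))"
        by (simp add: curve_sum_def linear_sum[OF g(2)] linear_scale[OF g(2)] \<phi>i)
      also have "\<dots> = mu (\<Union>k<2 ^ n. A \<inter> cell n k)"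
        by (rule finite_measure_finite_Union[symmetric])
           (use A cell_disjoint[of n] in \<open>auto simp: disjoint_family_on_def\<close>)
      also have "\<dots> = mu A"
      proof -
        have "{0..<1} \<inter> (\<Union>k<2 ^ n. A \<inter> cell n k) = {0..<1} \<inter> A"
        proof (intro equalityI subsetI)
          fix x :: real assume x: "x \<in> {0..<1} \<inter> A"
          define k where "k = nat \<lfloor>x * 2 ^ n\<rfloor>"
          have "real k \<le> x * 2 ^ n" "x * 2 ^ n < real k + 1" using x by (auto simp: k_def)
          moreover have "x * 2 ^ n < 2 ^ n" using x by simp
          ultimately have "real k < 2 ^ n" "x \<in> cell n k" by (linarith, simp add: cell_def field_simps)
          then have "k < 2 ^ n" "x \<in> A \<inter> cell n k" using x by auto
          then show "x \<in> {0..<1} \<inter> (\<Union>k<2 ^ n. A \<inter> cell n k)" using x by blast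
        qed auto
        moreover have "(\<Union>k<2 ^ n. A \<inter> cell n k) \<in> sets borel" using A by (intro sets.finite_UN) auto
        ultimately show ?thesis using A by (simp only: measure_unit_lborel)
      qed
      finally show ?thesis .
    qed
    then have "(\<lambda>n. mu A) \<longlonglongrightarrow> \<phi> (G A)" using bounded_linear.tendsto[OF bl G_limit[OF A]] by simp
    then show ?thesis by (simp add: LIMSEQ_const_iff)
  qed
  let ?E = "oscillating g c \<inter> {0..<1}"
  obtain T :: "nat \<Rightarrow> nat \<Rightarrow> real set" and S where T: "infinite S" "T 0 0 = ?E"
    "\<And>i k. k < 4 ^ i \<Longrightarrow> T i k \<in> sets unit_lborel" "\<And>i k. k < 4 ^ i \<Longrightarrow> mu (T i k) = mu ?E / 4 ^ i"
    "\<And>i k. k < 4 ^ i \<Longrightarrow> T i k = (\<Union>d<4. T (Suc i) (4 * k + d))"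
    "\<And>i k. k < 4 ^ i \<Longrightarrow> disjoint_family_on (\<lambda>d. T (Suc i) (4 * k + d)) {..<4}"
    "\<And>i k. i \<in> S \<Longrightarrow> k < 4 ^ i \<Longrightarrow> separated_pair (c / 8) (T (Suc i) (4 * k + 1)) (T (Suc i) (4 * k + 2))"
    by (rule separated_tree) blast
  define u where "u i k = G (T i k) /\<^sub>R mu ?E" for i k
  have sub: "T (i + n) (k * 4 ^ n + r) \<subseteq> T i k" if "k < 4 ^ i" "r < 4 ^ n" for i k n r
    using that(2)
  proof (induction n arbitrary: r)
    case (Suc n)
    have r: "r div 4 < 4 ^ n" using Suc.prems by (simp add: less_mult_imp_div_less mult.commute)
    have lt: "k * 4 ^ n + r div 4 < 4 ^ (i + n)"
    proof -
      have "k * 4 ^ n + r div 4 < (k + 1) * 4 ^ n" using r by simp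
      also have "\<dots> \<le> 4 ^ i * 4 ^ n" using that(1) by (intro mult_right_mono) auto
      finally show ?thesis by (simp add: power_add)
    qed
    have "T (i + Suc n) (k * 4 ^ Suc n + r) = T (Suc (i + n)) (4 * (k * 4 ^ n + r div 4) + r mod 4)"
      by (rule arg_cong2[where f = T]) auto
    also have "\<dots> \<subseteq> T (i + n) (k * 4 ^ n + r div 4)" unfolding T(5)[OF lt] by (rule UN_upper) simp
    also have "\<dots> \<subseteq> T i k" by (rule Suc.IH[OF r])
    finally show ?case .
  qed simp
  have lt: "4 * k + d < 4 ^ Suc i" if "k < 4 ^ i" "d < 4" for k d i :: nat using that by auto
  have lt': "k * 4 ^ n + r < 4 ^ (i + n)" if "k < 4 ^ i" "r < 4 ^ n" for i k n r :: nat
  proof -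
    have "k * 4 ^ n + r < (k + 1) * 4 ^ n" using that by simp
    also have "\<dots> \<le> 4 ^ i * 4 ^ n" using that(1) by (intro mult_right_mono) auto
    finally show ?thesis by (simp add: power_add)
  qed
  show ?thesis
  proof (rule that[of \<phi> "c / 8" S u L])
    show "linear \<phi>" "\<bar>\<phi> v\<bar> \<le> norm v" "0 < c / 8" "infinite S" for v using g(2,3,5) T(1) by auto
    fix i k :: nat assume k: "k < 4 ^ i"
    show "\<phi> (u i k) = 1 / 4 ^ i"
      using E(2) T(3,4)[OF k] by (simp add: u_def linear_scale[OF g(2)] \<phi>G)
    have "norm (u i k) \<le> (L * mu (T i k)) / mu ?E"
      using G_norm[OF T(3)[OF k]] E(2) by (simp add: u_def divide_inverse mult.commute mult_left_mono)
    then show "norm (u i k) \<le> L / 4 ^ i" using E(2) T(4)[OF k] by simp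
    have "G (T i k) = (\<Sum>d<4. G (T (Suc i) (4 * k + d)))"
      unfolding T(5)[OF k] by (rule G_UN[OF _ _ T(6)[OF k]]) (use T(3) lt[OF k] in auto)
    then show "u i k = (\<Sum>d<4. u (Suc i) (4 * k + d))" by (simp add: u_def scaleR_sum_right)
    assume "i \<in> S"
    from T(7)[OF this k] obtain \<psi> a where \<psi>: "linear \<psi>" "\<forall>v. \<bar>\<psi> v\<bar> \<le> norm v"
     "\<forall>A\<in>sets unit_lborel. A \<subseteq> T (Suc i) (4 * k + 1) \<longrightarrow> (a + c / 8) * mu A \<le> \<psi> (G A)"
     "\<forall>A\<in>sets unit_lborel. A \<subseteq> T (Suc i) (4 * k + 2) \<longrightarrow> \<psi> (G A) \<le> a * mu A"
      unfolding separated_pair_def by metis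
    have \<psi>u: "\<psi> (u j l) = \<psi> (G (T j l)) / mu ?E" for j l
      by (simp add: u_def linear_scale[OF \<psi>(1)] divide_inverse mult.commute)
    show "\<exists>\<psi> a. linear \<psi> \<and> (\<forall>v. \<bar>\<psi> v\<bar> \<le> norm v) \<and>
       (\<forall>n r. r < 4 ^ n \<longrightarrow> (a + c / 8) / 4 ^ (Suc i + n) \<le> \<psi> (u (Suc i + n) ((4 * k + 1) * 4 ^ n + r))) \<and>
       (\<forall>n r. r < 4 ^ n \<longrightarrow> \<psi> (u (Suc i + n) ((4 * k + 2) * 4 ^ n + r)) \<le> a / 4 ^ (Suc i + n))"
    proof (intro exI[of _ \<psi>] exI[of _ a] conjI allI impI \<psi>(1) \<psi>(2)[rule_format])
      fix n r :: nat assume r: "r < 4 ^ n"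
      have l: "4 * k + 1 < 4 ^ Suc i" "4 * k + 2 < 4 ^ Suc i" using lt[OF k, of 1] lt[OF k, of 2] by auto
      note l1 = lt'[OF l(1) r] and l2 = lt'[OF l(2) r]
      have "(a + c / 8) * (mu ?E / 4 ^ (Suc i + n)) \<le> \<psi> (G (T (Suc i + n) ((4 * k + 1) * 4 ^ n + r)))"
        using \<psi>(3) T(3)[OF l1] sub[OF l(1) r] T(4)[OF l1] by metis
      then show "(a + c / 8) / 4 ^ (Suc i + n) \<le> \<psi> (u (Suc i + n) ((4 * k + 1) * 4 ^ n + r))"
        unfolding \<psi>u using E(2) by (simp add: pos_le_divide_eq)
      have "\<psi> (G (T (Suc i + n) ((4 * k + 2) * 4 ^ n + r))) \<le> a * (mu ?E / 4 ^ (Suc i + n))"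
        using \<psi>(4) T(3)[OF l2] sub[OF l(2) r] T(4)[OF l2] by metis
      then show "\<psi> (u (Suc i + n) ((4 * k + 2) * 4 ^ n + r)) \<le> a / 4 ^ (Suc i + n)"
        unfolding \<psi>u using E(2) by (simp add: pos_divide_le_eq)
    qed
  qed
qed

section \<open>The limit space\<close>

text \<open>Level \<open>j\<close> of the construction doubles the open middle half of every interval of length
  \<open>1 / 4 ^ j\<close>; \<open>bandc j n\<close> is the middle half of \<open>[n / 4 ^ j, (n + 1) / 4 ^ j]\<close>.\<close>

definition bandc :: "nat \<Rightarrow> int \<Rightarrow> real set" where
  "bandc j n = {t. 4 * of_int n + 1 < 4 ^ Suc j * t \<and> 4 ^ Suc j * t < 4 * of_int n + 3}"

definition band :: "nat \<Rightarrow> real set" where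
  "band j = (\<Union>n. bandc j n)"

definition lo :: "nat \<Rightarrow> int \<Rightarrow> real" where "lo j n = (4 * of_int n + 1) / 4 ^ Suc j"
definition hi :: "nat \<Rightarrow> int \<Rightarrow> real" where "hi j n = (4 * of_int n + 3) / 4 ^ Suc j"

lemma bandc_iff: "t \<in> bandc j n \<longleftrightarrow> lo j n < t \<and> t < hi j n"
  by (auto simp: bandc_def lo_def hi_def divide_less_eq less_divide_eq mult.commute)

lemma bandc_floor: "t \<in> bandc j n \<Longrightarrow> \<lfloor>4 ^ j * t\<rfloor> = n"
  by (auto simp: bandc_def floor_eq_iff)

lemma bandc_unique: "t \<in> bandc j n \<Longrightarrow> t \<in> bandc j m \<Longrightarrow> m = n"
  using bandc_floor by blast

lemma bandI: "t \<in> bandc j n \<Longrightarrow> t \<in> band j" by (auto simp: band_def)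

lemma bandE: "t \<in> band j \<Longrightarrow> t \<in> bandc j \<lfloor>4 ^ j * t\<rfloor>"
  using bandc_floor unfolding band_def by blast

text \<open>In units of \<open>1 / 4 ^ Suc j\<close> a point of a grid of level at most
  \<open>j\<close> is a multiple of 4, and a band of level \<open>j\<close> lies strictly between 1
  and 3 modulo 4.\<close>

lemma grid_not_band:
  assumes "i \<le> j"
  shows "of_int k / 4 ^ i \<notin> band j"
proof
  assume "of_int k / 4 ^ i \<in> band j"
  then obtain n where "of_int k / 4 ^ i \<in> bandc j n" by (auto simp: band_def)
  moreover have "(4::real) ^ Suc j * (of_int k / 4 ^ i) = of_int (4 * (4 ^ (j - i) * k))"
  proof -
    have "(4::real) ^ Suc j = 4 * 4 ^ ((j - i) + i)" using assms by simp
    then show ?thesis unfolding power_add by simp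
  qed
  ultimately have "(of_int (4 * n + 1) :: real) < of_int (4 * (4 ^ (j - i) * k))"
    "(of_int (4 * (4 ^ (j - i) * k)) :: real) < of_int (4 * n + 3)"
    unfolding bandc_def mem_Collect_eq by (simp_all only: of_int_add of_int_mult of_int_numeral of_int_1)
  then have "4 * n + 1 < 4 * (4 ^ (j - i) * k)" "4 * (4 ^ (j - i) * k) < 4 * n + 3"
    unfolding of_int_less_iff by auto
  then show False by presburger
qed

lemma end_not_band:
  assumes "i \<le> j"
  shows "lo i n \<notin> band j" "hi i n \<notin> band j"
proof -
  have "lo i n \<notin> band i" "hi i n \<notin> band i"
  proof -
    have *: "\<not> (4 * of_int m + 1 < (4 * of_int n + of_int c :: real) \<and> 4 * of_int n + of_int c < (4 * of_int m + 3 :: real))"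
      if "c = 1 \<or> c = 3" for m c :: int
    proof
      assume "4 * of_int m + 1 < (4 * of_int n + of_int c :: real) \<and> 4 * of_int n + of_int c < (4 * of_int m + 3 :: real)"
      then have "(of_int (4 * m + 1) :: real) < of_int (4 * n + c)" "(of_int (4 * n + c) :: real) < of_int (4 * m + 3)"
        by simp_all
      then have "4 * m + 1 < 4 * n + c" "4 * n + c < 4 * m + 3" unfolding of_int_less_iff by auto
      then show False using that by presburger
    qed
    show "lo i n \<notin> band i" using *[of 1] by (auto simp: band_def bandc_def lo_def)
    show "hi i n \<notin> band i" using *[of 3] by (auto simp: band_def bandc_def hi_def)
  qed
  moreover have "lo i n = of_int (4 * n + 1) / 4 ^ Suc i" "hi i n = of_int (4 * n + 3) / 4 ^ Suc i"
    by (simp_all add: lo_def hi_def)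
  then have "lo i n \<notin> band j \<and> hi i n \<notin> band j" if "Suc i \<le> j"
    using grid_not_band[OF that] by metis
  ultimately show "lo i n \<notin> band j" "hi i n \<notin> band j" using assms by (metis Suc_leI le_neq_implies_less)+
qed

text \<open>The ends of a band of level \<open>i\<close> are points of every finer grid, so a closed
  cell of level \<open>j\<close> that meets the open band has its interior in it.\<close>

lemma bandc_cell:
  assumes ij: "i < j" and t: "t \<in> bandc i n" "of_int k \<le> 4 ^ j * t" "4 ^ j * t \<le> of_int (k + 1)"
    and s: "of_int k < 4 ^ j * s" "4 ^ j * s < of_int (k + 1)"
  shows "s \<in> bandc i n"
proof -
  define c :: int where "c = 4 ^ (j - Suc i)"
  have c: "c > 0" by (simp add: c_def)
  have e: "(4::real) ^ j * x = of_int c * (4 ^ Suc i * x)" for x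
  proof -
    have "(4::real) ^ j = 4 ^ ((j - Suc i) + Suc i)" using ij by simp
    also have "\<dots> = of_int c * 4 ^ Suc i" unfolding power_add by (simp add: c_def)
    finally show ?thesis by (simp only: mult.assoc)
  qed
  have t': "of_int (4 * n + 1) < 4 ^ Suc i * t" "4 ^ Suc i * t < of_int (4 * n + 3)"
    using t(1) by (auto simp: bandc_def)
  have "of_int (c * (4 * n + 1)) < 4 ^ j * t" "4 ^ j * t < of_int (c * (4 * n + 3))"
    unfolding e of_int_mult using t' c by (simp_all add: mult_strict_left_mono)
  then have "of_int (c * (4 * n + 1)) < (of_int (k + 1) :: real)" "of_int k < (of_int (c * (4 * n + 3)) :: real)"
    using t(2,3) by linarith+
  then have "c * (4 * n + 1) \<le> k" "k + 1 \<le> c * (4 * n + 3)" unfolding of_int_less_iff by linarith+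
  then have "of_int (c * (4 * n + 1)) \<le> (of_int k :: real)" "(of_int (k + 1) :: real) \<le> of_int (c * (4 * n + 3))"
    unfolding of_int_le_iff by auto
  then have "of_int (c * (4 * n + 1)) < 4 ^ j * s" "4 ^ j * s < of_int (c * (4 * n + 3))" using s by linarith+
  then have "of_int (4 * n + 1) < 4 ^ Suc i * s" "4 ^ Suc i * s < of_int (4 * n + 3)"
    unfolding e of_int_mult using c by (simp_all add: mult_less_cancel_left_pos)
  then show ?thesis by (simp add: bandc_def)
qed

lemma bandc_nested:
  assumes "i < j" "lo j m \<le> t" "t \<le> hi j m" "t \<in> bandc i n" "lo j m \<le> s" "s \<le> hi j m"
  shows "s \<in> bandc i n"
  using bandc_cell[OF assms(1,4), of m] assms mult_left_mono by (simp add: lo_def hi_def field_simps)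

section \<open>The metric of the limit space\<close>

text \<open>A point of the limit space is a pair \<open>(b, t)\<close> of its height \<open>t\<close> and the set \<open>b\<close> of the levels at
  which it lies on the second of the two copies. Every path between points that are separated at
  level \<open>j\<close> leaves the band through one of its ends, and the coarsest separation decides the
  distance.\<close>

definition sep :: "nat \<Rightarrow> nat set \<times> real \<Rightarrow> nat set \<times> real \<Rightarrow> bool" where
  "sep j x y \<longleftrightarrow> (\<exists>n. snd x \<in> bandc j n \<and> snd y \<in> bandc j n) \<and> (j \<in> fst x) \<noteq> (j \<in> fst y)"

text \<open>The arguments of the minimum are the lengths of the ways through the lower and through
  the upper end.\<close>

definition detour :: "nat \<Rightarrow> int \<Rightarrow> real \<Rightarrow> real \<Rightarrow> real" where
  "detour j n s t = min (s + t - 2 * lo j n) (2 * hi j n - s - t)"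

definition dd :: "nat set \<times> real \<Rightarrow> nat set \<times> real \<Rightarrow> real" where
  "dd x y = (if \<exists>j. sep j x y then let j = (LEAST j. sep j x y) in detour j \<lfloor>4 ^ j * snd x\<rfloor> (snd x) (snd y)
     else \<bar>snd x - snd y\<bar>)"

lemma sep_sym: "sep j x y \<longleftrightarrow> sep j y x" by (auto simp: sep_def)

lemma dd_unsep: "(\<And>j. \<not> sep j x y) \<Longrightarrow> dd x y = \<bar>snd x - snd y\<bar>"
  by (simp add: dd_def)

lemma dd_sep:
  assumes "sep j x y" "\<And>i. i < j \<Longrightarrow> \<not> sep i x y" "snd x \<in> bandc j n"
  shows "dd x y = detour j n (snd x) (snd y)"
  by (metis Least_equality assms not_less[symmetric] assms(1) bandc_floor[OF assms(3)] dd_def)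

lemma sep_cases:
  obtains "\<And>j. \<not> sep j x y" | j n where "sep j x y" "\<And>i. i < j \<Longrightarrow> \<not> sep i x y" "snd x \<in> bandc j n" "snd y \<in> bandc j n"
proof (cases "\<exists>j. sep j x y")
  case True
  define j where "j = (LEAST j. sep j x y)"
  have "sep j x y" unfolding j_def using True by (rule LeastI_ex)
  moreover have "\<not> sep i x y" if "i < j" for i using not_less_Least that unfolding j_def by blast
  ultimately show ?thesis using that(2) unfolding sep_def by blast
qed (use that(1) in blast)

lemma dd_sym: "dd x y = dd y x"
  by (smt (verit) sep_cases[of x y] dd_unsep[of x y] dd_unsep[of y x] sep_sym dd_sep detour_def)

lemma detour_ge: "s \<in> bandc j n \<Longrightarrow> t \<in> bandc j n \<Longrightarrow> \<bar>s - t\<bar> < detour j n s t"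
  by (auto simp: detour_def bandc_iff)

lemma detour_ge_min: "s \<in> bandc j n \<Longrightarrow> t \<in> bandc j n \<Longrightarrow> min (s - lo j n) (hi j n - s) \<le> detour j n s t"
  by (auto simp: detour_def bandc_iff)

lemma lo_hi_nested:
  assumes "i < j" "t \<in> bandc j m" "t \<in> bandc i n"
  shows "lo i n < lo j m" "hi j m < hi i n"
proof -
  have l: "lo j m \<le> t" "t \<le> hi j m" using assms(2) by (auto simp: bandc_iff)
  have "lo j m \<in> bandc i n" "hi j m \<in> bandc i n"
    using bandc_nested[OF assms(1) l assms(3)] l by auto
  then show "lo i n < lo j m" "hi j m < hi i n" by (auto simp: bandc_iff)
qed

lemma dd_ge_abs: "\<bar>snd x - snd y\<bar> \<le> dd x y"
proof (cases rule: sep_cases[of x y])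
  case 1
  then show ?thesis by (simp add: dd_unsep)
next
  case (2 j n)
  then show ?thesis using dd_sep[OF 2(1-3)] detour_ge[OF 2(3,4)] by simp
qed

text \<open>A coarser separation happens in a larger band around the finer one, so its detour is
  longer. Hence the detour of any separation, not only of the coarsest, bounds the distance from
  below.\<close>

lemma dd_ge_detour:
  assumes "sep j x y" "snd x \<in> bandc j n"
  shows "detour j n (snd x) (snd y) \<le> dd x y"
proof (cases rule: sep_cases[of x y])
  case 1
  then show ?thesis using assms by blast
next
  case (2 i m)
  have y: "snd y \<in> bandc j n" using assms bandc_unique unfolding sep_def by metis
  have "i \<le> j" using 2(2) assms(1) by (meson not_le)
  show ?thesis
  proof (cases "i = j")
    case True
    then have "m = n" using bandc_unique assms(2) 2(3) by metis
    then show ?thesis using dd_sep[OF 2(1-3)] True by simp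
  next
    case False
    then have "i < j" using \<open>i \<le> j\<close> by simp
    then have "lo i m < lo j n" "hi j n < hi i m" using lo_hi_nested[OF _ assms(2) 2(3)] by auto
    then show ?thesis using dd_sep[OF 2(1-3)] by (auto simp: detour_def)
  qed
qed

lemma dd_nonneg: "0 \<le> dd x y"
  using dd_ge_abs[of x y] by linarith

text \<open>Let \<open>x\<close> and \<open>z\<close> be separated in a band. If \<open>y\<close>
  lies in this band, it differs there in the same bit from one of them, and that distance contains a
  detour. If \<open>y\<close> lies outside, the differences of the heights already cover the way
  through an end.\<close>

lemma dd_triangle: "dd x z \<le> dd x y + dd y z"
proof (cases rule: sep_cases[of x z])
  case 1
  then show ?thesis using dd_unsep[OF 1] dd_ge_abs[of x y] dd_ge_abs[of y z] by linarith
next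
  case (2 j n)
  have e: "dd x z = detour j n (snd x) (snd z)" by (rule dd_sep[OF 2(1-3)])
  have xz: "lo j n < snd x" "snd x < hi j n" "lo j n < snd z" "snd z < hi j n" using 2(3,4) by (auto simp: bandc_iff)
  note ab = dd_ge_abs[of x y] dd_ge_abs[of y z]
  show ?thesis
  proof (cases "snd y \<in> bandc j n")
    case True
    then consider "sep j x y" | "sep j y z" using 2 unfolding sep_def by blast
    then show ?thesis
    proof cases
      case 1
      have "detour j n (snd x) (snd y) \<le> dd x y" by (rule dd_ge_detour[OF 1 2(3)])
      then show ?thesis using e ab by (auto simp: detour_def min_def split: if_splits)
    next
      case 2
      have "detour j n (snd y) (snd z) \<le> dd y z" by (rule dd_ge_detour[OF 2 True])
      then show ?thesis using e ab by (auto simp: detour_def min_def split: if_splits)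
    qed
  next
    case False
    then consider "snd y \<le> lo j n" | "hi j n \<le> snd y" by (auto simp: bandc_iff not_less)
    then show ?thesis using e ab xz by cases (auto simp: detour_def)
  qed
qed

lemma dd_eq_0_iff: "dd x y = 0 \<longleftrightarrow> snd x = snd y \<and> (\<forall>j. snd x \<in> band j \<longrightarrow> (j \<in> fst x \<longleftrightarrow> j \<in> fst y))"
proof
  assume 0: "dd x y = 0"
  then have e: "snd x = snd y" using dd_ge_abs[of x y] by simp
  have "\<not> sep j x y" for j
  proof
    assume s: "sep j x y"
    then obtain n where n: "snd x \<in> bandc j n" "snd y \<in> bandc j n" unfolding sep_def by blast
    then show False using dd_ge_detour[OF s n(1)] detour_ge[OF n] 0 by linarith
  qed
  then show "snd x = snd y \<and> (\<forall>j. snd x \<in> band j \<longrightarrow> (j \<in> fst x \<longleftrightarrow> j \<in> fst y))"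
    using e unfolding sep_def by (metis bandE)
next
  assume *: "snd x = snd y \<and> (\<forall>j. snd x \<in> band j \<longrightarrow> (j \<in> fst x \<longleftrightarrow> j \<in> fst y))"
  then have "\<not> sep j x y" for j unfolding sep_def using bandI by auto
  then show "dd x y = 0" using * by (simp add: dd_unsep)
qed

text \<open>The point at height \<open>t\<close> of the path that takes the copies prescribed by
  \<open>b\<close>. Bits of levels at which \<open>t\<close> lies in no band are dropped, so that a
  point of the limit space has only one representation. For fixed \<open>b\<close> the path is
  isometric.\<close>

definition pt :: "nat set \<Rightarrow> real \<Rightarrow> nat set \<times> real" where
  "pt b t = ({j \<in> b. t \<in> band j}, t)"

lemma snd_pt [simp]: "snd (pt b t) = t" by (simp add: pt_def)

lemma mem_fst_pt: "j \<in> fst (pt b t) \<longleftrightarrow> j \<in> b \<and> t \<in> band j" by (simp add: pt_def)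

lemma pt_eq_iff: "pt b t = pt b' t' \<longleftrightarrow> t = t' \<and> (\<forall>j. t \<in> band j \<longrightarrow> (j \<in> b \<longleftrightarrow> j \<in> b'))"
  by (auto simp: pt_def)

lemma dd_path [simp]: "dd (pt b s) (pt b t) = \<bar>s - t\<bar>"
proof -
  have "\<not> sep j (pt b s) (pt b t)" for j by (auto simp: sep_def mem_fst_pt intro: bandI)
  then show ?thesis by (simp add: dd_unsep)
qed

definition LS :: "nat set \<Rightarrow> (nat set \<times> real) set" where
  "LS S = {x. 0 \<le> snd x \<and> snd x \<le> 1 \<and> fst x \<subseteq> S \<and> (\<forall>j\<in>fst x. snd x \<in> band j)}"

lemma LS_pt: "b \<subseteq> S \<Longrightarrow> 0 \<le> t \<Longrightarrow> t \<le> 1 \<Longrightarrow> pt b t \<in> LS S"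
  by (auto simp: LS_def pt_def)

lemma LS_eq_pt: "x \<in> LS S \<Longrightarrow> pt (fst x) (snd x) = x"
  by (cases x) (auto simp: LS_def pt_def)

lemma Metric_space_LS: "Metric_space (LS S) dd"
proof
  show "dd x y = 0 \<longleftrightarrow> x = y" if "x \<in> LS S" "y \<in> LS S" for x y
    using that unfolding dd_eq_0_iff by (cases x; cases y) (auto simp: LS_def)
qed (auto simp: dd_nonneg intro: dd_sym dd_triangle)

lemma lo_hi_01:
  assumes "t \<in> bandc j n" "0 \<le> t" "t \<le> 1"
  shows "0 \<le> lo j n" "hi j n \<le> 1"
proof -
  have "n \<ge> 0" using bandc_floor[OF assms(1)] assms(2) by auto
  then show "0 \<le> lo j n" by (simp add: lo_def)
  have "4 * of_int n + 1 < 4 ^ Suc j * t" using assms(1) by (simp add: bandc_def)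
  also have "\<dots> \<le> 4 ^ Suc j * 1" using assms(3) by (intro mult_left_mono) auto
  finally have "(of_int (4 * n + 1) :: real) < of_int (4 * 4 ^ j)" by simp
  then have "4 * n + 3 \<le> 4 * 4 ^ j" unfolding of_int_less_iff by presburger
  then have "(of_int (4 * n + 3) :: real) \<le> of_int (4 * 4 ^ j)" unfolding of_int_le_iff .
  then show "hi j n \<le> 1" by (simp add: hi_def)
qed

text \<open>The crossing height \<open>\<tau>\<close> is taken from the coarsest grid that has a
  point between the two heights. At such a point only bits of coarser levels matter. On these levels
  both heights lie in a common cell, so the absence of separation makes the bits agree.\<close>

lemma geodesic_unsep:
  assumes x: "x \<in> LS S" and y: "y \<in> LS S" and us: "\<And>j. \<not> sep j x y" and lt: "snd x < snd y"
  shows "\<exists>\<tau> b b'. snd x \<le> \<tau> \<and> \<tau> \<le> snd y \<and> b \<subseteq> S \<and> b' \<subseteq> S \<and> x = pt b (snd x) \<and> y = pt b' (snd y) \<and> pt b \<tau> = pt b' \<tau>"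
proof -
  define P where "P i \<longleftrightarrow> (\<exists>k::int. snd x \<le> of_int k / 4 ^ i \<and> of_int k / 4 ^ i \<le> snd y)" for i :: nat
  have "\<exists>i. P i"
  proof -
    obtain i where i: "inverse (4 ^ i) < snd y - snd x"
      using real_arch_pow_inv[of "snd y - snd x" "1/4"] lt by (auto simp: power_divide inverse_eq_divide)
    define k where "k = \<lfloor>4 ^ i * snd y\<rfloor>"
    have k: "of_int k \<le> 4 ^ i * snd y" "4 ^ i * snd y < of_int k + 1" unfolding k_def by linarith+
    have "4 ^ i * (snd y - snd x) > 1" using i by (simp add: inverse_eq_divide divide_less_eq mult.commute)
    then have "4 ^ i * snd x < of_int k" using k(2) by (simp add: algebra_simps)
    then have "P i" unfolding P_def using k(1)
      by (intro exI[of _ k]) (auto simp: divide_le_eq le_divide_eq mult.commute)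
    then show ?thesis by blast
  qed
  define i where "i = (LEAST i. P i)"
  have "P i" unfolding i_def using \<open>\<exists>i. P i\<close> by (rule LeastI_ex)
  then obtain k where k: "snd x \<le> of_int k / 4 ^ i" "of_int k / 4 ^ i \<le> snd y" unfolding P_def by blast
  define \<tau> where "\<tau> = (of_int k / 4 ^ i :: real)"
  \<comment> \<open>Each path keeps the bits of its own point and follows the other point at the
    levels where its own point lies in no band.\<close>
  define b where "b = fst x \<union> (fst y - {j. snd x \<in> band j})"
  define b' where "b' = fst y \<union> (fst x - {j. snd y \<in> band j})"
  have fx: "snd x \<in> band j" if "j \<in> fst x" for j using x that by (auto simp: LS_def)
  have fy: "snd y \<in> band j" if "j \<in> fst y" for j using y that by (auto simp: LS_def)
  have comp: "\<exists>n. snd x \<in> bandc j n \<and> snd y \<in> bandc j n" if j: "j < i" "snd x \<in> band j" "snd y \<in> band j" for j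
  proof -
    have nP: "\<not> P j" using j(1) not_less_Least unfolding i_def by blast
    define n where "n = \<lfloor>4 ^ j * snd x\<rfloor>"
    have n: "snd x \<in> bandc j n" using bandE[OF j(2)] by (simp add: n_def)
    have n': "snd y \<in> bandc j \<lfloor>4 ^ j * snd y\<rfloor>" by (rule bandE[OF j(3)])
    have "\<not> of_int (n + 1) / 4 ^ j \<le> snd y"
    proof
      assume "of_int (n + 1) / 4 ^ j \<le> snd y"
      moreover have "snd x \<le> of_int (n + 1) / 4 ^ j"
        by (simp add: n_def le_divide_eq mult.commute)
      ultimately show False using nP unfolding P_def by blast
    qed
    then have "4 ^ j * snd y < of_int (n + 1)" by (simp add: divide_le_eq mult.commute not_le)
    moreover have "of_int n \<le> 4 ^ j * snd y"
    proof -
      have "of_int n \<le> 4 ^ j * snd x" unfolding n_def by linarith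
      also have "\<dots> \<le> 4 ^ j * snd y" using lt by simp
      finally show ?thesis .
    qed
    ultimately have "\<lfloor>4 ^ j * snd y\<rfloor> = n" by linarith
    then show ?thesis using n n' by auto
  qed
  have "pt b \<tau> = pt b' \<tau>"
    unfolding pt_eq_iff
  proof (intro conjI allI impI refl)
    fix j assume "\<tau> \<in> band j"
    then have "j < i" using grid_not_band[of i j k] unfolding \<tau>_def by (meson not_le)
    then have "snd x \<in> band j \<Longrightarrow> snd y \<in> band j \<Longrightarrow> j \<in> fst x \<longleftrightarrow> j \<in> fst y"
      using comp us[of j] unfolding sep_def by blast
    then show "j \<in> b \<longleftrightarrow> j \<in> b'" using fx fy unfolding b_def b'_def by blast
  qed
  moreover have "x = pt b (snd x)" "y = pt b' (snd y)"
    using fx fy by (auto simp: b_def b'_def pt_def prod_eq_iff)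
  moreover have "b \<subseteq> S" "b' \<subseteq> S" using x y by (auto simp: b_def b'_def LS_def)
  ultimately show ?thesis using k unfolding \<tau>_def by blast
qed

text \<open>An end of a band of level \<open>j\<close> lies in no band of level \<open>j\<close> or
  finer. A coarser band that contains the end contains both points, and they are not separated
  there.\<close>

lemma least_sep_ends:
  assumes s: "sep j x y" "\<And>i. i < j \<Longrightarrow> \<not> sep i x y" "snd x \<in> bandc j n" and \<tau>: "\<tau> = lo j n \<or> \<tau> = hi j n"
  shows "pt (fst x) \<tau> = pt (fst y) \<tau>"
  unfolding pt_eq_iff
proof (intro conjI allI impI refl)
  fix i assume i: "\<tau> \<in> band i"
  have "snd y \<in> bandc j n" using s(1,3) bandc_unique unfolding sep_def by metis
  then have xy: "lo j n < snd x" "snd x < hi j n" "lo j n < snd y" "snd y < hi j n" using s(3) by (auto simp: bandc_iff)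
  have "i < j" using end_not_band[of j i n] \<tau> i by (metis not_le)
  obtain m where "\<tau> \<in> bandc i m" using i by (auto simp: band_def)
  then have "snd x \<in> bandc i m" "snd y \<in> bandc i m"
    using bandc_nested[OF \<open>i < j\<close>, of n \<tau>] \<tau> xy by auto
  then show "i \<in> fst x \<longleftrightarrow> i \<in> fst y" using s(2)[OF \<open>i < j\<close>] unfolding sep_def by blast
qed

text \<open>Every distance is realized by two monotone pieces of paths that meet at height
  \<open>\<tau>\<close>. Lipschitz bounds and the construction of short chains are thereby reduced
  to single paths.\<close>

lemma geodesic:
  assumes x: "x \<in> LS S" and y: "y \<in> LS S"
  obtains \<tau> b b' where "0 \<le> \<tau>" "\<tau> \<le> 1" "b \<subseteq> S" "b' \<subseteq> S" "x = pt b (snd x)" "y = pt b' (snd y)" "pt b \<tau> = pt b' \<tau>"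
    "dd x y = \<bar>snd x - \<tau>\<bar> + \<bar>\<tau> - snd y\<bar>"
proof (cases rule: sep_cases[of x y])
  case 1
  have 01: "0 \<le> snd x" "snd x \<le> 1" "0 \<le> snd y" "snd y \<le> 1" using x y by (auto simp: LS_def)
  have e: "dd x y = \<bar>snd x - snd y\<bar>" by (rule dd_unsep[OF 1])
  consider "snd x < snd y" | "snd y < snd x" | "snd x = snd y" by linarith
  then show ?thesis
  proof cases
    assume lt: "snd x < snd y"
    obtain \<tau> b b' where *: "snd x \<le> \<tau>" "\<tau> \<le> snd y" "b \<subseteq> S" "b' \<subseteq> S" "x = pt b (snd x)" "y = pt b' (snd y)" "pt b \<tau> = pt b' \<tau>"
      using geodesic_unsep[OF x y 1 lt] by blast
    show ?thesis by (rule that[OF _ _ *(3-7)]) (use * e 01 in auto)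
  next
    assume lt: "snd y < snd x"
    obtain \<tau> b b' where *: "snd y \<le> \<tau>" "\<tau> \<le> snd x" "b \<subseteq> S" "b' \<subseteq> S" "y = pt b (snd y)" "x = pt b' (snd x)" "pt b \<tau> = pt b' \<tau>"
      using geodesic_unsep[OF y x _ lt] 1 sep_sym by metis
    show ?thesis by (rule that[OF _ _ *(4,3,6,5) *(7)[symmetric]]) (use * e 01 in auto)
  next
    assume "snd x = snd y"
    then have "x = y" using e Metric_space.zero[OF Metric_space_LS x y] by simp
    then show ?thesis using that[of "snd x" "fst x" "fst x"] LS_eq_pt[OF x] x e by (auto simp: LS_def)
  qed
next
  case (2 j n)
  have 01: "0 \<le> snd x" "snd x \<le> 1" "0 \<le> snd y" "snd y \<le> 1" "fst x \<subseteq> S" "fst y \<subseteq> S" using x y by (auto simp: LS_def)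
  have e: "dd x y = detour j n (snd x) (snd y)" by (rule dd_sep[OF 2(1-3)])
  have xy: "lo j n < snd x" "snd x < hi j n" "lo j n < snd y" "snd y < hi j n" using 2(3,4) by (auto simp: bandc_iff)
  note same = least_sep_ends[OF 2(1-3)]
  note l = lo_hi_01[OF 2(3) 01(1,2)]
  have x': "x = pt (fst x) (snd x)" "y = pt (fst y) (snd y)" using LS_eq_pt x y by auto
  show ?thesis
  proof (cases "snd x + snd y - 2 * lo j n \<le> 2 * hi j n - snd x - snd y")
    case True
    show ?thesis
      by (rule that[OF _ _ 01(5,6) x' same[of "lo j n"]]) (use True e l xy in \<open>auto simp: detour_def\<close>)
  next
    case False
    show ?thesis
      by (rule that[OF _ _ 01(5,6) x' same[of "hi j n"]]) (use False e l xy in \<open>auto simp: detour_def\<close>)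
  qed
qed

section \<open>The embedding\<close>

text \<open>\<open>sw b\<close> swaps the second and the third child at the levels in \<open>b\<close>; the curve of \<open>b\<close> runs through
  the increments \<open>u i\<close> in the resulting order.\<close>

definition swp :: "bool \<Rightarrow> nat \<Rightarrow> nat" where
  "swp c d = (if c \<and> d = 1 then 2 else if c \<and> d = 2 then 1 else d)"

lemma swp_less: "d < 4 \<Longrightarrow> swp c d < 4" by (auto simp: swp_def)

fun sw :: "nat set \<Rightarrow> nat \<Rightarrow> nat \<Rightarrow> nat" where
  "sw b 0 k = k"
| "sw b (Suc i) k = 4 * sw b i (k div 4) + swp (i \<in> b) (k mod 4)"

lemma sw_Suc: "d < 4 \<Longrightarrow> sw b (Suc i) (4 * k + d) = 4 * sw b i k + swp (i \<in> b) d"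
  by simp

lemma sum_lessThan_add: "(\<Sum>l<m + n. f l) = (\<Sum>l<m. f l) + (\<Sum>d<n. f (m + d))" for f :: "nat \<Rightarrow> 'a::comm_monoid_add"
  by (induction n) (simp_all add: add_ac)

lemma sw_less: "k < 4 ^ i \<Longrightarrow> sw b i k < 4 ^ i"
proof (induction i arbitrary: k)
  case (Suc i)
  have "sw b i (k div 4) < 4 ^ i" using Suc by (simp add: less_mult_imp_div_less mult.commute)
  then show ?case using swp_less[of "k mod 4" "i \<in> b"] by simp
qed simp

lemma sw_div: "sw b (m + n) l div 4 ^ n = sw b m (l div 4 ^ n)"
proof (induction n arbitrary: l)
  case (Suc n)
  have "sw b (m + Suc n) l div 4 = sw b (m + n) (l div 4)"
    using swp_less[of "l mod 4" "m + n \<in> b"] by simp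
  then show ?case using Suc[of "l div 4"] by (simp add: div_mult2_eq)
qed simp

lemma cell_band:
  assumes s: "real k < 4 ^ Suc i * s" "4 ^ Suc i * s < real (Suc k)"
  shows "s \<in> band i \<longleftrightarrow> k mod 4 = 1 \<or> k mod 4 = 2"
proof
  assume "s \<in> band i"
  then obtain n where n: "of_int (4 * n + 1) < 4 ^ Suc i * s" "4 ^ Suc i * s < of_int (4 * n + 3)"
    by (auto simp: band_def bandc_def)
  have "(of_int (4 * n + 1) :: real) < of_int (int (Suc k))" "(of_int (int k) :: real) < of_int (4 * n + 3)"
    using n s by simp_all
  then have "4 * n + 1 < int (Suc k)" "int k < 4 * n + 3" unfolding of_int_less_iff by auto
  then show "k mod 4 = 1 \<or> k mod 4 = 2" by presburger
next
  assume "k mod 4 = 1 \<or> k mod 4 = 2"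
  then have "4 * (k div 4) + 1 \<le> k" "Suc k \<le> 4 * (k div 4) + 3" by presburger+
  then have "real (4 * (k div 4) + 1) \<le> real k" "real (Suc k) \<le> real (4 * (k div 4) + 3)"
    unfolding of_nat_le_iff by auto
  then have "s \<in> bandc i (int (k div 4))" using s unfolding bandc_def by simp
  then show "s \<in> band i" by (rule bandI)
qed

lemma parent_cell:
  assumes "real k < 4 ^ Suc i * s" "4 ^ Suc i * s < real (Suc k)"
  shows "real (k div 4) < 4 ^ i * s" "4 ^ i * s < real (Suc (k div 4))"
  using assms by (auto simp: of_nat_le_iff)

text \<open>The swap of level \<open>j\<close> moves only descendants of second and third children,
  that is, cells inside the bands of level \<open>j\<close>.\<close>

lemma sw_cong:
  assumes "real k < 4 ^ i * s" "4 ^ i * s < real (Suc k)" "\<And>j. j < i \<Longrightarrow> s \<in> band j \<Longrightarrow> j \<in> b \<longleftrightarrow> j \<in> b'"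
  shows "sw b i k = sw b' i k"
  using assms
proof (induction i arbitrary: k)
  case (Suc i)
  have "sw b i (k div 4) = sw b' i (k div 4)"
    using Suc.IH[of "k div 4"] parent_cell[OF Suc.prems(1,2)] Suc.prems(3) by simp
  moreover have "swp (i \<in> b) (k mod 4) = swp (i \<in> b') (k mod 4)"
    using cell_band Suc.prems(1,2) Suc.prems(3)[of i] by (fastforce simp: swp_def)
  ultimately show ?case by simp
qed simp

locale tree_curve =
  fixes u :: "nat \<Rightarrow> nat \<Rightarrow> 'b::banach" and \<phi> :: "'b \<Rightarrow> real" and L \<epsilon> :: real and S :: "nat set"
  assumes \<phi>: "linear \<phi>" "\<bar>\<phi> v\<bar> \<le> norm v" and \<epsilon>: "\<epsilon> > 0"
    and \<phi>u: "k < 4 ^ i \<Longrightarrow> \<phi> (u i k) = 1 / 4 ^ i" and norm_u: "k < 4 ^ i \<Longrightarrow> norm (u i k) \<le> L / 4 ^ i"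
    and u_sum: "k < 4 ^ i \<Longrightarrow> u i k = (\<Sum>d<4. u (Suc i) (4 * k + d))"
    and u_sep: "i \<in> S \<Longrightarrow> k < 4 ^ i \<Longrightarrow> \<exists>\<psi> a. linear \<psi> \<and> (\<forall>v. \<bar>\<psi> v\<bar> \<le> norm v) \<and>
       (\<forall>n r. r < 4 ^ n \<longrightarrow> (a + \<epsilon>) / 4 ^ (Suc i + n) \<le> \<psi> (u (Suc i + n) ((4 * k + 1) * 4 ^ n + r))) \<and>
       (\<forall>n r. r < 4 ^ n \<longrightarrow> \<psi> (u (Suc i + n) ((4 * k + 2) * 4 ^ n + r)) \<le> a / 4 ^ (Suc i + n))"
begin

lemma L_nonneg: "0 \<le> L"
  using norm_u[of 0 0] by (simp add: order_trans[OF norm_ge_zero])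

definition P :: "nat set \<Rightarrow> nat \<Rightarrow> nat \<Rightarrow> 'b" where
  "P b i k = (\<Sum>l<k. u i (sw b i l))"

lemma P_add:
  "d \<le> 4 \<Longrightarrow> P b (Suc i) (4 * k + d) = P b (Suc i) (4 * k) + (\<Sum>d'<d. u (Suc i) (4 * sw b i k + swp (i \<in> b) d'))"
  unfolding P_def sum_lessThan_add using sw_Suc[of _ b i k] by (auto simp del: sw.simps intro!: sum.cong)

text \<open>A swap permutes summands inside a block of four, so it is invisible on the coarser grid.
  This makes the partial sums of different levels consistent.\<close>

lemma P_Suc4: "k < 4 ^ i \<Longrightarrow> P b (Suc i) (4 * k + 4) = P b (Suc i) (4 * k) + u i (sw b i k)"
proof -
  assume k: "k < 4 ^ i"
  have *: "(\<Sum>d<4. f d) = f 0 + f 1 + f 2 + f 3" for f :: "nat \<Rightarrow> 'b"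
    by (simp add: numeral_eq_Suc)
  have "(\<Sum>d<4. u (Suc i) (4 * sw b i k + swp (i \<in> b) d)) = (\<Sum>d<4. u (Suc i) (4 * sw b i k + d))"
    unfolding * by (simp add: swp_def)
  then show ?thesis using P_add[of 4 b i k] u_sum[OF sw_less[OF k]] by simp
qed

lemma P_4: "k \<le> 4 ^ i \<Longrightarrow> P b (Suc i) (4 * k) = P b i k"
proof (induction k)
  case (Suc k)
  then have "P b (Suc i) (4 * k + 4) = P b i k + u i (sw b i k)" using P_Suc4[of k i b] by simp
  then show ?case by (simp add: P_def add.commute)
qed (simp add: P_def)

lemma P_pow: "k \<le> 4 ^ i \<Longrightarrow> P b (i + n) (k * 4 ^ n) = P b i k"
proof (induction n)
  case (Suc n)
  have "k * 4 ^ n \<le> 4 ^ (i + n)" using Suc.prems by (simp add: power_add)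
  from P_4[OF this, of b] Suc show ?case by (simp add: mult_ac)
qed simp

lemma P_diff: "k \<le> l \<Longrightarrow> P b i l - P b i k = (\<Sum>j\<in>{k..<l}. u i (sw b i j))"
  unfolding P_def using sum_diff[of "{..<l}" "{..<k}" "\<lambda>j. u i (sw b i j)"]
  by (simp add: lessThan_minus_lessThan)

lemma norm_P: "k \<le> 4 ^ i \<Longrightarrow> l \<le> 4 ^ i \<Longrightarrow> norm (P b i l - P b i k) \<le> L / 4 ^ i * \<bar>real l - real k\<bar>"
proof -
  have *: "norm (P b i l - P b i k) \<le> L / 4 ^ i * (real l - real k)" if "k \<le> l" "l \<le> 4 ^ i" for k l
  proof -
    have "norm (P b i l - P b i k) \<le> (\<Sum>j\<in>{k..<l}. L / 4 ^ i)"
      unfolding P_diff[OF that(1)] using that(2) by (intro sum_norm_le norm_u sw_less) auto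
    then show ?thesis using that(1) by (simp add: of_nat_diff mult.commute)
  qed
  assume "k \<le> 4 ^ i" "l \<le> 4 ^ i"
  then show ?thesis using *[of k l] *[of l k] by (cases "k \<le> l") (auto simp: norm_minus_commute abs_if)
qed

definition fl :: "nat \<Rightarrow> real \<Rightarrow> nat" where "fl i t = nat \<lfloor>4 ^ i * t\<rfloor>"

lemma fl: "0 \<le> t \<Longrightarrow> real (fl i t) \<le> 4 ^ i * t" "0 \<le> t \<Longrightarrow> 4 ^ i * t < real (fl i t) + 1"
  by (auto simp: fl_def)

lemma fl_le: "0 \<le> t \<Longrightarrow> t \<le> 1 \<Longrightarrow> fl i t \<le> 4 ^ i"
proof -
  assume "0 \<le> t" "t \<le> 1"
  then have "4 ^ i * t \<le> 4 ^ i" "real (fl i t) \<le> 4 ^ i * t" using fl(1) by simp_all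
  then have "real (fl i t) \<le> 4 ^ i" by linarith
  then have "real (fl i t) \<le> real (4 ^ i)" by simp
  then show ?thesis unfolding of_nat_le_iff .
qed

definition F :: "nat set \<Rightarrow> real \<Rightarrow> 'b" where
  "F b t = lim (\<lambda>i. P b i (fl i t))"

lemma P_close:
  assumes t: "0 \<le> t" "t \<le> 1"
  shows "norm (P b (i + n) (fl (i + n) t) - P b i (fl i t)) \<le> L / 4 ^ i"
proof -
  have le: "fl i t * 4 ^ n \<le> 4 ^ (i + n)" using fl_le[OF t, of i] by (simp add: power_add)
  define X where "X = 4 ^ (i + n) * t"
  have X: "X = 4 ^ n * (4 ^ i * t)" by (simp add: X_def power_add)
  have "real (fl (i + n) t) \<le> X" "X < real (fl (i + n) t) + 1" unfolding X_def by (rule fl[OF t(1)])+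
  moreover have "4 ^ n * real (fl i t) \<le> X" unfolding X by (rule mult_left_mono[OF fl(1)[OF t(1)]]) simp
  moreover have "X \<le> 4 ^ n * (real (fl i t) + 1)"
    unfolding X by (rule mult_left_mono[OF less_imp_le[OF fl(2)[OF t(1)]]]) simp
  then have "X \<le> 4 ^ n * real (fl i t) + 4 ^ n" by (simp add: distrib_left)
  moreover have "1 \<le> (4::real) ^ n" by simp
  moreover have "real (fl i t * 4 ^ n) = 4 ^ n * real (fl i t)" by simp
  ultimately have "\<bar>real (fl (i + n) t) - real (fl i t * 4 ^ n)\<bar> \<le> 4 ^ n" by linarith
  then have "L / 4 ^ (i + n) * \<bar>real (fl (i + n) t) - real (fl i t * 4 ^ n)\<bar> \<le> L / 4 ^ (i + n) * 4 ^ n"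
    using L_nonneg by (intro mult_left_mono) auto
  also have "\<dots> = L / 4 ^ i" by (simp add: power_add)
  finally show ?thesis
    using norm_P[OF le fl_le[OF t], of b] P_pow[OF fl_le[OF t], of b i n] by simp
qed

lemma P_limit: "0 \<le> t \<Longrightarrow> t \<le> 1 \<Longrightarrow> (\<lambda>i. P b i (fl i t)) \<longlonglongrightarrow> F b t"
proof -
  assume t: "0 \<le> t" "t \<le> 1"
  have "Cauchy (\<lambda>i. P b i (fl i t))"
    unfolding Cauchy_iff
  proof (intro allI impI)
    fix e :: real assume "0 < e"
    have "(\<lambda>i. 2 * L / 4 ^ i) \<longlonglongrightarrow> 0" by (rule LIMSEQ_divide_realpow_zero) auto
    then have "eventually (\<lambda>i. 2 * L / 4 ^ i < e) sequentially" using \<open>0 < e\<close> by (rule order_tendstoD)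
    then obtain N where N: "2 * L / 4 ^ N < e" by (auto simp: eventually_sequentially)
    have "norm (P b m (fl m t) - P b n (fl n t)) < e" if "N \<le> m" "N \<le> n" for m n
    proof -
      have "norm (P b m (fl m t) - P b N (fl N t)) \<le> L / 4 ^ N" "norm (P b n (fl n t) - P b N (fl N t)) \<le> L / 4 ^ N"
        using P_close[OF t, of b N "m - N"] P_close[OF t, of b N "n - N"] that by auto
      then show ?thesis
        using norm_triangle_ineq4[of "P b m (fl m t) - P b N (fl N t)" "P b n (fl n t) - P b N (fl N t)"] N by simp
    qed
    then show "\<exists>M. \<forall>m\<ge>M. \<forall>n\<ge>M. norm (P b m (fl m t) - P b n (fl n t)) < e" by blast
  qed
  then show ?thesis unfolding F_def by (simp add: Cauchy_convergent convergent_LIMSEQ_iff[symmetric])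
qed

lemma fl_limit: "0 \<le> t \<Longrightarrow> (\<lambda>i. real (fl i t) / 4 ^ i) \<longlonglongrightarrow> t"
proof -
  assume t: "0 \<le> t"
  have "\<forall>i. norm (real (fl i t) / 4 ^ i - t) \<le> 1 / 4 ^ i"
  proof
    fix i
    have "\<bar>real (fl i t) - 4 ^ i * t\<bar> \<le> 1" using fl[OF t, of i] by (simp add: abs_le_iff)
    moreover have "real (fl i t) / 4 ^ i - t = (real (fl i t) - 4 ^ i * t) / 4 ^ i" by (simp add: diff_divide_distrib)
    ultimately show "norm (real (fl i t) / 4 ^ i - t) \<le> 1 / 4 ^ i" by (simp add: divide_right_mono)
  qed
  moreover have "(\<lambda>i. 1 / 4 ^ i :: real) \<longlonglongrightarrow> 0" by (rule LIMSEQ_divide_realpow_zero) auto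
  ultimately have "(\<lambda>i. real (fl i t) / 4 ^ i - t) \<longlonglongrightarrow> 0" by (rule Lim_null_comparison[OF always_eventually])
  then show ?thesis by (simp add: LIM_zero_iff)
qed

lemma F_lipschitz:
  assumes t: "0 \<le> t" "t \<le> 1" and s: "0 \<le> s" "s \<le> 1"
  shows "norm (F b t - F b s) \<le> L * \<bar>t - s\<bar>"
proof (rule LIMSEQ_le)
  show "(\<lambda>i. norm (P b i (fl i t) - P b i (fl i s))) \<longlonglongrightarrow> norm (F b t - F b s)"
    by (intro tendsto_intros P_limit t s)
  show "(\<lambda>i. L * \<bar>real (fl i t) / 4 ^ i - real (fl i s) / 4 ^ i\<bar>) \<longlonglongrightarrow> L * \<bar>t - s\<bar>"
    by (intro tendsto_intros fl_limit t s)
  have "norm (P b i (fl i t) - P b i (fl i s)) \<le> L * \<bar>real (fl i t) / 4 ^ i - real (fl i s) / 4 ^ i\<bar>" for i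
    using diff_divide_distrib[symmetric] norm_P[OF fl_le[OF s] fl_le[OF t], of b i] by (auto simp: field_simps)
  then show "\<exists>N. \<forall>i\<ge>N. norm (P b i (fl i t) - P b i (fl i s)) \<le> L * \<bar>real (fl i t) / 4 ^ i - real (fl i s) / 4 ^ i\<bar>" by blast
qed

text \<open>Swaps at the levels from \<open>m\<close> on keep the descendants of a cell of level
  \<open>m\<close> together. A slope bound for all descendants of its image is therefore a slope
  bound for the curve over the cell. Applied to \<open>- \<psi>\<close> it also gives upper
  bounds.\<close>

lemma linear_F_diff_ge:
  assumes \<psi>: "linear \<psi>" "\<And>v. \<bar>\<psi> v\<bar> \<le> norm v"
    and W: "\<And>n r. r < 4 ^ n \<Longrightarrow> \<alpha> / 4 ^ (m + n) \<le> \<psi> (u (m + n) (sw b m K * 4 ^ n + r))"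
    and K: "K < 4 ^ m" and s: "real K \<le> 4 ^ m * s" "s \<le> t" "4 ^ m * t \<le> real (Suc K)"
  shows "\<alpha> * (t - s) \<le> \<psi> (F b t - F b s)"
proof -
  have bl: "bounded_linear \<psi>"
    using \<psi> by (intro bounded_linear_intro[where K = 1]) (auto simp: linear_add linear_scale)
  have "0 \<le> 4 ^ m * s" using s(1) by (meson of_nat_0_le_iff order_trans)
  then have s0: "0 \<le> s" by (metis mult_pos_neg not_le zero_less_numeral zero_less_power)
  have "real (Suc K) \<le> real (4 ^ m)" using K unfolding of_nat_le_iff by simp
  then have "real (Suc K) \<le> 4 ^ m" by simp
  then have "4 ^ m * t \<le> 4 ^ m" using s(3) by linarith
  then have t1: "t \<le> 1" by simp
  note st = s0 order_trans[OF s0 s(2)] order_trans[OF s(2) t1] t1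
  have "\<alpha> * (real (fl (m + n) t) / 4 ^ (m + n) - real (fl (m + n) s) / 4 ^ (m + n)) \<le>
      \<psi> (P b (m + n) (fl (m + n) t) - P b (m + n) (fl (m + n) s))" for n
  proof -
    have e: "4 ^ (m + n) * x = 4 ^ n * (4 ^ m * x)" for x :: real by (simp add: power_add)
    have "4 ^ (m + n) * s \<le> 4 ^ (m + n) * t" using s(2) by simp
    then have le: "fl (m + n) s \<le> fl (m + n) t" unfolding fl_def by (intro nat_mono floor_mono)
    have "real (K * 4 ^ n) \<le> 4 ^ (m + n) * s" unfolding e using mult_left_mono[OF s(1), of "4 ^ n"] by (simp add: mult.commute)
    then have lo: "K * 4 ^ n \<le> fl (m + n) s" unfolding fl_def by (rule le_nat_floor)
    have "4 ^ (m + n) * t \<le> real (Suc K * 4 ^ n)" unfolding e using mult_left_mono[OF s(3), of "4 ^ n"] by (simp add: algebra_simps)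
    then have "real (fl (m + n) t) \<le> real (Suc K * 4 ^ n)" using fl(1)[OF st(2), of "m + n"] by linarith
    then have hi: "fl (m + n) t \<le> Suc K * 4 ^ n" unfolding of_nat_le_iff .
    have "\<alpha> / 4 ^ (m + n) \<le> \<psi> (u (m + n) (sw b (m + n) l))" if "l \<in> {fl (m + n) s..<fl (m + n) t}" for l
    proof -
      have "l div 4 ^ n = K" using that lo hi by (intro div_nat_eqI) (auto simp: algebra_simps)
      then have "sw b (m + n) l div 4 ^ n = sw b m K" by (simp add: sw_div)
      then have "sw b (m + n) l = sw b m K * 4 ^ n + sw b (m + n) l mod 4 ^ n" by (metis div_mult_mod_eq)
      then show ?thesis using W[of "sw b (m + n) l mod 4 ^ n" n] by simp
    qed
    then have "(\<Sum>l\<in>{fl (m + n) s..<fl (m + n) t}. \<alpha> / 4 ^ (m + n)) \<le> \<psi> (P b (m + n) (fl (m + n) t) - P b (m + n) (fl (m + n) s))"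
      unfolding P_diff[OF le] linear_sum[OF \<psi>(1)] by (rule sum_mono)
    moreover have "(\<Sum>l\<in>{fl (m + n) s..<fl (m + n) t}. \<alpha> / 4 ^ (m + n)) = \<alpha> * (real (fl (m + n) t) / 4 ^ (m + n) - real (fl (m + n) s) / 4 ^ (m + n))"
      using le by (simp add: of_nat_diff diff_divide_distrib algebra_simps)
    ultimately show ?thesis by simp
  qed
  moreover have "(\<lambda>n. \<alpha> * (real (fl (m + n) t) / 4 ^ (m + n) - real (fl (m + n) s) / 4 ^ (m + n))) \<longlonglongrightarrow> \<alpha> * (t - s)"
    using LIMSEQ_ignore_initial_segment[OF fl_limit[OF st(2)], of m] LIMSEQ_ignore_initial_segment[OF fl_limit[OF st(1)], of m]
    by (intro tendsto_intros) (simp_all add: add.commute)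
  moreover have "(\<lambda>n. \<psi> (P b (m + n) (fl (m + n) t) - P b (m + n) (fl (m + n) s))) \<longlonglongrightarrow> \<psi> (F b t - F b s)"
    using LIMSEQ_ignore_initial_segment[OF P_limit[OF st(2,4)], of b m] LIMSEQ_ignore_initial_segment[OF P_limit[OF st(1,3)], of b m]
    by (intro bounded_linear.tendsto[OF bl] tendsto_intros) (simp_all add: add.commute)
  ultimately show ?thesis by (intro LIMSEQ_le) auto
qed

lemma \<phi>_F: "0 \<le> t \<Longrightarrow> t \<le> 1 \<Longrightarrow> \<phi> (F b t) = t"
proof -
  assume t: "0 \<le> t" "t \<le> 1"
  have bl: "bounded_linear \<phi>"
    using \<phi> by (intro bounded_linear_intro[where K = 1]) (auto simp: linear_add linear_scale)
  have "\<phi> (P b i k) = real k / 4 ^ i" if "k \<le> 4 ^ i" for i k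
    using that \<phi>u[OF sw_less] by (simp add: P_def linear_sum[OF \<phi>(1)])
  then have "(\<lambda>i. real (fl i t) / 4 ^ i) \<longlonglongrightarrow> \<phi> (F b t)"
    using bounded_linear.tendsto[OF bl P_limit[OF t, of b]] fl_le[OF t] by simp
  then show ?thesis using fl_limit[OF t(1)] LIMSEQ_unique by blast
qed

lemma P_cong:
  assumes "k \<le> 4 ^ i" "\<And>j. j < i \<Longrightarrow> real k / 4 ^ i \<in> band j \<Longrightarrow> j \<in> b \<longleftrightarrow> j \<in> b'"
  shows "P b i k = P b' i k"
  using assms
proof (induction i arbitrary: k)
  case 0
  have "sw b 0 l = sw b' 0 l" for l by simp
  then show ?case unfolding P_def by (intro sum.cong) (auto simp del: sw.simps)
next
  case (Suc i)
  define k0 where "k0 = k div 4"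
  define d where "d = k mod 4"
  have k: "k = 4 * k0 + d" "d < 4" by (auto simp: k0_def d_def)
  have k0: "k0 \<le> 4 ^ i" using Suc.prems(1) by (simp add: k0_def div_le_mono2 div_le_mono[of k "4 * 4 ^ i" 4, simplified])
  show ?case
  proof (cases "d = 0")
    case True
    have "real k / 4 ^ Suc i = real k0 / 4 ^ i" using k(1) True by simp
    then have "P b i k0 = P b' i k0" using Suc.IH[OF k0] Suc.prems(2) by simp
    then show ?thesis using P_4[OF k0, of b] P_4[OF k0, of b'] k(1) True by simp
  next
    case False
    define s where "s = real k / 4 ^ Suc i"
    have s: "real k0 < 4 ^ i * s" "4 ^ i * s < real (Suc k0)" using k False by (auto simp: s_def)
    note prems = Suc.prems(2)[folded s_def]
    have "real k0 / 4 ^ i \<in> band j \<Longrightarrow> s \<in> band j" if "j < i" for j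
    proof -
      assume "real k0 / 4 ^ i \<in> band j"
      then obtain n where "real k0 / 4 ^ i \<in> bandc j n" by (auto simp: band_def)
      then have "s \<in> bandc j n" by (rule bandc_cell[OF that, where k = "int k0"]) (use s in simp_all)
      then show "s \<in> band j" by (rule bandI)
    qed
    then have P0: "P b i k0 = P b' i k0" using Suc.IH[OF k0] prems by simp
    have sw0: "sw b i k0 = sw b' i k0" by (rule sw_cong[OF s]) (use prems in auto)
    have bit: "i \<in> b \<longleftrightarrow> i \<in> b'" if "d = 2"
    proof (rule prems)
      have "s \<in> bandc i (int k0)" using k that by (simp add: bandc_def s_def)
      then show "s \<in> band i" by (rule bandI)
    qed simp
    have e: "P c (Suc i) k = P c i k0 + (\<Sum>d'<d. u (Suc i) (4 * sw c i k0 + swp (i \<in> c) d'))" for c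
      using P_add[of d c i k0] P_4[OF k0, of c] k by simp
    \<comment> \<open>After one child nothing has been swapped, and after three both swapped
      children are included. Only the partial sum after two children sees the bit, and this grid
      point is the middle of the band.\<close>
    consider "d = 1" | "d = 2" | "d = 3" using False k(2) by linarith
    then show ?thesis
    proof cases
      case 1
      then show ?thesis unfolding e using P0 sw0 by (simp add: swp_def)
    next
      case 2
      then show ?thesis unfolding e using P0 sw0 bit by simp
    next
      case 3
      then show ?thesis unfolding e using P0 sw0 by (simp add: swp_def numeral_eq_Suc add_ac)
    qed
  qed
qed

lemma F_cong:
  assumes t: "0 \<le> t" "t \<le> 1" and "pt b t = pt b' t"
  shows "F b t = F b' t"
proof -
  have ag: "j \<in> b \<longleftrightarrow> j \<in> b'" if "t \<in> band j" for j using assms(3) that by (simp add: pt_eq_iff)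
  have "P b i (fl i t) = P b' i (fl i t)" for i
  proof (rule P_cong[OF fl_le[OF t]])
    fix j assume j: "j < i" "real (fl i t) / 4 ^ i \<in> band j"
    then obtain n where n: "real (fl i t) / 4 ^ i \<in> bandc j n" by (auto simp: band_def)
    have "t \<in> bandc j n"
    proof (cases "4 ^ i * t = real (fl i t)")
      case True
      then have "t = real (fl i t) / 4 ^ i" by (simp add: field_simps)
      then show ?thesis using n by simp
    next
      case False
      then show ?thesis using fl[OF t(1), of i]
        by (intro bandc_cell[OF j(1) n, of "int (fl i t)"]) auto
    qed
    then show "j \<in> b \<longleftrightarrow> j \<in> b'" using ag bandI by blast
  qed
  then show ?thesis by (simp add: F_def)
qed

definition emb :: "nat set \<times> real \<Rightarrow> 'b" where "emb x = F (fst x) (snd x)"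

lemma emb_pt: "0 \<le> t \<Longrightarrow> t \<le> 1 \<Longrightarrow> emb (pt b t) = F b t"
  unfolding emb_def snd_pt by (rule F_cong) (auto simp: pt_eq_iff mem_fst_pt)

lemma emb_upper:
  assumes x: "x \<in> LS S'" and y: "y \<in> LS S'"
  shows "norm (emb x - emb y) \<le> L * dd x y"
proof -
  obtain \<tau> b b' where g: "0 \<le> \<tau>" "\<tau> \<le> 1" "b \<subseteq> S'" "b' \<subseteq> S'" "x = pt b (snd x)" "y = pt b' (snd y)" "pt b \<tau> = pt b' \<tau>"
    "dd x y = \<bar>snd x - \<tau>\<bar> + \<bar>\<tau> - snd y\<bar>"
    by (rule geodesic[OF x y])
  have 01: "0 \<le> snd x" "snd x \<le> 1" "0 \<le> snd y" "snd y \<le> 1" using x y by (auto simp: LS_def)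
  have ex: "emb x = F b (snd x)" "emb y = F b' (snd y)" using emb_pt 01 g(5,6) by metis+
  have "norm (emb x - emb y) \<le> norm (F b (snd x) - F b \<tau>) + norm (F b' \<tau> - F b' (snd y))"
    unfolding ex F_cong[OF g(1,2,7), symmetric]
    using norm_triangle_ineq[of "F b (snd x) - F b \<tau>" "F b \<tau> - F b' (snd y)"] by simp
  also have "\<dots> \<le> L * \<bar>snd x - \<tau>\<bar> + L * \<bar>\<tau> - snd y\<bar>"
    by (intro add_mono F_lipschitz 01 g(1,2))
  finally show ?thesis using g(8) by (simp add: distrib_left)
qed

text \<open>Over the band, \<open>\<psi>\<close> grows along the path of \<open>y\<close> with slope
  at least \<open>a + \<epsilon>\<close> up to the middle and at most \<open>a\<close> beyond it,
  and along the path of \<open>x\<close> in the opposite order. The paths agree at both ends of the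
  band, so \<open>\<psi>\<close> opens a gap of \<epsilon> times the distance to an end. Heights
  differ by at most the norm of the difference of the images because of \<open>\<phi>\<close>, and
  \<open>\<bar>a\<bar>\<close> is at most \<open>L\<close>; the factor \<open>1 + L\<close> is the
  price for comparing at different heights.\<close>

lemma emb_lower_sep:
  assumes x: "x \<in> LS S" and y: "y \<in> LS S" and s: "sep j x y" "\<And>i. i < j \<Longrightarrow> \<not> sep i x y"
    and jx: "j \<in> fst x" "j \<notin> fst y"
  shows "dd x y \<le> (2 * (1 + L) / \<epsilon> + 1) * norm (emb x - emb y)"
proof -
  have 01: "0 \<le> snd x" "snd x \<le> 1" "0 \<le> snd y" "snd y \<le> 1" using x y by (auto simp: LS_def)
  obtain n where n: "snd x \<in> bandc j n" "snd y \<in> bandc j n" using s(1) by (auto simp: sep_def)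
  have e: "dd x y = detour j n (snd x) (snd y)" by (rule dd_sep[OF s n(1)])
  have xy: "lo j n < snd x" "snd x < hi j n" "lo j n < snd y" "snd y < hi j n" using n by (auto simp: bandc_iff)
  note l01 = lo_hi_01[OF n(1) 01(1,2)]
  define k where "k = nat n"
  have "n \<ge> 0" using bandc_floor[OF n(1)] 01(1) by auto
  then have nk: "n = int k" by (simp add: k_def)
  have "4 * real k + 1 < 4 ^ Suc j * 1"
  proof -
    have "4 * real k + 1 < 4 ^ Suc j * snd x" using n(1) by (simp add: bandc_def nk)
    also have "\<dots> \<le> 4 ^ Suc j * 1" using 01(2) by (intro mult_left_mono) auto
    finally show ?thesis .
  qed
  then have "real (4 * k + 1) < real (4 * 4 ^ j)" by simp
  then have k: "k < 4 ^ j" unfolding of_nat_less_iff by simp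
  define w where "w = sw (fst x) j k"
  have wk: "w < 4 ^ j" unfolding w_def by (rule sw_less[OF k])
  \<comment> \<open>Above level \<open>j\<close> the two points lie in the same bands and are not
    separated, so their paths run through the same cell of the tree before the swap of level
    \<open>j\<close>.\<close>
  have wy: "sw (fst y) j k = w"
    unfolding w_def
  proof (rule sw_cong[of k j "snd x", symmetric])
    have "4 ^ Suc j * snd x < 4 * real k + 3" "4 * real k + 1 < 4 ^ Suc j * snd x" using n(1) by (auto simp: bandc_def nk)
    then show c: "real k < 4 ^ j * snd x" "4 ^ j * snd x < real (Suc k)" by auto
    fix i assume i: "i < j" "snd x \<in> band i"
    then obtain m where m: "snd x \<in> bandc i m" by (auto simp: band_def)
    then have "snd y \<in> bandc i m" using bandc_nested[OF i(1), of n "snd x" m "snd y"] xy by auto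
    then show "i \<in> fst x \<longleftrightarrow> i \<in> fst y" using m s(2)[OF i(1)] unfolding sep_def by blast
  qed
  have "j \<in> S" using jx(1) x by (auto simp: LS_def)
  from u_sep[OF this wk] obtain \<psi> a where \<psi>: "linear \<psi>" "\<And>v. \<bar>\<psi> v\<bar> \<le> norm v"
    and hi_slope: "\<And>n r. r < 4 ^ n \<Longrightarrow> (a + \<epsilon>) / 4 ^ (Suc j + n) \<le> \<psi> (u (Suc j + n) ((4 * w + 1) * 4 ^ n + r))"
    and lo_slope: "\<And>n r. r < 4 ^ n \<Longrightarrow> \<psi> (u (Suc j + n) ((4 * w + 2) * 4 ^ n + r)) \<le> a / 4 ^ (Suc j + n)"
    by blast
  have q: "(4 * k + 1) div 4 = k" "(4 * k + 2) div 4 = k" "(4 * k + 1) mod 4 = 1" "(4 * k + 2) mod 4 = 2" by presburger+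
  have swx: "sw (fst x) (Suc j) (4 * k + 1) = 4 * w + 2" "sw (fst x) (Suc j) (4 * k + 2) = 4 * w + 1"
    and swy: "sw (fst y) (Suc j) (4 * k + 1) = 4 * w + 1" "sw (fst y) (Suc j) (4 * k + 2) = 4 * w + 2"
    using jx wy q by (auto simp: swp_def w_def)
  have kl: "4 * k + 1 < 4 ^ Suc j" "4 * k + 2 < 4 ^ Suc j" using k by auto
  have aL: "\<bar>a\<bar> \<le> L"
  proof -
    have b: "4 * w + 1 < 4 ^ Suc j" "4 * w + 2 < 4 ^ Suc j" using wk by auto
    define c :: real where "c = 4 ^ Suc j"
    have c: "c > 0" by (simp add: c_def)
    have "(a + \<epsilon>) / c \<le> L / c"
      using hi_slope[of 0 0] \<psi>(2)[of "u (Suc j) (4 * w + 1)"] norm_u[OF b(1)] by (simp add: c_def)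
    then have "a + \<epsilon> \<le> L" using c by (simp add: divide_le_cancel)
    moreover have "- (L / c) \<le> a / c"
      using lo_slope[of 0 0] \<psi>(2)[of "u (Suc j) (4 * w + 2)"] norm_u[OF b(2)] by (simp add: c_def)
    then have "- L \<le> a" using c by (simp add: field_simps)
    ultimately have "a + \<epsilon> \<le> L" "- L \<le> a" by simp_all
    then show ?thesis using \<epsilon> by simp
  qed
  define mid where "mid = (4 * real k + 2) / 4 ^ Suc j"
  define h where "h = (1 / 4 ^ Suc j :: real)"
  have h: "h > 0" "mid = lo j n + h" "hi j n = mid + h"
    by (simp_all add: h_def mid_def lo_def hi_def nk add_divide_distrib)
  have \<psi>': "linear (\<lambda>v. - \<psi> v)" "\<And>v. \<bar>- \<psi> v\<bar> \<le> norm v"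
    using \<psi> by (simp_all add: linear_compose_neg)
  have lm: "4 ^ Suc j * lo j n = real (4 * k + 1)" "4 ^ Suc j * mid = real (4 * k + 2)" "4 ^ Suc j * hi j n = real (4 * k + 3)"
    by (simp_all add: lo_def hi_def mid_def nk)
  have pl: "real (4 * k + 1) \<le> 4 ^ Suc j * s" if "lo j n \<le> s" for s
    unfolding lm(1)[symmetric] using that by (intro mult_left_mono) auto
  have pm: "4 ^ Suc j * s \<le> real (Suc (4 * k + 1))" if "s \<le> mid" for s
    using mult_left_mono[OF that, of "4 ^ Suc j"] unfolding lm(2) by simp
  have pm': "real (4 * k + 2) \<le> 4 ^ Suc j * s" if "mid \<le> s" for s
    using mult_left_mono[OF that, of "4 ^ Suc j"] unfolding lm(2) by simp
  have ph: "4 ^ Suc j * s \<le> real (Suc (4 * k + 2))" if "s \<le> hi j n" for s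
    using mult_left_mono[OF that, of "4 ^ Suc j"] unfolding lm(3) by simp
  have y1: "(a + \<epsilon>) * (t - s) \<le> \<psi> (F (fst y) t - F (fst y) s)" if "lo j n \<le> s" "s \<le> t" "t \<le> mid" for s t
    by (rule linear_F_diff_ge[OF \<psi> _ kl(1) pl[OF that(1)] that(2) pm[OF that(3)]]) (use hi_slope swy in simp)
  have x2: "(a + \<epsilon>) * (t - s) \<le> \<psi> (F (fst x) t - F (fst x) s)" if "mid \<le> s" "s \<le> t" "t \<le> hi j n" for s t
    by (rule linear_F_diff_ge[OF \<psi> _ kl(2) pm'[OF that(1)] that(2) ph[OF that(3)]]) (use hi_slope swx in simp)
  have "(- a) * (t - s) \<le> - \<psi> (F (fst x) t - F (fst x) s)" if "lo j n \<le> s" "s \<le> t" "t \<le> mid" for s t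
    by (rule linear_F_diff_ge[OF \<psi>' _ kl(1) pl[OF that(1)] that(2) pm[OF that(3)]]) (use lo_slope swx in simp)
  then have x1: "\<psi> (F (fst x) t - F (fst x) s) \<le> a * (t - s)" if "lo j n \<le> s" "s \<le> t" "t \<le> mid" for s t
    using that by fastforce
  have "(- a) * (t - s) \<le> - \<psi> (F (fst y) t - F (fst y) s)" if "mid \<le> s" "s \<le> t" "t \<le> hi j n" for s t
    by (rule linear_F_diff_ge[OF \<psi>' _ kl(2) pm'[OF that(1)] that(2) ph[OF that(3)]]) (use lo_slope swy in simp)
  then have y2: "\<psi> (F (fst y) t - F (fst y) s) \<le> a * (t - s)" if "mid \<le> s" "s \<le> t" "t \<le> hi j n" for s t
    using that by fastforce
  have Flo: "F (fst x) (lo j n) = F (fst y) (lo j n)" and Fhi: "F (fst x) (hi j n) = F (fst y) (hi j n)"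
    using least_sep_ends[OF s n(1), of "lo j n"] least_sep_ends[OF s n(1), of "hi j n"] l01 xy
    by (auto intro!: F_cong)
  define N where "N = norm (emb x - emb y)"
  have N0: "0 \<le> N" by (simp add: N_def)
  have tN: "\<bar>snd x - snd y\<bar> \<le> N"
    unfolding N_def emb_def using \<phi>(2)[of "F (fst x) (snd x) - F (fst y) (snd y)"]
    by (simp add: linear_diff[OF \<phi>(1)] \<phi>_F 01)
  have \<psi>N: "\<psi> (F (fst y) (snd y)) - \<psi> (F (fst x) (snd x)) \<le> N"
    unfolding N_def emb_def using \<psi>(2)[of "F (fst x) (snd x) - F (fst y) (snd y)"]
    by (simp add: linear_diff[OF \<psi>(1)])
  have aN: "\<bar>a * (snd x - snd y)\<bar> \<le> L * N"
    unfolding abs_mult using aL tN by (intro mult_mono) (auto simp: L_nonneg)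
  have aN': "a * snd x - a * snd y \<le> L * N" "a * snd y - a * snd x \<le> L * N"
    using aN by (auto simp: abs_le_iff algebra_simps)
  define C where "C = (2 * (1 + L) / \<epsilon> + 1) * N"
  \<comment> \<open>A detour is twice the distance \<open>r\<close> of one point to an end, up to a
    difference of heights, which is at most \<open>N\<close>.\<close>
  have fin: "2 * r + N \<le> C" if "\<epsilon> * r \<le> (1 + L) * N" for r
  proof -
    have "r \<le> (1 + L) * N / \<epsilon>" using that \<epsilon> by (simp add: pos_le_divide_eq mult.commute)
    moreover have "C = 2 * ((1 + L) * N / \<epsilon>) + N" by (simp add: C_def distrib_right)
    ultimately show ?thesis by linarith
  qed
  have tN': "snd x \<le> snd y + N" "snd y \<le> snd x + N" using tN by (simp_all add: abs_le_iff)
  note ld = linear_diff[OF \<psi>(1)]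
  consider "snd x \<le> mid" "snd y \<le> mid" | "mid \<le> snd x" "mid \<le> snd y" |
    "snd x \<le> mid \<and> mid \<le> snd y \<or> snd y \<le> mid \<and> mid \<le> snd x" by linarith
  then have "dd x y \<le> C"
  proof cases
    case 1
    have A: "\<psi> (F (fst x) (snd x)) - \<psi> (F (fst x) (lo j n)) \<le> a * (snd x - lo j n)"
      using x1[of "lo j n" "snd x"] 1 xy by (simp add: ld)
    have B: "(a + \<epsilon>) * (snd y - lo j n) \<le> \<psi> (F (fst y) (snd y)) - \<psi> (F (fst y) (lo j n))"
      using y1[of "lo j n" "snd y"] 1 xy by (simp add: ld)
    have "\<epsilon> * (snd y - lo j n) \<le> (1 + L) * N"
      using A B Flo \<psi>N aN' by (simp add: algebra_simps)
    from fin[OF this] have "snd x + snd y - 2 * lo j n \<le> C" using tN'(1) by simp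
    then show ?thesis unfolding e detour_def min_le_iff_disj by blast
  next
    case 2
    have A: "(a + \<epsilon>) * (hi j n - snd x) \<le> \<psi> (F (fst x) (hi j n)) - \<psi> (F (fst x) (snd x))"
      using x2[of "snd x" "hi j n"] 2 xy by (simp add: ld)
    have B: "\<psi> (F (fst y) (hi j n)) - \<psi> (F (fst y) (snd y)) \<le> a * (hi j n - snd y)"
      using y2[of "snd y" "hi j n"] 2 xy by (simp add: ld)
    have "\<epsilon> * (hi j n - snd x) \<le> (1 + L) * N"
      using A B Fhi \<psi>N aN' by (simp add: algebra_simps)
    from fin[OF this] have "2 * hi j n - snd x - snd y \<le> C" using tN'(1) by simp
    then show ?thesis unfolding e detour_def min_le_iff_disj by blast
  next
    \<comment> \<open>With the heights on different sides of the middle, both paths are followed to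
      the middle, at a cost of \<open>L\<close> times the difference of the heights. There the gap
      is \<epsilon> times half the length of the band.\<close>
    case 3
    have mid01: "0 \<le> mid" "mid \<le> 1" using h l01 by linarith+
    have A: "\<psi> (F (fst x) mid) - \<psi> (F (fst x) (lo j n)) \<le> a * h"
      using x1[of "lo j n" mid] h by (simp add: ld)
    have B: "(a + \<epsilon>) * h \<le> \<psi> (F (fst y) mid) - \<psi> (F (fst y) (lo j n))"
      using y1[of "lo j n" mid] h by (simp add: ld)
    have "\<epsilon> * h \<le> \<psi> (F (fst y) mid - F (fst x) mid)" using A B Flo by (simp add: ld algebra_simps)
    also have "\<dots> \<le> norm (F (fst y) mid - F (fst x) mid)" using \<psi>(2)[of "F (fst y) mid - F (fst x) mid"] by simp
    also have "F (fst y) mid - F (fst x) mid = (F (fst y) mid - F (fst y) (snd y)) - (emb x - emb y) + (F (fst x) (snd x) - F (fst x) mid)"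
      by (simp add: emb_def)
    also have "norm \<dots> \<le> norm (F (fst y) mid - F (fst y) (snd y)) + N + norm (F (fst x) (snd x) - F (fst x) mid)"
      unfolding N_def by (intro order_trans[OF norm_triangle_ineq] add_right_mono norm_triangle_ineq4)
    also have "\<dots> \<le> L * \<bar>mid - snd y\<bar> + N + L * \<bar>snd x - mid\<bar>"
      by (intro add_mono F_lipschitz order_refl mid01 01)
    also have "\<dots> = N + L * (\<bar>mid - snd y\<bar> + \<bar>snd x - mid\<bar>)" by (simp add: algebra_simps)
    also have "\<bar>mid - snd y\<bar> + \<bar>snd x - mid\<bar> = \<bar>snd x - snd y\<bar>" using 3 by auto
    also have "N + L * \<bar>snd x - snd y\<bar> \<le> N + L * N" using tN L_nonneg by (simp add: mult_left_mono)
    finally have "\<epsilon> * h \<le> (1 + L) * N" by (simp add: algebra_simps)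
    from fin[OF this] have "2 * h \<le> C" using N0 by linarith
    moreover have "dd x y \<le> 2 * h" unfolding e detour_def h(2,3) by (auto simp: min_def)
    ultimately show ?thesis by simp
  qed
  then show ?thesis by (simp add: C_def N_def)
qed

theorem emb_lower:
  assumes x: "x \<in> LS S" and y: "y \<in> LS S"
  shows "dd x y \<le> (2 * (1 + L) / \<epsilon> + 1) * norm (emb x - emb y)"
proof (cases rule: sep_cases[of x y])
  case 1
  have 01: "0 \<le> snd x" "snd x \<le> 1" "0 \<le> snd y" "snd y \<le> 1" using x y by (auto simp: LS_def)
  have "dd x y \<le> 1 * norm (emb x - emb y)"
    using dd_unsep[OF 1] \<phi>(2)[of "emb x - emb y"] by (simp add: emb_def linear_diff[OF \<phi>(1)] \<phi>_F 01)
  also have "\<dots> \<le> (2 * (1 + L) / \<epsilon> + 1) * norm (emb x - emb y)"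
    using L_nonneg \<epsilon> by (intro mult_right_mono) auto
  finally show ?thesis .
next
  case (2 j n)
  show ?thesis
  proof (cases "j \<in> fst x")
    case True
    then have "j \<notin> fst y" using 2(1) by (auto simp: sep_def)
    then show ?thesis using emb_lower_sep[OF x y 2(1,2) True] by blast
  next
    case False
    then have "j \<in> fst y" using 2(1) by (auto simp: sep_def)
    moreover have "sep j y x" "\<And>i. i < j \<Longrightarrow> \<not> sep i y x" using 2(1,2) sep_sym by blast+
    ultimately show ?thesis using emb_lower_sep[OF y x] False by (simp add: dd_sym norm_minus_commute)
  qed
qed

end

section \<open>The graphs\<close>

lemma bandc_cell_closed:
  assumes ij: "i < j" and t: "t \<in> bandc i n" "of_int k \<le> 4 ^ j * t" "4 ^ j * t \<le> of_int (k + 1)"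
    and s: "of_int k \<le> 4 ^ j * s" "4 ^ j * s \<le> of_int (k + 1)"
  shows "lo i n \<le> s" "s \<le> hi i n"
proof -
  have "lo i n \<le> s \<and> s \<le> hi i n"
  proof (rule ccontr)
    assume ns: "\<not> (lo i n \<le> s \<and> s \<le> hi i n)"
    \<comment> \<open>\<open>m\<close> is the middle of the cell. The points on the way from
      \<open>s\<close> to \<open>m\<close> other than \<open>s\<close> are interior, hence in the
      band, and the closed bounds for \<open>s\<close> follow in the limit.\<close>
    define m where "m = (of_int k + 1 / 2) / (4 ^ j :: real)"
    have m: "4 ^ j * m = of_int k + 1 / 2" by (simp add: m_def)
    have conv: "of_int k < 4 ^ j * ((1 - x) * s + x * m) \<and> 4 ^ j * ((1 - x) * s + x * m) < of_int (k + 1)" if x: "0 < x" "x \<le> 1" for x :: real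
    proof -
      have e: "4 ^ j * ((1 - x) * s + x * m) = (1 - x) * (4 ^ j * s) + x * (of_int k + 1 / 2)"
        unfolding m[symmetric] by (simp add: algebra_simps)
      have "(1 - x) * of_int k \<le> (1 - x) * (4 ^ j * s)" "(1 - x) * (4 ^ j * s) \<le> (1 - x) * of_int (k + 1)"
        using s x by (auto intro!: mult_left_mono)
      then show ?thesis unfolding e using x by (simp add: algebra_simps)
    qed
    have inb: "(1 - x) * s + x * m \<in> bandc i n" if x: "0 < x" "x \<le> 1" for x :: real
      by (rule bandc_cell[OF ij t]) (use conv[OF x] in auto)
    have c: "((\<lambda>x. (1 - x) * s + x * m) \<longlongrightarrow> (1 - 0) * s + 0 * m) (at_right 0)"
      by (intro tendsto_intros)
    have ev: "eventually (\<lambda>x::real. 0 < x \<and> x \<le> 1) (at_right 0)"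
      by (rule eventually_at_rightI[of 0 1]) auto
    have "lo i n \<le> (1 - 0) * s + 0 * m"
      by (rule tendsto_lowerbound[OF c eventually_mono[OF ev] trivial_limit_at_right_real]) (use inb in \<open>force simp: bandc_iff\<close>)
    moreover have "(1 - 0) * s + 0 * m \<le> hi i n"
      by (rule tendsto_upperbound[OF c eventually_mono[OF ev] trivial_limit_at_right_real]) (use inb in \<open>force simp: bandc_iff\<close>)
    ultimately show False using ns by simp
  qed
  then show "lo i n \<le> s" "s \<le> hi i n" by auto
qed

definition ends :: "real \<Rightarrow> nat set" where
  "ends t = {j. \<exists>n. t = lo j n \<or> t = hi j n}"

text \<open>In the grid of level \<open>j + 1\<close> an end of level \<open>j\<close> has an index
  congruent to 1 or 3 modulo 4. So it belongs to no coarser grid, whereas the ends of coarser levels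
  do. Consequently at most one bit is undetermined at a vertex.\<close>

lemma ends_unique: "i \<in> ends t \<Longrightarrow> j \<in> ends t \<Longrightarrow> i = j"
proof -
  have *: False if ij: "i < j" "i \<in> ends t" "j \<in> ends t" for i j
  proof -
    obtain a :: int where a: "t = of_int a / 4 ^ Suc i"
    proof -
      obtain n where "t = lo i n \<or> t = hi i n" using ij(2) by (auto simp: ends_def)
      then show ?thesis using that[of "4 * n + 1"] that[of "4 * n + 3"] by (auto simp: lo_def hi_def)
    qed
    obtain n where n: "t = lo j n \<or> t = hi j n" using ij(3) by (auto simp: ends_def)
    have "4 ^ Suc j * t = of_int (4 * (4 ^ (j - Suc i) * a))"
    proof -
      have "(4::real) ^ Suc j = 4 * 4 ^ ((j - Suc i) + Suc i)" using ij(1) by simp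
      then show ?thesis unfolding a power_add by simp
    qed
    moreover have "4 ^ Suc j * t = of_int (4 * n + 1) \<or> 4 ^ Suc j * t = of_int (4 * n + 3)"
      using n by (auto simp: lo_def hi_def)
    ultimately have "4 * (4 ^ (j - Suc i) * a) = 4 * n + 1 \<or> 4 * (4 ^ (j - Suc i) * a) = 4 * n + 3"
      by (metis of_int_eq_iff)
    then show False by presburger
  qed
  assume "i \<in> ends t" "j \<in> ends t"
  then show "i = j" using *[of i j] *[of j i] by (metis linorder_neqE_nat)
qed

lemma finite_ends: "finite (ends t)" "card (ends t) \<le> 1"
proof -
  have "ends t = {} \<or> (\<exists>i. ends t = {i})" using ends_unique by blast
  then show "finite (ends t)" "card (ends t) \<le> 1" by auto
qed

text \<open>The bits that matter on the interior of the cell \<open>k\<close> of level \<open>i\<close>.\<close>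

definition cbits :: "nat \<Rightarrow> nat \<Rightarrow> nat set" where
  "cbits i k = {j. j < i \<and> (real k + 1 / 2) / 4 ^ i \<in> band j}"

definition cell :: "nat \<Rightarrow> nat \<Rightarrow> real set" where
  "cell i k = {real k / 4 ^ i..real (Suc k) / 4 ^ i}"

lemma cell_iff: "t \<in> cell i k \<longleftrightarrow> real k \<le> 4 ^ i * t \<and> 4 ^ i * t \<le> real (Suc k)"
  by (auto simp: cell_def divide_le_eq le_divide_eq mult.commute)

lemma mid_cell: "(real k + 1 / 2) / 4 ^ i \<in> cell i k"
  by (simp add: cell_iff)

lemma band_interior:
  assumes t: "real k < 4 ^ i * t" "4 ^ i * t < real (Suc k)" and j: "j < i"
  shows "t \<in> band j \<longleftrightarrow> j \<in> cbits i k"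
proof
  assume "t \<in> band j"
  then obtain n where n: "t \<in> bandc j n" by (auto simp: band_def)
  have "(real k + 1 / 2) / 4 ^ i \<in> bandc j n"
    by (rule bandc_cell[OF j n, of "int k"]) (use t in auto)
  then show "j \<in> cbits i k" using j bandI by (auto simp: cbits_def)
next
  assume "j \<in> cbits i k"
  then obtain n where n: "(real k + 1 / 2) / 4 ^ i \<in> bandc j n" by (auto simp: cbits_def band_def)
  have "t \<in> bandc j n"
    by (rule bandc_cell[OF j n, of "int k"]) (use t in auto)
  then show "t \<in> band j" by (rule bandI)
qed

lemma band_cell:
  assumes t: "t \<in> cell i k" and j: "j < i" "t \<in> band j"
  shows "j \<in> cbits i k"
proof -
  obtain n where n: "t \<in> bandc j n" using j(2) by (auto simp: band_def)
  have "(real k + 1 / 2) / 4 ^ i \<in> bandc j n"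
    by (rule bandc_cell[OF j(1) n, of "int k"]) (use t in \<open>auto simp: cell_iff\<close>)
  then show ?thesis using j(1) bandI by (auto simp: cbits_def)
qed

lemma cbits_cell:
  assumes t: "t \<in> cell i k" and j: "j \<in> cbits i k"
  shows "t \<in> band j \<or> j \<in> ends t"
proof -
  obtain n where n: "(real k + 1 / 2) / 4 ^ i \<in> bandc j n" "j < i" using j by (auto simp: cbits_def band_def)
  have "lo j n \<le> t" "t \<le> hi j n"
    by (rule bandc_cell_closed[OF n(2,1), of "int k"]; use t in \<open>simp add: cell_iff\<close>)+
  then consider "t = lo j n" | "t = hi j n" | "t \<in> bandc j n" by (auto simp: bandc_iff le_less)
  then show ?thesis by cases (auto simp: ends_def intro: bandI)
qed

lemma finite_cbits [simp]: "finite (cbits i k)" by (simp add: cbits_def)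

lemma cbits_less: "j \<in> cbits i k \<Longrightarrow> j < i" by (simp add: cbits_def)

text \<open>On the way from a cell to its neighbour a bit can become relevant only if the common
  point is an end of its level, and there is at most one such level. As each relevant bit halves the
  measure of an edge, adjacent edges will differ by a factor of at most 2.\<close>

lemma card_cbits_adjacent:
  assumes "t \<in> cell i k" "t \<in> cell i k'"
  shows "card (S \<inter> cbits i k) \<le> card (S \<inter> cbits i k') + 1"
proof -
  have "S \<inter> cbits i k \<subseteq> (S \<inter> cbits i k') \<union> ends t"
    using cbits_cell[OF assms(1)] band_cell[OF assms(2)] cbits_less by blast
  then have "card (S \<inter> cbits i k) \<le> card ((S \<inter> cbits i k') \<union> ends t)"
    by (intro card_mono) (auto simp: finite_ends)
  also have "\<dots> \<le> card (S \<inter> cbits i k') + 1"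
    using card_Un_le[of "S \<inter> cbits i k'" "ends t"] finite_ends(2)[of t] by linarith
  finally show ?thesis .
qed

lemma cell_ex:
  assumes "0 \<le> t" "t \<le> 1"
  obtains k where "k < 4 ^ i" "t \<in> cell i k"
proof (cases "t = 1")
  case True
  have "Suc (4 ^ i - 1) = (4::nat) ^ i" by simp
  then have "real (Suc (4 ^ i - 1)) = 4 ^ i" by (metis of_nat_numeral of_nat_power)
  moreover have "(4::nat) ^ i - 1 < 4 ^ i" by simp
  ultimately show ?thesis using that[of "4 ^ i - 1"] True by (simp add: cell_iff)
next
  case False
  define k where "k = nat \<lfloor>4 ^ i * t\<rfloor>"
  have k: "real k \<le> 4 ^ i * t" "4 ^ i * t < real k + 1" using assms(1) by (auto simp: k_def)
  have "4 ^ i * t < 4 ^ i" using assms(2) False by simp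
  then have "real k < 4 ^ i" using k(1) by linarith
  then have "real k < real (4 ^ i)" by simp
  then show ?thesis using that[of k] k unfolding of_nat_less_iff by (simp add: cell_iff)
qed

lemma cell_01: "k < 4 ^ i \<Longrightarrow> t \<in> cell i k \<Longrightarrow> 0 \<le> t \<and> t \<le> 1"
proof -
  assume k: "k < 4 ^ i" and t: "t \<in> cell i k"
  have "real (Suc k) \<le> real (4 ^ i)" using k unfolding of_nat_le_iff by simp
  then have "real (Suc k) \<le> 4 ^ i" by simp
  then have "4 ^ i * t \<le> 4 ^ i" "0 \<le> 4 ^ i * t" using t of_nat_0_le_iff[of k, where 'a = real] unfolding cell_iff by linarith+
  moreover from this have "0 \<le> t" by (metis mult_pos_neg not_le zero_less_numeral zero_less_power)
  ultimately show ?thesis by simp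
qed

section \<open>The graphs and their edges\<close>

text \<open>Points of the graphs have finite sets of bits, encoded as natural numbers.\<close>

definition dec :: "nat \<times> real \<Rightarrow> nat set \<times> real" where "dec p = (set_decode (fst p), snd p)"
definition gp :: "nat set \<Rightarrow> real \<Rightarrow> nat \<times> real" where "gp b t = (set_encode {j \<in> b. t \<in> band j}, t)"
definition gpts :: "nat set \<Rightarrow> nat \<Rightarrow> (nat \<times> real) set" where "gpts S i = {p. dec p \<in> LS (S \<inter> {..<i})}"
definition gm :: "nat set \<Rightarrow> nat \<Rightarrow> (nat \<times> real) metric" where
  "gm S i = metric (gpts S i, \<lambda>p q. dd (dec p) (dec q))"

lemma snd_dec [simp]: "snd (dec p) = snd p" by (simp add: dec_def)
lemma snd_gp [simp]: "snd (gp b t) = t" by (simp add: gp_def)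

lemma dec_inj: "dec p = dec q \<Longrightarrow> p = q"
  by (cases p; cases q) (auto simp: dec_def dest: arg_cong[where f = set_encode])

lemma dec_gp [simp]: "finite b \<Longrightarrow> dec (gp b t) = pt b t"
  by (simp add: dec_def gp_def pt_def)

lemma gp_eq_iff: "finite b \<Longrightarrow> finite b' \<Longrightarrow> gp b t = gp b' t' \<longleftrightarrow> pt b t = pt b' t'"
  by (metis dec_gp dec_inj)

lemma Metric_space_gm: "Metric_space (gpts S i) (\<lambda>p q. dd (dec p) (dec q))"
proof -
  interpret L: Metric_space "LS (S \<inter> {..<i})" dd by (rule Metric_space_LS)
  show ?thesis
  proof
    show "dd (dec p) (dec q) = 0 \<longleftrightarrow> p = q" if "p \<in> gpts S i" "q \<in> gpts S i" for p q
      using that L.zero[of "dec p" "dec q"] dec_inj[of p q] by (auto simp: gpts_def)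
  qed (auto intro: dd_sym dd_triangle)
qed

lemma mspace_gm [simp]: "mspace (gm S i) = gpts S i"
  and mdist_gm [simp]: "mdist (gm S i) = (\<lambda>p q. dd (dec p) (dec q))"
  unfolding gm_def using Metric_space.mspace_metric[OF Metric_space_gm] Metric_space.mdist_metric[OF Metric_space_gm] by auto

lemma finite_bits: "b \<subseteq> S \<inter> {..<i} \<Longrightarrow> finite (b::nat set)"
  by (rule finite_subset[of _ "{..<i}"]) auto

lemma gp_gpts: "b \<subseteq> S \<inter> {..<i} \<Longrightarrow> 0 \<le> t \<Longrightarrow> t \<le> 1 \<Longrightarrow> gp b t \<in> gpts S i"
  using LS_pt[of b "S \<inter> {..<i}" t] finite_bits[of b S i] by (simp add: gpts_def)

lemma gpts_gp:
  assumes "p \<in> gpts S i"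
  shows "p = gp (fst (dec p)) (snd p)" "fst (dec p) \<subseteq> S \<inter> {..<i}" "0 \<le> snd p" "snd p \<le> 1"
  using assms finite_bits[of "fst (dec p)" S i] LS_eq_pt[of "dec p" "S \<inter> {..<i}"] dec_inj by (auto simp: gpts_def LS_def)

definition gverts :: "nat set \<Rightarrow> nat \<Rightarrow> nat \<Rightarrow> (nat \<times> real) set" where
  "gverts S i n = {p \<in> gpts S i. \<exists>k::nat. snd p = real k / 4 ^ n}"

definition gseg :: "nat \<Rightarrow> nat set \<Rightarrow> nat \<Rightarrow> (nat \<times> real) set" where
  "gseg n b k = gp b ` cell n k"

text \<open>The level \<open>i\<close> of the graph and the level \<open>n\<close> of the grid are
  separate parameters: \<open>n = i\<close> gives the edges of the graph and
  \<open>n = Suc i\<close> those of its subdivision. Different \<open>b\<close> may describe the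
  same edge.\<close>

definition gedges :: "nat set \<Rightarrow> nat \<Rightarrow> nat \<Rightarrow> (nat \<times> real) set set" where
  "gedges S i n = {gseg n b k | b k. b \<subseteq> S \<inter> {..<i} \<and> k < 4 ^ n}"

definition XG :: "nat set \<Rightarrow> nat \<Rightarrow> (nat \<times> real) metric_graph" where
  "XG S i = \<lparr>gmetric = gm S i, verts = gverts S i i, edges = gedges S i i\<rparr>"

lemma XG_simps [simp]: "gmetric (XG S i) = gm S i" "verts (XG S i) = gverts S i i" "edges (XG S i) = gedges S i i"
  by (simp_all add: XG_def)

lemma gsegI: "t \<in> cell n k \<Longrightarrow> gp b t \<in> gseg n b k" by (simp add: gseg_def)

lemma gsegE: "p \<in> gseg n b k \<Longrightarrow> snd p \<in> cell n k" "p \<in> gseg n b k \<Longrightarrow> p = gp b (snd p)"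
  by (auto simp: gseg_def)

lemma mem_gseg_iff:
  assumes "b \<subseteq> S \<inter> {..<i}" "p \<in> gpts S i"
  shows "p \<in> gseg n b k \<longleftrightarrow> snd p \<in> cell n k \<and> (\<forall>j. snd p \<in> band j \<longrightarrow> (j \<in> fst (dec p) \<longleftrightarrow> j \<in> b))"
proof -
  have "p \<in> gseg n b k \<longleftrightarrow> snd p \<in> cell n k \<and> p = gp b (snd p)" by (auto simp: gseg_def)
  also have "p = gp b (snd p) \<longleftrightarrow> pt (fst (dec p)) (snd p) = pt b (snd p)"
    using gpts_gp[OF assms(2)] finite_bits[OF gpts_gp(2)[OF assms(2)]] finite_bits[OF assms(1)]
    by (metis gp_eq_iff)
  finally show ?thesis by (simp add: pt_eq_iff)
qed

lemma gseg_subset: "b \<subseteq> S \<inter> {..<i} \<Longrightarrow> k < 4 ^ n \<Longrightarrow> gseg n b k \<subseteq> gpts S i"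
  unfolding gseg_def using cell_01 gp_gpts by blast

lemma gseg_eq:
  assumes "b \<subseteq> S \<inter> {..<i}" "b' \<subseteq> S \<inter> {..<i}" "i \<le> n" "b \<inter> cbits n k = b' \<inter> cbits n k"
  shows "gseg n b k = gseg n b' k"
proof -
  have "gp b t = gp b' t" if t: "t \<in> cell n k" for t
  proof -
    have "j \<in> b \<longleftrightarrow> j \<in> b'" if "t \<in> band j" for j
    proof (cases "j < n")
      case True
      then have "j \<in> cbits n k" using band_cell[OF t] that by blast
      then show ?thesis using assms(4) by blast
    next
      case False
      then have "j \<notin> b" "j \<notin> b'" using assms(1-3) by auto
      then show ?thesis by simp
    qed
    then show ?thesis using finite_bits assms(1,2) by (auto simp: gp_eq_iff pt_eq_iff)
  qed
  then show ?thesis unfolding gseg_def by (intro image_cong) auto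
qed

text \<open>An interior point carries all the bits that are relevant on its cell, so it determines
  the edge.\<close>

lemma gseg_interior_eq:
  assumes b: "b \<subseteq> S \<inter> {..<i}" "b' \<subseteq> S \<inter> {..<i}" "i \<le> n"
    and p: "p \<in> gseg n b k" "p \<in> gseg n b' k'" "real k < 4 ^ n * snd p" "4 ^ n * snd p < real (Suc k)"
  shows "gseg n b k = gseg n b' k'"
proof -
  have t: "snd p \<in> cell n k" "snd p \<in> cell n k'" using p(1,2) gsegE by auto
  have "real k' < real (Suc k)" "real k < real (Suc k')" using t(2) p(3,4) unfolding cell_iff by linarith+
  then have kk: "k' = k" unfolding of_nat_less_iff by simp
  have "p = gp b (snd p)" "p = gp b' (snd p)" using p(1,2) gsegE(2) by blast+
  then have "pt b (snd p) = pt b' (snd p)" using gp_eq_iff finite_bits b by metis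
  then have "b \<inter> cbits n k = b' \<inter> cbits n k"
    using band_interior[OF p(3,4)] cbits_less unfolding pt_eq_iff by blast
  then show ?thesis using gseg_eq[OF b] kk by simp
qed

lemma gverts_interior:
  assumes "p \<in> gpts S i" "snd p \<in> cell n k"
  shows "p \<in> gverts S i n \<longleftrightarrow> snd p = real k / 4 ^ n \<or> snd p = real (Suc k) / 4 ^ n"
proof
  assume "p \<in> gverts S i n"
  then obtain l :: nat where l: "snd p = real l / 4 ^ n" by (auto simp: gverts_def)
  then have "real k \<le> real l" "real l \<le> real (Suc k)" using assms(2) by (auto simp: cell_iff)
  then have "l = k \<or> l = Suc k" unfolding of_nat_le_iff by auto
  then show "snd p = real k / 4 ^ n \<or> snd p = real (Suc k) / 4 ^ n" using l by auto
next
  assume "snd p = real k / 4 ^ n \<or> snd p = real (Suc k) / 4 ^ n"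
  then show "p \<in> gverts S i n" using assms(1) unfolding gverts_def by blast
qed

lemma cell_shift: "s \<in> {0..1 / 4 ^ n} \<longleftrightarrow> real k / 4 ^ n + s \<in> cell n k"
  by (auto simp: cell_def add_divide_distrib)

lemma edge_param_XG:
  assumes b: "b \<subseteq> S \<inter> {..<i}" and k: "k < 4 ^ i"
  shows "edge_param (1 / 4 ^ i) (XG S i) (gseg i b k) (\<lambda>s. gp b (real k / 4 ^ i + s))"
  unfolding edge_param_def XG_simps mspace_gm mdist_gm
proof (intro conjI ballI)
  show "gseg i b k \<subseteq> gpts S i" by (rule gseg_subset[OF b k])
  have "inj_on (\<lambda>s. gp b (real k / 4 ^ i + s)) {0..1 / 4 ^ i}"
    by (rule inj_onI) (metis add_left_cancel snd_gp)
  moreover have "(\<lambda>s. gp b (real k / 4 ^ i + s)) ` {0..1 / 4 ^ i} = gseg i b k"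
  proof (intro equalityI subsetI)
    fix p assume "p \<in> gseg i b k"
    then obtain t where t: "t \<in> cell i k" "p = gp b t" by (auto simp: gseg_def)
    then show "p \<in> (\<lambda>s. gp b (real k / 4 ^ i + s)) ` {0..1 / 4 ^ i}"
      using cell_shift[of "t - real k / 4 ^ i" i k] by (intro image_eqI[of _ _ "t - real k / 4 ^ i"]) auto
  qed (use cell_shift[of _ i k] in \<open>auto intro: gsegI\<close>)
  ultimately show "bij_betw (\<lambda>s. gp b (real k / 4 ^ i + s)) {0..1 / 4 ^ i} (gseg i b k)"
    by (simp add: bij_betw_def)
  show "dd (dec (gp b (real k / 4 ^ i + s))) (dec (gp b (real k / 4 ^ i + t))) = \<bar>s - t\<bar>" for s t
    using finite_bits[OF b] by simp
  fix t assume t: "t \<in> {0..1 / (4::real) ^ i}"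
  have p: "gp b (real k / 4 ^ i + t) \<in> gpts S i" "snd (gp b (real k / 4 ^ i + t)) \<in> cell i k"
    using t cell_shift[of t i k] gseg_subset[OF b k] gsegI by auto
  show "(gp b (real k / 4 ^ i + t) \<in> gverts S i i) = (t = 0 \<or> t = 1 / 4 ^ i)"
    unfolding gverts_interior[OF p] by (auto simp: add_divide_distrib)
qed

text \<open>Chains together with their lengths, in a form that can be concatenated and reversed. A
  chain whose length is the distance is built in this way; that no chain is shorter is the triangle
  inequality.\<close>

inductive reach :: "'a metric_graph \<Rightarrow> 'a \<Rightarrow> 'a \<Rightarrow> real \<Rightarrow> bool" for G where
  reach_refl: "reach G x x 0"
| reach_step: "e \<in> edges G \<Longrightarrow> x \<in> e \<Longrightarrow> y \<in> e \<Longrightarrow> reach G y z r \<Longrightarrow> reach G x z (mdist (gmetric G) x y + r)"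

lemma reach_trans: "reach G x y r \<Longrightarrow> reach G y z s \<Longrightarrow> reach G x z (r + s)"
  by (induction rule: reach.induct) (auto simp: add.assoc intro: reach.reach_step)

lemma reach_edge: "e \<in> edges G \<Longrightarrow> x \<in> e \<Longrightarrow> y \<in> e \<Longrightarrow> reach G x y (mdist (gmetric G) x y)"
  using reach.reach_step[OF _ _ _ reach.reach_refl] by fastforce

lemma reach_sym:
  assumes "reach G x y r" "\<And>x y. mdist (gmetric G) x y = mdist (gmetric G) y x"
  shows "reach G y x r"
  using assms(1)
proof (induction rule: reach.induct)
  case (reach_step e x y z r)
  have "reach G z x (r + mdist (gmetric G) y x)"
    by (rule reach_trans[OF reach_step.IH reach_edge[OF reach_step.hyps(1,3,2)]])
  then show ?case using assms(2)[of x y] by (simp add: add.commute)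
qed (rule reach.reach_refl)

lemma reach_chain: "reach G x y r \<Longrightarrow> \<exists>ps\<in>chains G x y. chain_length G ps = r"
proof (induction rule: reach.induct)
  case (reach_refl x)
  show ?case by (intro bexI[of _ "[x]"]) (auto simp: chains_def chain_length_def)
next
  case (reach_step e x y z r)
  then obtain ps where ps: "ps \<in> chains G y z" "chain_length G ps = r" by blast
  then obtain qs where qs: "ps = y # qs" unfolding chains_def by (cases ps) auto
  show ?case
  proof (intro bexI[of _ "x # ps"])
    show "x # ps \<in> chains G x z" using ps(1) reach_step.hyps(1-3) unfolding qs chains_def by auto
    show "chain_length G (x # ps) = mdist (gmetric G) x y + r"
      using ps(2) unfolding qs chain_length_def by (simp add: sum.lessThan_Suc_shift del: sum.lessThan_Suc)
  qed
qed

lemma chain_length_ge: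
  assumes d: "\<And>x. mdist (gmetric G) x x = 0" "\<And>x y z. mdist (gmetric G) x z \<le> mdist (gmetric G) x y + mdist (gmetric G) y z"
  shows "ps \<noteq> [] \<Longrightarrow> mdist (gmetric G) (hd ps) (last ps) \<le> chain_length G ps"
proof (induction ps)
  case (Cons x ps)
  show ?case
  proof (cases ps)
    case Nil
    then show ?thesis by (simp add: chain_length_def d)
  next
    case (Cons y qs)
    have "chain_length G (x # ps) = mdist (gmetric G) x y + chain_length G ps"
      unfolding Cons chain_length_def by (simp add: sum.lessThan_Suc_shift del: sum.lessThan_Suc)
    then show ?thesis using Cons.IH Cons d(2)[of x "last ps" y] by (simp add: Cons)
  qed
qed simp

text \<open>Induction on the number of cells that remain, counted from the floor of the start. Each
  step walks to the next grid point inside one edge.\<close>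

lemma reach_path_less:
  assumes b: "b \<subseteq> S \<inter> {..<i}" and s: "0 \<le> s" "s \<le> t" "t \<le> 1" and n: "4 ^ i * t \<le> of_int \<lfloor>4 ^ i * s\<rfloor> + real n"
  shows "reach (XG S i) (gp b s) (gp b t) (t - s)"
  using s n
proof (induction n arbitrary: s)
  case 0
  have "of_int \<lfloor>4 ^ i * s\<rfloor> \<le> 4 ^ i * s" by linarith
  then have "4 ^ i * t \<le> 4 ^ i * s" using 0(4) by linarith
  then have "s = t" using 0 by simp
  then show ?case using reach.reach_refl[of "XG S i" "gp b t"] by simp
next
  case (Suc n)
  note fin = finite_bits[OF b]
  define k where "k = nat \<lfloor>4 ^ i * s\<rfloor>"
  have k: "real k \<le> 4 ^ i * s" "4 ^ i * s < real (Suc k)" "real k = of_int \<lfloor>4 ^ i * s\<rfloor>"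
  proof -
    show "real k = of_int \<lfloor>4 ^ i * s\<rfloor>" using Suc.prems(1) by (simp add: k_def)
    then show "real k \<le> 4 ^ i * s" "4 ^ i * s < real (Suc k)" by linarith+
  qed
  define g where "g = real (Suc k) / 4 ^ i"
  have g: "4 ^ i * g = real (Suc k)" by (simp add: g_def)
  show ?case
  proof (cases "s = 1")
    case True
    then have "s = t" using Suc.prems by simp
    then show ?thesis using reach.reach_refl[of "XG S i" "gp b t"] by simp
  next
    case False
    then have "4 ^ i * s < 4 ^ i" using Suc.prems by simp
    then have "real k < 4 ^ i" using k(1) by linarith
    then have "real k < real (4 ^ i)" by simp
    then have k4: "k < 4 ^ i" unfolding of_nat_less_iff .
    have E: "gseg i b k \<in> edges (XG S i)" using b k4 by (auto simp: gedges_def)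
    have sc: "s \<in> cell i k" "g \<in> cell i k" using k g by (auto simp: cell_iff)
    show ?thesis
    proof (cases "t \<le> g")
      case True
      then have "4 ^ i * t \<le> real (Suc k)" unfolding g[symmetric] by simp
      moreover have "4 ^ i * s \<le> 4 ^ i * t" using Suc.prems(2) by simp
      then have "real k \<le> 4 ^ i * t" using k(1) by linarith
      ultimately have "t \<in> cell i k" by (simp add: cell_iff)
      then show ?thesis using reach_edge[OF E gsegI[OF sc(1)] gsegI] fin Suc.prems(2) by fastforce
    next
      case False
      have "s \<le> g" using sc k(2) g mult_le_cancel_left_pos[of "4 ^ i" s g] by simp
      have "\<lfloor>4 ^ i * g\<rfloor> = int (Suc k)" unfolding g by (simp add: floor_of_nat)
      then have "4 ^ i * t \<le> of_int \<lfloor>4 ^ i * g\<rfloor> + real n" using Suc.prems(4) k(3) by simp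
      then have "reach (XG S i) (gp b g) (gp b t) (t - g)"
        using Suc.IH[of g] False Suc.prems \<open>s \<le> g\<close> by simp
      moreover have "reach (XG S i) (gp b s) (gp b g) (g - s)"
        using reach_edge[OF E gsegI[OF sc(1)] gsegI[OF sc(2)]] fin \<open>s \<le> g\<close> by (simp add: abs_minus_commute)
      ultimately show ?thesis using reach_trans by fastforce
    qed
  qed
qed

lemma reach_path:
  assumes b: "b \<subseteq> S \<inter> {..<i}" and s: "0 \<le> s" "s \<le> 1" "0 \<le> t" "t \<le> 1"
  shows "reach (XG S i) (gp b s) (gp b t) \<bar>s - t\<bar>"
proof -
  have *: "reach (XG S i) (gp b s) (gp b t) (t - s)" if "0 \<le> s" "s \<le> t" "t \<le> 1" for s t
  proof -
    obtain n :: nat where "4 ^ i * t - of_int \<lfloor>4 ^ i * s\<rfloor> \<le> real n" using real_arch_simple by blast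
    then show ?thesis using reach_path_less[OF b that, of n] by simp
  qed
  show ?thesis
  proof (cases "s \<le> t")
    case True
    then show ?thesis using *[of s t] s by simp
  next
    case False
    then have "reach (XG S i) (gp b t) (gp b s) (s - t)" using *[of t s] s by simp
    then have "reach (XG S i) (gp b s) (gp b t) (s - t)" by (rule reach_sym) (simp add: dd_sym)
    then show ?thesis using False by simp
  qed
qed

lemma reach_dist:
  assumes p: "p \<in> gpts S i" and q: "q \<in> gpts S i"
  shows "reach (XG S i) p q (dd (dec p) (dec q))"
proof -
  obtain \<tau> b b' where g: "0 \<le> \<tau>" "\<tau> \<le> 1" "b \<subseteq> S \<inter> {..<i}" "b' \<subseteq> S \<inter> {..<i}" "dec p = pt b (snd (dec p))" "dec q = pt b' (snd (dec q))" "pt b \<tau> = pt b' \<tau>"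
    "dd (dec p) (dec q) = \<bar>snd (dec p) - \<tau>\<bar> + \<bar>\<tau> - snd (dec q)\<bar>"
    using geodesic[of "dec p" "S \<inter> {..<i}" "dec q"] p q unfolding gpts_def by blast
  have "p = gp b (snd p)" "q = gp b' (snd q)"
    using g(3-6) finite_bits dec_inj dec_gp by (metis snd_dec)+
  moreover have "gp b \<tau> = gp b' \<tau>" using g(3,4,7) finite_bits gp_eq_iff by metis
  ultimately show ?thesis
    using reach_trans[OF reach_path[OF g(3) gpts_gp(3,4)[OF p] g(1,2)]] reach_path[OF g(4) g(1,2) gpts_gp(3,4)[OF q]] g(8)
    by simp
qed

lemma connected_metric_graph_XG: "connected_metric_graph (1 / 4 ^ i) (XG S i)"
  unfolding connected_metric_graph_def XG_simps mspace_gm mdist_gm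
proof (intro conjI ballI impI)
  show "gpts S i \<noteq> {}" using gp_gpts[of "{}" S i 0] by auto
  show "gpts S i = gverts S i i \<union> \<Union> (gedges S i i)"
  proof (intro equalityI subsetI)
    fix p assume p: "p \<in> gpts S i"
    obtain k where k: "k < 4 ^ i" "snd p \<in> cell i k" using cell_ex gpts_gp(3,4)[OF p] by metis
    have "p \<in> gseg i (fst (dec p)) k" using gpts_gp(1)[OF p] gsegI[OF k(2)] by metis
    moreover have "gseg i (fst (dec p)) k \<in> gedges S i i" unfolding gedges_def using gpts_gp(2)[OF p] k(1) by blast
    ultimately show "p \<in> gverts S i i \<union> \<Union> (gedges S i i)" by blast
  next
    have "gverts S i i \<subseteq> gpts S i" by (auto simp: gverts_def)
    moreover have "e \<subseteq> gpts S i" if "e \<in> gedges S i i" for e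
      using that gseg_subset unfolding gedges_def by blast
    ultimately show "p \<in> gpts S i" if "p \<in> gverts S i i \<union> \<Union> (gedges S i i)" for p using that by blast
  qed
  show "\<exists>\<gamma>. edge_param (1 / 4 ^ i) (XG S i) e \<gamma>" if e: "e \<in> gedges S i i" for e
  proof -
    obtain b k where "e = gseg i b k" "b \<subseteq> S \<inter> {..<i}" "k < 4 ^ i" using e by (auto simp: gedges_def)
    then show ?thesis using edge_param_XG by blast
  qed
  show "e \<inter> e' \<subseteq> gverts S i i" if e: "e \<in> gedges S i i" "e' \<in> gedges S i i" "e \<noteq> e'" for e e'
  proof
    fix p assume p: "p \<in> e \<inter> e'"
    obtain b k b' k' where e: "e = gseg i b k" "e' = gseg i b' k'" "b \<subseteq> S \<inter> {..<i}" "b' \<subseteq> S \<inter> {..<i}" "k < 4 ^ i" "k' < 4 ^ i"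
      using e(1,2) by (auto simp: gedges_def)
    have pc: "p \<in> gpts S i" "snd p \<in> cell i k" using p gseg_subset[OF e(3,5)] gsegE(1) unfolding e by blast+
    show "p \<in> gverts S i i"
    proof (rule ccontr)
      assume "p \<notin> gverts S i i"
      then have "snd p \<noteq> real k / 4 ^ i" "snd p \<noteq> real (Suc k) / 4 ^ i" using gverts_interior[OF pc] by auto
      then have "real k < 4 ^ i * snd p" "4 ^ i * snd p < real (Suc k)" using pc(2) unfolding cell_iff
        by (auto simp: le_less field_simps)
      then have "e = e'" unfolding e using gseg_interior_eq[OF e(3,4) order_refl] p e by blast
      then show False using that by simp
    qed
  qed
  fix p q assume p: "p \<in> gpts S i" and q: "q \<in> gpts S i"
  obtain ps where ps: "ps \<in> chains (XG S i) p q" "chain_length (XG S i) ps = dd (dec p) (dec q)"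
    using reach_chain[OF reach_dist[OF p q]] by blast
  show "chains (XG S i) p q \<noteq> {}" using ps by blast
  have "dd (dec p) (dec q) \<le> chain_length (XG S i) qs" if "qs \<in> chains (XG S i) p q" for qs
    using chain_length_ge[of "XG S i" qs] that dd_triangle dd_eq_0_iff by (auto simp: chains_def)
  then show "dd (dec p) (dec q) = Inf (chain_length (XG S i) ` chains (XG S i) p q)"
    using ps by (intro cInf_eq_minimum[symmetric]) (metis imageI, auto)
qed

section \<open>The bonding maps\<close>

text \<open>The subdivision locates points by their distance from an end vertex \<open>v\<close>,
  and either end may serve. Counted from the lower end, part \<open>j\<close> is child
  \<open>j\<close>; counted from the upper end, it is child \<open>3 - j\<close>.\<close>

lemma seg_part:
  assumes b: "b \<subseteq> S \<inter> {..<i}" and j: "j < 4" and v: "v = gp b tv" and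
    c: "tv = real k / 4 ^ i \<and> k' = 4 * k + j \<or> tv = real (Suc k) / 4 ^ i \<and> k' = 4 * k + 3 - j"
  shows "{y \<in> gseg i b k. real j * (1 / 4 ^ i / real 4) \<le> dd (dec v) (dec y) \<and>
     dd (dec v) (dec y) \<le> real (Suc j) * (1 / 4 ^ i / real 4)} = gseg (Suc i) b k'"
proof -
  have "t \<in> cell i k \<and> real j * (1 / 4 ^ i / real 4) \<le> \<bar>tv - t\<bar> \<and> \<bar>tv - t\<bar> \<le> real (Suc j) * (1 / 4 ^ i / real 4) \<longleftrightarrow> t \<in> cell (Suc i) k'" for t
  proof -
    define T where "T = 4 ^ Suc i * t"
    have T: "4 ^ i * t = T / 4" by (simp add: T_def)
    define V where "V = 4 ^ Suc i * tv"
    have "\<bar>V - T\<bar> = 4 ^ Suc i * \<bar>tv - t\<bar>" unfolding V_def T_def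
      by (simp add: abs_mult flip: right_diff_distrib)
    then have e: "real j * (1 / 4 ^ i / real 4) \<le> \<bar>tv - t\<bar> \<longleftrightarrow> real j \<le> \<bar>V - T\<bar>"
      "\<bar>tv - t\<bar> \<le> real (Suc j) * (1 / 4 ^ i / real 4) \<longleftrightarrow> \<bar>V - T\<bar> \<le> real (Suc j)"
      by (simp_all add: field_simps)
    have "V = 4 * real k \<and> k' = 4 * k + j \<or> V = 4 * real k + 4 \<and> k' = 4 * k + 3 - j"
      using c by (auto simp: V_def field_simps)
    then show ?thesis unfolding e cell_iff T T_def[symmetric] using j by (auto simp: of_nat_diff)
  qed
  moreover have "{y \<in> gseg i b k. real j * (1 / 4 ^ i / real 4) \<le> dd (dec v) (dec y) \<and>
     dd (dec v) (dec y) \<le> real (Suc j) * (1 / 4 ^ i / real 4)} =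
     gp b ` {t \<in> cell i k. real j * (1 / 4 ^ i / real 4) \<le> \<bar>tv - t\<bar> \<and> \<bar>tv - t\<bar> \<le> real (Suc j) * (1 / 4 ^ i / real 4)}"
    unfolding gseg_def v using finite_bits[OF b] by auto
  ultimately show ?thesis unfolding gseg_def by simp
qed

lemma gseg_vert:
  assumes b: "b \<subseteq> S \<inter> {..<i}" and k: "k < 4 ^ i" and v: "v \<in> gseg i b k \<inter> gverts S i i"
  obtains tv where "v = gp b tv" "tv = real k / 4 ^ i \<or> tv = real (Suc k) / 4 ^ i"
  using v gseg_subset[OF b k] gsegE gverts_interior by blast

lemma subdivide_edges: "edges (subdivide (1 / 4 ^ i) 4 (XG S i)) = gedges S i (Suc i)"
proof -
  have "edges (subdivide (1 / 4 ^ i) 4 (XG S i)) = {{y\<in>e. real j * (1 / 4 ^ i / real 4) \<le> dd (dec v) (dec y) \<and>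
                     dd (dec v) (dec y) \<le> real (Suc j) * (1 / 4 ^ i / real 4)} | e v j.
               e \<in> gedges S i i \<and> v \<in> e \<inter> gverts S i i \<and> j < 4}"
    by (simp add: subdivide_def)
  also have "\<dots> = gedges S i (Suc i)"
  proof (intro equalityI subsetI)
    fix E assume "E \<in> {{y\<in>e. real j * (1 / 4 ^ i / real 4) \<le> dd (dec v) (dec y) \<and>
                     dd (dec v) (dec y) \<le> real (Suc j) * (1 / 4 ^ i / real 4)} | e v j.
               e \<in> gedges S i i \<and> v \<in> e \<inter> gverts S i i \<and> j < 4}"
    then obtain e v j where E: "E = {y\<in>e. real j * (1 / 4 ^ i / real 4) \<le> dd (dec v) (dec y) \<and>
                     dd (dec v) (dec y) \<le> real (Suc j) * (1 / 4 ^ i / real 4)}"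
      and *: "e \<in> gedges S i i" "v \<in> e \<inter> gverts S i i" "j < 4" by blast
    obtain b k where b: "e = gseg i b k" "b \<subseteq> S \<inter> {..<i}" "k < 4 ^ i" using *(1) by (auto simp: gedges_def)
    obtain tv where tv: "v = gp b tv" "tv = real k / 4 ^ i \<or> tv = real (Suc k) / 4 ^ i"
      using gseg_vert[OF b(2,3)] *(2) b(1) by metis
    obtain k' where k': "tv = real k / 4 ^ i \<and> k' = 4 * k + j \<or> tv = real (Suc k) / 4 ^ i \<and> k' = 4 * k + 3 - j"
      using tv(2) by blast
    have "E = gseg (Suc i) b k'" unfolding E b(1) by (rule seg_part[OF b(2) *(3) tv(1) k'])
    moreover have "k' < 4 ^ Suc i" using k' b(3) *(3) by auto
    ultimately show "E \<in> gedges S i (Suc i)" using b(2) unfolding gedges_def by blast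
  next
    fix E assume "E \<in> gedges S i (Suc i)"
    then obtain b k' where b: "E = gseg (Suc i) b k'" "b \<subseteq> S \<inter> {..<i}" "k' < 4 ^ Suc i" by (auto simp: gedges_def)
    define k where "k = k' div 4"
    define j where "j = k' mod 4"
    have k: "k < 4 ^ i" "j < 4" "k' = 4 * k + j" using b(3) by (auto simp: k_def j_def less_mult_imp_div_less mult.commute)
    define v where "v = gp b (real k / 4 ^ i)"
    have c: "real k / 4 ^ i \<in> cell i k" by (simp add: cell_iff)
    have v: "v \<in> gseg i b k" unfolding v_def by (rule gsegI[OF c])
    moreover have "v \<in> gverts S i i" using v gseg_subset[OF b(2) k(1)] unfolding gverts_def v_def by auto
    ultimately show "E \<in> {{y\<in>e. real j * (1 / 4 ^ i / real 4) \<le> dd (dec v) (dec y) \<and>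
                     dd (dec v) (dec y) \<le> real (Suc j) * (1 / 4 ^ i / real 4)} | e v j.
               e \<in> gedges S i i \<and> v \<in> e \<inter> gverts S i i \<and> j < 4}"
      using seg_part[OF b(2) k(2) v_def, of k k'] k b(1,2) unfolding gedges_def by blast
  qed
  finally show ?thesis .
qed

lemma subdivide_verts: "verts (subdivide (1 / 4 ^ i) 4 (XG S i)) = gverts S i (Suc i)"
proof -
  have "verts (subdivide (1 / 4 ^ i) 4 (XG S i)) = gverts S i i \<union> {y. \<exists>e\<in>gedges S i i. \<exists>v\<in>e \<inter> gverts S i i. \<exists>j\<le>4.
                             y \<in> e \<and> dd (dec v) (dec y) = real j * (1 / 4 ^ i / real 4)}"
    by (simp add: subdivide_def)
  also have "\<dots> = gverts S i (Suc i)"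
  proof (intro equalityI subsetI)
    fix y assume "y \<in> gverts S i i \<union> {y. \<exists>e\<in>gedges S i i. \<exists>v\<in>e \<inter> gverts S i i. \<exists>j\<le>4.
                             y \<in> e \<and> dd (dec v) (dec y) = real j * (1 / 4 ^ i / real 4)}"
    then show "y \<in> gverts S i (Suc i)"
    proof
      assume y: "y \<in> gverts S i i"
      then obtain k :: nat where "snd y = real k / 4 ^ i" by (auto simp: gverts_def)
      then have "snd y = real (4 * k) / 4 ^ Suc i" by simp
      then show ?thesis using y unfolding gverts_def by blast
    next
      assume "y \<in> {y. \<exists>e\<in>gedges S i i. \<exists>v\<in>e \<inter> gverts S i i. \<exists>j\<le>4.
                             y \<in> e \<and> dd (dec v) (dec y) = real j * (1 / 4 ^ i / real 4)}"
      then obtain e v j where *: "e \<in> gedges S i i" "v \<in> e \<inter> gverts S i i" "j \<le> 4" "y \<in> e"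
        "dd (dec v) (dec y) = real j * (1 / 4 ^ i / real 4)" by blast
      obtain b k where b: "e = gseg i b k" "b \<subseteq> S \<inter> {..<i}" "k < 4 ^ i" using *(1) by (auto simp: gedges_def)
      obtain tv where tv: "v = gp b tv" "tv = real k / 4 ^ i \<or> tv = real (Suc k) / 4 ^ i"
        using gseg_vert[OF b(2,3)] *(2) b(1) by metis
      have y: "y = gp b (snd y)" "snd y \<in> cell i k" "y \<in> gpts S i" using *(4) gsegE gseg_subset[OF b(2,3)] unfolding b(1) by blast+
      have d: "\<bar>tv - snd y\<bar> = real j / 4 ^ Suc i"
        using *(5) y(1) finite_bits[OF b(2)] tv(1) by (metis dd_path dec_gp divide_divide_eq_left mult.commute of_nat_numeral power_Suc times_divide_eq_right mult.right_neutral)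
      have "real k / 4 ^ i \<le> snd y" "snd y \<le> real (Suc k) / 4 ^ i" using y(2) by (auto simp: cell_def)
      then have "snd y = real (4 * k + j) / 4 ^ Suc i \<or> snd y = real (4 * Suc k - j) / 4 ^ Suc i"
        using tv(2) d *(3) by (auto simp: of_nat_diff add_divide_distrib diff_divide_distrib)
      then show ?thesis using y(3) unfolding gverts_def by blast
    qed
  next
    fix y assume y: "y \<in> gverts S i (Suc i)"
    then have yg: "y \<in> gpts S i" by (simp add: gverts_def)
    obtain l :: nat where l: "snd y = real l / 4 ^ Suc i" using y by (auto simp: gverts_def)
    obtain k where k: "k < 4 ^ i" "snd y \<in> cell i k" using cell_ex gpts_gp(3,4)[OF yg] by metis
    define b where "b = fst (dec y)"
    have b: "b \<subseteq> S \<inter> {..<i}" "y = gp b (snd y)" using gpts_gp[OF yg] by (auto simp: b_def)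
    have ye: "y \<in> gseg i b k" using b(2) gsegI[OF k(2)] by metis
    define v where "v = gp b (real k / 4 ^ i)"
    have c: "real k / 4 ^ i \<in> cell i k" by (simp add: cell_iff)
    have v: "v \<in> gseg i b k" unfolding v_def by (rule gsegI[OF c])
    then have v': "v \<in> gverts S i i" using gseg_subset[OF b(1) k(1)] unfolding gverts_def v_def by auto
    have "real k * 4 \<le> real l" "real l \<le> real (Suc k) * 4" using k(2) unfolding cell_iff l by simp_all
    then have "real (k * 4) \<le> real l" "real l \<le> real (Suc k * 4)" by simp_all
    then have kl: "4 * k \<le> l" "l - 4 * k \<le> 4" unfolding of_nat_le_iff by auto
    have "dd (dec v) (dec y) = \<bar>real k / 4 ^ i - snd y\<bar>"
      using finite_bits[OF b(1)] b(2) unfolding v_def by (metis dd_path dec_gp)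
    also have "\<dots> = real (l - 4 * k) * (1 / 4 ^ i / real 4)"
      unfolding l using kl(1) by (simp add: of_nat_diff field_simps)
    finally have d: "dd (dec v) (dec y) = real (l - 4 * k) * (1 / 4 ^ i / real 4)" .
    have "gseg i b k \<in> gedges S i i" using b(1) k(1) unfolding gedges_def by blast
    then show "y \<in> gverts S i i \<union> {y. \<exists>e\<in>gedges S i i. \<exists>v\<in>e \<inter> gverts S i i. \<exists>j\<le>4.
                             y \<in> e \<and> dd (dec v) (dec y) = real j * (1 / 4 ^ i / real 4)}"
      using v v' ye d kl(2) by blast
  qed
  finally show ?thesis .
qed

definition pj :: "nat \<Rightarrow> nat \<times> real \<Rightarrow> nat \<times> real" where
  "pj i p = (set_encode (set_decode (fst p) \<inter> {..<i}), snd p)"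

lemma snd_pj [simp]: "snd (pj i p) = snd p" by (simp add: pj_def)

lemma dec_pj: "dec (pj i p) = (fst (dec p) \<inter> {..<i}, snd p)" by (simp add: dec_def pj_def)

lemma pj_gp: "finite b \<Longrightarrow> pj i (gp b t) = gp (b \<inter> {..<i}) t"
  by (rule dec_inj) (auto simp: dec_pj pt_def)

lemma pj_gpts: "p \<in> gpts S (Suc i) \<Longrightarrow> pj i p \<in> gpts S i"
  by (auto simp: gpts_def dec_pj LS_def)

lemma pj_seg: "b \<subseteq> S \<inter> {..<Suc i} \<Longrightarrow> pj i ` gseg n b k = gseg n (b \<inter> {..<i}) k"
  using pj_gp[OF finite_bits] unfolding gseg_def image_image by (intro image_cong) auto

text \<open>A point near the image of \<open>x\<close> is lifted by giving it the bit
  \<open>i\<close> of \<open>x\<close>. This creates no separation at level \<open>i\<close>, so the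
  lift has the same distance from \<open>x\<close>.\<close>

lemma pj_open_map: "open_map (mtopology_of (gm S (Suc i))) (mtopology_of (gm S i)) (pj i)"
  unfolding open_map_def
proof (intro allI impI)
  interpret X: Metric_space "gpts S (Suc i)" "\<lambda>p q. dd (dec p) (dec q)" by (rule Metric_space_gm)
  interpret Y: Metric_space "gpts S i" "\<lambda>p q. dd (dec p) (dec q)" by (rule Metric_space_gm)
  fix U assume "openin (mtopology_of (gm S (Suc i))) U"
  then have U: "U \<subseteq> gpts S (Suc i)" "\<And>x. x \<in> U \<Longrightarrow> \<exists>r>0. X.mball x r \<subseteq> U"
    by (auto simp: gm_def X.openin_mtopology)
  have "\<exists>r>0. Y.mball (pj i x) r \<subseteq> pj i ` U" if x: "x \<in> U" for x
  proof -
    obtain r where r: "r > 0" "X.mball x r \<subseteq> U" using U(2)[OF x] by blast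
    have "Y.mball (pj i x) r \<subseteq> pj i ` U"
    proof
      fix y assume "y \<in> Y.mball (pj i x) r"
      then have y: "y \<in> gpts S i" "dd (dec (pj i x)) (dec y) < r" by auto
      define b where "b = fst (dec y) \<union> (fst (dec x) \<inter> {i})"
      have xg: "x \<in> gpts S (Suc i)" using x U(1) by blast
      have fy: "fst (dec y) \<subseteq> S \<inter> {..<i}" "fst (dec x) \<subseteq> S \<inter> {..<Suc i}" using gpts_gp(2) y(1) xg by blast+
      then have b: "b \<subseteq> S \<inter> {..<Suc i}" by (auto simp: b_def)
      define z where "z = gp b (snd y)"
      have z: "z \<in> gpts S (Suc i)" unfolding z_def by (rule gp_gpts[OF b gpts_gp(3,4)[OF y(1)]])
      have "b \<inter> {..<i} = fst (dec y)" using fy by (auto simp: b_def)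
      then have "pj i z = y" unfolding z_def pj_gp[OF finite_bits[OF b]] using gpts_gp(1)[OF y(1)] by simp
      moreover have "dd (dec x) (dec z) = dd (dec (pj i x)) (dec y)"
      proof -
        have "sep j (dec x) (dec z) \<longleftrightarrow> sep j (dec (pj i x)) (dec y)" for j
          using fy finite_bits[OF b] bandI[of "snd y" j]
          unfolding sep_def z_def dec_pj by (auto simp: b_def mem_fst_pt)
        then show ?thesis unfolding dd_def by (simp add: z_def)
      qed
      ultimately show "y \<in> pj i ` U" using r(2) y(2) z xg by (intro image_eqI[of _ _ z]) auto
    qed
    then show ?thesis using r(1) by blast
  qed
  then show "openin (mtopology_of (gm S i)) (pj i ` U)"
    using U(1) pj_gpts by (auto simp: gm_def Y.openin_mtopology)
qed

lemma pj_verts: "pj i ` gverts S (Suc i) (Suc i) \<subseteq> gverts S i (Suc i)"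
  using pj_gpts by (auto simp: gverts_def)

lemma pj_edges: "e \<in> gedges S (Suc i) (Suc i) \<Longrightarrow> pj i ` e \<in> gedges S i (Suc i)"
  using pj_seg by (fastforce simp: gedges_def)

lemma pj_isometry:
  assumes "e \<in> gedges S (Suc i) (Suc i)" "y \<in> e" "z \<in> e"
  shows "dd (dec (pj i y)) (dec (pj i z)) = dd (dec y) (dec z)"
proof -
  obtain b k where b: "e = gseg (Suc i) b k" "b \<subseteq> S \<inter> {..<Suc i}" using assms(1) by (auto simp: gedges_def)
  have y: "y = gp b (snd y)" "z = gp b (snd z)" using assms(2,3) gsegE(2) unfolding b(1) by blast+
  have fin: "finite b" "finite (b \<inter> {..<i})" using finite_bits[OF b(2)] by auto
  have "dec y = pt b (snd y)" "dec z = pt b (snd z)" using y fin by (metis dec_gp)+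
  moreover have "dec (pj i y) = pt (b \<inter> {..<i}) (snd y)" "dec (pj i z) = pt (b \<inter> {..<i}) (snd z)"
    using y fin pj_gp dec_gp by metis+
  ultimately show ?thesis by simp
qed

text \<open>Two points of a fiber differ at most in the bit \<open>i\<close>, and a detour at this
  level is no longer than the band.\<close>

lemma pj_fiber:
  assumes y: "y \<in> gpts S (Suc i)" and z: "z \<in> gpts S (Suc i)" and e: "pj i y = pj i z"
  shows "dd (dec y) (dec z) \<le> 2 / 4 ^ Suc i"
proof (cases rule: sep_cases[of "dec y" "dec z"])
  case 1
  have "snd y = snd z" using e by (metis snd_pj)
  then show ?thesis using dd_unsep[OF 1] by simp
next
  case (2 j n)
  have s: "snd y = snd z" using e by (metis snd_pj)
  have f: "fst (dec y) \<inter> {..<i} = fst (dec z) \<inter> {..<i}" using arg_cong[OF e, of dec] by (simp add: dec_pj)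
  have "fst (dec y) \<subseteq> {..<Suc i}" "fst (dec z) \<subseteq> {..<Suc i}" using gpts_gp(2) y z by blast+
  moreover have "(j \<in> fst (dec y)) \<noteq> (j \<in> fst (dec z))" using 2(1) by (auto simp: sep_def)
  ultimately have "j = i" using f by (metis (no_types, lifting) IntD1 IntI lessThan_iff less_Suc_eq subsetD)
  have "dd (dec y) (dec z) = detour j n (snd y) (snd y)" using dd_sep[OF 2(1-3)] s by simp
  also have "\<dots> \<le> hi j n - lo j n" by (auto simp: detour_def min_def)
  also have "\<dots> = 2 / 4 ^ Suc i" unfolding \<open>j = i\<close> by (simp add: hi_def lo_def diff_divide_distrib[symmetric])
  finally show ?thesis .
qed

text \<open>At most two cells contain the height of \<open>v\<close>. Over each of them
  \<open>v\<close> prescribes the bits of an edge through \<open>v\<close>, except at the one level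
  of which \<open>v\<close> may be an end. This leaves two times two edges.\<close>

lemma edges_at_vertex:
  assumes v: "v \<in> gverts S i i"
  shows "finite {e \<in> gedges S i i. v \<in> e}" "card {e \<in> gedges S i i. v \<in> e} \<le> 4"
proof -
  have vg: "v \<in> gpts S i" using v by (simp add: gverts_def)
  obtain l :: nat where l: "snd v = real l / 4 ^ i" using v by (auto simp: gverts_def)
  define c where "c = fst (dec v)"
  have c: "c \<subseteq> S \<inter> {..<i}" using gpts_gp(2)[OF vg] by (simp add: c_def)
  \<comment> \<open>For \<open>l = 0\<close> the truncated subtraction gives \<open>l\<close> again,
    which merely repeats an element.\<close>
  let ?B = "{gseg i c k | k. k \<in> {l, l - 1}} \<union> {gseg i (c \<union> ends (snd v) \<inter> S \<inter> {..<i}) k | k. k \<in> {l, l - 1}}"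
  have "{e \<in> gedges S i i. v \<in> e} \<subseteq> ?B"
  proof
    fix e assume "e \<in> {e \<in> gedges S i i. v \<in> e}"
    then obtain b k where b: "e = gseg i b k" "b \<subseteq> S \<inter> {..<i}" "k < 4 ^ i" "v \<in> gseg i b k" by (auto simp: gedges_def)
    have vc: "snd v \<in> cell i k" using gsegE(1)[OF b(4)] .
    then have "real k \<le> real l" "real l \<le> real (Suc k)" unfolding cell_iff l by simp_all
    then have k: "k \<in> {l, l - 1}" unfolding of_nat_le_iff by auto
    have ag: "j \<in> b \<longleftrightarrow> j \<in> c" if "snd v \<in> band j" for j
      using b(4) that unfolding mem_gseg_iff[OF b(2) vg] c_def by blast
    have cb: "snd v \<in> band j" if "j \<in> c" for j using vg that by (auto simp: gpts_def LS_def c_def)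
    show "e \<in> ?B"
    proof (cases "b \<inter> ends (snd v) \<inter> cbits i k = {}")
      case True
      have "b \<inter> cbits i k = c \<inter> cbits i k" using cbits_cell[OF vc] ag cb True by blast
      then have "e = gseg i c k" unfolding b(1) by (rule gseg_eq[OF b(2) c order_refl])
      then show ?thesis using k by blast
    next
      case False
      have "b \<inter> cbits i k = (c \<union> ends (snd v) \<inter> S \<inter> {..<i}) \<inter> cbits i k"
      proof (intro equalityI subsetI)
        fix j assume "j \<in> b \<inter> cbits i k"
        then show "j \<in> (c \<union> ends (snd v) \<inter> S \<inter> {..<i}) \<inter> cbits i k" using cbits_cell[OF vc, of j] ag b(2) by blast
      next
        fix j assume j: "j \<in> (c \<union> ends (snd v) \<inter> S \<inter> {..<i}) \<inter> cbits i k"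
        obtain j' where j': "j' \<in> b" "j' \<in> ends (snd v)" using False by blast
        show "j \<in> b \<inter> cbits i k"
          using ag cb j j'(2) ends_unique j'(1) by fastforce
      qed
      moreover have "c \<union> ends (snd v) \<inter> S \<inter> {..<i} \<subseteq> S \<inter> {..<i}" using c by blast
      ultimately have "e = gseg i (c \<union> ends (snd v) \<inter> S \<inter> {..<i}) k" unfolding b(1) by (intro gseg_eq[OF b(2) _ order_refl]) auto
      then show ?thesis using k by blast
    qed
  qed
  moreover have B: "?B = {gseg i c l, gseg i c (l - 1), gseg i (c \<union> ends (snd v) \<inter> S \<inter> {..<i}) l, gseg i (c \<union> ends (snd v) \<inter> S \<inter> {..<i}) (l - 1)}"
    by auto
  ultimately have sub: "{e \<in> gedges S i i. v \<in> e} \<subseteq> {gseg i c l, gseg i c (l - 1), gseg i (c \<union> ends (snd v) \<inter> S \<inter> {..<i}) l, gseg i (c \<union> ends (snd v) \<inter> S \<inter> {..<i}) (l - 1)}"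
    by simp
  then show "finite {e \<in> gedges S i i. v \<in> e}" by (rule finite_subset) simp
  have "card {e \<in> gedges S i i. v \<in> e} \<le> card {gseg i c l, gseg i c (l - 1), gseg i (c \<union> ends (snd v) \<inter> S \<inter> {..<i}) l, gseg i (c \<union> ends (snd v) \<inter> S \<inter> {..<i}) (l - 1)}"
    by (rule card_mono[OF _ sub]) simp
  also have "\<dots> \<le> 4"
  proof -
    have "card {a, b, c, d} \<le> 4" for a b c d :: "(nat \<times> real) set"
      using card_length[of "[a, b, c, d]"] by simp
    then show ?thesis .
  qed
  finally show "card {e \<in> gedges S i i. v \<in> e} \<le> 4" .
qed

section \<open>The inverse limit\<close>

text \<open>Truncating the bits to the levels below \<open>i\<close> gives the coordinates of a
  point of the inverse limit. \<open>Psi\<close> identifies \<open>LS S\<close> with the inverse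
  limit.\<close>

definition Psi :: "nat set \<times> real \<Rightarrow> nat \<Rightarrow> nat \<times> real" where
  "Psi x = (\<lambda>i. (set_encode (fst x \<inter> {..<i}), snd x))"

lemma dec_Psi: "dec (Psi x i) = (fst x \<inter> {..<i}, snd x)"
  by (simp add: Psi_def dec_def)

lemma snd_Psi [simp]: "snd (Psi x i) = snd x" by (simp add: Psi_def)

lemma Psi_inj: "Psi x = Psi y \<Longrightarrow> x = y"
proof -
  assume e: "Psi x = Psi y"
  then have "dec (Psi x i) = dec (Psi y i)" for i by simp
  then have *: "fst x \<inter> {..<i} = fst y \<inter> {..<i}" "snd x = snd y" for i unfolding dec_Psi by auto
  have "j \<in> fst x \<longleftrightarrow> j \<in> fst y" for j using *(1)[of "Suc j"] by blast
  then show "x = y" using *(2) by (auto simp: prod_eq_iff)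
qed

lemma Psi_pt: "Psi (pt b t) i = gp (b \<inter> {..<i}) t"
  by (rule dec_inj) (auto simp: dec_Psi pt_def)

lemma Psi_gpts: "x \<in> LS S \<Longrightarrow> Psi x i \<in> gpts S i"
  by (auto simp: gpts_def dec_Psi LS_def)

lemma inverse_limit_set_XG: "inverse_limit_set (XG S) pj = Psi ` LS S"
proof (intro equalityI subsetI)
  fix x assume "x \<in> inverse_limit_set (XG S) pj"
  then have x: "\<And>i. x i \<in> gpts S i" "\<And>i. pj i (x (Suc i)) = x i" by (auto simp: inverse_limit_set_def)
  define t where "t = snd (x 0)"
  define c where "c = (\<Union>i. fst (dec (x i)))"
  have t: "snd (x i) = t" for i
  proof (induction i)
    case (Suc i)
    then show ?case using arg_cong[OF x(2)[of i], of snd] by simp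
  qed (simp add: t_def)
  have d: "fst (dec (x i)) = fst (dec (x (i + n))) \<inter> {..<i}" for i n
  proof (induction n)
    case 0
    then show ?case using gpts_gp(2)[OF x(1)[of i]] by auto
  next
    case (Suc n)
    have "fst (dec (x (i + n))) = fst (dec (x (Suc (i + n)))) \<inter> {..<i + n}"
      using arg_cong[OF x(2)[of "i + n"], of dec] by (metis dec_pj fst_conv)
    moreover have "{..<i + n} \<inter> {..<i} = {..<i}" by auto
    ultimately show ?case using Suc by (simp add: Int_assoc)
  qed
  have ci: "fst (dec (x i)) = c \<inter> {..<i}" for i
  proof
    show "fst (dec (x i)) \<subseteq> c \<inter> {..<i}" using gpts_gp(2)[OF x(1)[of i]] by (auto simp: c_def)
    show "c \<inter> {..<i} \<subseteq> fst (dec (x i))"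
    proof
      fix j assume "j \<in> c \<inter> {..<i}"
      then obtain i' where i': "j \<in> fst (dec (x i'))" "j < i" by (auto simp: c_def)
      show "j \<in> fst (dec (x i))"
      proof (cases "i \<le> i'")
        case True
        then show ?thesis using d[of i "i' - i"] i' by simp
      next
        case False
        then show ?thesis using d[of i' "i - i'"] i' by auto
      qed
    qed
  qed
  have "x = Psi (c, t)"
  proof
    fix i
    show "x i = Psi (c, t) i" by (rule dec_inj) (use ci[of i] t[of i] in \<open>auto simp: dec_Psi prod_eq_iff\<close>)
  qed
  moreover have "(c, t) \<in> LS S"
  proof -
    have L: "dec (x i) \<in> LS (S \<inter> {..<i})" for i using x(1) by (simp add: gpts_def)
    have "j \<in> S \<and> t \<in> band j" if "j \<in> c" for j
    proof -
      have "j \<in> fst (dec (x (Suc j)))" using ci[of "Suc j"] that by simp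
      then show ?thesis using L[of "Suc j"] t[of "Suc j"] by (auto simp: LS_def)
    qed
    moreover have "0 \<le> t" "t \<le> 1" using L[of 0] t[of 0] by (auto simp: LS_def)
    ultimately show ?thesis by (auto simp: LS_def)
  qed
  ultimately show "x \<in> Psi ` LS S" by blast
next
  fix x assume "x \<in> Psi ` LS S"
  then obtain y where y: "x = Psi y" "y \<in> LS S" by blast
  have "pj i (Psi y (Suc i)) = Psi y i" for i
    by (rule dec_inj) (auto simp: dec_pj dec_Psi)
  then show "x \<in> inverse_limit_set (XG S) pj"
    using y Psi_gpts by (simp add: inverse_limit_set_def)
qed

lemma dd_trunc_le: "dd (fst x \<inter> {..<i}, snd x) (fst y \<inter> {..<i}, snd y) \<le> dd x y"
proof (cases rule: sep_cases[of "(fst x \<inter> {..<i}, snd x)" "(fst y \<inter> {..<i}, snd y)"])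
  case 1
  then show ?thesis using dd_unsep[OF 1] dd_ge_abs[of x y] by simp
next
  case (2 j n)
  then have "sep j x y" by (auto simp: sep_def)
  then show ?thesis using dd_sep[OF 2(1-3)] dd_ge_detour[of j x y n] 2(3) by simp
qed

text \<open>Once \<open>i\<close> exceeds the level of the coarsest separation, truncation no longer
  changes the distance. The limit in the definition of the inverse limit metric is that of an
  eventually constant sequence.\<close>

lemma dd_trunc_limit: "eventually (\<lambda>i. dd (fst x \<inter> {..<i}, snd x) (fst y \<inter> {..<i}, snd y) = dd x y) sequentially"
proof (cases rule: sep_cases[of x y])
  case 1
  have "\<not> sep j (fst x \<inter> {..<i}, snd x) (fst y \<inter> {..<i}, snd y)" for i j using 1[of j] by (auto simp: sep_def)
  then show ?thesis using dd_unsep[OF 1] by (simp add: dd_unsep)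
next
  case (2 j n)
  show ?thesis
    using eventually_gt_at_top[of j]
  proof eventually_elim
    case (elim i)
    have "sep j (fst x \<inter> {..<i}, snd x) (fst y \<inter> {..<i}, snd y)" using 2(1) elim by (auto simp: sep_def)
    moreover have "\<not> sep k (fst x \<inter> {..<i}, snd x) (fst y \<inter> {..<i}, snd y)" if "k < j" for k
      using 2(2)[OF that] by (auto simp: sep_def)
    ultimately show ?case using dd_sep[OF 2(1-3)] dd_sep[of j _ _ n] 2(3) by simp
  qed
qed

definition minf :: "nat set \<Rightarrow> (nat \<Rightarrow> nat \<times> real) metric" where
  "minf S = inverse_limit_metric (XG S) pj"

lemma inverse_limit_dist:
  assumes "x \<in> LS S" "y \<in> LS S"
  shows "(if Psi x \<in> inverse_limit_set (XG S) pj \<and> Psi y \<in> inverse_limit_set (XG S) pj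
     then lim (\<lambda>i. mdist (gmetric (XG S i)) (Psi x i) (Psi y i)) else 0) = dd x y"
  using tendsto_eventually[OF dd_trunc_limit] assms by (simp add: dec_Psi inverse_limit_set_XG limI)

lemma Metric_space_minf:
  "Metric_space (inverse_limit_set (XG S) pj) (\<lambda>x y. if x \<in> inverse_limit_set (XG S) pj \<and> y \<in> inverse_limit_set (XG S) pj
     then lim (\<lambda>i. mdist (gmetric (XG S i)) (x i) (y i)) else 0)"
    (is "Metric_space ?M ?d")
proof -
  interpret L: Metric_space "LS S" dd by (rule Metric_space_LS)
  have d: "?d (Psi x) (Psi y) = dd x y" if "x \<in> LS S" "y \<in> LS S" for x y
    using inverse_limit_dist[OF that] .
  have M: "\<exists>a\<in>LS S. x = Psi a" if "x \<in> ?M" for x using that unfolding inverse_limit_set_XG by blast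
  show ?thesis
  proof
    fix x y
    show "0 \<le> ?d x y"
    proof (cases "x \<in> ?M \<and> y \<in> ?M")
      case True
      then obtain a b where "a \<in> LS S" "b \<in> LS S" "x = Psi a" "y = Psi b" using M by blast
      then show ?thesis using d[of a b] dd_nonneg[of a b] by (simp only:)
    qed auto
    show "?d x y = ?d y x"
      using M d dd_sym by simp
  next
    fix x y assume "x \<in> ?M" "y \<in> ?M"
    then obtain a b where a: "a \<in> LS S" "b \<in> LS S" "x = Psi a" "y = Psi b" using M by blast
    show "?d x y = 0 \<longleftrightarrow> x = y" unfolding a(3,4) d[OF a(1,2)] using L.zero[OF a(1,2)] Psi_inj by blast
  next
    fix x y z assume "x \<in> ?M" "y \<in> ?M" "z \<in> ?M"
    then obtain a b c where a: "a \<in> LS S" "b \<in> LS S" "c \<in> LS S" "x = Psi a" "y = Psi b" "z = Psi c" using M by meson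
    show "?d x z \<le> ?d x y + ?d y z" unfolding a(4-6) d[OF a(1,2)] d[OF a(1,3)] d[OF a(2,3)] by (rule dd_triangle)
  qed
qed

lemma mspace_minf: "mspace (minf S) = Psi ` LS S"
  unfolding minf_def inverse_limit_metric_def Metric_space.mspace_metric[OF Metric_space_minf] by (rule inverse_limit_set_XG)

lemma mdist_minf: "x \<in> LS S \<Longrightarrow> y \<in> LS S \<Longrightarrow> mdist (minf S) (Psi x) (Psi y) = dd x y"
  unfolding minf_def inverse_limit_metric_def Metric_space.mdist_metric[OF Metric_space_minf] by (rule inverse_limit_dist)

lemma openin_metric: "openin (mtopology_of m) U \<longleftrightarrow> U \<subseteq> mspace m \<and>
    (\<forall>x\<in>U. \<exists>r>0. \<forall>y\<in>mspace m. mdist m x y < r \<longrightarrow> y \<in> U)"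
proof -
  interpret M: Metric_space "mspace m" "mdist m" by (rule Metric_space_mspace_mdist)
  have "M.mball x r \<subseteq> U \<longleftrightarrow> (\<forall>y\<in>mspace m. mdist m x y < r \<longrightarrow> y \<in> U)" if "x \<in> mspace m" for x r
    using that by auto
  then show ?thesis unfolding mtopology_of_def M.openin_mtopology by (meson subsetD)
qed

section \<open>Parametrization of the limit space, continuity and measurability\<close>

text \<open>\<open>Phi S\<close> parametrizes the limit space by the compact product of a Cantor set and an interval; the
  clamped height makes it total and continuous.\<close>

definition cl01 :: "real \<Rightarrow> real" where "cl01 t = max 0 (min 1 t)"

lemma cl01: "0 \<le> cl01 t" "cl01 t \<le> 1" "0 \<le> t \<Longrightarrow> t \<le> 1 \<Longrightarrow> cl01 t = t" "\<bar>cl01 s - cl01 t\<bar> \<le> \<bar>s - t\<bar>"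
  by (auto simp: cl01_def)

definition bits :: "nat set \<Rightarrow> (nat \<Rightarrow> bool) \<Rightarrow> nat set" where "bits S \<beta> = {j \<in> S. \<beta> j}"

lemma bits_subset: "bits S \<beta> \<subseteq> S" by (auto simp: bits_def)

definition Phi :: "nat set \<Rightarrow> (nat \<Rightarrow> bool) \<times> real \<Rightarrow> nat set \<times> real" where
  "Phi S \<omega> = pt (bits S (fst \<omega>)) (cl01 (snd \<omega>))"

lemma Phi_LS: "Phi S \<omega> \<in> LS S"
  unfolding Phi_def by (rule LS_pt[OF bits_subset cl01(1,2)])

lemma dd_agree:
  assumes "\<And>j. j < n \<Longrightarrow> j \<in> b \<longleftrightarrow> j \<in> b'"
  shows "dd (pt b t) (pt b' t) \<le> 2 / 4 ^ n"
proof (cases rule: sep_cases[of "pt b t" "pt b' t"])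
  case 1
  then show ?thesis using dd_unsep[OF 1] by simp
next
  case (2 j m)
  have "n \<le> j" using 2(1) assms by (metis mem_fst_pt not_le sep_def snd_pt)
  have "dd (pt b t) (pt b' t) = detour j m t t" using dd_sep[OF 2(1-3)] by simp
  also have "\<dots> \<le> hi j m - lo j m" by (auto simp: detour_def min_def)
  also have "\<dots> = 2 / 4 ^ Suc j" by (simp add: hi_def lo_def diff_divide_distrib[symmetric])
  also have "\<dots> \<le> 2 / 4 ^ n" using \<open>n \<le> j\<close> by (intro divide_left_mono power_increasing) auto
  finally show ?thesis .
qed

lemma dd_Phi_close:
  assumes "\<And>j. j < n \<Longrightarrow> fst \<omega> j = fst \<omega>' j"
  shows "dd (Phi S \<omega>) (Phi S \<omega>') \<le> \<bar>snd \<omega> - snd \<omega>'\<bar> + 2 / 4 ^ n"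
proof -
  have "dd (Phi S \<omega>) (Phi S \<omega>') \<le> dd (pt (bits S (fst \<omega>)) (cl01 (snd \<omega>))) (pt (bits S (fst \<omega>)) (cl01 (snd \<omega>')))
      + dd (pt (bits S (fst \<omega>)) (cl01 (snd \<omega>'))) (pt (bits S (fst \<omega>')) (cl01 (snd \<omega>')))"
    unfolding Phi_def by (rule dd_triangle)
  also have "\<dots> \<le> \<bar>snd \<omega> - snd \<omega>'\<bar> + 2 / 4 ^ n"
    using cl01(4) assms by (intro add_mono dd_agree) (auto simp: bits_def)
  finally show ?thesis .
qed

text \<open>With it the Borel sets of the Cantor set times the line are the product sigma algebra,
  so that open sets and measurable rectangles can be used side by side.\<close>

instance bool :: second_countable_topology
proof
  have "open = generate_topology (UNIV :: bool set set)"
    by (auto simp: discrete_topology_class.open_discrete generate_topology.Basis)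
  then show "\<exists>B::bool set set. countable B \<and> open = generate_topology B"
    by (intro exI[of _ UNIV]) (auto intro: countable_finite)
qed

lemma open_Phi_preimage:
  assumes U: "\<And>x. x \<in> U \<Longrightarrow> \<exists>r>0. \<forall>y\<in>LS S. dd x y < r \<longrightarrow> y \<in> U"
  shows "open (Phi S -` U)"
proof (subst open_subopen, intro ballI)
  fix \<omega> assume "\<omega> \<in> Phi S -` U"
  then obtain r where r: "r > 0" "\<And>y. y \<in> LS S \<Longrightarrow> dd (Phi S \<omega>) y < r \<Longrightarrow> y \<in> U" using U[of "Phi S \<omega>"] by auto
  have "(\<lambda>n. 2 / 4 ^ n :: real) \<longlonglongrightarrow> 0" by (rule LIMSEQ_divide_realpow_zero) auto
  then have "eventually (\<lambda>n. 2 / 4 ^ n < r / 2) sequentially" using r(1) by (intro order_tendstoD) auto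
  then obtain n where n: "2 / 4 ^ n < r / 2" by (auto simp: eventually_sequentially)
  define W where "W = (\<Inter>j<n. (\<lambda>\<beta>. \<beta> j) -` {fst \<omega> j}) \<times> {snd \<omega> - r / 2<..<snd \<omega> + r / 2}"
  have "open ((\<lambda>\<beta>::nat \<Rightarrow> bool. \<beta> j) -` {fst \<omega> j})" for j
    by (rule open_vimage[OF discrete_topology_class.open_discrete]) (rule continuous_on_product_coordinates)
  then have "open W" unfolding W_def by (intro open_Times open_INT) auto
  moreover have "\<omega> \<in> W" using r(1) by (auto simp: W_def mem_Times_iff)
  moreover have "W \<subseteq> Phi S -` U"
  proof
    fix \<omega>' assume w: "\<omega>' \<in> W"
    have "dd (Phi S \<omega>) (Phi S \<omega>') \<le> \<bar>snd \<omega> - snd \<omega>'\<bar> + 2 / 4 ^ n"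
      by (rule dd_Phi_close) (use w in \<open>auto simp: W_def mem_Times_iff\<close>)
    moreover have "\<bar>snd \<omega> - snd \<omega>'\<bar> < r / 2" using w by (auto simp: W_def mem_Times_iff abs_if)
    ultimately show "\<omega>' \<in> Phi S -` U" using r(2)[OF Phi_LS] n by simp
  qed
  ultimately show "\<exists>T. open T \<and> \<omega> \<in> T \<and> T \<subseteq> Phi S -` U" by blast
qed

lemma continuous_map_Phi: "continuous_map euclidean (mtopology_of (minf S)) (\<lambda>\<omega>. Psi (Phi S \<omega>))"
  unfolding continuous_map_def
proof (intro conjI allI impI)
  show "(\<lambda>\<omega>. Psi (Phi S \<omega>)) \<in> topspace euclidean \<rightarrow> topspace (mtopology_of (minf S))"
    using Phi_LS by (auto simp: mspace_minf)
  fix U assume "openin (mtopology_of (minf S)) U"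
  then have U: "\<And>x. x \<in> U \<Longrightarrow> \<exists>r>0. \<forall>y\<in>mspace (minf S). mdist (minf S) x y < r \<longrightarrow> y \<in> U" "U \<subseteq> mspace (minf S)"
    unfolding openin_metric by auto
  have "open (Phi S -` {x \<in> LS S. Psi x \<in> U})"
  proof (rule open_Phi_preimage)
    fix x assume x: "x \<in> {x \<in> LS S. Psi x \<in> U}"
    then obtain r where r: "r > 0" "\<forall>y\<in>mspace (minf S). mdist (minf S) (Psi x) y < r \<longrightarrow> y \<in> U" using U(1) by blast
    have "y \<in> {x \<in> LS S. Psi x \<in> U}" if "y \<in> LS S" "dd x y < r" for y
      using r(2) that x mdist_minf[of x S y] mspace_minf by auto
    then show "\<exists>r>0. \<forall>y\<in>LS S. dd x y < r \<longrightarrow> y \<in> {x \<in> LS S. Psi x \<in> U}" using r(1) by blast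
  qed
  moreover have "Phi S -` {x \<in> LS S. Psi x \<in> U} = {\<omega> \<in> topspace euclidean. Psi (Phi S \<omega>) \<in> U}" using Phi_LS by auto
  ultimately show "openin euclidean {\<omega> \<in> topspace euclidean. Psi (Phi S \<omega>) \<in> U}" by simp
qed

lemma continuous_map_proj: "continuous_map (mtopology_of (minf S)) (mtopology_of (gm S i)) (\<lambda>x. x i)"
  unfolding continuous_map_def
proof (intro conjI allI impI)
  show "(\<lambda>x. x i) \<in> topspace (mtopology_of (minf S)) \<rightarrow> topspace (mtopology_of (gm S i))"
    using Psi_gpts by (auto simp: mspace_minf)
  fix U assume "openin (mtopology_of (gm S i)) U"
  then have U: "\<And>p. p \<in> U \<Longrightarrow> \<exists>r>0. \<forall>q\<in>gpts S i. dd (dec p) (dec q) < r \<longrightarrow> q \<in> U" unfolding openin_metric by auto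
  show "openin (mtopology_of (minf S)) {x \<in> topspace (mtopology_of (minf S)). x i \<in> U}"
    unfolding openin_metric topspace_mtopology_of
  proof (intro conjI ballI)
    fix x assume x: "x \<in> {x \<in> mspace (minf S). x i \<in> U}"
    then obtain a where a: "a \<in> LS S" "x = Psi a" by (auto simp: mspace_minf)
    obtain r where r: "r > 0" "\<And>q. q \<in> gpts S i \<Longrightarrow> dd (dec (x i)) (dec q) < r \<Longrightarrow> q \<in> U" using U x by blast
    have "y \<in> {x \<in> mspace (minf S). x i \<in> U}" if y: "y \<in> mspace (minf S)" "mdist (minf S) x y < r" for y
    proof -
      obtain b where b: "b \<in> LS S" "y = Psi b" using y by (auto simp: mspace_minf)
      have "dd (dec (x i)) (dec (y i)) \<le> dd a b" unfolding a(2) b(2) dec_Psi by (rule dd_trunc_le)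
      then have "dd (dec (x i)) (dec (y i)) < r" using y(2) mdist_minf[OF a(1) b(1)] a(2) b(2) by simp
      then show ?thesis using r(2)[of "y i"] Psi_gpts[OF b(1)] b(2) y(1) by simp
    qed
    then show "\<exists>r>0. \<forall>y\<in>mspace (minf S). mdist (minf S) x y < r \<longrightarrow> y \<in> {x \<in> mspace (minf S). x i \<in> U}" using r(1) by blast
  qed auto
qed

lemma measurable_borel_of_metric:
  assumes "continuous_map (mtopology_of m) (mtopology_of m') f"
  shows "f \<in> borel_of_metric m \<rightarrow>\<^sub>M borel_of_metric m'"
  unfolding borel_of_metric_def
proof (rule measurable_sigma_sets[of _ "mspace m'" "{U. openin (mtopology_of m') U}"])
  show s: "sets (sigma (mspace m') {U. openin (mtopology_of m') U}) = sigma_sets (mspace m') {U. openin (mtopology_of m') U}"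
    by (intro sets_measure_of) (auto simp: openin_metric)
  show "{U. openin (mtopology_of m') U} \<subseteq> Pow (mspace m')" by (auto simp: openin_metric)
  show "f \<in> space (sigma (mspace m) {U. openin (mtopology_of m) U}) \<rightarrow> mspace m'"
    using assms unfolding continuous_map_def by (simp add: space_measure_of_conv Pi_iff)
  fix U assume "U \<in> {U. openin (mtopology_of m') U}"
  then have "openin (mtopology_of m) {x \<in> mspace m. f x \<in> U}" using assms unfolding continuous_map_def by simp
  moreover have "f -` U \<inter> space (sigma (mspace m) {U. openin (mtopology_of m) U}) = {x \<in> mspace m. f x \<in> U}"
    by (auto simp: space_measure_of_conv)
  ultimately show "f -` U \<inter> space (sigma (mspace m) {U. openin (mtopology_of m) U}) \<in> sets (sigma (mspace m) {U. openin (mtopology_of m) U})"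
    by (auto simp: openin_metric intro!: in_measure_of)
qed

lemma measurable_borel_to_metric:
  assumes "continuous_map euclidean (mtopology_of m') f"
  shows "f \<in> borel \<rightarrow>\<^sub>M borel_of_metric m'"
  unfolding borel_of_metric_def
proof (rule measurable_sigma_sets[of _ "mspace m'" "{U. openin (mtopology_of m') U}"])
  show s: "sets (sigma (mspace m') {U. openin (mtopology_of m') U}) = sigma_sets (mspace m') {U. openin (mtopology_of m') U}"
    by (intro sets_measure_of) (auto simp: openin_metric)
  show "{U. openin (mtopology_of m') U} \<subseteq> Pow (mspace m')" by (auto simp: openin_metric)
  show "f \<in> space borel \<rightarrow> mspace m'"
    using assms unfolding continuous_map_def by (simp add: Pi_iff)
  fix U assume "U \<in> {U. openin (mtopology_of m') U}"
  then have "open {x. f x \<in> U}" using assms unfolding continuous_map_def by simp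
  then show "f -` U \<inter> space borel \<in> sets borel" by (simp add: vimage_def)
qed

section \<open>The measures\<close>

definition coins :: "(nat \<Rightarrow> bool) measure" where
  "coins = PiM UNIV (\<lambda>_. measure_pmf (bernoulli_pmf (1 / 2)))"

definition U01 :: "real measure" where "U01 = uniform_measure lborel {0..1}"

definition Om :: "((nat \<Rightarrow> bool) \<times> real) measure" where "Om = coins \<Otimes>\<^sub>M U01"

lemma prob_space_coins: "prob_space coins"
  unfolding coins_def by (intro prob_space_PiM prob_space_measure_pmf)

lemma prob_space_U01: "prob_space U01"
  unfolding U01_def by (intro prob_space_uniform_measure) auto

lemma sets_U01 [simp]: "sets U01 = sets borel" and space_U01 [simp]: "space U01 = UNIV"
  by (auto simp: U01_def)

lemma sets_coins: "sets coins = sets borel"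
proof -
  have "sets (borel :: bool measure) = UNIV"
    using discrete_topology_class.open_discrete[where 'a = bool] by (auto intro: borel_open)
  then have "sets coins = sets (PiM UNIV (\<lambda>_::nat. borel :: bool measure))"
    unfolding coins_def by (intro sets_PiM_cong) auto
  then show ?thesis by (simp add: sets_PiM_equal_borel)
qed

lemma space_coins [simp]: "space coins = UNIV"
  using sets_eq_imp_space_eq[OF sets_coins] by simp

lemma sets_Om: "sets Om = sets borel"
proof -
  have "sets Om = sets (borel \<Otimes>\<^sub>M borel :: ((nat \<Rightarrow> bool) \<times> real) measure)"
    unfolding Om_def by (intro sets_pair_measure_cong sets_coins) simp
  then show ?thesis by (metis borel_prod)
qed

lemma space_Om [simp]: "space Om = UNIV"
  using sets_eq_imp_space_eq[OF sets_Om] by simp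

lemma prob_space_Om: "prob_space Om"
  unfolding Om_def by (intro prob_space_pair prob_space_coins prob_space_U01)

lemma emeasure_U01: "A \<in> sets borel \<Longrightarrow> emeasure U01 A = emeasure lborel ({0..1} \<inter> A)"
  unfolding U01_def by (subst emeasure_uniform_measure) (auto simp: divide_ennreal_def)

lemma emeasure_coins:
  assumes "finite R"
  shows "emeasure coins {\<beta>. \<forall>j\<in>R. \<beta> j = c j} = ennreal ((1 / 2) ^ card R)"
proof -
  interpret product_prob_space "\<lambda>_::nat. measure_pmf (bernoulli_pmf (1 / 2))" UNIV
    by unfold_locales
  have "emeasure coins {\<beta>. \<forall>j\<in>R. \<beta> j = c j} = (\<Prod>j\<in>R. emeasure (measure_pmf (bernoulli_pmf (1 / 2))) {c j})"
    using emeasure_PiM_Collect[of R "\<lambda>j. {c j}"] assms by (simp add: coins_def[symmetric])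
  also have "\<dots> = (\<Prod>j\<in>R. ennreal (1 / 2))"
    using prod.cong refl by (simp add: emeasure_pmf_single)
  also have "\<dots> = ennreal ((1 / 2) ^ card R)" unfolding prod_constant by (rule ennreal_power) simp
  finally show ?thesis .
qed

lemma sets_borel_of_metric: "sets (borel_of_metric m) = sigma_sets (mspace m) {U. openin (mtopology_of m) U}"
  unfolding borel_of_metric_def by (intro sets_measure_of) (auto simp: openin_metric)

lemma space_borel_of_metric [simp]: "space (borel_of_metric m) = mspace m"
  by (simp add: borel_of_metric_def space_measure_of_conv)

lemma closedin_sets: "closedin (mtopology_of m) A \<Longrightarrow> A \<in> sets (borel_of_metric m)"
proof -
  assume A: "closedin (mtopology_of m) A"
  then have "mspace m - A \<in> sets (borel_of_metric m)"
    unfolding closedin_def sets_borel_of_metric by (intro sigma_sets.Basic) auto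
  then have "mspace m - (mspace m - A) \<in> sets (borel_of_metric m)"
    using sets.compl_sets[of "mspace m - A" "borel_of_metric m"] by simp
  moreover have "A \<subseteq> mspace m" using A closedin_subset by fastforce
  ultimately show ?thesis by (simp add: double_diff)
qed

lemma compactin_sets: "compactin (mtopology_of m) A \<Longrightarrow> A \<in> sets (borel_of_metric m)"
  using Metric_space.Hausdorff_space_mtopology[OF Metric_space_mspace_mdist[of m]]
  by (intro closedin_sets compactin_imp_closedin) (auto simp: mtopology_of_def)

text \<open>All measures are images of one measure under compatible maps, so the conditions on
  pushforwards reduce to composition of maps.\<close>

definition mui :: "nat set \<Rightarrow> nat \<Rightarrow> (nat \<times> real) measure" where
  "mui S i = distr Om (borel_of_metric (gm S i)) (\<lambda>\<omega>. Psi (Phi S \<omega>) i)"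

definition muinf :: "nat set \<Rightarrow> (nat \<Rightarrow> nat \<times> real) measure" where
  "muinf S = distr Om (borel_of_metric (minf S)) (\<lambda>\<omega>. Psi (Phi S \<omega>))"

lemma measurable_Phi: "(\<lambda>\<omega>. Psi (Phi S \<omega>)) \<in> Om \<rightarrow>\<^sub>M borel_of_metric (minf S)"
  using measurable_borel_to_metric[OF continuous_map_Phi] measurable_cong_sets[OF sets_Om refl] by blast

lemma measurable_proj: "(\<lambda>x. x i) \<in> borel_of_metric (minf S) \<rightarrow>\<^sub>M borel_of_metric (gm S i)"
  by (rule measurable_borel_of_metric[OF continuous_map_proj])

lemma measurable_Phi_proj: "(\<lambda>\<omega>. Psi (Phi S \<omega>) i) \<in> Om \<rightarrow>\<^sub>M borel_of_metric (gm S i)"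
  by (rule measurable_compose[OF measurable_Phi measurable_proj])

lemma sets_mui [simp]: "sets (mui S i) = sets (borel_of_metric (gm S i))" by (simp add: mui_def)
lemma sets_muinf [simp]: "sets (muinf S) = sets (borel_of_metric (minf S))" by (simp add: muinf_def)
lemma space_mui [simp]: "space (mui S i) = gpts S i" by (simp add: mui_def)

lemma prob_space_muinf: "prob_space (muinf S)"
  unfolding muinf_def by (rule prob_space.prob_space_distr[OF prob_space_Om measurable_Phi])

lemma distr_muinf: "distr (muinf S) (mui S i) (\<lambda>x. x i) = mui S i"
proof -
  have "distr (muinf S) (mui S i) (\<lambda>x. x i) = distr (muinf S) (borel_of_metric (gm S i)) (\<lambda>x. x i)"
    by (intro distr_cong) auto
  also have "\<dots> = mui S i"
    unfolding muinf_def mui_def by (subst distr_distr[OF measurable_proj measurable_Phi]) (simp add: comp_def)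
  finally show ?thesis .
qed

lemma continuous_map_pj: "continuous_map (mtopology_of (gm S (Suc i))) (mtopology_of (gm S i)) (pj i)"
  unfolding continuous_map_def
proof (intro conjI allI impI)
  show "pj i \<in> topspace (mtopology_of (gm S (Suc i))) \<rightarrow> topspace (mtopology_of (gm S i))"
    using pj_gpts by auto
  fix U assume "openin (mtopology_of (gm S i)) U"
  then have U: "\<And>p. p \<in> U \<Longrightarrow> \<exists>r>0. \<forall>q\<in>gpts S i. dd (dec p) (dec q) < r \<longrightarrow> q \<in> U" unfolding openin_metric by auto
  show "openin (mtopology_of (gm S (Suc i))) {x \<in> topspace (mtopology_of (gm S (Suc i))). pj i x \<in> U}"
    unfolding openin_metric topspace_mtopology_of mspace_gm mdist_gm
  proof (intro conjI ballI)
    fix x assume x: "x \<in> {x \<in> gpts S (Suc i). pj i x \<in> U}"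
    obtain r where r: "r > 0" "\<And>q. q \<in> gpts S i \<Longrightarrow> dd (dec (pj i x)) (dec q) < r \<Longrightarrow> q \<in> U" using U x by blast
    have "y \<in> {x \<in> gpts S (Suc i). pj i x \<in> U}" if y: "y \<in> gpts S (Suc i)" "dd (dec x) (dec y) < r" for y
      using r(2)[OF pj_gpts[OF y(1)]] y dd_trunc_le[of "dec x" i "dec y"] unfolding dec_pj by simp
    then show "\<exists>r>0. \<forall>y\<in>gpts S (Suc i). dd (dec x) (dec y) < r \<longrightarrow> y \<in> {x \<in> gpts S (Suc i). pj i x \<in> U}" using r(1) by blast
  qed auto
qed

lemma measurable_pj: "pj i \<in> borel_of_metric (gm S (Suc i)) \<rightarrow>\<^sub>M borel_of_metric (gm S i)"
  by (rule measurable_borel_of_metric[OF continuous_map_pj])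

lemma pj_Psi: "pj i (Psi x (Suc i)) = Psi x i"
  by (rule dec_inj) (auto simp: dec_pj dec_Psi)

lemma distr_mui: "distr (mui S (Suc i)) (mui S i) (pj i) = mui S i"
proof -
  have "distr (mui S (Suc i)) (mui S i) (pj i) = distr (mui S (Suc i)) (borel_of_metric (gm S i)) (pj i)"
    by (intro distr_cong) auto
  also have "\<dots> = mui S i"
    unfolding mui_def by (subst distr_distr[OF measurable_pj measurable_Phi_proj]) (simp add: comp_def pj_Psi)
  finally show ?thesis .
qed

lemma Psi_Phi: "Psi (Phi S (\<beta>, t)) i = gp (bits S \<beta> \<inter> {..<i}) (cl01 t)"
  by (simp add: Phi_def Psi_pt)

lemma continuous_map_path:
  assumes b: "b \<subseteq> S \<inter> {..<i}"
  shows "continuous_map euclidean (mtopology_of (gm S i)) (\<lambda>t. gp b (cl01 t))"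
  unfolding continuous_map_def
proof (intro conjI allI impI)
  show "(\<lambda>t. gp b (cl01 t)) \<in> topspace euclidean \<rightarrow> topspace (mtopology_of (gm S i))"
    using gp_gpts[OF b cl01(1,2)] by auto
  fix U assume "openin (mtopology_of (gm S i)) U"
  then have U: "\<And>p. p \<in> U \<Longrightarrow> \<exists>r>0. \<forall>q\<in>gpts S i. dd (dec p) (dec q) < r \<longrightarrow> q \<in> U" unfolding openin_metric by auto
  have "open {t. gp b (cl01 t) \<in> U}"
    unfolding open_dist
  proof (intro ballI)
    fix t assume "t \<in> {t. gp b (cl01 t) \<in> U}"
    then obtain r where r: "r > 0" "\<And>q. q \<in> gpts S i \<Longrightarrow> dd (dec (gp b (cl01 t))) (dec q) < r \<Longrightarrow> q \<in> U" using U by blast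
    have "s \<in> {t. gp b (cl01 t) \<in> U}" if "dist s t < r" for s
      using r(2)[OF gp_gpts[OF b cl01(1,2)], of s] that cl01(4)[of t s] finite_bits[OF b] by (simp add: dist_real_def abs_minus_commute)
    then show "\<exists>e>0. \<forall>y. dist y t < e \<longrightarrow> y \<in> {t. gp b (cl01 t) \<in> U}" using r(1) by blast
  qed
  then show "openin euclidean {x \<in> topspace euclidean. gp b (cl01 x) \<in> U}" by simp
qed

lemma compact_cell: "compact (cell n k)" by (simp add: cell_def)

lemma gseg_sets:
  assumes b: "b \<subseteq> S \<inter> {..<i}" and k: "k < 4 ^ n"
  shows "gseg n b k \<in> sets (borel_of_metric (gm S i))"
proof -
  have "gseg n b k = (\<lambda>t. gp b (cl01 t)) ` cell n k"
    unfolding gseg_def using cell_01[OF k] cl01(3) by (intro image_cong) auto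
  moreover have "compactin (mtopology_of (gm S i)) ((\<lambda>t. gp b (cl01 t)) ` cell n k)"
    by (rule image_compactin[OF _ continuous_map_path[OF b]]) (simp add: compact_cell)
  ultimately show ?thesis using compactin_sets by simp
qed

lemma emeasure_lborel_shift:
  assumes "X \<in> sets borel"
  shows "emeasure lborel {s. c + s \<in> X} = emeasure lborel (X :: real set)"
proof -
  have "emeasure lborel X = emeasure (distr lborel borel ((+) c)) X" by (simp add: lborel_distr_plus)
  also have "\<dots> = emeasure lborel {s. c + s \<in> X}" using assms by (subst emeasure_distr) (auto simp: vimage_def)
  finally show ?thesis by simp
qed

lemma coins_cylinder_sets:
  assumes "finite R"
  shows "{\<beta>. \<forall>j\<in>R. \<beta> j = c j} \<in> sets coins"
  using closed_vimage continuous_on_product_coordinates discrete_topology_class.open_discrete borel_closed by (simp add: closed_def sets_coins)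

lemma emeasure_Om_rectangle:
  assumes "finite R" "X \<in> sets borel"
  shows "{\<beta>. \<forall>j\<in>R. \<beta> j = c j} \<times> X \<in> sets Om"
    and "emeasure Om ({\<beta>. \<forall>j\<in>R. \<beta> j = c j} \<times> X) = ennreal ((1 / 2) ^ card R) * emeasure lborel ({0..1} \<inter> X)"
proof -
  interpret U: prob_space U01 by (rule prob_space_U01)
  show "{\<beta>. \<forall>j\<in>R. \<beta> j = c j} \<times> X \<in> sets Om"
    unfolding Om_def using coins_cylinder_sets[OF assms(1)] assms(2) by (intro pair_measureI) auto
  show "emeasure Om ({\<beta>. \<forall>j\<in>R. \<beta> j = c j} \<times> X) = ennreal ((1 / 2) ^ card R) * emeasure lborel ({0..1} \<inter> X)"
    unfolding Om_def using coins_cylinder_sets[OF assms(1)] assms(2)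
    by (subst U.emeasure_pair_measure_Times) (auto simp: emeasure_coins[OF assms(1)] emeasure_U01)
qed

lemma AE_Om_snd:
  assumes "AE t in U01. P t"
  shows "AE \<omega> in Om. P (snd \<omega>)"
proof -
  interpret U: prob_space U01 by (rule prob_space_U01)
  obtain D where D: "{t \<in> space U01. \<not> P t} \<subseteq> D" "emeasure U01 D = 0" "D \<in> sets U01" using AE_E[OF assms] by metis
  have "UNIV \<times> D \<in> sets Om" unfolding Om_def using D(3) sets.top[of coins] by (intro pair_measureI) auto
  moreover have "emeasure Om (UNIV \<times> D) = 0"
    unfolding Om_def using D(2,3) sets.top[of coins] by (subst U.emeasure_pair_measure_Times) auto
  ultimately have "UNIV \<times> D \<in> null_sets Om" by auto
  then show ?thesis by (rule AE_I') (use D(1) in auto)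
qed

lemma AE_U01: "(AE t in lborel. 0 \<le> t \<longrightarrow> t \<le> 1 \<longrightarrow> P t) \<Longrightarrow> AE t in U01. P t"
  unfolding U01_def by (subst AE_uniform_measure) (auto elim: AE_mp)

text \<open>Up to a null set of heights, the parameters of the points of \<open>A\<close> form a
  cylinder times a set of heights: the coins in \<open>R\<close> are the relevant bits, and the edge
  prescribes all of them. Hence each relevant bit contributes a factor one half to the density of
  arclength.\<close>

lemma emeasure_gseg:
  assumes b: "b \<subseteq> S \<inter> {..<i}" and "i \<le> n" and k: "k < 4 ^ n" and A: "A \<in> sets (borel_of_metric (gm S i))" "A \<subseteq> gseg n b k"
  shows "emeasure (mui S i) A = ennreal ((1 / 2) ^ card (S \<inter> {..<i} \<inter> cbits n k)) * emeasure lborel {s \<in> {0..1 / 4 ^ n}. gp b (real k / 4 ^ n + s) \<in> A}"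
proof -
  define R where "R = S \<inter> {..<i} \<inter> cbits n k"
  define C where "C = {\<beta>::nat \<Rightarrow> bool. \<forall>j\<in>R. \<beta> j = (j \<in> b)}"
  define T' where "T' = {t \<in> cell n k. gp b t \<in> A}"
  define D where "D = {real k / 4 ^ n, real (Suc k) / 4 ^ n}"
  define T where "T = T' - D"
  have c01: "cl01 t = t" if "t \<in> cell n k" for t using cell_01[OF k that] cl01(3) by blast
  have "T' = cell n k \<inter> ((\<lambda>t. gp b (cl01 t)) -` A \<inter> space borel)" using c01 by (auto simp: T'_def)
  then have T': "T' \<in> sets borel"
    using measurable_sets[OF measurable_borel_to_metric[OF continuous_map_path[OF b]] A(1)] compact_cell[of n k]
    by (simp add: compact_imp_closed borel_closed)
  have T: "T \<in> sets borel" unfolding T_def D_def using T' by auto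
  have inner: "real k < 4 ^ n * t \<and> 4 ^ n * t < real (Suc k)" if "t \<in> cell n k" "t \<notin> D" for t
    using that unfolding cell_iff D_def by (auto simp: le_less field_simps)
  \<comment> \<open>At an end of the cell fewer bits may be visible, and outside of the unit
    interval the height is clamped. Both sets of heights are null for the uniform measure.\<close>
  let ?N = "D \<union> - {0..1}"
  have Pre: "(\<beta>, t) \<in> (\<lambda>\<omega>. Psi (Phi S \<omega>) i) -` A \<longleftrightarrow> (\<beta>, t) \<in> C \<times> T" if t: "t \<notin> ?N" for \<beta> t
  proof -
    have t01: "cl01 t = t" using t cl01(3) by auto
    have fin: "finite (bits S \<beta> \<inter> {..<i})" "finite b" using finite_bits[OF b] by auto
    show ?thesis
    proof
      assume "(\<beta>, t) \<in> (\<lambda>\<omega>. Psi (Phi S \<omega>) i) -` A"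
      then have gA: "gp (bits S \<beta> \<inter> {..<i}) t \<in> A" by (simp add: Psi_Phi t01)
      then have "gp (bits S \<beta> \<inter> {..<i}) t \<in> gseg n b k" using A(2) by blast
      then have *: "t \<in> cell n k" "gp (bits S \<beta> \<inter> {..<i}) t = gp b t" using gsegE by fastforce+
      then have ag: "j \<in> bits S \<beta> \<inter> {..<i} \<longleftrightarrow> j \<in> b" if "t \<in> band j" for j
        using that fin by (simp add: gp_eq_iff pt_eq_iff)
      have "\<beta> j = (j \<in> b)" if "j \<in> R" for j
      proof -
        have "t \<in> band j" using that inner[OF *(1)] t band_interior[of k n t j] cbits_less unfolding R_def by blast
        then show ?thesis using ag[of j] that by (auto simp: R_def bits_def)
      qed
      then show "(\<beta>, t) \<in> C \<times> T" using *(1) gA t unfolding C_def T_def T'_def *(2) by auto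
    next
      assume ct: "(\<beta>, t) \<in> C \<times> T"
      then have tc: "t \<in> cell n k" "gp b t \<in> A" by (auto simp: T_def T'_def)
      have "j \<in> bits S \<beta> \<inter> {..<i} \<longleftrightarrow> j \<in> b" if "t \<in> band j" for j
      proof (cases "j < i \<and> j \<in> S")
        case True
        then have "j \<in> cbits n k" using inner[OF tc(1)] t band_interior[of k n t j] that \<open>i \<le> n\<close> by auto
        then have "j \<in> R" using True by (simp add: R_def)
        then show ?thesis using ct True by (auto simp: C_def bits_def)
      next
        case False
        then show ?thesis using b by (auto simp: bits_def)
      qed
      then have "gp (bits S \<beta> \<inter> {..<i}) t = gp b t" using fin by (simp add: gp_eq_iff pt_eq_iff)
      then show "(\<beta>, t) \<in> (\<lambda>\<omega>. Psi (Phi S \<omega>) i) -` A" using tc(2) by (simp add: Psi_Phi t01)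
    qed
  qed
  have finR: "finite R" by (simp add: R_def)
  have DT: "T' - T \<subseteq> D" by (auto simp: T_def)
  have Dn: "D \<in> null_sets lborel" unfolding D_def by (intro finite_imp_null_set_lborel) auto
  then have "AE t in lborel. t \<notin> D" by (rule AE_not_in)
  then have "AE t in U01. t \<notin> ?N" by (intro AE_U01) (auto elim: AE_mp)
  then have "AE \<omega> in Om. snd \<omega> \<notin> ?N" by (rule AE_Om_snd)
  then have ae: "AE \<omega> in Om. \<omega> \<in> (\<lambda>\<omega>. Psi (Phi S \<omega>) i) -` A \<longleftrightarrow> \<omega> \<in> C \<times> T"
    by eventually_elim (use Pre in \<open>metis prod.collapse\<close>)
  have CT: "C \<times> T \<in> sets Om" "emeasure Om (C \<times> T) = ennreal ((1 / 2) ^ card R) * emeasure lborel ({0..1} \<inter> T)"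
    unfolding C_def by (rule emeasure_Om_rectangle[OF finR T])+
  have "emeasure (mui S i) A = emeasure Om ((\<lambda>\<omega>. Psi (Phi S \<omega>) i) -` A)"
    unfolding mui_def using A(1) by (subst emeasure_distr[OF measurable_Phi_proj]) auto
  also have "\<dots> = emeasure Om (C \<times> T)"
    using measurable_sets[OF measurable_Phi_proj A(1)] by (intro emeasure_eq_AE ae CT) simp
  also have "\<dots> = ennreal ((1 / 2) ^ card R) * emeasure lborel T"
  proof -
    have "{0..1} \<inter> T = T" using cell_01[OF k] by (auto simp: T_def T'_def)
    then show ?thesis unfolding CT(2) by simp
  qed
  also have "emeasure lborel T = emeasure lborel T'"
  proof (rule emeasure_eq_AE)
    show "AE x in lborel. x \<in> T \<longleftrightarrow> x \<in> T'" by (rule AE_I'[OF Dn]) (use DT in \<open>auto simp: T_def\<close>)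
  qed (use T T' in auto)
  also have "emeasure lborel T' = emeasure lborel {s. real k / 4 ^ n + s \<in> T'}" by (rule emeasure_lborel_shift[OF T', symmetric])
  also have "{s. real k / 4 ^ n + s \<in> T'} = {s \<in> {0..1 / 4 ^ n}. gp b (real k / 4 ^ n + s) \<in> A}"
    unfolding T'_def using cell_shift[of _ n k] by auto
  finally show ?thesis by (simp add: R_def)
qed

lemma measure_gseg:
  assumes b: "b \<subseteq> S \<inter> {..<i}" and n: "i \<le> n" and k: "k < 4 ^ n"
  shows "measure (mui S i) (gseg n b k) = (1 / 2) ^ card (S \<inter> {..<i} \<inter> cbits n k) / 4 ^ n"
proof -
  have "{s \<in> {0..1 / 4 ^ n}. gp b (real k / 4 ^ n + s) \<in> gseg n b k} = {0..1 / 4 ^ n}"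
    using gsegI cell_shift n k by auto
  then have "emeasure (mui S i) (gseg n b k) = ennreal ((1 / 2) ^ card (S \<inter> {..<i} \<inter> cbits n k)) * ennreal (1 / 4 ^ n)"
    using emeasure_gseg[OF b n k gseg_sets[OF b k] order_refl] by simp
  then show ?thesis by (simp add: measure_def ennreal_mult'[symmetric])
qed

lemma measure_ratio:
  assumes e: "e1 \<in> gedges S i i" "e2 \<in> gedges S i i" "e1 \<inter> e2 \<noteq> {}"
  shows "measure (mui S i) e1 / measure (mui S i) e2 \<in> {1 / 2..2}"
proof -
  obtain b k b' k' where b: "e1 = gseg i b k" "e2 = gseg i b' k'" "b \<subseteq> S \<inter> {..<i}" "b' \<subseteq> S \<inter> {..<i}" "k < 4 ^ i" "k' < 4 ^ i"
    using e(1,2) by (auto simp: gedges_def)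
  obtain p where p: "p \<in> e1" "p \<in> e2" using e(3) by blast
  have t: "snd p \<in> cell i k" "snd p \<in> cell i k'" using p gsegE(1) unfolding b by blast+
  define x where "x = card (S \<inter> {..<i} \<inter> cbits i k)"
  define y where "y = card (S \<inter> {..<i} \<inter> cbits i k')"
  have "x \<le> y + 1" "y \<le> x + 1"
    using card_cbits_adjacent[OF t, of "S \<inter> {..<i}"] card_cbits_adjacent[OF t(2,1), of "S \<inter> {..<i}"] by (auto simp: x_def y_def)
  then consider "x = y" | "x = Suc y" | "y = Suc x" by linarith
  moreover have "measure (mui S i) e1 / measure (mui S i) e2 = (1 / 2) ^ x / (1 / 2) ^ y"
    using measure_gseg[OF b(3) order_refl b(5)] measure_gseg[OF b(4) order_refl b(6)] by (simp add: b(1,2) x_def y_def)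
  ultimately show ?thesis by cases (auto simp: power_divide)
qed

lemma gseg_cell_eq: "gseg n b k = gseg n b' k' \<Longrightarrow> k = k'"
proof -
  assume e: "gseg n b k = gseg n b' k'"
  have "snd ` gseg n b k = cell n k" for b k by (auto simp: gseg_def image_image)
  then have c: "cell n k = cell n k'" using e by metis
  have "real k / 4 ^ n \<in> cell n k" "real k' / 4 ^ n \<in> cell n k'" by (auto simp: cell_iff)
  then have "real k / 4 ^ n \<in> cell n k'" "real k' / 4 ^ n \<in> cell n k" using c by simp_all
  then have "real k' \<le> real k" "real k \<le> real k'" by (simp_all add: cell_iff)
  then show "k = k'" by simp
qed

text \<open>If \<open>v\<close> lies in a band of level \<open>i\<close> and \<open>i\<close> is in
  \<open>S\<close>, then \<open>w\<close> fixes the bit \<open>i\<close>, and exactly one lift of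
  \<open>e'\<close> contains \<open>w\<close>; it carries half of the measure. Otherwise every lift
  of \<open>e'\<close> contains \<open>w\<close>, their union is the full preimage, and the ratio is
  1 because the measure is pushed forward. In both cases the value depends only on
  \<open>v\<close>.\<close>

lemma lift_measure:
  assumes v: "pj i w = v" and w: "w \<in> gpts S (Suc i)" and e': "e' \<in> gedges S i (Suc i)" "v \<in> e'"
  shows "measure (mui S (Suc i)) (\<Union>{e \<in> gedges S (Suc i) (Suc i). w \<in> e \<and> pj i ` e = e'}) / measure (mui S i) e' =
     (if i \<in> S \<and> snd v \<in> band i then 1 / 2 else 1)"
proof -
  have sv: "snd w = snd v" using v by (metis snd_pj)
  have vg: "v \<in> gpts S i" using pj_gpts[OF w] v by simp
  obtain b k where b: "e' = gseg (Suc i) b k" "b \<subseteq> S \<inter> {..<i}" "k < 4 ^ Suc i" using e'(1) by (auto simp: gedges_def)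
  have vc: "snd v \<in> cell (Suc i) k" using e'(2) gsegE(1) unfolding b(1) by blast
  have vb: "j \<in> fst (dec w) \<longleftrightarrow> j \<in> b" if "j < i" "snd v \<in> band j" for j
  proof -
    have "j \<in> fst (dec v) \<longleftrightarrow> j \<in> b" using e'(2) that(2) unfolding b(1) mem_gseg_iff[OF b(2) vg] by blast
    then show ?thesis using that(1) unfolding v[symmetric] dec_pj by auto
  qed
  have wS: "fst (dec w) \<subseteq> S \<inter> {..<Suc i}" by (rule gpts_gp(2)[OF w])
  have lift: "c \<subseteq> S \<inter> {..<Suc i} \<and> c \<inter> {..<i} = b \<and> pj i ` gseg (Suc i) c k = e'"
    if "c = b \<or> (i \<in> S \<and> c = insert i b)" for c
  proof -
    have "c \<subseteq> S \<inter> {..<Suc i}" "c \<inter> {..<i} = b" using b(2) that by auto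
    then show ?thesis using pj_seg[of c S i "Suc i" k] by (simp add: b(1))
  qed
  have me': "measure (mui S i) e' = (1 / 2) ^ card (S \<inter> {..<i} \<inter> cbits (Suc i) k) / 4 ^ Suc i"
    unfolding b(1) by (rule measure_gseg[OF b(2) _ b(3)]) simp
  show ?thesis
  proof (cases "i \<in> S \<and> snd v \<in> band i")
    case True
    define c where "c = (if i \<in> fst (dec w) then insert i b else b)"
    have c: "c \<subseteq> S \<inter> {..<Suc i}" "c \<inter> {..<i} = b" "pj i ` gseg (Suc i) c k = e'"
      using lift[of c] True by (auto simp: c_def)
    have ic: "i \<in> c \<longleftrightarrow> i \<in> fst (dec w)" using b(2) by (auto simp: c_def)
    have "{e \<in> gedges S (Suc i) (Suc i). w \<in> e \<and> pj i ` e = e'} = {gseg (Suc i) c k}"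
    proof (intro equalityI subsetI)
      fix e assume e: "e \<in> {e \<in> gedges S (Suc i) (Suc i). w \<in> e \<and> pj i ` e = e'}"
      then obtain c' k' where c': "e = gseg (Suc i) c' k'" "c' \<subseteq> S \<inter> {..<Suc i}" "k' < 4 ^ Suc i" by (auto simp: gedges_def)
      have pe: "gseg (Suc i) (c' \<inter> {..<i}) k' = gseg (Suc i) b k" using e pj_seg[OF c'(2)] by (auto simp: c'(1) b(1))
      then have kk: "k' = k" by (rule gseg_cell_eq)
      have "i \<in> c' \<longleftrightarrow> i \<in> c"
        using e True unfolding c'(1) ic using mem_gseg_iff[OF c'(2) w] sv by auto
      moreover have "j \<in> c' \<longleftrightarrow> j \<in> b" if "j \<in> cbits (Suc i) k" "j < i" for j
      proof -
        let ?m = "(real k + 1 / 2) / 4 ^ Suc i"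
        have fin: "finite (c' \<inter> {..<i})" "finite b" using finite_bits[OF b(2)] by auto
        have "gp b ?m \<in> gseg (Suc i) b k" by (rule gsegI[OF mid_cell])
        then have "gp b ?m \<in> gseg (Suc i) (c' \<inter> {..<i}) k" using pe kk by simp
        then have "gp b ?m = gp (c' \<inter> {..<i}) ?m" using gsegE(2) by fastforce
        then have "pt b ?m = pt (c' \<inter> {..<i}) ?m" using fin by (simp only: gp_eq_iff)
        moreover have "?m \<in> band j" using that(1) by (simp add: cbits_def)
        ultimately show ?thesis using that(2) unfolding pt_eq_iff by auto
      qed
      ultimately have "c' \<inter> cbits (Suc i) k = c \<inter> cbits (Suc i) k"
      proof (intro set_eqI)
        fix j assume *: "i \<in> c' \<longleftrightarrow> i \<in> c" "\<And>j. j \<in> cbits (Suc i) k \<Longrightarrow> j < i \<Longrightarrow> j \<in> c' \<longleftrightarrow> j \<in> b"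
        consider "j = i" | "j < i" | "j \<ge> Suc i" by linarith
        then show "j \<in> c' \<inter> cbits (Suc i) k \<longleftrightarrow> j \<in> c \<inter> cbits (Suc i) k"
        proof cases
          case 2
          then show ?thesis using *(2)[of j] c(2) by blast
        qed (use *(1) c(1) c'(2) in auto)
      qed
      then have "e = gseg (Suc i) c k" unfolding c'(1) kk by (rule gseg_eq[OF c'(2) c(1) order_refl])
      then show "e \<in> {gseg (Suc i) c k}" by simp
    next
      fix e assume "e \<in> {gseg (Suc i) c k}"
      then have e: "e = gseg (Suc i) c k" by simp
      have "j \<in> fst (dec w) \<longleftrightarrow> j \<in> c" if "snd v \<in> band j" for j
      proof (cases "j < i")
        case True
        then show ?thesis using vb[OF True that] c(2) by auto
      next
        case False
        then show ?thesis using ic wS c(1) by (cases "j = i") auto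
      qed
      then have "w \<in> gseg (Suc i) c k" unfolding mem_gseg_iff[OF c(1) w] using vc sv by simp
      then show "e \<in> {e \<in> gedges S (Suc i) (Suc i). w \<in> e \<and> pj i ` e = e'}"
        using c b(3) unfolding e gedges_def by blast
    qed
    then have "measure (mui S (Suc i)) (\<Union>{e \<in> gedges S (Suc i) (Suc i). w \<in> e \<and> pj i ` e = e'}) =
        (1 / 2) ^ card (S \<inter> {..<Suc i} \<inter> cbits (Suc i) k) / 4 ^ Suc i"
      using measure_gseg[OF c(1) order_refl b(3)] by simp
    moreover have "S \<inter> {..<Suc i} \<inter> cbits (Suc i) k = insert i (S \<inter> {..<i} \<inter> cbits (Suc i) k)"
      using True band_cell[OF vc, of i] by (auto simp: less_Suc_eq)
    then have "card (S \<inter> {..<Suc i} \<inter> cbits (Suc i) k) = Suc (card (S \<inter> {..<i} \<inter> cbits (Suc i) k))" by simp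
    ultimately show ?thesis using True me' by simp
  next
    case False
    have "\<Union>{e \<in> gedges S (Suc i) (Suc i). w \<in> e \<and> pj i ` e = e'} = pj i -` e' \<inter> space (mui S (Suc i))"
    proof (intro equalityI subsetI)
      fix y assume "y \<in> \<Union>{e \<in> gedges S (Suc i) (Suc i). w \<in> e \<and> pj i ` e = e'}"
      then obtain e where e: "e \<in> gedges S (Suc i) (Suc i)" "pj i ` e = e'" "y \<in> e" by blast
      then have "y \<in> gpts S (Suc i)" using gseg_subset unfolding gedges_def by blast
      then show "y \<in> pj i -` e' \<inter> space (mui S (Suc i))" using e by auto
    next
      fix y assume "y \<in> pj i -` e' \<inter> space (mui S (Suc i))"
      then have y: "y \<in> gpts S (Suc i)" "pj i y \<in> e'" by auto
      have yS: "fst (dec y) \<subseteq> S \<inter> {..<Suc i}" by (rule gpts_gp(2)[OF y(1)])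
      define c where "c = (if i \<in> fst (dec y) then insert i b else b)"
      have c: "c \<subseteq> S \<inter> {..<Suc i}" "c \<inter> {..<i} = b" "pj i ` gseg (Suc i) c k = e'"
      proof -
        have "c = b \<or> (i \<in> S \<and> c = insert i b)" using yS by (auto simp: c_def)
        from lift[OF this] show "c \<subseteq> S \<inter> {..<Suc i}" "c \<inter> {..<i} = b" "pj i ` gseg (Suc i) c k = e'" by blast+
      qed
      have ic: "i \<in> c \<longleftrightarrow> i \<in> fst (dec y)" using b(2) by (auto simp: c_def)
      have yc: "snd y \<in> cell (Suc i) k" using y(2) gsegE(1)[of "pj i y"] unfolding b(1) by simp
      have "j \<in> fst (dec y) \<longleftrightarrow> j \<in> c" if "snd y \<in> band j" for j
      proof (cases "j < i")
        case True
        have "j \<in> fst (dec (pj i y)) \<longleftrightarrow> j \<in> b"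
          using y(2) that unfolding b(1) mem_gseg_iff[OF b(2) pj_gpts[OF y(1)]] by simp
        then show ?thesis using True c(2) by (auto simp: dec_pj)
      next
        case False
        then show ?thesis using ic yS c(1) by (cases "j = i") auto
      qed
      then have yseg: "y \<in> gseg (Suc i) c k" unfolding mem_gseg_iff[OF c(1) y(1)] using yc by simp
      have "j \<in> fst (dec w) \<longleftrightarrow> j \<in> c" if "snd v \<in> band j" for j
      proof (cases "j < i")
        case True
        then show ?thesis using vb[OF True that] c(2) by auto
      next
        case F: False
        have "j \<notin> S" if "j = i" using False \<open>snd v \<in> band j\<close> that by blast
        then show ?thesis using F wS c(1) by (cases "j = i") auto
      qed
      then have "w \<in> gseg (Suc i) c k" unfolding mem_gseg_iff[OF c(1) w] using vc sv by simp
      then show "y \<in> \<Union>{e \<in> gedges S (Suc i) (Suc i). w \<in> e \<and> pj i ` e = e'}"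
        using c b(3) yseg unfolding gedges_def by blast
    qed
    moreover have "measure (mui S i) e' = measure (mui S (Suc i)) (pj i -` e' \<inter> space (mui S (Suc i)))"
    proof -
      have m: "pj i \<in> mui S (Suc i) \<rightarrow>\<^sub>M mui S i"
        using measurable_pj measurable_cong_sets[OF sets_mui sets_mui] by blast
      have "measure (mui S i) e' = measure (distr (mui S (Suc i)) (mui S i) (pj i)) e'" by (simp add: distr_mui)
      also have "\<dots> = measure (mui S (Suc i)) (pj i -` e' \<inter> space (mui S (Suc i)))"
        by (rule measure_distr[OF m]) (simp add: b(1) gseg_sets[OF b(2,3)])
      finally show ?thesis .
    qed
    moreover have "measure (mui S i) e' \<noteq> 0" unfolding me' by simp
    ultimately show ?thesis using False by simp
  qed
qed

theorem admissible_XG: "admissible_inverse_system (XG S) pj (mui S)"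
  unfolding admissible_inverse_system_def Let_def
\<comment> \<open>The constants are the number of parts of a subdivided edge and the bounds from
  \<open>edges_at_vertex\<close>, \<open>pj_fiber\<close> and \<open>measure_ratio\<close>, in this
  order.\<close>
proof (rule exI[of _ 4], rule exI[of _ 4], rule exI[of _ 2], rule exI[of _ 2], intro conjI allI ballI impI)
  fix i
  have l: "1 / real 4 ^ i = 1 / 4 ^ i" "1 / real 4 ^ i = 1 / 4 ^ i" by simp_all
  note se = subdivide_edges[of i S] and sv = subdivide_verts[of i S]
  have sg: "gmetric (subdivide l n X) = gmetric X" for l n and X :: "(nat \<times> real) metric_graph" by (simp add: subdivide_def)
  show "connected_metric_graph (1 / real 4 ^ i) (XG S i)" using connected_metric_graph_XG[of i S] by simp
  show "open_map (mtopology_of (gmetric (XG S (Suc i)))) (mtopology_of (gmetric (subdivide (1 / real 4 ^ i) 4 (XG S i)))) (pj i)"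
    unfolding sg using pj_open_map by simp
  show "pj i ` verts (XG S (Suc i)) \<subseteq> verts (subdivide (1 / real 4 ^ i) 4 (XG S i))"
    using pj_verts[of i S] sv by simp
  show "sets (mui S i) = sets (borel_of_metric (gmetric (XG S i)))" by simp
  show "distr (mui S (Suc i)) (mui S i) (pj i) = mui S i" by (rule distr_mui)
  show "finite {e \<in> edges (XG S i). v \<in> e}" "real (card {e \<in> edges (XG S i). v \<in> e}) \<le> 4" if "v \<in> verts (XG S i)" for v
    using edges_at_vertex[of v S i] that by simp_all
  show "pj i ` e \<in> edges (subdivide (1 / real 4 ^ i) 4 (XG S i))" if "e \<in> edges (XG S (Suc i))" for e
    using pj_edges[of e S i] that se by simp
  show "mdist (gmetric (subdivide (1 / real 4 ^ i) 4 (XG S i))) (pj i y) (pj i z) = mdist (gmetric (XG S (Suc i))) y z"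
    if "e \<in> edges (XG S (Suc i))" "y \<in> e" "z \<in> e" for e y z
    unfolding sg using pj_isometry[of e S i y z] that by simp
  show "mdist (gmetric (XG S (Suc i))) y z \<le> 2 / real 4 ^ Suc i"
    if "y \<in> mspace (gmetric (XG S (Suc i)))" "z \<in> mspace (gmetric (XG S (Suc i)))" "pj i y = pj i z" for y z
    using pj_fiber[of y S i z] that by simp
  show "\<exists>c>0. \<exists>\<gamma>. edge_param (1 / real 4 ^ i) (XG S i) e \<gamma> \<and>
          (\<forall>A\<in>sets (mui S i). A \<subseteq> e \<longrightarrow>
             emeasure (mui S i) A = ennreal c * emeasure lborel {t\<in>{0..1 / real 4 ^ i}. \<gamma> t \<in> A})"
    if e: "e \<in> edges (XG S i)" for e
  proof -
    obtain b k where b: "e = gseg i b k" "b \<subseteq> S \<inter> {..<i}" "k < 4 ^ i" using e by (auto simp: gedges_def)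
    show ?thesis
      using edge_param_XG[OF b(2,3)] emeasure_gseg[OF b(2) order_refl b(3)]
      by (intro exI[of _ "(1 / 2) ^ card (S \<inter> {..<i} \<inter> cbits i k)"] exI[of _ "\<lambda>s. gp b (real k / 4 ^ i + s)"] conjI) (simp_all add: b(1))
  qed
  show "measure (mui S i) e1 / measure (mui S i) e2 \<in> {1 / 2..2}"
    if "e1 \<in> edges (XG S i)" "e2 \<in> edges (XG S i)" "e1 \<inter> e2 \<noteq> {}" for e1 e2
    using measure_ratio[of e1 S i e2] that by simp
  show "\<exists>q. \<forall>e'\<in>edges (subdivide (1 / real 4 ^ i) 4 (XG S i)). v \<in> e' \<longrightarrow>
             measure (mui S (Suc i)) (\<Union>{e\<in>edges (XG S (Suc i)). w \<in> e \<and> pj i ` e = e'})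
               / measure (mui S i) e' = q"
    if w: "w \<in> mspace (gmetric (XG S (Suc i)))" "pj i w = v" for v w
    using lift_measure[OF w(2)] w(1) se by (intro exI[of _ "if i \<in> S \<and> snd v \<in> band i then 1 / 2 else 1"]) simp
qed auto

theorem inverse_limit_measure_XG: "inverse_limit_measure (XG S) pj (mui S) (muinf S)"
  unfolding inverse_limit_measure_def using distr_muinf by (simp add: minf_def)

section \<open>Tangent cones\<close>

text \<open>Zorn's lemma is applied to families of sets all of whose finite intersections are
  infinite. Maximality yields the dichotomy between a set and its complement, and infinite
  intersections exclude singletons.\<close>

lemma nonprincipal_ultrafilter_exists: "\<exists>\<omega>. nonprincipal_ultrafilter \<omega>"
proof -
  define \<A> where "\<A> = {M :: nat set set. \<forall>F. finite F \<longrightarrow> F \<subseteq> M \<longrightarrow> infinite (\<Inter>F)}"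
  have "\<A> \<noteq> {}"
  proof -
    have "{} \<in> \<A>" by (simp add: \<A>_def)
    then show ?thesis by blast
  qed
  then have "\<exists>M\<in>\<A>. \<forall>X\<in>\<A>. M \<subseteq> X \<longrightarrow> X = M"
  proof (rule subset_Zorn_nonempty)
    fix \<C> assume ne: "\<C> \<noteq> {}" and ch: "subset.chain \<A> \<C>"
    show "\<Union>\<C> \<in> \<A>"
      unfolding \<A>_def
    proof (intro CollectI allI impI)
      fix F assume "finite F" "F \<subseteq> \<Union>\<C>"
      then obtain B where "B \<in> \<C>" "F \<subseteq> B" using finite_subset_Union_chain[OF _ _ ne ch] by metis
      moreover have "B \<in> \<A>" using ch \<open>B \<in> \<C>\<close> by (auto simp: subset.chain_def)
      ultimately show "infinite (\<Inter>F)" using \<open>finite F\<close> unfolding \<A>_def by blast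
    qed
  qed
  then obtain M where M: "M \<in> \<A>" and mx: "\<And>X. X \<in> \<A> \<Longrightarrow> M \<subseteq> X \<Longrightarrow> X = M" by blast
  have inf: "infinite (\<Inter>F)" if "finite F" "F \<subseteq> M" for F using M that unfolding \<A>_def by blast
  have ext: "\<exists>F. finite F \<and> F \<subseteq> M \<and> finite (\<Inter>F \<inter> P)" if P: "P \<notin> M" for P
  proof -
    have "insert P M \<notin> \<A>" using mx[of "insert P M"] P by blast
    then obtain G where G: "finite G" "G \<subseteq> insert P M" "finite (\<Inter>G)" unfolding \<A>_def by blast
    have "\<Inter>(G - {P}) \<inter> P \<subseteq> \<Inter>G" by blast
    then have "finite (\<Inter>(G - {P}) \<inter> P)" using G(3) by (rule finite_subset)
    then show ?thesis using G by (intro exI[of _ "G - {P}"]) auto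
  qed
  have dich: "P \<in> M \<or> - P \<in> M" for P
  proof (rule ccontr)
    assume "\<not> (P \<in> M \<or> - P \<in> M)"
    then obtain F G where F: "finite F" "F \<subseteq> M" "finite (\<Inter>F \<inter> P)" and G: "finite G" "G \<subseteq> M" "finite (\<Inter>G \<inter> - P)"
      using ext[of P] ext[of "- P"] by blast
    have "\<Inter>(F \<union> G) \<subseteq> (\<Inter>F \<inter> P) \<union> (\<Inter>G \<inter> - P)" by blast
    then have "finite (\<Inter>(F \<union> G))" using F(3) G(3) by (meson finite_UnI finite_subset)
    then show False using inf[of "F \<union> G"] F G by simp
  qed
  have int: "X \<inter> Y \<inter> Z \<noteq> {}" if "X \<in> M" "Y \<in> M" "Z \<in> M" for X Y Z
    using inf[of "{X, Y, Z}"] that by (auto simp: Int_assoc)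
  define \<omega> where "\<omega> = Abs_filter (\<lambda>P. {n. P n} \<in> M)"
  have ev: "eventually P \<omega> \<longleftrightarrow> {n. P n} \<in> M" for P
    unfolding \<omega>_def
  proof (rule eventually_Abs_filter, rule is_filter.intro)
    show "{n. True} \<in> M" using dich[of UNIV] int[of "{}" "{}" "{}"] by auto
    show "{n. P n \<and> Q n} \<in> M" if "{n. P n} \<in> M" "{n. Q n} \<in> M" for P Q
      using dich[of "{n. P n \<and> Q n}"] int[OF that, of "- {n. P n \<and> Q n}"] by blast
    show "{n. Q n} \<in> M" if "\<forall>n. P n \<longrightarrow> Q n" "{n. P n} \<in> M" for P Q
      using dich[of "{n. Q n}"] int[OF that(2,2), of "- {n. Q n}"] that(1) by blast
  qed
  have "nonprincipal_ultrafilter \<omega>"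
    unfolding nonprincipal_ultrafilter_def
  proof (intro conjI allI)
    show "\<omega> \<noteq> bot" unfolding trivial_limit_def ev using int[of "{}" "{}" "{}"] by auto
    show "eventually P \<omega> \<or> eventually (\<lambda>i. \<not> P i) \<omega>" for P
      unfolding ev using dich[of "{n. P n}"] by (simp add: Collect_neg_eq)
    show "\<not> eventually (\<lambda>i. i = n) \<omega>" for n unfolding ev using inf[of "{{n}}"] by auto
  qed
  then show ?thesis by blast
qed

section \<open>Separation by two points as a bilipschitz invariant\<close>

text \<open>A bilipschitz invariant that tells a tangent cone from a Euclidean space: the complement of two
  points has two bounded pieces, each of which is separated from the rest in a scale invariant way.\<close>

definition bypassed :: "'a metric \<Rightarrow> bool" where
  "bypassed m \<longleftrightarrow> (\<exists>p\<in>mspace m. \<exists>q\<in>mspace m. \<exists>(W :: bool \<Rightarrow> 'a set) \<kappa> C. \<kappa> > 0 \<and> W True \<inter> W False = {} \<and>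
     (\<forall>e. W e \<noteq> {} \<and> W e \<subseteq> mspace m - {p, q} \<and>
       (\<forall>y\<in>W e. mdist m p y \<le> C \<and>
          (\<forall>z\<in>mspace m. mdist m y z < \<kappa> * min (mdist m p y) (mdist m q y) \<longrightarrow> z \<in> W e))))"

text \<open>Distances change by factors between \<open>1 / L\<close> and \<open>L\<close>, and
  \<kappa> compares two distances; it therefore deteriorates to
  \<open>\<kappa> / (L * L)\<close>.\<close>

lemma bypassed_bilipschitz:
  assumes "bypassed m" "bilipschitz_equivalent m m'"
  shows "bypassed m'"
proof -
  obtain p q W \<kappa> C where p: "p \<in> mspace m" "q \<in> mspace m" and \<kappa>: "\<kappa> > 0" and dis: "W True \<inter> W False = {}"
    and W: "\<And>e::bool. W e \<noteq> {}" "\<And>e. W e \<subseteq> mspace m - {p, q}" "\<And>e y. y \<in> W e \<Longrightarrow> mdist m p y \<le> C"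
      "\<And>e y z. y \<in> W e \<Longrightarrow> z \<in> mspace m \<Longrightarrow> mdist m y z < \<kappa> * min (mdist m p y) (mdist m q y) \<Longrightarrow> z \<in> W e"
    using assms(1) unfolding bypassed_def by metis
  obtain F L where F: "F \<in> mspace m \<rightarrow> mspace m'" "F ` mspace m = mspace m'" and L: "L > 0"
    "\<And>x y. x \<in> mspace m \<Longrightarrow> y \<in> mspace m \<Longrightarrow> mdist m x y / L \<le> mdist m' (F x) (F y)"
    "\<And>x y. x \<in> mspace m \<Longrightarrow> y \<in> mspace m \<Longrightarrow> mdist m' (F x) (F y) \<le> L * mdist m x y"
    using assms(2) unfolding bilipschitz_equivalent_def bilipschitz_embedding_def by metis
  interpret m: Metric_space "mspace m" "mdist m" by (rule Metric_space_mspace_mdist)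
  interpret m': Metric_space "mspace m'" "mdist m'" by (rule Metric_space_mspace_mdist)
  have inj: "x = y" if "x \<in> mspace m" "y \<in> mspace m" "F x = F y" for x y
  proof -
    have "F y \<in> mspace m'" using that F(1) by blast
    then have "mdist m' (F x) (F y) = 0" using that(3) by simp
    then have "mdist m x y \<le> 0" using L(2)[OF that(1,2)] L(1) by (simp add: divide_le_0_iff)
    then show ?thesis using m.nonneg[of x y] m.zero[OF that(1,2)] by linarith
  qed
  have Wm: "W e \<subseteq> mspace m" for e using W(2) by blast
  show ?thesis
    unfolding bypassed_def
  proof (rule bexI[of _ "F p"], rule bexI[of _ "F q"], rule exI[of _ "\<lambda>e. F ` W e"], rule exI[of _ "\<kappa> / (L * L)"],
      rule exI[of _ "L * C"], intro conjI allI ballI impI)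
    show "F p \<in> mspace m'" "F q \<in> mspace m'" using p F(1) by auto
    show "0 < \<kappa> / (L * L)" using \<kappa> L(1) by simp
    show "F ` W True \<inter> F ` W False = {}"
      using ccontr inj Wm dis by fastforce
    fix e
    show "F ` W e \<noteq> {}" using W(1) by blast
    show "F ` W e \<subseteq> mspace m' - {F p, F q}" using W(2)[of e] inj p F(1) by blast
    fix y' assume "y' \<in> F ` W e"
    then obtain y where y: "y \<in> W e" "y' = F y" by blast
    have ym: "y \<in> mspace m" using y Wm by blast
    have "mdist m' (F p) (F y) \<le> L * mdist m p y" by (rule L(3)[OF p(1) ym])
    also have "\<dots> \<le> L * C" using W(3)[OF y(1)] L(1) by simp
    finally show "mdist m' (F p) y' \<le> L * C" by (simp add: y(2))
    fix z' assume z': "z' \<in> mspace m'" "mdist m' y' z' < \<kappa> / (L * L) * min (mdist m' (F p) y') (mdist m' (F q) y')"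
    then obtain z where z: "z \<in> mspace m" "z' = F z" using F(2) by blast
    have "mdist m y z / L \<le> mdist m' y' z'" unfolding y z by (rule L(2)[OF ym z(1)])
    also have "\<dots> < \<kappa> / (L * L) * min (mdist m' (F p) y') (mdist m' (F q) y')" by (rule z'(2))
    also have "\<dots> \<le> \<kappa> / (L * L) * (L * min (mdist m p y) (mdist m q y))"
    proof (rule mult_left_mono)
      have "min (mdist m' (F p) y') (mdist m' (F q) y') \<le> min (L * mdist m p y) (L * mdist m q y)"
        unfolding y(2) by (intro min.mono L(3) p ym)
      also have "\<dots> = L * min (mdist m p y) (mdist m q y)" using L(1) by (simp add: min_mult_distrib_left)
      finally show "min (mdist m' (F p) y') (mdist m' (F q) y') \<le> L * min (mdist m p y) (mdist m q y)" .
    qed (use \<kappa> L(1) in simp)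
    also have "\<dots> = \<kappa> * min (mdist m p y) (mdist m q y) / L" using L(1) by (simp add: field_simps)
    finally have "mdist m y z < \<kappa> * min (mdist m p y) (mdist m q y)" using L(1) by (simp add: divide_less_cancel)
    then have "z \<in> W e" by (rule W(4)[OF y(1) z(1)])
    then show "z' \<in> F ` W e" using z(2) by blast
  qed
qed

lemma mdist_euclidean_k: "mdist (euclidean_k k) u v = L2_set (\<lambda>i. u i - v i) {..<k}"
  unfolding euclidean_k_def Metric_space.mdist_metric[OF Metric_space_euclidean_k] ..

lemma mdist_coordinate_line:
  assumes "j < k"
  shows "mdist (euclidean_k k) (y(j := a)) (y(j := b)) = \<bar>a - b\<bar>"
proof -
  have "mdist (euclidean_k k) (y(j := a)) (y(j := b)) = L2_set (\<lambda>i. if i = j then a - b else 0) {..<k}"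
    unfolding mdist_euclidean_k by (intro L2_set_cong) auto
  also have "\<dots> = \<bar>a - b\<bar>"
  proof -
    have "(\<Sum>i<k. (if i = j then a - b else 0)\<^sup>2) = (\<Sum>i<k. if i = j then (a - b)\<^sup>2 else 0)"
      by (intro sum.cong) auto
    then show ?thesis using assms by (simp add: L2_set_def)
  qed
  finally show ?thesis .
qed

text \<open>On a compact segment that avoids \<open>p\<close> and \<open>q\<close> the distance from
  these points is bounded below. Membership in \<open>W\<close> therefore propagates by steps of
  uniform length, and finitely many of them lead from one end of the segment to the other.\<close>

lemma coordinate_segment:
  assumes W: "\<And>y z. y \<in> W \<Longrightarrow> z \<in> mspace (euclidean_k k) \<Longrightarrow>
      mdist (euclidean_k k) y z < \<kappa> * min (mdist (euclidean_k k) p y) (mdist (euclidean_k k) q y) \<Longrightarrow> z \<in> W"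
    and \<kappa>: "\<kappa> > 0" and j: "j < k" and pq: "p \<in> mspace (euclidean_k k)" "q \<in> mspace (euclidean_k k)"
    and y: "y \<in> mspace (euclidean_k k)" "y(j := a) \<in> W"
    and av: "\<And>c. c \<in> closed_segment a b \<Longrightarrow> y(j := c) \<noteq> p \<and> y(j := c) \<noteq> q"
  shows "y(j := b) \<in> W"
proof -
  let ?d = "mdist (euclidean_k k)"
  interpret m: Metric_space "mspace (euclidean_k k)" ?d by (rule Metric_space_mspace_mdist)
  have ym: "y(j := c) \<in> mspace (euclidean_k k)" for c using y(1) j by auto
  define g where "g c = min (?d p (y(j := c))) (?d q (y(j := c)))" for c
  have lip: "\<bar>?d r (y(j := c)) - ?d r (y(j := c'))\<bar> \<le> \<bar>c - c'\<bar>" if "r \<in> mspace (euclidean_k k)" for r c c'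
    using m.triangle[OF that ym[of c] ym[of c']] m.triangle[OF that ym[of c'] ym[of c]]
      mdist_coordinate_line[OF j, of y c c'] mdist_coordinate_line[OF j, of y c' c] by (simp add: abs_le_iff)
  have "continuous_on UNIV (\<lambda>c. ?d r (y(j := c)))" if "r \<in> mspace (euclidean_k k)" for r
    unfolding continuous_on_iff dist_real_def using lip[OF that] by (meson le_less_trans)
  then have "continuous_on UNIV g" unfolding g_def using pq by (intro continuous_on_min) auto
  then have "continuous_on (closed_segment a b) g" by (rule continuous_on_subset) simp
  then obtain c0 where c0: "c0 \<in> closed_segment a b" "\<And>c. c \<in> closed_segment a b \<Longrightarrow> g c0 \<le> g c"
    using continuous_attains_inf[of "closed_segment a b" g] by auto
  have "g c0 > 0"
    unfolding g_def min_less_iff_conj using m.mdist_pos_eq[OF pq(1) ym[of c0]] m.mdist_pos_eq[OF pq(2) ym[of c0]] av[OF c0(1)] by metis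
  obtain N where N: "\<bar>b - a\<bar> < real N * (\<kappa> * g c0)" using reals_Archimedean3[of "\<kappa> * g c0"] \<kappa> \<open>g c0 > 0\<close> by auto
  then have N0: "N > 0" by (cases N) auto
  define c where "c n = a + (b - a) * (real n / real N)" for n
  have cs: "c n \<in> closed_segment a b" if "n \<le> N" for n
  proof -
    have "c n = (1 - real n / real N) *\<^sub>R a + (real n / real N) *\<^sub>R b"
      unfolding c_def real_scaleR_def left_diff_distrib by (simp only: mult.commute[of _ a] mult.commute[of _ b])
    then show ?thesis unfolding closed_segment_def using that N0 by (intro CollectI exI[of _ "real n / real N"]) simp
  qed
  have "y(j := c n) \<in> W" if "n \<le> N" for n
    using that
  proof (induction n)
    case 0
    then show ?case using y(2) by (simp add: c_def del: fun_upd_apply)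
  next
    case (Suc n)
    have "?d (y(j := c n)) (y(j := c (Suc n))) = \<bar>c n - c (Suc n)\<bar>" by (rule mdist_coordinate_line[OF j])
    also have "c n - c (Suc n) = (b - a) * ((real n - real (Suc n)) / real N)" unfolding c_def diff_divide_distrib by algebra
    also have "\<bar>(b - a) * ((real n - real (Suc n)) / real N)\<bar> = \<bar>b - a\<bar> / real N" by (simp add: abs_mult)
    also have "\<dots> < \<kappa> * g c0" using N N0 by (simp add: divide_less_eq mult.commute)
    also have "\<dots> \<le> \<kappa> * g (c n)" using c0(2)[OF cs[of n]] Suc.prems \<kappa> by simp
    finally show ?case using W[OF _ ym] Suc.IH Suc.prems unfolding g_def by (meson Suc_leD)
  qed
  from this[of N] show ?thesis using N0 by (simp add: c_def)
qed

text \<open>From a point of a bounded piece, the coordinate rays in both directions have to hit \<open>p\<close> or \<open>q\<close>.\<close>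

lemma not_bypassed_euclidean: "\<not> bypassed (euclidean_k k)"
proof
  let ?m = "euclidean_k k"
  assume "bypassed ?m"
  then obtain p q W \<kappa> C where p: "p \<in> mspace ?m" "q \<in> mspace ?m" and \<kappa>: "\<kappa> > 0" and dis: "W True \<inter> W False = {}"
    and W: "\<And>e::bool. W e \<noteq> {}" "\<And>e. W e \<subseteq> mspace ?m - {p, q}" "\<And>e y. y \<in> W e \<Longrightarrow> mdist ?m p y \<le> C"
      "\<And>e y z. y \<in> W e \<Longrightarrow> z \<in> mspace ?m \<Longrightarrow> mdist ?m y z < \<kappa> * min (mdist ?m p y) (mdist ?m q y) \<Longrightarrow> z \<in> W e"
    unfolding bypassed_def by metis
  interpret m: Metric_space "mspace ?m" "mdist ?m" by (rule Metric_space_mspace_mdist)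
  have seg: "y(j := b) \<in> W e" if "y \<in> W e" "j < k" "\<And>c. c \<in> closed_segment (y j) b \<Longrightarrow> y(j := c) \<noteq> p \<and> y(j := c) \<noteq> q" for y j b e
    by (rule coordinate_segment[where W = "W e" and a = "y j" and \<kappa> = \<kappa> and p = p and q = q and k = k])
      (use W(4)[of _ e] \<kappa> p W(2)[of e] that in auto)
  have hit: "\<exists>c. c \<in> closed_segment (y j) b \<and> (y(j := c) = p \<or> y(j := c) = q)"
    if y: "y \<in> W e" and j: "j < k" and b: "\<bar>y j - b\<bar> > 2 * C" for y j b e
  proof (rule ccontr)
    assume *: "\<not> ?thesis"
    have "y(j := b) \<in> W e" by (rule seg[OF y j]) (use * in blast)
    then have "mdist ?m p (y(j := b)) \<le> C" "y(j := b) \<in> mspace ?m" using W(2,3) by blast+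
    moreover have "mdist ?m p y \<le> C" "y \<in> mspace ?m" using y W(2,3) by blast+
    ultimately have "mdist ?m y (y(j := b)) \<le> 2 * C" using m.triangle[of y p "y(j := b)"] p(1) m.commute[of y p] by auto
    then show False using mdist_coordinate_line[OF j, of y "y j" b] b by simp
  qed
  have right: "\<exists>c > y j. y(j := c) = p \<or> y(j := c) = q" and left: "\<exists>c < y j. y(j := c) = p \<or> y(j := c) = q"
    if y: "y \<in> W e" and j: "j < k" for y j e
  proof -
    have ne: "y \<noteq> p" "y \<noteq> q" using y W(2) by blast+
    obtain c where c: "c \<in> closed_segment (y j) (y j + (2 * \<bar>C\<bar> + 1))" "y(j := c) = p \<or> y(j := c) = q"
      using hit[OF y j, of "y j + (2 * \<bar>C\<bar> + 1)"] by force
    obtain c' where c': "c' \<in> closed_segment (y j) (y j - (2 * \<bar>C\<bar> + 1))" "y(j := c') = p \<or> y(j := c') = q"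
      using hit[OF y j, of "y j - (2 * \<bar>C\<bar> + 1)"] by force
    have "c \<noteq> y j" "c' \<noteq> y j" using c(2) c'(2) ne by auto
    moreover have "y j \<le> c" "c' \<le> y j" using c(1) c'(1) by (auto simp: closed_segment_eq_real_ivl split: if_splits)
    ultimately show "\<exists>c > y j. y(j := c) = p \<or> y(j := c) = q" "\<exists>c < y j. y(j := c) = p \<or> y(j := c) = q"
      using c(2) c'(2) by (auto intro: exI[of _ c] exI[of _ c'])
  qed
  obtain y y' where y: "y \<in> W True" and y': "y' \<in> W False" using W(1) by blast
  \<comment> \<open>In dimension 0 there is only one point. In dimension 1 both pieces lie between
    \<open>p\<close> and \<open>q\<close>, and the segment from one piece to the other avoids these
    points. From dimension 2 on, three coordinate rays from \<open>y\<close> would have to hit two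
    points in three distinct places.\<close>
  consider "k = 0" | "k = 1" | "k \<ge> 2" by linarith
  then show False
  proof cases
    case 1
    have "y \<in> mspace ?m" "y \<noteq> p" using y W(2) by blast+
    then show False using p(1) 1 by (auto simp: fun_eq_iff)
  next
    case 2
    have b: "(\<exists>c > x 0. x(0 := c) = p \<or> x(0 := c) = q)" "(\<exists>c < x 0. x(0 := c) = p \<or> x(0 := c) = q)" if "x \<in> W e" for x e
      using right[OF that, of 0] left[OF that, of 0] 2 by auto
    have pb: "p 0 < x 0 \<and> x 0 < q 0 \<or> q 0 < x 0 \<and> x 0 < p 0" if "x \<in> W e" for x e
      using b[OF that] by (metis fun_upd_same order.asym)
    have "y' = y(0 := y' 0)"
    proof
      fix i
      have "y \<in> mspace ?m" "y' \<in> mspace ?m" using y y' W(2) by blast+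
      then show "y' i = (y(0 := y' 0)) i" using 2 by (cases i) auto
    qed
    moreover have "y(0 := y' 0) \<in> W True"
    proof (rule seg[OF y])
      fix c assume "c \<in> closed_segment (y 0) (y' 0)"
      then have "c \<noteq> p 0" "c \<noteq> q 0" using pb[OF y] pb[OF y'] by (auto simp: closed_segment_eq_real_ivl split: if_splits)
      then show "y(0 := c) \<noteq> p \<and> y(0 := c) \<noteq> q" by auto
    qed (use 2 in simp)
    ultimately show False using dis y' by auto
  next
    case 3
    obtain c1 c2 c3 where c: "c1 > y 0" "y(0 := c1) = p \<or> y(0 := c1) = q" "c2 < y 0" "y(0 := c2) = p \<or> y(0 := c2) = q"
      "c3 > y 1" "y(1 := c3) = p \<or> y(1 := c3) = q"
      using right[OF y, of 0] left[OF y, of 0] right[OF y, of 1] 3 by auto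
    have "y(0 := c1) \<noteq> y(0 := c2)" "y(0 := c1) \<noteq> y(1 := c3)" "y(0 := c2) \<noteq> y(1 := c3)"
      using c(1,3,5) by (auto simp: fun_eq_iff)
    then show False using c by metis
  qed
qed

section \<open>Diamonds at small scales and their ultralimits\<close>

text \<open>The same configuration at scale \<open>r\<close> near a point, with uniform constants.\<close>

definition diamond :: "'a metric \<Rightarrow> 'a \<Rightarrow> real \<Rightarrow> 'a \<Rightarrow> 'a \<Rightarrow> (bool \<Rightarrow> 'a set) \<Rightarrow> (bool \<Rightarrow> 'a) \<Rightarrow> bool" where
  "diamond m x r p q W u \<longleftrightarrow> p \<in> mspace m \<and> q \<in> mspace m \<and> mdist m x p \<le> r \<and> mdist m x q \<le> r \<and>
     W True \<inter> W False = {} \<and>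
     (\<forall>e. W e \<subseteq> mspace m \<and> u e \<in> W e \<and> r / 4 \<le> mdist m p (u e) \<and> r / 4 \<le> mdist m q (u e) \<and>
       (\<forall>y\<in>W e. mdist m p y \<le> r \<and>
          (\<forall>z\<in>mspace m. mdist m y z < min (mdist m p y) (mdist m q y) \<longrightarrow> z \<in> W e)))"

lemma diamond_scale:
  assumes "c > 0" "diamond m x r p q W u"
  shows "diamond (scale_metric c m) x (c * r) p q W u"
proof -
  have s: "mspace (scale_metric c m) = mspace m" "mdist (scale_metric c m) y z = c * mdist m y z" for y z
    unfolding scale_metric_def Metric_space.mspace_metric[OF Metric_space_scale[OF assms(1)]]
      Metric_space.mdist_metric[OF Metric_space_scale[OF assms(1)]] by auto
  have "c * a < min (c * b) (c * b') \<longleftrightarrow> a < min b b'" for a b b' :: real using assms(1) by auto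
  moreover have "c * r / 4 \<le> c * a \<longleftrightarrow> r / 4 \<le> a" for a :: real using mult_le_cancel_left_pos[OF assms(1), of "r / 4" a] by simp
  ultimately show ?thesis using assms unfolding diamond_def s by auto
qed

locale pointed_ultralimit =
  fixes \<omega> and M :: "nat \<Rightarrow> 'a metric" and x :: "nat \<Rightarrow> 'a"
  assumes \<omega>: "nonprincipal_ultrafilter \<omega>" and x: "\<And>i. x i \<in> mspace (M i)"
begin

abbreviation "Q \<equiv> ultra_points \<omega> M x"
abbreviation "T \<equiv> ultralimit \<omega> M x"
abbreviation "B \<equiv> bounded_seqs M x"

definition cls :: "(nat \<Rightarrow> 'a) \<Rightarrow> (nat \<Rightarrow> 'a) set" where
  "cls y = {z \<in> B. ultra_dist \<omega> M y z = 0}"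

lemma proper: "\<omega> \<noteq> bot" using \<omega> by (simp add: nonprincipal_ultrafilter_def)

lemma seq_in: "y \<in> B \<Longrightarrow> y i \<in> mspace (M i)" by (simp add: bounded_seqs_def)

lemma tri: "y \<in> B \<Longrightarrow> z \<in> B \<Longrightarrow> w \<in> B \<Longrightarrow> mdist (M i) (y i) (w i) \<le> mdist (M i) (y i) (z i) + mdist (M i) (z i) (w i)"
  by (intro Metric_space.triangle[OF Metric_space_mspace_mdist] seq_in)

lemma dist_limit: "((\<lambda>i. mdist (M i) (y i) (z i)) \<longlongrightarrow> ultra_dist \<omega> M y z) \<omega>" if yz: "y \<in> B" "z \<in> B"
proof -
  obtain C D where CD: "\<And>i. mdist (M i) (x i) (y i) \<le> C" "\<And>i. mdist (M i) (x i) (z i) \<le> D"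
    using yz unfolding bounded_seqs_def by blast
  have "\<bar>mdist (M i) (y i) (z i)\<bar> \<le> C + D" for i
  proof -
    interpret m: Metric_space "mspace (M i)" "mdist (M i)" by (rule Metric_space_mspace_mdist)
    show ?thesis using m.triangle[OF seq_in[OF yz(1), of i] x seq_in[OF yz(2), of i]] m.commute[of "y i" "x i"] m.nonneg[of "y i" "z i"] CD[of i]
      by linarith
  qed
  then show ?thesis unfolding ultra_dist_def by (rule ultrafilter_convergent[OF \<omega>])
qed

lemma ultra_dist_nonneg: "y \<in> B \<Longrightarrow> z \<in> B \<Longrightarrow> 0 \<le> ultra_dist \<omega> M y z"
  by (rule tendsto_lowerbound[OF dist_limit _ proper]) auto

lemma ultra_dist_sym: "ultra_dist \<omega> M y z = ultra_dist \<omega> M z y"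
  unfolding ultra_dist_def by (simp add: Metric_space.commute[OF Metric_space_mspace_mdist])

lemma ultra_dist_self: "y \<in> B \<Longrightarrow> ultra_dist \<omega> M y y = 0"
proof -
  assume y: "y \<in> B"
  have "mdist (M i) (y i) (y i) = 0" for i using seq_in[OF y, of i] by simp
  then show ?thesis using tendsto_unique[OF proper dist_limit[OF y y]] by simp
qed

lemma ultra_dist_triangle: "y \<in> B \<Longrightarrow> z \<in> B \<Longrightarrow> w \<in> B \<Longrightarrow> ultra_dist \<omega> M y w \<le> ultra_dist \<omega> M y z + ultra_dist \<omega> M z w"
  by (rule tendsto_le[OF proper tendsto_add[OF dist_limit dist_limit] dist_limit]) (use tri in auto)

lemma in_Q_iff: "A \<in> Q \<longleftrightarrow> (\<exists>y\<in>B. A = cls y)"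
  by (simp add: cls_def ultra_points_def quotient_def)

lemma in_cls: "y \<in> B \<Longrightarrow> y \<in> cls y" by (simp add: cls_def ultra_dist_self)

lemma in_Q_B: "A \<in> Q \<Longrightarrow> y \<in> A \<Longrightarrow> y \<in> B" by (auto simp: in_Q_iff cls_def)

lemma cls_dist0: "A \<in> Q \<Longrightarrow> y \<in> A \<Longrightarrow> z \<in> A \<Longrightarrow> ultra_dist \<omega> M y z = 0"
proof -
  assume A: "A \<in> Q" "y \<in> A" "z \<in> A"
  then obtain w where w: "w \<in> B" "A = cls w" by (auto simp: in_Q_iff)
  then have "y \<in> B" "z \<in> B" "ultra_dist \<omega> M w y = 0" "ultra_dist \<omega> M w z = 0" using A by (auto simp: cls_def)
  then show ?thesis using ultra_dist_triangle[of y w z] w(1) ultra_dist_nonneg[of y z] ultra_dist_sym[of y w] by simp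
qed

lemma mspace_T: "mspace T = Q"
  unfolding ultralimit_def by (rule Metric_space.mspace_metric[OF Metric_space_ultralimit[OF \<omega> x]])

lemma mdist_T:
  assumes A: "A \<in> Q" "C \<in> Q" and yz: "y \<in> A" "z \<in> C"
  shows "((\<lambda>i. mdist (M i) (y i) (z i)) \<longlongrightarrow> mdist T A C) \<omega>"
proof -
  let ?y = "SOME y. y \<in> A" and ?z = "SOME z. z \<in> C"
  have s: "?y \<in> A" "?z \<in> C" using yz by (metis someI)+
  note B = in_Q_B[OF A(1) yz(1)] in_Q_B[OF A(2) yz(2)] in_Q_B[OF A(1) s(1)] in_Q_B[OF A(2) s(2)]
  have 0: "ultra_dist \<omega> M y ?y = 0" "ultra_dist \<omega> M z ?z = 0" using cls_dist0 A yz s by blast+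
  have "mdist T A C = ultra_dist \<omega> M ?y ?z"
    unfolding ultralimit_def Metric_space.mdist_metric[OF Metric_space_ultralimit[OF \<omega> x]] using A by simp
  also have "\<dots> = ultra_dist \<omega> M y z"
    using ultra_dist_triangle[OF B(1,3,2)] ultra_dist_triangle[OF B(3,4,2)] ultra_dist_triangle[OF B(3,1,4)] ultra_dist_triangle[OF B(1,2,4)]
      ultra_dist_sym[of ?z z] ultra_dist_sym[of ?y y] 0 by simp
  finally show ?thesis using dist_limit[OF B(1,2)] by simp
qed

text \<open>A point of the ultralimit belongs to the piece \<open>V e\<close> if a representing
  sequence is in \<open>W i e\<close> for \<open>\<omega>\<close>-almost all \<open>i\<close>. A
  strict inequality between limits holds for almost all indices, so the closeness condition passes
  to the limit, and away from \<open>p\<close> and \<open>q\<close> the choice of the representative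
  does not matter. The points \<open>u i e\<close> keep the pieces nonempty; this needs their
  distances from \<open>p\<close> and \<open>q\<close> to be bounded below.\<close>

lemma bypassed_ultralimit:
  assumes D: "\<And>i. diamond (M i) (x i) 1 (p i) (q i) (W i) (u i)"
  shows "bypassed T"
proof -
  note m = Metric_space_mspace_mdist
  have D': "p i \<in> mspace (M i)" "q i \<in> mspace (M i)" "mdist (M i) (x i) (p i) \<le> 1" "mdist (M i) (x i) (q i) \<le> 1"
     "W i True \<inter> W i False = {}" "W i e \<subseteq> mspace (M i)" "u i e \<in> W i e" "1 / 4 \<le> mdist (M i) (p i) (u i e)" "1 / 4 \<le> mdist (M i) (q i) (u i e)"
     "y \<in> W i e \<Longrightarrow> mdist (M i) (p i) y \<le> 1"
     "y \<in> W i e \<Longrightarrow> z \<in> mspace (M i) \<Longrightarrow> mdist (M i) y z < min (mdist (M i) (p i) y) (mdist (M i) (q i) y) \<Longrightarrow> z \<in> W i e"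
    for i e y z using D[of i] unfolding diamond_def by blast+
  have pq: "p \<in> B" "q \<in> B" using D'(1-4) unfolding bounded_seqs_def by blast+
  have uB: "(\<lambda>i. u i e) \<in> B" for e
  proof -
    have "mdist (M i) (x i) (u i e) \<le> 2" for i
      using Metric_space.triangle[OF m[of "M i"] x[of i] D'(1)[of i], of "u i e"] D'(3)[of i] D'(10)[of "u i e" i e] D'(6,7)[of i e] by force
    then show ?thesis using D'(6,7) unfolding bounded_seqs_def by blast
  qed
  define V where "V e = {A \<in> Q. \<exists>y\<in>A. eventually (\<lambda>i. y i \<in> W i e) \<omega>} - {cls p, cls q}" for e
  have pQ: "cls p \<in> Q" "cls q \<in> Q" "p \<in> cls p" "q \<in> cls q" using pq in_cls by (auto simp: in_Q_iff)
  have close: "eventually (\<lambda>i. z i \<in> W i e) \<omega>"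
    if A: "A \<in> Q" "C \<in> Q" "y \<in> A" "z \<in> C" "eventually (\<lambda>i. y i \<in> W i e) \<omega>" "mdist T A C < min (mdist T (cls p) A) (mdist T (cls q) A)" for A C y z e
  proof -
    have "eventually (\<lambda>i. mdist (M i) (y i) (z i) < min (mdist (M i) (p i) (y i)) (mdist (M i) (q i) (y i))) \<omega>"
    proof -
      have l: "((\<lambda>i. min (mdist (M i) (p i) (y i)) (mdist (M i) (q i) (y i)) - mdist (M i) (y i) (z i)) \<longlongrightarrow>
          min (mdist T (cls p) A) (mdist T (cls q) A) - mdist T A C) \<omega>"
        by (intro tendsto_diff tendsto_min mdist_T A pQ)
      show ?thesis using order_tendstoD(1)[OF l, of 0] A(6) by simp
    qed
    then show ?thesis using A(5)
    proof eventually_elim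
      case (elim i)
      then show ?case using D'(11)[of "y i" i e "z i"] seq_in[OF in_Q_B[OF A(2,4)]] by blast
    qed
  qed
  interpret T: Metric_space "mspace T" "mdist T" by (rule m)
  have pos: "0 < mdist T (cls p) A" "0 < mdist T (cls q) A" if "A \<in> V e" for A e
    using that pQ T.mdist_pos_eq[of "cls p" A] T.mdist_pos_eq[of "cls q" A] unfolding V_def mspace_T by auto
  show ?thesis
    unfolding bypassed_def mspace_T
  proof (rule bexI[OF _ pQ(1)], rule bexI[OF _ pQ(2)], intro exI[of _ V] exI[of _ 1] conjI allI ballI impI)
    show "V True \<inter> V False = {}"
    proof (rule ccontr)
      assume "V True \<inter> V False \<noteq> {}"
      then obtain A where A: "A \<in> V True" "A \<in> V False" by blast
      then obtain y z where yz: "A \<in> Q" "y \<in> A" "eventually (\<lambda>i. y i \<in> W i True) \<omega>" "z \<in> A" "eventually (\<lambda>i. z i \<in> W i False) \<omega>"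
        unfolding V_def by blast
      have "mdist T A A = 0" using yz(1) by (simp add: mspace_T)
      then have "eventually (\<lambda>i. z i \<in> W i True) \<omega>"
        using close[OF yz(1,1,2,4,3)] pos[OF A(1)] by simp
      with yz(5) have "eventually (\<lambda>i. False) \<omega>" by eventually_elim (use D'(5) in blast)
      then show False using proper by simp
    qed
    fix e
    have ud: "mdist T (cls r) (cls (\<lambda>i. u i e)) \<ge> 1 / 4" if "r \<in> B" "\<And>i. mdist (M i) (r i) (u i e) \<ge> 1 / 4" for r
      by (rule tendsto_lowerbound[OF mdist_T _ proper, of _ _ r "\<lambda>i. u i e"]) (use that uB in_cls in \<open>auto simp: in_Q_iff\<close>)
    have "cls (\<lambda>i. u i e) \<in> Q" using uB by (auto simp: in_Q_iff)
    moreover have "cls (\<lambda>i. u i e) \<noteq> cls p" "cls (\<lambda>i. u i e) \<noteq> cls q"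
      using pQ ud[OF pq(1) D'(8)] ud[OF pq(2) D'(9)] by (auto simp: mspace_T)
    moreover have "\<exists>y\<in>cls (\<lambda>i. u i e). eventually (\<lambda>i. y i \<in> W i e) \<omega>"
      using in_cls[OF uB[of e]] D'(7)[of _ e] by (intro bexI[of _ "\<lambda>i. u i e"]) auto
    ultimately show "V e \<noteq> {}" unfolding V_def by blast
    show "V e \<subseteq> Q - {cls p, cls q}" by (auto simp: V_def)
    fix A assume A: "A \<in> V e"
    then obtain y where y: "A \<in> Q" "y \<in> A" "eventually (\<lambda>i. y i \<in> W i e) \<omega>" unfolding V_def by blast
    have "eventually (\<lambda>i. mdist (M i) (p i) (y i) \<le> 1) \<omega>" using y(3) by eventually_elim (use D'(10) in blast)
    then show "mdist T (cls p) A \<le> 1" by (rule tendsto_upperbound[OF mdist_T[OF pQ(1) y(1) pQ(3) y(2)] _ proper])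
    fix C assume C: "C \<in> Q" "mdist T A C < 1 * min (mdist T (cls p) A) (mdist T (cls q) A)"
    obtain z where z: "z \<in> C" using C(1) in_cls by (auto simp: in_Q_iff)
    have "eventually (\<lambda>i. z i \<in> W i e) \<omega>" using close[OF y(1) C(1) y(2) z y(3)] C(2) by simp
    moreover have "C \<noteq> cls p" "C \<noteq> cls q" using C(2) T.commute[of A] by auto
    ultimately show "C \<in> V e" unfolding V_def using C(1) z by blast
  qed simp
qed

end

text \<open>\<open>p\<close> and \<open>q\<close> are the ends of the middle half of a closed cell
  of level \<open>s\<close> that contains the height of \<open>x\<close>, on a path through
  \<open>x\<close>. The pieces are the two copies of this middle half between \<open>p\<close> and
  \<open>q\<close>, and their midpoints have distance a quarter of the scale from both. To leave a
  copy without leaving the heights of the band means to be separated at a level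
  \<open>j \<le> s\<close>, and the band of that level reaches at least as far as \<open>p\<close>
  and \<open>q\<close>.\<close>

lemma diamond_LS:
  assumes x: "x \<in> LS S" and s: "s \<in> S"
  shows "\<exists>p q W u. diamond (minf S) (Psi x) (1 / 4 ^ s) p q W u"
proof -
  have x01: "0 \<le> snd x" "snd x \<le> 1" using x by (auto simp: LS_def)
  obtain k where k: "k < 4 ^ s" "snd x \<in> cell s k" by (rule cell_ex[OF x01])
  define l h mid where "l = lo s (int k)" and "h = hi s (int k)" and "mid = (lo s (int k) + hi s (int k)) / 2"
  have lh: "4 ^ s * l = real k + 1 / 4" "4 ^ s * h = real k + 3 / 4" "4 ^ s * mid = real k + 1 / 2"
    by (auto simp: l_def h_def mid_def lo_def hi_def field_simps)
  have len: "mid - l = 1 / 4 / 4 ^ s" "h - mid = 1 / 4 / 4 ^ s" "h - l = 1 / 2 / 4 ^ s"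
    by (auto simp: l_def h_def mid_def lo_def hi_def field_simps)
  have lt: "l < mid" "mid < h" using len by (smt (verit) divide_pos_pos zero_less_power)+
  have cl: "l \<in> cell s k" "h \<in> cell s k" "mid \<in> cell s k" unfolding cell_iff lh by auto
  note l01 = cell_01[OF k(1) cl(1)] and h01 = cell_01[OF k(1) cl(2)] and m01 = cell_01[OF k(1) cl(3)]
  have mb: "mid \<in> bandc s (int k)" using lt by (simp add: bandc_iff l_def h_def)
  have xd: "\<bar>snd x - t\<bar> \<le> 1 / 4 ^ s" if "t \<in> cell s k" for t
    using k(2) that unfolding cell_def by (auto simp: add_divide_distrib)
  have fx: "fst x \<subseteq> S" using x by (simp add: LS_def)
  define p q where "p = pt (fst x) l" and "q = pt (fst x) h"
  have pL: "p \<in> LS S" "q \<in> LS S" unfolding p_def q_def using fx l01 h01 by (auto intro: LS_pt)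
  have nest: "t \<in> band j \<longleftrightarrow> l \<in> band j" if "j < s" "l \<le> t" "t \<le> h" for j t
    using bandc_nested[OF that(1), of "int k" t _ l] bandc_nested[OF that(1), of "int k" l _ t] that lt unfolding l_def h_def band_def by auto
  define W where "W e = {y \<in> LS S. snd y \<in> bandc s (int k) \<and> (s \<in> fst y \<longleftrightarrow> e) \<and> (\<forall>j<s. j \<in> fst y \<longleftrightarrow> j \<in> fst p)}" for e
  define u where "u e = pt ((fst x \<inter> {..<s}) \<union> (if e then {s} else {})) mid" for e
  have dist: "dd p y = snd y - l" "dd q y = h - snd y" if y: "y \<in> W e" for y e
  proof -
    have yb: "l < snd y" "snd y < h" using y by (auto simp: W_def bandc_iff l_def h_def)
    have ys: "y = pt (fst y) (snd y)" using y LS_eq_pt unfolding W_def by fastforce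
    have "p = pt (fst y) l"
      unfolding p_def pt_eq_iff
    proof (intro conjI allI impI)
      fix j assume j: "l \<in> band j"
      then have "j < s" using end_not_band(1)[of s j "int k"] unfolding l_def by (meson not_le)
      then show "j \<in> fst x \<longleftrightarrow> j \<in> fst y" using y j unfolding W_def p_def mem_fst_pt by auto
    qed simp
    then have "dd p y = \<bar>l - snd y\<bar>" using dd_path[of "fst y" l "snd y"] ys by simp
    then show "dd p y = snd y - l" using yb by simp
    have "q = pt (fst y) h"
      unfolding q_def pt_eq_iff
    proof (intro conjI allI impI)
      fix j assume j: "h \<in> band j"
      then have "j < s" using end_not_band(2)[of s j "int k"] unfolding h_def by (meson not_le)
      moreover have "l \<in> band j" using nest[OF \<open>j < s\<close>, of h] j lt by simp
      ultimately show "j \<in> fst x \<longleftrightarrow> j \<in> fst y" using y unfolding W_def p_def mem_fst_pt by auto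
    qed simp
    then have "dd q y = \<bar>h - snd y\<bar>" using dd_path[of "fst y" h "snd y"] ys by simp
    then show "dd q y = h - snd y" using yb by simp
  qed
  have closed: "z \<in> W e" if y: "y \<in> W e" and z: "z \<in> LS S" and d: "dd y z < min (dd p y) (dd q y)" for y z e
  proof (rule ccontr)
    assume nz: "z \<notin> W e"
    have yb: "snd y \<in> bandc s (int k)" using y by (simp add: W_def)
    have d': "dd y z < snd y - l" "dd y z < h - snd y" using d dist[OF y] by auto
    then have zb: "snd z \<in> bandc s (int k)" using dd_ge_abs[of y z] by (auto simp: bandc_iff l_def h_def)
    have "\<exists>j n. j \<le> s \<and> sep j y z \<and> snd y \<in> bandc j n"
    proof (cases "(s \<in> fst y) = (s \<in> fst z)")
      case False
      then show ?thesis using yb zb unfolding sep_def by blast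
    next
      case True
      then obtain j where j: "j < s" "(j \<in> fst y) \<noteq> (j \<in> fst z)" using nz y z zb unfolding W_def by blast
      then have "snd y \<in> band j \<or> snd z \<in> band j" using y z unfolding W_def LS_def by blast
      then obtain n where "snd y \<in> bandc j n \<or> snd z \<in> bandc j n" unfolding band_def by blast
      then have "snd y \<in> bandc j n \<and> snd z \<in> bandc j n"
        using bandc_nested[OF j(1), of "int k" "snd y" n "snd z"] bandc_nested[OF j(1), of "int k" "snd z" n "snd y"] yb zb
        unfolding bandc_iff[of _ s] by auto
      then show ?thesis using j unfolding sep_def by (meson less_imp_le)
    qed
    then obtain j n where j: "j \<le> s" "sep j y z" "snd y \<in> bandc j n" by blast
    have zj: "snd z \<in> bandc j n" using j(2,3) bandc_unique unfolding sep_def by metis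
    have "lo j n \<le> l \<and> h \<le> hi j n"
      using bandc_unique[OF yb, of n] j(3) lo_hi_nested[OF _ yb j(3)] j(1) by (fastforce simp: l_def h_def)
    moreover have "min (snd y - lo j n) (hi j n - snd y) \<le> dd y z"
      using detour_ge_min[OF j(3) zj] dd_ge_detour[OF j(2,3)] by linarith
    ultimately show False using d' by auto
  qed
  have uW: "u e \<in> W e" for e
  proof -
    have "u e \<in> LS S" unfolding u_def using fx s m01 by (intro LS_pt) auto
    moreover have "s \<in> fst (u e) \<longleftrightarrow> e" using bandI[OF mb] by (auto simp: u_def mem_fst_pt)
    moreover have "j \<in> fst (u e) \<longleftrightarrow> j \<in> fst p" if "j < s" for j
      using that nest[OF that, of mid] lt by (auto simp: u_def p_def mem_fst_pt)
    ultimately show ?thesis using mb by (simp add: W_def u_def)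
  qed
  have WL: "W e \<subseteq> LS S" for e by (auto simp: W_def)
  have PL: "mdist (minf S) (Psi a) (Psi b) = dd a b" if "a \<in> LS S" "b \<in> LS S" for a b using mdist_minf[OF that] .
  have "diamond (minf S) (Psi x) (1 / 4 ^ s) (Psi p) (Psi q) (\<lambda>e. Psi ` W e) (\<lambda>e. Psi (u e))"
    unfolding diamond_def mspace_minf
  proof (intro conjI allI ballI impI)
    show "Psi p \<in> Psi ` LS S" "Psi q \<in> Psi ` LS S" using pL by auto
    have "dd x p = \<bar>snd x - l\<bar>" "dd x q = \<bar>snd x - h\<bar>" using dd_path[of "fst x" "snd x"] LS_eq_pt[OF x] by (simp_all add: p_def q_def)
    then show "mdist (minf S) (Psi x) (Psi p) \<le> 1 / 4 ^ s" "mdist (minf S) (Psi x) (Psi q) \<le> 1 / 4 ^ s"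
      using PL[OF x pL(1)] PL[OF x pL(2)] xd[OF cl(1)] xd[OF cl(2)] by auto
    show "Psi ` W True \<inter> Psi ` W False = {}" using Psi_inj unfolding W_def by blast
    fix e
    show "Psi ` W e \<subseteq> Psi ` LS S" using WL by blast
    show "Psi (u e) \<in> Psi ` W e" using uW by blast
    have uL: "u e \<in> LS S" "snd (u e) = mid" using uW[of e] WL[of e] by (blast, simp add: u_def)
    show "1 / 4 ^ s / 4 \<le> mdist (minf S) (Psi p) (Psi (u e))" "1 / 4 ^ s / 4 \<le> mdist (minf S) (Psi q) (Psi (u e))"
      using PL[OF pL(1) uL(1)] PL[OF pL(2) uL(1)] dist[OF uW[of e]] len uL(2) by auto
    fix y' assume "y' \<in> Psi ` W e"
    then obtain y where y: "y \<in> W e" "y' = Psi y" by blast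
    have yL: "y \<in> LS S" using y WL by blast
    have "snd y \<le> h" using y(1) by (simp add: W_def bandc_iff h_def)
    then have "dd p y \<le> 1 / 4 ^ s"
    proof -
      have "1 / 2 / 4 ^ s \<le> (1::real) / 4 ^ s" by (rule divide_right_mono) auto
      then show ?thesis using dist(1)[OF y(1)] len(3) \<open>snd y \<le> h\<close> by linarith
    qed
    then show "mdist (minf S) (Psi p) y' \<le> 1 / 4 ^ s" using PL[OF pL(1) yL] y(2) by simp
    fix z' assume z': "z' \<in> Psi ` LS S" "mdist (minf S) y' z' < min (mdist (minf S) (Psi p) y') (mdist (minf S) (Psi q) y')"
    then obtain z where z: "z \<in> LS S" "z' = Psi z" by blast
    have "dd y z < min (dd p y) (dd q y)"
      using z'(2) PL[OF yL z(1)] PL[OF pL(1) yL] PL[OF pL(2) yL] unfolding y(2) z(2) by simp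
    then show "z' \<in> Psi ` W e" using closed[OF y(1) z(1)] z(2) by blast
  qed
  then show ?thesis by blast
qed

theorem non_euclidean_tangent_cone:
  assumes S: "infinite S" and x: "x \<in> mspace (minf S)"
  shows "\<exists>T. tangent_cone (minf S) x T \<and> (\<forall>k. \<not> bilipschitz_equivalent T (euclidean_k k))"
proof -
  obtain \<omega> where \<omega>: "nonprincipal_ultrafilter \<omega>" using nonprincipal_ultrafilter_exists by blast
  obtain a where a: "a \<in> LS S" "x = Psi a" using x by (auto simp: mspace_minf)
  \<comment> \<open>A diamond is available only at the levels in \<open>S\<close>, so the scales
    follow their increasing enumeration.\<close>
  define s where "s = enumerate S"
  have s: "strict_mono s" "\<And>i. s i \<in> S" using S by (auto simp: s_def strict_mono_enumerate enumerate_in_set)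
  define r where "r i = (1 / 4 ^ s i :: real)" for i
  have r: "r i > 0" for i by (simp add: r_def)
  have "\<forall>i. \<exists>p q W u. diamond (minf S) x (r i) p q W u" using diamond_LS[OF a(1) s(2)] by (simp add: a(2) r_def)
  then obtain p q W u where D: "\<And>i. diamond (minf S) x (r i) (p i) (q i) (W i) (u i)" by metis
  have D1: "diamond (scale_metric (1 / r i) (minf S)) x 1 (p i) (q i) (W i) (u i)" for i
    using diamond_scale[OF _ D, of "1 / r i" i] r[of i] by simp
  have sm: "mspace (scale_metric c m) = mspace m" if "c > 0" for c m
    unfolding scale_metric_def by (rule Metric_space.mspace_metric[OF Metric_space_scale[OF that]])
  interpret U: pointed_ultralimit \<omega> "\<lambda>i. scale_metric (1 / r i) (minf S)" "\<lambda>_. x"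
  proof
    show "x \<in> mspace (scale_metric (1 / r i) (minf S))" for i using sm[of "1 / r i" "minf S"] r[of i] x by (simp only: zero_less_divide_1_iff)
  qed (rule \<omega>)
  have "bypassed U.T" by (rule U.bypassed_ultralimit[OF D1])
  moreover have "tangent_cone (minf S) x U.T"
    unfolding tangent_cone_def
  proof (intro exI conjI allI)
    show "nonprincipal_ultrafilter \<omega>" "0 < r i" for i using \<omega> r by auto
    show "decseq r" unfolding decseq_def r_def
      using s(1) by (auto intro!: divide_left_mono power_increasing simp: strict_mono_less_eq)
    have "(\<lambda>n. 1 / 4 ^ n :: real) \<longlonglongrightarrow> 0" by (rule LIMSEQ_divide_realpow_zero) auto
    from LIMSEQ_subseq_LIMSEQ[OF this s(1)] show "r \<longlonglongrightarrow> 0" by (simp add: r_def[abs_def] comp_def)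
  qed simp
  ultimately show ?thesis using bypassed_bilipschitz not_bypassed_euclidean by blast
qed

section \<open>Density of edges\<close>

text \<open>In contrast to \<open>cell\<close>, these cells are half-open, so every height in
  \<open>[0, 1)\<close> lies in exactly one of them.\<close>

definition fcell :: "nat \<Rightarrow> real \<Rightarrow> nat" where "fcell N t = nat \<lfloor>4 ^ N * t\<rfloor>"

lemma fcell_iff:
  assumes "0 \<le> t"
  shows "fcell N t = k \<longleftrightarrow> real k \<le> 4 ^ N * t \<and> 4 ^ N * t < real (Suc k)"
proof -
  have "0 \<le> \<lfloor>4 ^ N * t\<rfloor>" using assms by simp
  then have "fcell N t = k \<longleftrightarrow> \<lfloor>4 ^ N * t\<rfloor> = int k" unfolding fcell_def by auto
  then show ?thesis by (simp add: floor_eq_iff add.commute)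
qed

lemma fcell_cell: "0 \<le> t \<Longrightarrow> t \<in> cell N (fcell N t)"
  using fcell_iff[of t N "fcell N t"] by (simp add: cell_iff)

lemma fcell_less: "0 \<le> t \<Longrightarrow> t < 1 \<Longrightarrow> fcell N t < 4 ^ N"
proof -
  assume t: "0 \<le> t" "t < 1"
  have "real (fcell N t) \<le> 4 ^ N * t" using fcell_iff[OF t(1), of N "fcell N t"] by simp
  also have "\<dots> < 4 ^ N * 1" using t(2) by (intro mult_strict_left_mono) auto
  finally have "real (fcell N t) < real (4 ^ N)" by simp
  then show ?thesis unfolding of_nat_less_iff .
qed

lemma fcell_Suc: "fcell N t = fcell (Suc N) t div 4"
  using floor_divide_real_eq_div[of 4 "4 ^ Suc N * t"] by (simp add: fcell_def nat_div_distrib')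

lemma cbits_Suc: "cbits N (k div 4) = cbits (Suc N) k \<inter> {..<N}"
proof -
  have m: "real (k div 4) < 4 ^ N * ((real k + 1 / 2) / 4 ^ Suc N)" "4 ^ N * ((real k + 1 / 2) / 4 ^ Suc N) < real (Suc (k div 4))"
    by (auto simp: of_nat_le_iff)
  have "j \<in> cbits N (k div 4) \<longleftrightarrow> j \<in> cbits (Suc N) k" if "j < N" for j
    using band_interior[OF m that] that by (simp add: cbits_def)
  then show ?thesis using cbits_less[of _ N "k div 4"] by auto
qed

lemma cbits_bandc:
  assumes "j \<in> cbits N k"
  shows "\<exists>n. lo j n \<le> real k / 4 ^ N \<and> real (Suc k) / 4 ^ N \<le> hi j n"
proof -
  obtain n where n: "(real k + 1 / 2) / 4 ^ N \<in> bandc j n" "j < N" using assms by (auto simp: cbits_def band_def)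
  have m: "of_int (int k) \<le> 4 ^ N * ((real k + 1 / 2) / 4 ^ N)" "4 ^ N * ((real k + 1 / 2) / 4 ^ N) \<le> of_int (int k + 1)"
    and s: "of_int (int k) \<le> 4 ^ N * (real k / 4 ^ N)" "4 ^ N * (real k / 4 ^ N) \<le> of_int (int k + 1)"
      "of_int (int k) \<le> 4 ^ N * (real (Suc k) / 4 ^ N)" "4 ^ N * (real (Suc k) / 4 ^ N) \<le> of_int (int k + 1)"
    by simp_all
  show ?thesis using bandc_cell_closed(1)[OF n(2,1) m s(1,2)] bandc_cell_closed(2)[OF n(2,1) m s(3,4)] by blast
qed

definition O1 :: "((nat \<Rightarrow> bool) \<times> real) set" where "O1 = {\<omega>. 0 \<le> snd \<omega> \<and> snd \<omega> < 1}"

text \<open>The equivalence classes are the level \<open>N\<close> edges, as sets of parameters.\<close>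

definition same_edge :: "nat set \<Rightarrow> nat \<Rightarrow> (nat \<Rightarrow> bool) \<times> real \<Rightarrow> (nat \<Rightarrow> bool) \<times> real \<Rightarrow> bool" where
  "same_edge S N \<omega> \<omega>' \<longleftrightarrow> fcell N (snd \<omega>) = fcell N (snd \<omega>') \<and>
     (\<forall>j\<in>S \<inter> cbits N (fcell N (snd \<omega>)). fst \<omega> j = fst \<omega>' j)"

lemma same_edge_refl: "same_edge S N \<omega> \<omega>"
  and same_edge_sym: "same_edge S N \<omega> \<omega>' \<Longrightarrow> same_edge S N \<omega>' \<omega>"
  and same_edge_trans: "same_edge S N \<omega> \<omega>' \<Longrightarrow> same_edge S N \<omega>' \<omega>'' \<Longrightarrow> same_edge S N \<omega> \<omega>''"
  by (auto simp: same_edge_def)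

lemma same_edge_mono: "M \<le> N \<Longrightarrow> same_edge S N \<omega> \<omega>' \<Longrightarrow> same_edge S M \<omega> \<omega>'"
proof (induction N rule: dec_induct)
  case (step N)
  have "same_edge S N \<omega> \<omega>'"
    using step.prems unfolding same_edge_def fcell_Suc[of N] cbits_Suc by auto
  then show ?case by (rule step.IH)
qed

definition saturated :: "nat set \<Rightarrow> nat \<Rightarrow> ((nat \<Rightarrow> bool) \<times> real) set \<Rightarrow> bool" where
  "saturated S N A \<longleftrightarrow> A \<subseteq> O1 \<and> (\<forall>\<omega>\<in>A. \<forall>\<omega>'\<in>O1. same_edge S N \<omega> \<omega>' \<longrightarrow> \<omega>' \<in> A)"

definition edge_set :: "nat set \<Rightarrow> nat \<Rightarrow> nat \<times> nat set \<Rightarrow> ((nat \<Rightarrow> bool) \<times> real) set" where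
  "edge_set S N = (\<lambda>(k, c). {\<beta>. \<forall>j\<in>S \<inter> cbits N k. \<beta> j = (j \<in> c)} \<times> {real k / 4 ^ N..<real (Suc k) / 4 ^ N})"

text \<open>A superset of the neighbourhood of radius \<open>4 ^ K / 4 ^ N\<close> of an edge that
  is still a cylinder times an interval: the bits of all levels that have an end near the cell are
  released. Ends are searched within twice the radius, which leaves room for a detour.\<close>

definition edge_nbhd :: "nat set \<Rightarrow> nat \<Rightarrow> nat \<Rightarrow> nat \<times> nat set \<Rightarrow> ((nat \<Rightarrow> bool) \<times> real) set" where
  "edge_nbhd S K N = (\<lambda>(k, c).
     {\<beta>. \<forall>j\<in>S \<inter> cbits N k - {j. \<exists>t\<in>{(real k - 2 * 4 ^ K) / 4 ^ N..(real k + 1 + 2 * 4 ^ K) / 4 ^ N}. j \<in> ends t}. \<beta> j = (j \<in> c)}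
       \<times> {(real k - 4 ^ K) / 4 ^ N..(real k + 1 + 4 ^ K) / 4 ^ N})"

lemma measure_edge_set:
  assumes "k < 4 ^ N"
  shows "edge_set S N (k, c) \<in> sets Om" "measure Om (edge_set S N (k, c)) = (1 / 2) ^ card (S \<inter> cbits N k) / 4 ^ N"
proof -
  have "{0..1} \<inter> {real k / 4 ^ N..<real (Suc k) / 4 ^ N} = {real k / 4 ^ N..<real (Suc k) / 4 ^ N}"
    using cell_01[OF assms, of "_"] unfolding cell_def by fastforce
  then have "emeasure lborel ({0..1} \<inter> {real k / 4 ^ N..<real (Suc k) / 4 ^ N}) = ennreal (1 / 4 ^ N)"
    by (simp add: diff_divide_distrib[symmetric] divide_right_mono)
  then show "edge_set S N (k, c) \<in> sets Om" "measure Om (edge_set S N (k, c)) = (1 / 2) ^ card (S \<inter> cbits N k) / 4 ^ N"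
    using emeasure_Om_rectangle[of "S \<inter> cbits N k" "{real k / 4 ^ N..<real (Suc k) / 4 ^ N}" "\<lambda>j. j \<in> c"]
    unfolding edge_set_def prod.case by (simp_all add: measure_def ennreal_mult'[symmetric])
qed

text \<open>The bound counts the points of the grid of level \<open>N\<close>, each of which is an end at one level at most.\<close>

lemma card_near_ends:
  fixes a :: int and m :: nat
  shows "finite ({..<N} \<inter> {j. \<exists>t\<in>{of_int a / 4 ^ N..(of_int a + real m) / 4 ^ N}. j \<in> ends t})" (is "finite ?F")
    and "card ({..<N} \<inter> {j. \<exists>t\<in>{of_int a / 4 ^ N..(of_int a + real m) / 4 ^ N}. j \<in> ends t}) \<le> Suc m"
proof -
  show fin: "finite ?F" by simp
  have "?F \<subseteq> (\<Union>z\<in>{a..a + int m}. ends (of_int z / 4 ^ N))"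
  proof
    fix j assume "j \<in> ?F"
    then obtain t where t: "j < N" "of_int a / 4 ^ N \<le> t" "t \<le> (of_int a + real m) / 4 ^ N" "j \<in> ends t" by auto
    obtain n where "t = lo j n \<or> t = hi j n" using t(4) by (auto simp: ends_def)
    then obtain y :: int where y: "t = of_int y / 4 ^ Suc j"
    proof
      assume "t = lo j n" then show ?thesis using that[of "4 * n + 1"] by (simp add: lo_def)
    next
      assume "t = hi j n" then show ?thesis using that[of "4 * n + 3"] by (simp add: hi_def)
    qed
    define z where "z = y * 4 ^ (N - Suc j)"
    have "(4::real) ^ N = 4 ^ (N - Suc j) * 4 ^ Suc j" unfolding power_add[symmetric] using t(1) by simp
    then have z: "t = of_int z / 4 ^ N" unfolding y z_def by simp
    have "(of_int a :: real) \<le> of_int z" "of_int z \<le> (of_int (a + int m) :: real)"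
      using t(2,3) unfolding z by (simp_all add: divide_le_cancel)
    then have "z \<in> {a..a + int m}" unfolding of_int_le_iff by simp
    then show "j \<in> (\<Union>z\<in>{a..a + int m}. ends (of_int z / 4 ^ N))" using t(4) z by blast
  qed
  then have "card ?F \<le> card (\<Union>z\<in>{a..a + int m}. ends (of_int z / (4::real) ^ N))"
    by (intro card_mono) (auto simp: finite_ends)
  also have "\<dots> \<le> (\<Sum>z\<in>{a..a + int m}. card (ends (of_int z / (4::real) ^ N)))" by (rule card_UN_le) simp
  also have "\<dots> \<le> (\<Sum>z\<in>{a..a + int m}. 1)" by (intro sum_mono finite_ends)
  also have "\<dots> = Suc m" by simp
  finally show "card ?F \<le> Suc m" .
qed

text \<open>At most \<open>4 * 4 ^ K + 2\<close> bits are released, each at the cost of a factor 2,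
  and the interval is \<open>2 * 4 ^ K + 1\<close> times as long as the cell. The bound is
  independent of \<open>N\<close>, so it acts as a doubling condition for edges.\<close>

lemma measure_edge_nbhd:
  assumes k: "k < 4 ^ N"
  shows "edge_nbhd S K N (k, c) \<in> sets Om"
    "measure Om (edge_nbhd S K N (k, c)) \<le> 2 ^ (4 * 4 ^ K + 2) * (2 * 4 ^ K + 1) * measure Om (edge_set S N (k, c))"
proof -
  define F where "F = {j. \<exists>t\<in>{(real k - 2 * 4 ^ K) / 4 ^ N..(real k + 1 + 2 * 4 ^ K) / 4 ^ N}. j \<in> ends t}"
  define R where "R = S \<inter> cbits N k"
  define X where "X = {(real k - 4 ^ K) / 4 ^ N..(real k + 1 + 4 ^ K) / (4::real) ^ N}"
  have e: "edge_nbhd S K N (k, c) = {\<beta>. \<forall>j\<in>R - F. \<beta> j = (j \<in> c)} \<times> X" by (simp add: edge_nbhd_def F_def R_def X_def)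
  have R: "finite R" "R \<subseteq> {..<N}" using cbits_less by (auto simp: R_def)
  note m = emeasure_Om_rectangle[of "R - F" X "\<lambda>j. j \<in> c"]
  show "edge_nbhd S K N (k, c) \<in> sets Om" unfolding e using m(1) R(1) by (simp add: X_def)
  have cF: "card ({..<N} \<inter> F) \<le> Suc (4 * 4 ^ K + 1)" "finite ({..<N} \<inter> F)"
    using card_near_ends[of N "int k - 2 * 4 ^ K" "4 * 4 ^ K + 1"] by (auto simp: field_simps F_def)
  have "card R \<le> card ((R - F) \<union> ({..<N} \<inter> F))" using R cF(2) by (intro card_mono) auto
  also have "\<dots> \<le> card (R - F) + (4 * 4 ^ K + 2)" using card_Un_le[of "R - F" "{..<N} \<inter> F"] cF(1) by linarith
  finally have "(1 / 2 :: real) ^ (card (R - F) + (4 * 4 ^ K + 2)) \<le> (1 / 2) ^ card R" by (rule power_decreasing) auto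
  then have p: "(1 / 2 :: real) ^ card (R - F) \<le> 2 ^ (4 * 4 ^ K + 2) * (1 / 2) ^ card R"
    unfolding power_add by (simp add: power_divide field_simps)
  have XL: "emeasure lborel ({0..1} \<inter> X) \<le> ennreal ((2 * 4 ^ K + 1) / 4 ^ N)"
  proof -
    have "emeasure lborel ({0..1} \<inter> X) \<le> emeasure lborel X" by (intro emeasure_mono) (auto simp: X_def)
    also have "\<dots> = ennreal ((2 * 4 ^ K + 1) / 4 ^ N)" unfolding X_def
      by (subst emeasure_lborel_Icc) (auto simp: diff_divide_distrib[symmetric] divide_right_mono)
    finally show ?thesis .
  qed
  have "emeasure Om (edge_nbhd S K N (k, c)) = ennreal ((1 / 2) ^ card (R - F)) * emeasure lborel ({0..1} \<inter> X)"
    unfolding e by (rule m(2)) (use R(1) in \<open>auto simp: X_def\<close>)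
  also have "\<dots> \<le> ennreal (2 ^ (4 * 4 ^ K + 2) * (1 / 2) ^ card R) * ennreal ((2 * 4 ^ K + 1) / 4 ^ N)"
    by (intro mult_mono ennreal_leI p XL) auto
  also have "\<dots> = ennreal (2 ^ (4 * 4 ^ K + 2) * (2 * 4 ^ K + 1) * ((1 / 2) ^ card R / 4 ^ N))"
    by (subst ennreal_mult''[symmetric]) (auto intro!: arg_cong[where f = ennreal])
  finally have le: "emeasure Om (edge_nbhd S K N (k, c)) \<le> ennreal (2 ^ (4 * 4 ^ K + 2) * (2 * 4 ^ K + 1) * ((1 / 2) ^ card R / 4 ^ N))" .
  show "measure Om (edge_nbhd S K N (k, c)) \<le> 2 ^ (4 * 4 ^ K + 2) * (2 * 4 ^ K + 1) * measure Om (edge_set S N (k, c))"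
    unfolding measure_edge_set(2)[OF k] R_def[symmetric] unfolding measure_def
    by (rule enn2real_leI[OF _ le]) simp
qed

lemma mem_fst_Phi: "j \<in> S \<Longrightarrow> cl01 t \<in> band j \<Longrightarrow> j \<in> fst (Phi S (\<beta>, t)) \<longleftrightarrow> \<beta> j"
  by (simp add: Phi_def mem_fst_pt bits_def)

lemma snd_Phi [simp]: "snd (Phi S \<omega>) = cl01 (snd \<omega>)" by (simp add: Phi_def)

text \<open>A point that differs from the edge in a bit without nearby ends is separated from it in
  a band whose ends are more than two radii away from the cell. The heights differ by at most one
  radius, so the detour is longer than the radius.\<close>

lemma edge_nbhdI:
  assumes \<omega>: "\<omega> \<in> O1" and \<omega>': "\<omega>' \<in> edge_set S N (k, c)" and k: "k < 4 ^ N"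
    and d: "dd (Phi S \<omega>) (Phi S \<omega>') \<le> 4 ^ K / 4 ^ N"
  shows "\<omega> \<in> edge_nbhd S K N (k, c)"
proof -
  obtain \<beta> t \<beta>' t' where e: "\<omega> = (\<beta>, t)" "\<omega>' = (\<beta>', t')" by (metis surj_pair)
  have t: "cl01 t = t" using \<omega> by (simp add: e O1_def cl01)
  have tc: "real k / 4 ^ N \<le> t'" "t' < real (Suc k) / 4 ^ N" and bc: "\<And>j. j \<in> S \<Longrightarrow> j \<in> cbits N k \<Longrightarrow> \<beta>' j = (j \<in> c)"
    using \<omega>' by (auto simp: edge_set_def e)
  then have "t' \<in> cell N k" by (simp add: cell_def)
  then have t': "cl01 t' = t'" using cell_01[OF k] cl01(3) by blast
  have ab: "\<bar>t - t'\<bar> \<le> 4 ^ K / 4 ^ N" using dd_ge_abs[of "Phi S \<omega>" "Phi S \<omega>'"] d by (simp add: e t t')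
  have I: "(real k - 4 ^ K) / 4 ^ N \<le> t" "t \<le> (real k + 1 + 4 ^ K) / 4 ^ N"
    using ab tc unfolding diff_divide_distrib add_divide_distrib of_nat_Suc by linarith+
  have "\<beta> j = (j \<in> c)"
    if j: "j \<in> S \<inter> cbits N k" "\<And>t. t \<in> {(real k - 2 * 4 ^ K) / 4 ^ N..(real k + 1 + 2 * 4 ^ K) / 4 ^ N} \<Longrightarrow> j \<notin> ends t" for j
  proof (rule ccontr)
    assume ne: "\<beta> j \<noteq> (j \<in> c)"
    obtain n where "lo j n \<le> real k / 4 ^ N" "real (Suc k) / 4 ^ N \<le> hi j n" using cbits_bandc j(1) by blast
    moreover have p: "(0::real) < 4 ^ K / 4 ^ N" by simp
    moreover have "lo j n \<notin> {(real k - 2 * 4 ^ K) / 4 ^ N..(real k + 1 + 2 * 4 ^ K) / 4 ^ N}"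
      "hi j n \<notin> {(real k - 2 * 4 ^ K) / 4 ^ N..(real k + 1 + 2 * 4 ^ K) / 4 ^ N}"
      using j(2) by (auto simp: ends_def)
    moreover have "(real k + 1 + 2 * 4 ^ K) / 4 ^ N = real (Suc k) / 4 ^ N + 2 * (4 ^ K / 4 ^ N)"
      "(real k - 2 * 4 ^ K) / 4 ^ N = real k / 4 ^ N - 2 * (4 ^ K / 4 ^ N)"
      by (simp_all add: diff_divide_distrib add_divide_distrib)
    moreover have "real k / 4 ^ N \<le> real (Suc k) / 4 ^ N" by (intro divide_right_mono) auto
    ultimately have lh: "lo j n < real k / 4 ^ N - 2 * (4 ^ K / 4 ^ N)" "real (Suc k) / 4 ^ N + 2 * (4 ^ K / 4 ^ N) < hi j n"
      using p by auto
    have b: "t \<in> bandc j n" "t' \<in> bandc j n" unfolding bandc_iff using lh ab tc p by linarith+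
    have "j \<in> fst (Phi S \<omega>) \<longleftrightarrow> \<beta> j" "j \<in> fst (Phi S \<omega>') \<longleftrightarrow> \<beta>' j"
      using mem_fst_Phi j(1) bandI[OF b(1)] bandI[OF b(2)] t t' unfolding e by simp_all
    then have "sep j (Phi S \<omega>) (Phi S \<omega>')" using b ne bc[of j] j(1) unfolding sep_def by (auto simp: e t t')
    then have "detour j n t t' \<le> dd (Phi S \<omega>) (Phi S \<omega>')" using dd_ge_detour[of j "Phi S \<omega>" "Phi S \<omega>'" n] b by (simp add: e t t')
    then show False using d lh ab tc p by (auto simp: detour_def min_def split: if_splits)
  qed
  then show ?thesis using I by (auto simp: edge_nbhd_def e)
qed

lemma edge_set_iff:
  "k < 4 ^ N \<Longrightarrow> \<omega> \<in> edge_set S N (k, c) \<longleftrightarrow> \<omega> \<in> O1 \<and> fcell N (snd \<omega>) = k \<and> (\<forall>j\<in>S \<inter> cbits N k. fst \<omega> j = (j \<in> c))"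
proof -
  assume k: "k < 4 ^ N"
  have "real k / 4 ^ N \<le> t \<and> t < real (Suc k) / 4 ^ N \<longleftrightarrow> real k \<le> 4 ^ N * t \<and> 4 ^ N * t < real (Suc k)" for t
    by (auto simp: divide_le_eq less_divide_eq mult.commute)
  moreover have "0 \<le> t \<and> t < 1" if "real k / 4 ^ N \<le> t \<and> t < real (Suc k) / 4 ^ N" for t
  proof -
    have "real (Suc k) \<le> real (4 ^ N)" using k unfolding of_nat_le_iff by simp
    then have "real (Suc k) / 4 ^ N \<le> 1" by simp
    moreover have "0 \<le> real k / 4 ^ N" by simp
    ultimately show ?thesis using that by linarith
  qed
  moreover obtain \<beta> t where e: "\<omega> = (\<beta>, t)" by (metis surj_pair)
  ultimately have "real k / 4 ^ N \<le> t \<and> t < real (Suc k) / 4 ^ N \<longleftrightarrow> 0 \<le> t \<and> t < 1 \<and> fcell N t = k"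
    using fcell_iff[of t N k] by blast
  then show ?thesis unfolding e edge_set_def O1_def by auto
qed

text \<open>\<open>A\<close> is a finite disjoint union of edges, so the estimate for single edges
  adds up with the same constant.\<close>

lemma saturated_nbhd:
  assumes A: "saturated S N A"
  shows "A \<in> sets Om" "\<exists>B\<in>sets Om. measure Om B \<le> 2 ^ (4 * 4 ^ K + 2) * (2 * 4 ^ K + 1) * measure Om A \<and>
     (\<forall>\<omega>\<in>O1. \<forall>\<omega>'\<in>A. dd (Phi S \<omega>) (Phi S \<omega>') \<le> 4 ^ K / 4 ^ N \<longrightarrow> \<omega> \<in> B)"
proof -
  interpret O: prob_space Om by (rule prob_space_Om)
  define C :: real where "C = 2 ^ (4 * 4 ^ K + 2) * (2 * 4 ^ K + 1)"
  define I where "I = {i \<in> Sigma {..<4 ^ N} (\<lambda>k. Pow (S \<inter> cbits N k)). edge_set S N i \<subseteq> A}"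
  have fin: "finite I" unfolding I_def by (intro finite_Collect_conjI disjI1 finite_SigmaI) auto
  have Ik: "\<exists>k c. i = (k, c) \<and> k < 4 ^ N \<and> c \<subseteq> S \<inter> cbits N k" if "i \<in> I" for i using that by (auto simp: I_def)
  have sets: "edge_set S N i \<in> sets Om" "edge_nbhd S K N i \<in> sets Om"
    "measure Om (edge_nbhd S K N i) \<le> C * measure Om (edge_set S N i)" if "i \<in> I" for i
    using Ik[OF that] measure_edge_set(1) measure_edge_nbhd unfolding C_def by blast+
  have mem: "\<exists>i\<in>I. \<omega> \<in> edge_set S N i" if w: "\<omega> \<in> A" for \<omega>
  proof -
    have w1: "\<omega> \<in> O1" using A w by (auto simp: saturated_def)
    define k where "k = fcell N (snd \<omega>)"
    define c where "c = {j \<in> S \<inter> cbits N k. fst \<omega> j}"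
    have k: "k < 4 ^ N" using w1 fcell_less by (simp add: k_def O1_def)
    have "\<omega> \<in> edge_set S N (k, c)" unfolding edge_set_iff[OF k] using w1 by (auto simp: k_def c_def)
    moreover have "edge_set S N (k, c) \<subseteq> A"
      using edge_set_iff[OF k] A w by (auto simp: same_edge_def k_def c_def saturated_def)
    ultimately show ?thesis using k by (intro bexI[of _ "(k, c)"]) (auto simp: I_def c_def)
  qed
  have AU: "A = (\<Union>i\<in>I. edge_set S N i)" using mem by (auto simp: I_def)
  then show "A \<in> sets Om" using sets(1) fin by auto
  have disj: "disjoint_family_on (edge_set S N) I"
    unfolding disjoint_family_on_def
  proof (intro ballI impI)
    fix i i' assume i: "i \<in> I" "i' \<in> I" "i \<noteq> i'"
    obtain k c k' c' where e: "i = (k, c)" "k < 4 ^ N" "c \<subseteq> S \<inter> cbits N k" "i' = (k', c')" "k' < 4 ^ N" "c' \<subseteq> S \<inter> cbits N k'"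
      using Ik[OF i(1)] Ik[OF i(2)] by blast
    show "edge_set S N i \<inter> edge_set S N i' = {}"
      using ccontr edge_set_iff[OF e(2)] edge_set_iff[OF e(5)] e(3,6) i(3) e by (fastforce simp: e)
  qed
  have "measure Om (\<Union>i\<in>I. edge_nbhd S K N i) \<le> (\<Sum>i\<in>I. measure Om (edge_nbhd S K N i))"
    using sets(2) by (intro O.finite_measure_subadditive_finite fin) auto
  also have "\<dots> \<le> (\<Sum>i\<in>I. C * measure Om (edge_set S N i))" by (intro sum_mono sets(3))
  also have "\<dots> = C * measure Om A"
  proof -
    have "edge_set S N ` I \<subseteq> sets Om" using sets(1) by blast
    from O.finite_measure_finite_Union[OF fin this disj] show ?thesis unfolding AU sum_distrib_left[symmetric] by simp
  qed
  finally have "measure Om (\<Union>i\<in>I. edge_nbhd S K N i) \<le> C * measure Om A" .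
  moreover have "(\<Union>i\<in>I. edge_nbhd S K N i) \<in> sets Om" using sets(2) fin by auto
  moreover have "\<omega> \<in> (\<Union>i\<in>I. edge_nbhd S K N i)"
    if "\<omega> \<in> O1" "\<omega>' \<in> A" "dd (Phi S \<omega>) (Phi S \<omega>') \<le> 4 ^ K / 4 ^ N" for \<omega> \<omega>'
    using mem[OF \<open>\<omega>' \<in> A\<close>] Ik edge_nbhdI[OF that(1) _ _ that(3)] by fastforce
  ultimately show "\<exists>B\<in>sets Om. measure Om B \<le> 2 ^ (4 * 4 ^ K + 2) * (2 * 4 ^ K + 1) * measure Om A \<and>
     (\<forall>\<omega>\<in>O1. \<forall>\<omega>'\<in>A. dd (Phi S \<omega>) (Phi S \<omega>') \<le> 4 ^ K / 4 ^ N \<longrightarrow> \<omega> \<in> B)"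
    unfolding C_def[symmetric] by blast
qed

lemma AE_not_grid: "AE \<omega> in Om. \<omega> \<in> O1 \<and> (\<forall>N (k::nat). snd \<omega> \<noteq> real k / 4 ^ N)"
proof -
  define D where "D = (\<Union>N. range (\<lambda>k::nat. real k / 4 ^ N))"
  have "countable D" by (simp add: D_def)
  then have "AE t in lborel. t \<notin> D" by (intro AE_not_in countable_imp_null_set_lborel)
  then have "AE t in U01. t \<notin> D \<and> 0 \<le> t \<and> t \<le> 1"
    by (intro AE_U01) (auto elim: AE_mp)
  then have "AE \<omega> in Om. snd \<omega> \<notin> D \<and> 0 \<le> snd \<omega> \<and> snd \<omega> \<le> 1" by (rule AE_Om_snd)
  then show ?thesis
  proof (rule AE_mp, intro AE_I2 impI)
    fix \<omega> :: "(nat \<Rightarrow> bool) \<times> real" assume w: "snd \<omega> \<notin> D \<and> 0 \<le> snd \<omega> \<and> snd \<omega> \<le> 1"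
    have nk: "snd \<omega> \<noteq> real k / 4 ^ N" for N and k :: nat using w by (auto simp: D_def)
    from nk[of 1 0] have "snd \<omega> \<noteq> 1" by simp
    then show "\<omega> \<in> O1 \<and> (\<forall>N (k::nat). snd \<omega> \<noteq> real k / 4 ^ N)" using nk w by (auto simp: O1_def)
  qed
qed

text \<open>The height of \<open>\<omega>\<close> is interior to its cell. A point in the same cell
  with a different relevant bit can only be reached through an end of a band, and such ends are at
  least as far as the ends of the cell.\<close>

lemma same_edge_near:
  assumes \<omega>: "\<omega> \<in> O1" "\<And>k::nat. snd \<omega> \<noteq> real k / 4 ^ N"
  shows "\<exists>r>0. \<forall>\<omega>'\<in>O1. dd (Phi S \<omega>) (Phi S \<omega>') < r \<longrightarrow> same_edge S N \<omega> \<omega>'"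
proof -
  obtain \<beta> t where e: "\<omega> = (\<beta>, t)" by (metis surj_pair)
  have t: "0 \<le> t" "cl01 t = t" using \<omega>(1) by (simp_all add: e O1_def cl01)
  define k where "k = fcell N t"
  have "real k \<le> 4 ^ N * t" "4 ^ N * t < real (Suc k)" using fcell_iff[OF t(1), of N k] by (simp_all add: k_def)
  then have k: "real k / 4 ^ N < t" "t < real (Suc k) / 4 ^ N" using \<omega>(2)[of k] by (auto simp: e field_simps le_less)
  define r where "r = min (t - real k / 4 ^ N) (real (Suc k) / 4 ^ N - t)"
  have "r > 0" using k by (simp add: r_def)
  moreover have "same_edge S N \<omega> \<omega>'" if w: "\<omega>' \<in> O1" "dd (Phi S \<omega>) (Phi S \<omega>') < r" for \<omega>'
  proof -
    obtain \<beta>' t' where e': "\<omega>' = (\<beta>', t')" by (metis surj_pair)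
    have t': "0 \<le> t'" "cl01 t' = t'" using w(1) by (simp_all add: e' O1_def cl01)
    have "\<bar>t - t'\<bar> < r" using dd_ge_abs[of "Phi S \<omega>" "Phi S \<omega>'"] w(2) by (simp add: e e' t t')
    then have "real k / 4 ^ N < t'" "t' < real (Suc k) / 4 ^ N" unfolding r_def by linarith+
    then have k': "real k < 4 ^ N * t'" "4 ^ N * t' < real (Suc k)" by (auto simp: field_simps)
    have "fcell N t' = k" using fcell_iff[OF t'(1), of N k] k' by simp
    moreover have "\<beta> j = \<beta>' j" if j: "j \<in> S \<inter> cbits N k" for j
    proof (rule ccontr)
      assume ne: "\<beta> j \<noteq> \<beta>' j"
      obtain n where lh: "lo j n \<le> real k / 4 ^ N" "real (Suc k) / 4 ^ N \<le> hi j n" using cbits_bandc j by blast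
      have b: "t \<in> bandc j n" "t' \<in> bandc j n" unfolding bandc_iff using lh k \<open>real k / 4 ^ N < t'\<close> \<open>t' < real (Suc k) / 4 ^ N\<close> by linarith+
      have "j \<in> fst (Phi S \<omega>) \<longleftrightarrow> \<beta> j" "j \<in> fst (Phi S \<omega>') \<longleftrightarrow> \<beta>' j"
        using mem_fst_Phi j(1) bandI[OF b(1)] bandI[OF b(2)] t t' unfolding e e' by simp_all
      then have "sep j (Phi S \<omega>) (Phi S \<omega>')" using b ne unfolding sep_def by (auto simp: e e' t t')
      then have "detour j n t t' \<le> dd (Phi S \<omega>) (Phi S \<omega>')" using dd_ge_detour[of j "Phi S \<omega>" "Phi S \<omega>'" n] b by (simp add: e e' t t')
      moreover have "min (t - lo j n) (hi j n - t) \<le> detour j n t t'" by (rule detour_ge_min[OF b])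
      ultimately show False using w(2) lh unfolding r_def by linarith
    qed
    ultimately show ?thesis unfolding same_edge_def e e' by (simp add: k_def)
  qed
  ultimately show ?thesis by blast
qed

text \<open>An edge that misses \<open>G\<close> is charged to its largest ancestor that misses \<open>G\<close>. These ancestors are
  disjoint, so the measures of their neighbourhoods are summable and the lemma of Borel and Cantelli
  applies.\<close>

lemma edges_meet:
  assumes G: "G \<subseteq> O1"
  shows "AE \<omega> in Om. \<omega> \<in> G \<longrightarrow> (\<exists>N1. \<forall>N\<ge>N1. \<forall>\<omega>'\<in>O1. dd (Phi S \<omega>) (Phi S \<omega>') \<le> 4 ^ K / 4 ^ N \<longrightarrow>
     (\<exists>\<omega>''\<in>G. same_edge S N \<omega>' \<omega>''))"
proof -
  interpret O: prob_space Om by (rule prob_space_Om)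
  define C :: real where "C = 2 ^ (4 * 4 ^ K + 2) * (2 * 4 ^ K + 1)"
  \<comment> \<open>\<open>H N\<close> is the union of the edges of level \<open>N\<close> that miss
    \<open>G\<close>. It grows with \<open>N\<close>, so \<open>disjointed H N\<close> collects the
    maximal edges of level \<open>N\<close> among those that miss \<open>G\<close>.\<close>
  define H where "H N = {\<omega> \<in> O1. \<forall>\<omega>'\<in>G. \<not> same_edge S N \<omega> \<omega>'}" for N
  have satH: "saturated S N (H M)" if "M \<le> N" for M N
    unfolding saturated_def H_def using same_edge_mono[OF that] same_edge_trans by blast
  have satD: "saturated S N (disjointed H N)" for N
    unfolding saturated_def disjointed_def
  proof (intro conjI ballI impI)
    show "H N - (\<Union>i\<in>{0..<N}. H i) \<subseteq> O1" by (auto simp: H_def)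
    fix \<omega> \<omega>' assume w: "\<omega> \<in> H N - (\<Union>i\<in>{0..<N}. H i)" "\<omega>' \<in> O1" "same_edge S N \<omega> \<omega>'"
    have "\<omega>' \<in> H N" using satH[of N N] w unfolding saturated_def by blast
    moreover have "\<omega>' \<notin> H i" if "i < N" for i
    proof
      assume "\<omega>' \<in> H i"
      then have "\<omega> \<in> H i" using satH[of i N] that same_edge_sym[OF w(3)] w(1) unfolding saturated_def by (metis DiffD1 less_imp_le subsetD order_refl satH saturated_def)
      then show False using w(1) that by auto
    qed
    ultimately show "\<omega>' \<in> H N - (\<Union>i\<in>{0..<N}. H i)" by auto
  qed
  have "\<forall>N. \<exists>B\<in>sets Om. measure Om B \<le> C * measure Om (disjointed H N) \<and>
     (\<forall>\<omega>\<in>O1. \<forall>\<omega>'\<in>disjointed H N. dd (Phi S \<omega>) (Phi S \<omega>') \<le> 4 ^ K / 4 ^ N \<longrightarrow> \<omega> \<in> B)"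
    unfolding C_def using saturated_nbhd(2)[OF satD] by blast
  then obtain B where B: "\<And>N. B N \<in> sets Om" "\<And>N. measure Om (B N) \<le> C * measure Om (disjointed H N)"
    "\<And>N \<omega> \<omega>'. \<omega> \<in> O1 \<Longrightarrow> \<omega>' \<in> disjointed H N \<Longrightarrow> dd (Phi S \<omega>) (Phi S \<omega>') \<le> 4 ^ K / 4 ^ N \<Longrightarrow> \<omega> \<in> B N"
    by metis
  have "(\<lambda>N. measure Om (disjointed H N)) sums measure Om (\<Union>N. disjointed H N)"
    by (rule O.finite_measure_UNION[OF _ disjoint_family_disjointed]) (use saturated_nbhd(1)[OF satD] in auto)
  then have "summable (\<lambda>N. C * measure Om (disjointed H N))" by (intro summable_mult sums_summable)
  then have "summable (\<lambda>N. measure Om (B N))"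
    by (rule summable_comparison_test'[of _ 0]) (use B(2) in auto)
  then have "AE \<omega> in Om. eventually (\<lambda>N. \<omega> \<in> space Om - B N) sequentially"
    by (intro borel_cantelli_AE1 B(1)) (auto simp: O.emeasure_eq_measure)
  with AE_not_grid show ?thesis
  proof eventually_elim
    case (elim \<omega>)
    show ?case
    proof
      assume wG: "\<omega> \<in> G"
      obtain N0 where N0: "\<And>N. N \<ge> N0 \<Longrightarrow> \<omega> \<notin> B N" using elim(2) unfolding eventually_sequentially by blast
      obtain r where r: "r > 0" "\<And>\<omega>'. \<omega>' \<in> O1 \<Longrightarrow> dd (Phi S \<omega>) (Phi S \<omega>') < r \<Longrightarrow> same_edge S N0 \<omega> \<omega>'"
        using same_edge_near[of \<omega> N0 S] elim(1) by blast
      have "(\<lambda>n. 4 ^ K / 4 ^ n :: real) \<longlonglongrightarrow> 0" by (rule LIMSEQ_divide_realpow_zero) auto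
      then have "eventually (\<lambda>n. 4 ^ K / 4 ^ n < r) sequentially" using r(1) by (intro order_tendstoD) auto
      then obtain N1 where N1: "\<And>n. n \<ge> N1 \<Longrightarrow> 4 ^ K / 4 ^ n < r" unfolding eventually_sequentially by blast
      show "\<exists>N1. \<forall>N\<ge>N1. \<forall>\<omega>'\<in>O1. dd (Phi S \<omega>) (Phi S \<omega>') \<le> 4 ^ K / 4 ^ N \<longrightarrow> (\<exists>\<omega>''\<in>G. same_edge S N \<omega>' \<omega>'')"
      proof (intro exI[of _ N1] allI impI ballI)
        fix N \<omega>' assume N: "N \<ge> N1" and w': "\<omega>' \<in> O1" "dd (Phi S \<omega>) (Phi S \<omega>') \<le> 4 ^ K / 4 ^ N"
        have se: "same_edge S N0 \<omega> \<omega>'" using r(2)[OF w'(1)] w'(2) N1[OF N] by simp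
        show "\<exists>\<omega>''\<in>G. same_edge S N \<omega>' \<omega>''"
        proof (rule ccontr)
          assume "\<not> ?thesis"
          then have wN: "\<omega>' \<in> H N" using w'(1) by (simp add: H_def)
          define M where "M = (LEAST M. \<omega>' \<in> H M)"
          have M: "\<omega>' \<in> H M" "M \<le> N" unfolding M_def using wN by (auto intro: LeastI Least_le)
          have "\<omega>' \<notin> H i" if "i < M" for i using not_less_Least that unfolding M_def by blast
          then have "\<omega>' \<in> disjointed H M" using M(1) by (auto simp: disjointed_def)
          moreover have "(4::real) ^ K / 4 ^ N \<le> 4 ^ K / 4 ^ M" using M(2) by (intro divide_left_mono power_increasing) auto
          ultimately have "\<omega> \<in> B M" using B(3)[of \<omega> \<omega>' M] elim(1) w'(2) by simp
          \<comment> \<open>A late \<open>M\<close> is excluded by Borel and Cantelli. For an early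
            \<open>M\<close> the points \<open>\<omega>\<close> and \<open>\<omega>'\<close> lie on
            one edge of level \<open>M\<close>, and this edge meets \<open>G\<close> in
            \<open>\<omega>\<close>.\<close>
          then have "M < N0" using N0 by (meson not_le)
          have "same_edge S M \<omega>' \<omega>" using same_edge_mono[of M N0] \<open>M < N0\<close> same_edge_sym[OF se] by simp
          then show False using M(1) wG by (auto simp: H_def)
        qed
      qed
    qed
  qed
qed

section \<open>Differentiability\<close>

text \<open>The full cells between \<open>s\<close> and \<open>t\<close> are governed by
  \<open>step\<close>. The two incomplete cells at the ends are bounded by the Lipschitz constant,
  each at the cost of \<open>M / 4 ^ N\<close>.\<close>

lemma telescope:
  fixes h :: "real \<Rightarrow> 'v::real_normed_vector"
  assumes lip: "\<And>s t. s \<in> {0..1} \<Longrightarrow> t \<in> {0..1} \<Longrightarrow> norm (h s - h t) \<le> M * \<bar>s - t\<bar>" and M: "M \<ge> 0" and \<epsilon>: "\<epsilon> \<ge> 0"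
    and step: "\<And>k::nat. s \<le> real k / 4 ^ N \<Longrightarrow> real (Suc k) / 4 ^ N \<le> t \<Longrightarrow>
      norm (h (real (Suc k) / 4 ^ N) - h (real k / 4 ^ N)) \<le> \<epsilon> / 4 ^ N"
    and st: "0 \<le> s" "s \<le> t" "t \<le> 1"
  shows "norm (h t - h s) \<le> \<epsilon> * (t - s) + 2 * M / 4 ^ N"
proof -
  define a b where "a = nat \<lceil>4 ^ N * s\<rceil>" and "b = nat \<lfloor>4 ^ N * t\<rfloor>"
  have p: "0 \<le> 4 ^ N * s" "0 \<le> 4 ^ N * t" using st by auto
  have "4 ^ N * s \<le> real a" "real a < 4 ^ N * s + 1" using p(1) unfolding a_def by linarith+
  then have a: "s \<le> real a / 4 ^ N" "real a / 4 ^ N < s + 1 / 4 ^ N" by (auto simp: field_simps)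
  have "real b \<le> 4 ^ N * t" "4 ^ N * t < real b + 1" using p(2) unfolding b_def by linarith+
  then have b: "real b / 4 ^ N \<le> t" "t < real b / 4 ^ N + 1 / 4 ^ N" by (auto simp: field_simps)
  show ?thesis
  proof (cases "a \<le> b")
    case True
    have "norm (h (real (a + n) / 4 ^ N) - h (real a / 4 ^ N)) \<le> real n * (\<epsilon> / 4 ^ N)" if "a + n \<le> b" for n
      using that
    proof (induction n)
      case (Suc n)
      have "real (Suc (a + n)) / 4 ^ N \<le> real b / 4 ^ N" "real a / 4 ^ N \<le> real (a + n) / 4 ^ N"
        using Suc.prems by (auto intro: divide_right_mono)
      then have "norm (h (real (Suc (a + n)) / 4 ^ N) - h (real (a + n) / 4 ^ N)) \<le> \<epsilon> / 4 ^ N"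
        by (metis order_trans[OF a(1)] order_trans[OF _ b(1)] step)
      then have "norm ((h (real (Suc (a + n)) / 4 ^ N) - h (real (a + n) / 4 ^ N)) + (h (real (a + n) / 4 ^ N) - h (real a / 4 ^ N)))
          \<le> \<epsilon> / 4 ^ N + real n * (\<epsilon> / 4 ^ N)"
        using Suc by (intro norm_triangle_mono) auto
      then show ?case by (simp only: distrib_right of_nat_Suc mult_1 add_Suc_right diff_add_cancel add_diff_eq add.commute) simp
    qed simp
    from this[of "b - a"] have m: "norm (h (real b / 4 ^ N) - h (real a / 4 ^ N)) \<le> (real b - real a) * (\<epsilon> / 4 ^ N)"
      using True by (simp add: of_nat_diff)
    also have "\<dots> = \<epsilon> * (real b / 4 ^ N - real a / 4 ^ N)" by (simp add: field_simps)
    also have "\<dots> \<le> \<epsilon> * (t - s)" using a b \<epsilon> by (intro mult_left_mono) auto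
    finally have m: "norm (h (real b / 4 ^ N) - h (real a / 4 ^ N)) \<le> \<epsilon> * (t - s)" .
    have ab: "real a / 4 ^ N \<le> real b / 4 ^ N" using True by (intro divide_right_mono) auto
    have a01: "real a / 4 ^ N \<in> {0..1}" "real b / 4 ^ N \<in> {0..1}" unfolding atLeastAtMost_iff using a b ab st by linarith+
    have "norm (h (real a / 4 ^ N) - h s) \<le> M * \<bar>real a / 4 ^ N - s\<bar>" using st a01 by (intro lip) simp_all
    also have "\<dots> \<le> M * (1 / 4 ^ N)" using a M by (intro mult_left_mono) auto
    finally have 1: "norm (h (real a / 4 ^ N) - h s) \<le> M / 4 ^ N" by simp
    have "norm (h t - h (real b / 4 ^ N)) \<le> M * \<bar>t - real b / 4 ^ N\<bar>" using st a01 by (intro lip) simp_all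
    also have "\<dots> \<le> M * (1 / 4 ^ N)" using b M by (intro mult_left_mono) auto
    finally have 2: "norm (h t - h (real b / 4 ^ N)) \<le> M / 4 ^ N" by simp
    have "h t - h s = (h t - h (real b / 4 ^ N)) + ((h (real b / 4 ^ N) - h (real a / 4 ^ N)) + (h (real a / 4 ^ N) - h s))" by simp
    also have "norm \<dots> \<le> M / 4 ^ N + (\<epsilon> * (t - s) + M / 4 ^ N)" by (intro norm_triangle_mono 1 2 m)
    finally show ?thesis by simp
  next
    case False
    then have "real (Suc b) / 4 ^ N \<le> real a / 4 ^ N" by (intro divide_right_mono) auto
    then have "real b / 4 ^ N + 1 / 4 ^ N \<le> real a / 4 ^ N" by (simp add: add_divide_distrib add.commute)
    then have "t - s \<le> 1 / 4 ^ N" using a b by linarith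
    have "norm (h t - h s) \<le> M * \<bar>t - s\<bar>" using st by (intro lip) auto
    also have "\<dots> \<le> M * (1 / 4 ^ N)" using st M \<open>t - s \<le> 1 / 4 ^ N\<close> by (intro mult_left_mono) auto
    also have "\<dots> \<le> 2 * M / 4 ^ N" using M by (simp add: divide_right_mono)
    also have "\<dots> \<le> \<epsilon> * (t - s) + 2 * M / 4 ^ N" using st \<epsilon> by simp
    finally show ?thesis .
  qed
qed

lemma telescope_abs:
  fixes h :: "real \<Rightarrow> 'v::real_normed_vector"
  assumes lip: "\<And>s t. s \<in> {0..1} \<Longrightarrow> t \<in> {0..1} \<Longrightarrow> norm (h s - h t) \<le> M * \<bar>s - t\<bar>" and M: "M \<ge> 0" and \<epsilon>: "\<epsilon> \<ge> 0"
    and step: "\<And>k::nat. min s t \<le> real k / 4 ^ N \<Longrightarrow> real (Suc k) / 4 ^ N \<le> max s t \<Longrightarrow>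
      norm (h (real (Suc k) / 4 ^ N) - h (real k / 4 ^ N)) \<le> \<epsilon> / 4 ^ N"
    and st: "s \<in> {0..1}" "t \<in> {0..1}"
  shows "norm (h t - h s) \<le> \<epsilon> * \<bar>t - s\<bar> + 2 * M / 4 ^ N"
proof (cases "s \<le> t")
  case True
  then show ?thesis using telescope[where h = h and s = s and t = t and M = M and \<epsilon> = \<epsilon> and N = N, OF lip M \<epsilon> step] st by auto
next
  case False
  then have "norm (h s - h t) \<le> \<epsilon> * (s - t) + 2 * M / 4 ^ N"
    using telescope[where h = h and s = t and t = s and M = M and \<epsilon> = \<epsilon> and N = N, OF lip M \<epsilon> step] st by auto
  then show ?thesis using False by (simp add: norm_minus_commute)
qed

lemma continuous_on_Phi:
  fixes f :: "nat set \<times> real \<Rightarrow> 'v::metric_space"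
  assumes lip: "\<And>x y. x \<in> LS S \<Longrightarrow> y \<in> LS S \<Longrightarrow> dist (f x) (f y) \<le> L * dd x y"
  shows "continuous_on UNIV (\<lambda>\<omega>. f (Phi S \<omega>))"
  unfolding continuous_on_open_vimage[OF open_UNIV]
proof (intro allI impI)
  fix B :: "'v set" assume B: "open B"
  have "open (Phi S -` {x \<in> LS S. f x \<in> B})"
  proof (rule open_Phi_preimage)
    fix x assume x: "x \<in> {x \<in> LS S. f x \<in> B}"
    then obtain e where e: "e > 0" "\<And>y. dist y (f x) < e \<Longrightarrow> y \<in> B" using B unfolding open_dist by blast
    have "y \<in> {x \<in> LS S. f x \<in> B}" if "y \<in> LS S" "dd x y < e / (\<bar>L\<bar> + 1)" for y
    proof -
      have "dist (f y) (f x) \<le> L * dd x y" using lip[of x y] that x by (simp add: dist_commute)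
      also have "\<dots> \<le> (\<bar>L\<bar> + 1) * dd x y" using dd_nonneg by (intro mult_right_mono) auto
      also have "\<dots> < e" using that(2) by (simp add: less_divide_eq mult.commute)
      finally show ?thesis using e(2) that(1) by blast
    qed
    then show "\<exists>r>0. \<forall>y\<in>LS S. dd x y < r \<longrightarrow> y \<in> {x \<in> LS S. f x \<in> B}"
      using e(1) by (intro exI[of _ "e / (\<bar>L\<bar> + 1)"]) auto
  qed
  moreover have "Phi S -` {x \<in> LS S. f x \<in> B} = (\<lambda>\<omega>. f (Phi S \<omega>)) -` B \<inter> UNIV" using Phi_LS by auto
  ultimately show "open ((\<lambda>\<omega>. f (Phi S \<omega>)) -` B \<inter> UNIV)" by simp
qed

text \<open>Along a path through \<open>x\<close> the height changes by exactly the distance. Such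
  points detect the slope, so they give its uniqueness and the convergence of approximate
  slopes.\<close>

lemma vertical_point:
  assumes x: "x \<in> LS S" and r: "r > 0"
  shows "\<exists>y\<in>LS S. dd x y < r \<and> dd x y = \<bar>snd y - snd x\<bar> \<and> snd y \<noteq> snd x"
proof -
  have x01: "0 \<le> snd x" "snd x \<le> 1" "fst x \<subseteq> S" using x by (auto simp: LS_def)
  define s where "s = min (1 / 2) (r / 2)"
  define t where "t = (if snd x \<le> 1 / 2 then snd x + s else snd x - s)"
  have t: "0 \<le> t" "t \<le> 1" "t \<noteq> snd x" "\<bar>t - snd x\<bar> < r" using x01 r by (auto simp: t_def s_def)
  have "dd x (pt (fst x) t) = \<bar>snd x - t\<bar>" using dd_path[of "fst x" "snd x" t] LS_eq_pt[OF x] by simp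
  then show ?thesis using t LS_pt[OF x01(3) t(1,2)] by (intro bexI[of _ "pt (fst x) t"]) (auto simp: abs_minus_commute)
qed

locale lipschitz_into_RNP =
  fixes S :: "nat set" and V :: "'v::banach set" and f :: "nat set \<times> real \<Rightarrow> 'v" and L :: real
  assumes V: "closed V" "subspace V" "RNP V"
    and fV: "\<And>x. x \<in> LS S \<Longrightarrow> f x \<in> V"
    and lip: "\<And>x y. x \<in> LS S \<Longrightarrow> y \<in> LS S \<Longrightarrow> norm (f x - f y) \<le> L * dd x y"
    and L: "L \<ge> 0"
begin

definition g :: "(nat \<Rightarrow> bool) \<times> real \<Rightarrow> 'v" where "g \<omega> = f (Phi S \<omega>)"

lemma continuous_g: "continuous_on UNIV g"
  unfolding g_def by (rule continuous_on_Phi) (use lip in \<open>simp add: dist_norm\<close>)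

lemma gV: "g \<omega> \<in> V" by (simp add: g_def fV Phi_LS)

text \<open>The path through \<open>\<omega>\<close> has slope \<open>v\<close> up to \<epsilon> at
  all scales up to \<delta>. Fixing \<delta> makes the set closed, hence measurable.\<close>

definition good :: "real \<Rightarrow> 'v \<Rightarrow> real \<Rightarrow> ((nat \<Rightarrow> bool) \<times> real) set" where
  "good \<delta> v \<epsilon> = {\<omega>. \<forall>s. \<bar>s\<bar> \<le> \<delta> \<longrightarrow> norm (g (fst \<omega>, snd \<omega> + s) - g \<omega> - s *\<^sub>R v) \<le> \<epsilon> * \<bar>s\<bar>}"

lemma closed_good: "closed (good \<delta> v \<epsilon>)"
proof -
  have "continuous_on UNIV (\<lambda>\<omega>. norm (g (fst \<omega>, snd \<omega> + s) - g \<omega> - s *\<^sub>R v))" for s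
    by (intro continuous_intros continuous_on_compose2[OF continuous_g]) auto
  then have "closed {\<omega>. norm (g (fst \<omega>, snd \<omega> + s) - g \<omega> - s *\<^sub>R v) \<le> \<epsilon> * \<bar>s\<bar>}" for s
    by (intro closed_Collect_le) auto
  then have "closed (\<Inter>s\<in>{s. \<bar>s\<bar> \<le> \<delta>}. {\<omega>. norm (g (fst \<omega>, snd \<omega> + s) - g \<omega> - s *\<^sub>R v) \<le> \<epsilon> * \<bar>s\<bar>})" by blast
  moreover have "good \<delta> v \<epsilon> = (\<Inter>s\<in>{s. \<bar>s\<bar> \<le> \<delta>}. {\<omega>. norm (g (fst \<omega>, snd \<omega> + s) - g \<omega> - s *\<^sub>R v) \<le> \<epsilon> * \<bar>s\<bar>})"
    by (auto simp: good_def)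
  ultimately show ?thesis by simp
qed

text \<open>Every derivative of \<open>f\<close> along a path is a limit of such difference quotients.\<close>

lemma countable_slopes: "\<exists>Q. countable Q \<and> Q \<subseteq> V \<and> (\<forall>\<omega> \<omega>' n. \<forall>e>0. \<exists>q\<in>Q. norm (q - real n *\<^sub>R (g \<omega> - g \<omega>')) < e)"
proof -
  obtain D :: "((nat \<Rightarrow> bool) \<times> real) set" where D: "countable D" "\<And>X. open X \<Longrightarrow> X \<noteq> {} \<Longrightarrow> \<exists>d\<in>D. d \<in> X"
    by (rule countable_dense_setE) blast
  have near: "\<exists>d\<in>D. norm (g d - g \<omega>) < e" if "e > 0" for \<omega> e
  proof -
    have "open (g -` ball (g \<omega>) e \<inter> UNIV)" using continuous_g continuous_on_open_vimage[OF open_UNIV, of g] by blast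
    moreover have "\<omega> \<in> g -` ball (g \<omega>) e \<inter> UNIV" using that by simp
    ultimately obtain d where "d \<in> D" "d \<in> g -` ball (g \<omega>) e" using D(2) by blast
    then show ?thesis by (auto simp: dist_norm norm_minus_commute)
  qed
  define Q where "Q = (\<lambda>(n, d, d'). real n *\<^sub>R (g d - g d')) ` (UNIV \<times> D \<times> D)"
  show ?thesis
  proof (intro exI[of _ Q] conjI allI impI)
    show "countable Q" unfolding Q_def using D(1) by blast
    show "Q \<subseteq> V" unfolding Q_def using gV V(2) by (auto intro: subspace_scale subspace_diff)
    fix \<omega> \<omega>' n and e :: real assume e: "e > 0"
    define e' where "e' = e / (2 * (real n + 1))"
    have "e' > 0" using e by (simp add: e'_def)
    then obtain d d' where d: "d \<in> D" "norm (g d - g \<omega>) < e'" "d' \<in> D" "norm (g d' - g \<omega>') < e'" using near by metis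
    have "norm (real n *\<^sub>R (g d - g d') - real n *\<^sub>R (g \<omega> - g \<omega>')) = real n * norm ((g d - g \<omega>) - (g d' - g \<omega>'))"
      unfolding scaleR_diff_right[symmetric] norm_scaleR by (simp add: algebra_simps)
    also have "\<dots> \<le> real n * (2 * e')" using norm_triangle_ineq4[of "g d - g \<omega>" "g d' - g \<omega>'"] d by (intro mult_left_mono) auto
    also have "\<dots> < (real n + 1) * (2 * e')" using \<open>e' > 0\<close> by simp
    also have "\<dots> = e" unfolding e'_def by (simp add: field_simps add_eq_0_iff)
    finally show "\<exists>q\<in>Q. norm (q - real n *\<^sub>R (g \<omega> - g \<omega>')) < e"
      using d by (intro bexI[of _ "real n *\<^sub>R (g d - g d')"]) (auto simp: Q_def intro: rev_image_eqI[of "(n, d, d')"])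
  qed
qed

definition slopes :: "'v set" where
  "slopes = (SOME Q. countable Q \<and> Q \<subseteq> V \<and> (\<forall>\<omega> \<omega>' n. \<forall>e>0. \<exists>q\<in>Q. norm (q - real n *\<^sub>R (g \<omega> - g \<omega>')) < e))"

lemma slopes: "countable slopes" "slopes \<subseteq> V" "e > 0 \<Longrightarrow> \<exists>q\<in>slopes. norm (q - real n *\<^sub>R (g \<omega> - g \<omega>')) < e"
  using someI_ex[OF countable_slopes] unfolding slopes_def[symmetric] by blast+

lemma g_path: "norm (g (\<beta>, s) - g (\<beta>, t)) \<le> L * \<bar>s - t\<bar>"
proof -
  have "norm (g (\<beta>, s) - g (\<beta>, t)) \<le> L * dd (Phi S (\<beta>, s)) (Phi S (\<beta>, t))" unfolding g_def by (rule lip[OF Phi_LS Phi_LS])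
  also have "dd (Phi S (\<beta>, s)) (Phi S (\<beta>, t)) = \<bar>cl01 s - cl01 t\<bar>" by (simp add: Phi_def)
  also have "L * \<bar>cl01 s - cl01 t\<bar> \<le> L * \<bar>s - t\<bar>" using cl01(4) L by (rule mult_left_mono)
  finally show ?thesis .
qed

lemma differentiable_imp_good:
  assumes d: "(\<lambda>t. g (\<beta>, t)) differentiable (at t)" and e: "\<epsilon> > 0"
  shows "\<exists>q\<in>slopes. \<exists>m. (\<beta>, t) \<in> good (1 / real (Suc m)) q \<epsilon>"
proof -
  obtain v where "((\<lambda>t. g (\<beta>, t)) has_vector_derivative v) (at t)"
    using d vector_derivative_works by blast
  have "\<exists>\<delta>>0. \<forall>s. norm (s - t) < \<delta> \<longrightarrow> norm (g (\<beta>, s) - g (\<beta>, t) - (s - t) *\<^sub>R v) \<le> \<epsilon> / 4 * norm (s - t)"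
  proof -
    have "\<epsilon> / 4 > 0" using e by simp
    then show ?thesis using \<open>((\<lambda>t. g (\<beta>, t)) has_vector_derivative v) (at t)\<close> unfolding has_vector_derivative_def has_derivative_at_alt by blast
  qed
  then obtain \<delta> where \<delta>: "\<delta> > 0"
    "\<And>s. norm (s - t) < \<delta> \<Longrightarrow> norm (g (\<beta>, s) - g (\<beta>, t) - (s - t) *\<^sub>R v) \<le> \<epsilon> / 4 * norm (s - t)" by blast
  obtain m where m: "1 / real (Suc m) < \<delta>" using \<delta>(1) reals_Archimedean[of \<delta>] by (auto simp: inverse_eq_divide)
  let ?s = "1 / real (Suc m)"
  \<comment> \<open>\<open>q\<close> is within \<open>\<epsilon> / 4\<close> of a difference
    quotient, which in turn is within \<open>\<epsilon> / 4\<close> of the derivative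
    \<open>v\<close>.\<close>
  obtain q where q: "q \<in> slopes" "norm (q - real (Suc m) *\<^sub>R (g (\<beta>, t + ?s) - g (\<beta>, t))) < \<epsilon> / 4"
    using slopes(3)[of "\<epsilon> / 4"] e by fastforce
  have "norm (real (Suc m) *\<^sub>R (g (\<beta>, t + ?s) - g (\<beta>, t)) - v) = real (Suc m) * norm (g (\<beta>, t + ?s) - g (\<beta>, t) - ?s *\<^sub>R v)"
  proof -
    have "real (Suc m) *\<^sub>R (g (\<beta>, t + ?s) - g (\<beta>, t)) - v = real (Suc m) *\<^sub>R (g (\<beta>, t + ?s) - g (\<beta>, t) - ?s *\<^sub>R v)"
      by (simp add: scaleR_diff_right)
    then show ?thesis by simp
  qed
  also have "\<dots> \<le> real (Suc m) * (\<epsilon> / 4 * ?s)" using \<delta>(2)[of "t + ?s"] m by (intro mult_left_mono) auto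
  also have "\<dots> = \<epsilon> / 4 * (real (Suc m) * ?s)" by (simp only: mult.left_commute)
  also have "real (Suc m) * ?s = 1" by simp
  also have "\<epsilon> / 4 * 1 = \<epsilon> / 4" by simp
  finally have "norm (q - v) \<le> \<epsilon> / 2" using q(2) norm_triangle_ineq[of "q - real (Suc m) *\<^sub>R (g (\<beta>, t + ?s) - g (\<beta>, t))" "real (Suc m) *\<^sub>R (g (\<beta>, t + ?s) - g (\<beta>, t)) - v"]
    by simp
  then have qv: "norm (v - q) \<le> \<epsilon> / 2" by (simp add: norm_minus_commute)
  have "norm (g (\<beta>, t + s) - g (\<beta>, t) - s *\<^sub>R q) \<le> \<epsilon> * \<bar>s\<bar>" if "\<bar>s\<bar> \<le> ?s" for s
  proof -
    have "g (\<beta>, t + s) - g (\<beta>, t) - s *\<^sub>R q = (g (\<beta>, t + s) - g (\<beta>, t) - s *\<^sub>R v) + s *\<^sub>R (v - q)" by (simp add: scaleR_diff_right)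
    also have "norm \<dots> \<le> \<epsilon> / 4 * \<bar>s\<bar> + \<bar>s\<bar> * (\<epsilon> / 2)"
    proof (rule norm_triangle_mono)
      show "norm (g (\<beta>, t + s) - g (\<beta>, t) - s *\<^sub>R v) \<le> \<epsilon> / 4 * \<bar>s\<bar>" using \<delta>(2)[of "t + s"] that m by simp
      show "norm (s *\<^sub>R (v - q)) \<le> \<bar>s\<bar> * (\<epsilon> / 2)" unfolding norm_scaleR using qv by (intro mult_left_mono) auto
    qed
    also have "\<dots> \<le> \<epsilon> * \<bar>s\<bar>" using e by (simp add: field_simps)
    finally show ?thesis .
  qed
  then show ?thesis using q(1) by (auto simp: good_def)
qed

text \<open>For a fixed sequence of bits the path is a Lipschitz map of the line into
  \<open>V\<close>, the height being clamped outside of the unit interval. RNP applies to each such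
  path, and Fubini's theorem combines them.\<close>

lemma AE_good:
  assumes e: "\<epsilon> > 0"
  shows "AE \<omega> in Om. \<exists>q\<in>slopes. \<exists>m. \<omega> \<in> good (1 / real (Suc m)) q \<epsilon>"
proof -
  interpret C: prob_space coins by (rule prob_space_coins)
  interpret U: prob_space U01 by (rule prob_space_U01)
  interpret P: pair_sigma_finite coins U01 by unfold_locales
  have "{\<omega>. \<exists>q\<in>slopes. \<exists>m. \<omega> \<in> good (1 / real (Suc m)) q \<epsilon>} = (\<Union>q\<in>slopes. \<Union>m. good (1 / real (Suc m)) q \<epsilon>)" by auto
  also have "\<dots> \<in> sets Om" unfolding sets_Om using slopes(1) closed_good by (intro sets.countable_UN'' sets.countable_UN') (auto intro: borel_closed)
  finally have m: "{\<omega> \<in> space (coins \<Otimes>\<^sub>M U01). \<exists>q\<in>slopes. \<exists>m. \<omega> \<in> good (1 / real (Suc m)) q \<epsilon>} \<in> sets (coins \<Otimes>\<^sub>M U01)"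
    unfolding Om_def[symmetric] by simp
  show ?thesis
    unfolding Om_def
  proof (rule P.AE_pair_measure[OF m], rule AE_I2)
    fix \<beta>
    have "Lipschitz_continuous_map euclidean_metric (submetric euclidean_metric V) (\<lambda>t. g (\<beta>, t))"
      unfolding Lipschitz_continuous_map_def using gV g_path by (auto simp: dist_norm intro: exI[of _ L])
    then have "AE t in lebesgue. (\<lambda>t. g (\<beta>, t)) differentiable (at t)" using V(3) unfolding RNP_def by blast
    then have "AE t in lborel. (\<lambda>t. g (\<beta>, t)) differentiable (at t)" unfolding AE_completion_iff .
    then have "AE t in U01. (\<lambda>t. g (\<beta>, t)) differentiable (at t)" by (intro AE_U01) (auto elim: AE_mp)
    then show "AE t in U01. \<exists>q\<in>slopes. \<exists>m. (\<beta>, t) \<in> good (1 / real (Suc m)) q \<epsilon>"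
      by (rule AE_mp) (intro AE_I2 impI differentiable_imp_good e)
  qed
qed

text \<open>The end points of an edge of level \<open>N\<close> have one preimage each in the limit space. Therefore an
  estimate on any path through the edge is an estimate on all of them.\<close>

lemma edge_slope:
  assumes meets: "\<exists>\<omega>''\<in>good \<delta> q \<epsilon> \<inter> O1. same_edge S N (\<lambda>j. j \<in> b, real k / 4 ^ N) \<omega>''"
    and b: "b \<subseteq> S" and k: "real (Suc k) / 4 ^ N \<le> 1" and \<delta>: "1 / 4 ^ N \<le> \<delta>" and \<epsilon>: "\<epsilon> \<ge> 0"
  shows "norm (f (pt b (real (Suc k) / 4 ^ N)) - f (pt b (real k / 4 ^ N)) - (1 / 4 ^ N) *\<^sub>R q) \<le> \<epsilon> / 4 ^ N"
proof -
  let ?s = "real k / 4 ^ N" and ?t = "real (Suc k) / 4 ^ N"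
  have st: "?t = ?s + 1 / 4 ^ N" by (simp add: add_divide_distrib)
  obtain \<beta> u where w: "(\<beta>, u) \<in> good \<delta> q \<epsilon>" "(\<beta>, u) \<in> O1" "same_edge S N (\<lambda>j. j \<in> b, ?s) (\<beta>, u)" using meets by auto
  have fk: "fcell N ?s = k" using fcell_iff[of ?s N k] by simp
  have u0: "0 \<le> u" using w(2) by (simp add: O1_def)
  have "fcell N u = k" using w(3) fk by (simp add: same_edge_def)
  then have uc: "u \<in> cell N k" using fcell_cell[OF u0, of N] by simp
  have agree: "(j \<in> b) = \<beta> j" if "j \<in> S" "j \<in> cbits N k" for j
    using w(3) that fk by (auto simp: same_edge_def)
  \<comment> \<open>At a grid point only bits of levels below \<open>N\<close> are visible; they are
    relevant on the cell, where \<open>\<beta>\<close> and \<open>b\<close> agree.\<close>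
  have same: "Phi S (\<beta>, t) = pt b t" if t: "t = real l / 4 ^ N" "t \<in> cell N k" "t \<in> {0..1}" for t and l :: nat
  proof -
    have "(j \<in> S \<and> \<beta> j) = (j \<in> b)" if j: "t \<in> band j" for j
      using grid_not_band[of N j "int l"] j t(1) not_le of_int_of_nat_eq band_cell[OF t(2)] agree[of j] b by auto
    then show ?thesis using t(3) by (simp add: Phi_def cl01 bits_def pt_eq_iff)
  qed
  have s01: "?s \<in> {0..1}" "?t \<in> {0..1}" unfolding atLeastAtMost_iff
  proof -
    have "0 \<le> ?s" "0 \<le> ?t" "?s \<le> ?t" unfolding st by simp_all
    then show "0 \<le> ?s \<and> ?s \<le> 1" "0 \<le> ?t \<and> ?t \<le> 1" using k by linarith+
  qed
  have gs: "g (\<beta>, ?s) = f (pt b ?s)" "g (\<beta>, ?t) = f (pt b ?t)"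
    unfolding g_def using same[of ?s k] same[of ?t "Suc k"] s01 by (auto simp: cell_def divide_right_mono)
  have us: "?s \<le> u" "u \<le> ?t" using uc by (auto simp: cell_def)
  have "norm (g (\<beta>, u + (?t - u)) - g (\<beta>, u) - (?t - u) *\<^sub>R q) \<le> \<epsilon> * \<bar>?t - u\<bar>"
    "norm (g (\<beta>, u + (?s - u)) - g (\<beta>, u) - (?s - u) *\<^sub>R q) \<le> \<epsilon> * \<bar>?s - u\<bar>"
  proof -
    have G: "norm (g (\<beta>, u + s) - g (\<beta>, u) - s *\<^sub>R q) \<le> \<epsilon> * \<bar>s\<bar>" if "\<bar>s\<bar> \<le> \<delta>" for s
      using w(1) that unfolding good_def by simp
    have "\<bar>?t - u\<bar> \<le> \<delta>" "\<bar>?s - u\<bar> \<le> \<delta>" using us st \<delta> by linarith+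
    then show "norm (g (\<beta>, u + (?t - u)) - g (\<beta>, u) - (?t - u) *\<^sub>R q) \<le> \<epsilon> * \<bar>?t - u\<bar>"
      "norm (g (\<beta>, u + (?s - u)) - g (\<beta>, u) - (?s - u) *\<^sub>R q) \<le> \<epsilon> * \<bar>?s - u\<bar>" using G by blast+
  qed
  then have 1: "norm (f (pt b ?t) - g (\<beta>, u) - (?t - u) *\<^sub>R q) \<le> \<epsilon> * (?t - u)"
    and 2: "norm (f (pt b ?s) - g (\<beta>, u) - (?s - u) *\<^sub>R q) \<le> \<epsilon> * (u - ?s)"
    using us gs by (simp_all del: of_nat_Suc)
  have "f (pt b ?t) - f (pt b ?s) - (1 / 4 ^ N) *\<^sub>R q
      = (f (pt b ?t) - g (\<beta>, u) - (?t - u) *\<^sub>R q) - (f (pt b ?s) - g (\<beta>, u) - (?s - u) *\<^sub>R q)"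
  proof -
    have "(1 / 4 ^ N) *\<^sub>R q = (?t - u) *\<^sub>R q - (?s - u) *\<^sub>R q" unfolding scaleR_diff_left[symmetric] using st by simp
    then show ?thesis by simp
  qed
  also have "norm \<dots> \<le> \<epsilon> * (?t - u) + \<epsilon> * (u - ?s)"
    by (rule order_trans[OF norm_triangle_ineq4]) (intro add_mono 1 2)
  also have "\<dots> = \<epsilon> / 4 ^ N" using st by (simp add: algebra_simps)
  finally show ?thesis .
qed

text \<open>\<open>N\<close> is chosen with
  \<open>4 ^ K / 4 ^ Suc N < d \<le> 4 ^ K / 4 ^ N\<close>, so that edges of level \<open>N\<close>
  are short compared with \<open>d\<close> while \<open>meets\<close> still reaches them. All full
  edges of a geodesic have slope \<open>q\<close> up to \<epsilon>. Up to four incomplete edges cost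
  \<open>M / 4 ^ N\<close> each; the factor 16 is their number times the ratio 4 of the two bounds
  for \<open>d\<close>.\<close>

lemma local_estimate:
  assumes meets: "\<And>N \<omega>'. N \<ge> N1 \<Longrightarrow> \<omega>' \<in> O1 \<Longrightarrow> dd (Phi S \<omega>) (Phi S \<omega>') \<le> 4 ^ K / 4 ^ N \<Longrightarrow>
      \<exists>\<omega>''\<in>good \<delta> q \<epsilon> \<inter> O1. same_edge S N \<omega>' \<omega>''"
    and \<delta>: "\<delta> > 0" and \<epsilon>: "\<epsilon> > 0" and K: "16 * (L + norm q) \<le> \<epsilon> * 4 ^ K"
  shows "\<exists>r>0. \<forall>y\<in>LS S. dd (Phi S \<omega>) y < r \<longrightarrow>
     norm (f y - f (Phi S \<omega>) - (snd y - snd (Phi S \<omega>)) *\<^sub>R q) \<le> 2 * \<epsilon> * dd (Phi S \<omega>) y"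
proof -
  define x where "x = Phi S \<omega>"
  have x: "x \<in> LS S" by (simp add: x_def Phi_LS)
  interpret D: Metric_space "LS S" dd by (rule Metric_space_LS)
  define M where "M = L + norm q"
  have M: "M \<ge> 0" using L by (simp add: M_def)
  have lim: "(\<lambda>n. c / 4 ^ n :: real) \<longlonglongrightarrow> 0" for c by (rule LIMSEQ_divide_realpow_zero) auto
  have "eventually (\<lambda>n. 1 / 4 ^ n < \<delta>) sequentially" using lim[of 1] \<delta> by (intro order_tendstoD) auto
  then obtain N2 where N2: "\<And>n. n \<ge> N2 \<Longrightarrow> 1 / 4 ^ n < \<delta>" "N2 \<ge> N1" unfolding eventually_sequentially by (meson max.cobounded1 max.cobounded2 order_trans)
  show ?thesis
    unfolding x_def[symmetric]
  proof (intro exI[of _ "4 ^ K / 4 ^ N2"] conjI ballI impI)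
    fix y assume y: "y \<in> LS S" "dd x y < 4 ^ K / 4 ^ N2"
    define d where "d = dd x y"
    show "norm (f y - f x - (snd y - snd x) *\<^sub>R q) \<le> 2 * \<epsilon> * dd x y"
    proof (cases "d = 0")
      case True
      then have "x = y" using D.zero[OF x y(1)] by (simp add: d_def)
      then show ?thesis using \<epsilon> dd_nonneg[of x y] by simp
    next
      case False
      then have d0: "d > 0" using dd_nonneg[of x y] unfolding d_def by linarith
      have "eventually (\<lambda>n. 4 ^ K / 4 ^ n < d) sequentially" using lim d0 by (intro order_tendstoD) auto
      then have ex: "\<exists>n. 4 ^ K / 4 ^ Suc n < d" unfolding eventually_sequentially by (meson le_Suc_eq order_refl)
      define N where "N = (LEAST n. 4 ^ K / 4 ^ Suc n < d)"
      have N: "4 ^ K / 4 ^ Suc N < d" unfolding N_def using ex by (rule LeastI_ex)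
      have N': "d \<le> 4 ^ K / 4 ^ n" if "n \<le> N" for n
      proof (cases n)
        case 0
        have "(4::real) ^ K / 4 ^ N2 \<le> 4 ^ K / 4 ^ 0" by (intro divide_left_mono power_increasing) auto
        then show ?thesis using y(2) 0 by (simp add: d_def)
      next
        case (Suc n')
        then show ?thesis using not_less_Least[of n' "\<lambda>n. 4 ^ K / 4 ^ Suc n < d"] that unfolding N_def by (simp add: not_less)
      qed
      have NN2: "N \<ge> N2"
      proof (rule ccontr)
        assume "\<not> N \<ge> N2"
        then have "(4::real) ^ K / 4 ^ N2 \<le> 4 ^ K / 4 ^ Suc N" by (intro divide_left_mono power_increasing) auto
        then show False using N y(2) by (simp add: d_def)
      qed
      obtain \<tau> b b' where geo: "0 \<le> \<tau>" "\<tau> \<le> 1" "b \<subseteq> S" "b' \<subseteq> S" "x = pt b (snd x)" "y = pt b' (snd y)" "pt b \<tau> = pt b' \<tau>"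
        "dd x y = \<bar>snd x - \<tau>\<bar> + \<bar>\<tau> - snd y\<bar>" by (rule geodesic[OF x y(1)])
      have t01: "snd x \<in> {0..1}" "snd y \<in> {0..1}" "\<tau> \<in> {0..1}" using x y geo by (auto simp: LS_def)
      \<comment> \<open>Subtracting the linear part turns the slope \<open>q\<close> into 0 and
        raises the Lipschitz constant to \<open>M\<close>.\<close>
      define h where "h c t = f (pt c t) - t *\<^sub>R q" for c t
      have hl: "norm (h c s - h c t) \<le> M * \<bar>s - t\<bar>" if "c \<subseteq> S" "s \<in> {0..1}" "t \<in> {0..1}" for c s t
      proof -
        have "h c s - h c t = (f (pt c s) - f (pt c t)) + (t - s) *\<^sub>R q" by (simp add: h_def scaleR_diff_left)
        also have "norm \<dots> \<le> L * \<bar>s - t\<bar> + \<bar>s - t\<bar> * norm q"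
          using lip[of "pt c s" "pt c t"] that LS_pt[OF that(1)] by (intro norm_triangle_mono) (auto simp: abs_minus_commute)
        also have "\<dots> = M * \<bar>s - t\<bar>" unfolding M_def distrib_right by (simp only: mult.commute)
        finally show ?thesis .
      qed
      have step: "norm (h c (real (Suc k) / 4 ^ N) - h c (real k / 4 ^ N)) \<le> \<epsilon> / 4 ^ N"
        if c: "c \<subseteq> S" "real (Suc k) / 4 ^ N \<le> 1" "dd x (pt c (real k / 4 ^ N)) \<le> d" for c and k :: nat
      proof -
        have k1: "real k / 4 ^ N < 1"
        proof -
          have "real k / 4 ^ N < real (Suc k) / 4 ^ N" by (intro divide_strict_right_mono) auto
          then show ?thesis using c(2) by linarith
        qed
        have Ph: "Phi S (\<lambda>j. j \<in> c, real k / 4 ^ N) = pt c (real k / 4 ^ N)"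
          using k1 c(1) by (auto simp: Phi_def cl01 bits_def pt_eq_iff)
        have "\<exists>\<omega>''\<in>good \<delta> q \<epsilon> \<inter> O1. same_edge S N (\<lambda>j. j \<in> c, real k / 4 ^ N) \<omega>''"
          by (rule meets) (use NN2 N2(2) k1 c(3) N'[OF order_refl] in \<open>auto simp: O1_def Ph x_def[symmetric]\<close>)
        from edge_slope[OF this c(1,2) less_imp_le[OF N2(1)[OF NN2]] less_imp_le[OF \<epsilon>]]
        have "norm (f (pt c (real (Suc k) / 4 ^ N)) - f (pt c (real k / 4 ^ N)) - (1 / 4 ^ N) *\<^sub>R q) \<le> \<epsilon> / 4 ^ N" .
        moreover have "h c (real (Suc k) / 4 ^ N) - h c (real k / 4 ^ N) = f (pt c (real (Suc k) / 4 ^ N)) - f (pt c (real k / 4 ^ N)) - (1 / 4 ^ N) *\<^sub>R q"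
          unfolding h_def by (simp add: add_divide_distrib scaleR_add_left)
        ultimately show ?thesis by simp
      qed
      have 1: "norm (h b \<tau> - h b (snd x)) \<le> \<epsilon> * \<bar>\<tau> - snd x\<bar> + 2 * M / 4 ^ N"
      proof (rule telescope_abs[where h = "h b" and s = "snd x" and t = \<tau> and M = M and \<epsilon> = \<epsilon> and N = N])
        fix k :: nat assume k: "min (snd x) \<tau> \<le> real k / 4 ^ N" "real (Suc k) / 4 ^ N \<le> max (snd x) \<tau>"
        have k': "real k / 4 ^ N \<le> real (Suc k) / 4 ^ N" by (intro divide_right_mono) auto
        have "dd x (pt b (real k / 4 ^ N)) = \<bar>snd x - real k / 4 ^ N\<bar>" by (subst geo(5)) simp
        also have "\<dots> \<le> d" using k k' geo(8) unfolding d_def by linarith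
        finally show "norm (h b (real (Suc k) / 4 ^ N) - h b (real k / 4 ^ N)) \<le> \<epsilon> / 4 ^ N"
          using k(2) t01 by (intro step geo(3)) (auto simp only: atLeastAtMost_iff le_max_iff_disj)
      qed (use hl[OF geo(3)] M \<epsilon> t01 in auto)
      have 2: "norm (h b' (snd y) - h b' \<tau>) \<le> \<epsilon> * \<bar>snd y - \<tau>\<bar> + 2 * M / 4 ^ N"
      proof (rule telescope_abs[where h = "h b'" and s = \<tau> and t = "snd y" and M = M and \<epsilon> = \<epsilon> and N = N])
        fix k :: nat assume k: "min \<tau> (snd y) \<le> real k / 4 ^ N" "real (Suc k) / 4 ^ N \<le> max \<tau> (snd y)"
        have k': "real k / 4 ^ N \<le> real (Suc k) / 4 ^ N" by (intro divide_right_mono) auto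
        have "dd x (pt b' (real k / 4 ^ N)) \<le> dd x (pt b \<tau>) + dd (pt b' \<tau>) (pt b' (real k / 4 ^ N))"
          unfolding geo(7) by (rule dd_triangle)
        also have "dd x (pt b \<tau>) = \<bar>snd x - \<tau>\<bar>" by (subst geo(5)) simp
        also have "\<bar>snd x - \<tau>\<bar> + dd (pt b' \<tau>) (pt b' (real k / 4 ^ N)) \<le> d"
          using k k' geo(8) unfolding d_def dd_path by linarith
        finally show "norm (h b' (real (Suc k) / 4 ^ N) - h b' (real k / 4 ^ N)) \<le> \<epsilon> / 4 ^ N"
          using k(2) t01 by (intro step geo(4)) (auto simp only: atLeastAtMost_iff le_max_iff_disj)
      qed (use hl[OF geo(4)] M \<epsilon> t01 in auto)
      have "f y - f x - (snd y - snd x) *\<^sub>R q = (h b' (snd y) - h b' \<tau>) + (h b \<tau> - h b (snd x))"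
        unfolding h_def geo(7) geo(5)[symmetric] geo(6)[symmetric] by (simp add: scaleR_diff_left)
      also have "norm \<dots> \<le> (\<epsilon> * \<bar>snd y - \<tau>\<bar> + 2 * M / 4 ^ N) + (\<epsilon> * \<bar>\<tau> - snd x\<bar> + 2 * M / 4 ^ N)"
        by (intro norm_triangle_mono 1 2)
      also have "\<dots> = \<epsilon> * d + 4 * M / 4 ^ N" unfolding d_def geo(8) by (simp add: algebra_simps abs_minus_commute)
      also have "4 * M / 4 ^ N \<le> \<epsilon> * d"
        using K divide_right_mono mult_left_mono[OF less_imp_le[OF N] less_imp_le[OF \<epsilon>]] by (auto simp: field_simps M_def)
      finally show ?thesis by (simp add: d_def)
    qed
  qed simp
qed

definition near_linear :: "nat set \<times> real \<Rightarrow> nat \<Rightarrow> 'v \<Rightarrow> nat \<Rightarrow> bool" where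
  "near_linear x n q m \<longleftrightarrow> (\<forall>y\<in>LS S. dd x y < 1 / real (Suc m) \<longrightarrow>
     norm (f y - f x - (snd y - snd x) *\<^sub>R q) \<le> 2 / real (Suc n) * dd x y)"

lemma AE_near_linear: "AE \<omega> in Om. \<forall>n. \<exists>q\<in>slopes. \<exists>m. near_linear (Phi S \<omega>) n q m"
proof -
  have "\<exists>K::nat. 16 * (L + norm q) \<le> 1 / real (Suc n) * 4 ^ K" for n and q :: 'v
  proof -
    obtain K where "16 * (L + norm q) * real (Suc n) < 4 ^ K" using real_arch_pow[of 4] by auto
    then show ?thesis by (intro exI[of _ K]) (simp add: field_simps)
  qed
  then have "\<forall>n q. \<exists>K::nat. 16 * (L + norm (q::'v)) \<le> 1 / real (Suc n) * 4 ^ K" by blast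
  then obtain K :: "nat \<Rightarrow> 'v \<Rightarrow> nat" where K: "\<And>n q. 16 * (L + norm q) \<le> 1 / real (Suc n) * 4 ^ (K n q)" unfolding choice_iff by blast
  have "AE \<omega> in Om. \<forall>n. \<exists>q\<in>slopes. \<exists>m. \<omega> \<in> good (1 / real (Suc m)) q (1 / real (Suc n))"
    unfolding AE_all_countable by (intro allI AE_good) simp
  moreover have "AE \<omega> in Om. \<forall>q\<in>slopes. \<forall>n m. \<omega> \<in> good (1 / real (Suc m)) q (1 / real (Suc n)) \<inter> O1 \<longrightarrow>
      (\<exists>N1. \<forall>N\<ge>N1. \<forall>\<omega>'\<in>O1. dd (Phi S \<omega>) (Phi S \<omega>') \<le> 4 ^ K n q / 4 ^ N \<longrightarrow>
         (\<exists>\<omega>''\<in>good (1 / real (Suc m)) q (1 / real (Suc n)) \<inter> O1. same_edge S N \<omega>' \<omega>''))"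
    unfolding AE_ball_countable[OF slopes(1)] AE_all_countable by (intro ballI allI edges_meet) simp
  ultimately show ?thesis using AE_not_grid
  proof eventually_elim
    case (elim \<omega>)
    show ?case
    proof
      fix n
      obtain q m where q: "q \<in> slopes" "\<omega> \<in> good (1 / real (Suc m)) q (1 / real (Suc n))" using elim(1) by blast
      then obtain N1 where N1: "\<And>N \<omega>'. N \<ge> N1 \<Longrightarrow> \<omega>' \<in> O1 \<Longrightarrow> dd (Phi S \<omega>) (Phi S \<omega>') \<le> 4 ^ K n q / 4 ^ N \<Longrightarrow>
          \<exists>\<omega>''\<in>good (1 / real (Suc m)) q (1 / real (Suc n)) \<inter> O1. same_edge S N \<omega>' \<omega>''"
        using elim(2,3) by (metis IntI)
      obtain r where r: "r > 0" "\<And>y. y \<in> LS S \<Longrightarrow> dd (Phi S \<omega>) y < r \<Longrightarrow>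
          norm (f y - f (Phi S \<omega>) - (snd y - snd (Phi S \<omega>)) *\<^sub>R q) \<le> 2 * (1 / real (Suc n)) * dd (Phi S \<omega>) y"
      proof -
        have "1 / real (Suc m) > 0" "1 / real (Suc n) > 0" by simp_all
        from local_estimate[OF N1 this K] show ?thesis using that by blast
      qed
      obtain m' where m': "1 / real (Suc m') < r" using reals_Archimedean[OF r(1)] by (auto simp: inverse_eq_divide)
      have "near_linear (Phi S \<omega>) n q m'"
        unfolding near_linear_def using r(2) m' by (metis less_trans mult.right_neutral times_divide_eq_right)
      then show "\<exists>q\<in>slopes. \<exists>m. near_linear (Phi S \<omega>) n q m" using q(1) by blast
    qed
  qed
qed

text \<open>Measurability is needed to carry an almost everywhere statement from the parameters to
  the limit measure. A strict violation at some \<open>y\<close> persists when \<open>x\<close> is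
  moved a little, because both sides depend on \<open>x\<close> in a Lipschitz way.\<close>

lemma closedin_near_linear: "closedin (mtopology_of (minf S)) (Psi ` {x \<in> LS S. near_linear x n q m})"
proof -
  let ?A = "Psi ` {x \<in> LS S. near_linear x n q m}"
  define c where "c = 2 / real (Suc n)"
  define r where "r = 1 / real (Suc m)"
  define M where "M = L + norm q + c"
  have M: "M \<ge> 0" "c \<ge> 0" using L by (auto simp: M_def c_def)
  have "openin (mtopology_of (minf S)) (Psi ` LS S - ?A)"
    unfolding openin_metric mspace_minf
  proof (intro conjI ballI)
    fix z assume "z \<in> Psi ` LS S - ?A"
    then obtain x where x: "x \<in> LS S" "z = Psi x" "\<not> near_linear x n q m" by blast
    then obtain y where y: "y \<in> LS S" "dd x y < r" "c * dd x y < norm (f y - f x - (snd y - snd x) *\<^sub>R q)"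
      unfolding near_linear_def c_def r_def by (auto simp: not_le)
    define \<rho> where "\<rho> = min (r - dd x y) ((norm (f y - f x - (snd y - snd x) *\<^sub>R q) - c * dd x y) / (M + 1))"
    have "\<rho> > 0" using y M by (simp add: \<rho>_def)
    moreover have "z' \<in> Psi ` LS S - ?A" if z': "z' \<in> Psi ` LS S" "mdist (minf S) z z' < \<rho>" for z'
    proof -
      obtain x' where x': "x' \<in> LS S" "z' = Psi x'" using z'(1) by blast
      have dx: "dd x x' < \<rho>" using z'(2) mdist_minf[OF x(1) x'(1)] x(2) x'(2) by simp
      have dy: "dd x' y \<le> dd x x' + dd x y" using dd_triangle[of x' y x] dd_sym[of x' x] by simp
      have "dd x' y < r" using dx dy unfolding \<rho>_def by linarith
      moreover have "c * dd x' y < norm (f y - f x' - (snd y - snd x') *\<^sub>R q)"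
      proof -
        have "f y - f x - (snd y - snd x) *\<^sub>R q = (f y - f x' - (snd y - snd x') *\<^sub>R q) + ((f x' - f x) + (snd x - snd x') *\<^sub>R q)"
          by (simp add: scaleR_diff_left)
        also have "norm \<dots> \<le> norm (f y - f x' - (snd y - snd x') *\<^sub>R q) + (L * dd x x' + dd x x' * norm q)"
          using lip[OF x'(1) x(1)] dd_ge_abs[of x x'] dd_sym[of x' x]
          by (intro norm_triangle_mono) (auto intro: mult_right_mono)
        finally have 1: "norm (f y - f x - (snd y - snd x) *\<^sub>R q) \<le> norm (f y - f x' - (snd y - snd x') *\<^sub>R q) + (L * dd x x' + dd x x' * norm q)" .
        have "c * dd x' y \<le> c * dd x x' + c * dd x y" using mult_left_mono[OF dy M(2)] by (simp add: distrib_left)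
        moreover have "(M + 1) * dd x x' < norm (f y - f x - (snd y - snd x) *\<^sub>R q) - c * dd x y"
          using dx M(1) by (simp add: \<rho>_def less_divide_eq mult.commute)
        moreover have "(M + 1) * dd x x' = L * dd x x' + dd x x' * norm q + c * dd x x' + dd x x'" by (simp add: M_def algebra_simps)
        ultimately show ?thesis using 1 dd_nonneg[of x x'] by linarith
      qed
      ultimately have "\<not> near_linear x' n q m" using y(1) unfolding near_linear_def c_def r_def by (auto simp: not_le)
      then show ?thesis using x' Psi_inj by blast
    qed
    ultimately show "\<exists>r>0. \<forall>y\<in>Psi ` LS S. mdist (minf S) z y < r \<longrightarrow> y \<in> Psi ` LS S - ?A" by blast
  qed auto
  then show ?thesis unfolding closedin_def topspace_mtopology_of mspace_minf by blast
qed

lemma AE_muinf_near_linear: "AE z in muinf S. \<exists>x\<in>LS S. z = Psi x \<and> (\<forall>n. \<exists>q\<in>slopes. \<exists>m. near_linear x n q m)"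
proof -
  let ?P = "\<lambda>z. \<forall>n. \<exists>q\<in>slopes. \<exists>m. z \<in> Psi ` {x \<in> LS S. near_linear x n q m}"
  have "{z \<in> space (borel_of_metric (minf S)). ?P z} = (\<Inter>n. \<Union>q\<in>slopes. \<Union>m. Psi ` {x \<in> LS S. near_linear x n q m})"
    by (auto simp: mspace_minf)
  also have "\<dots> \<in> sets (borel_of_metric (minf S))"
    using slopes(1) closedin_sets[OF closedin_near_linear]
    by (intro sets.countable_INT' sets.countable_UN'' sets.countable_UN') auto
  finally have m: "{z \<in> space (borel_of_metric (minf S)). ?P z} \<in> sets (borel_of_metric (minf S))" .
  have "AE \<omega> in Om. ?P (Psi (Phi S \<omega>))"
    using AE_near_linear by eventually_elim (use Phi_LS in blast)
  then have "AE z in muinf S. ?P z" unfolding muinf_def AE_distr_iff[OF measurable_Phi m] .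
  then show ?thesis
  proof (rule AE_mp, intro AE_I2 impI)
    fix z assume P: "?P z"
    then obtain x where x: "x \<in> LS S" "z = Psi x" by blast
    have "\<exists>q\<in>slopes. \<exists>m. near_linear x n q m" for n
      using P Psi_inj unfolding x(2) by blast
    then show "\<exists>x\<in>LS S. z = Psi x \<and> (\<forall>n. \<exists>q\<in>slopes. \<exists>m. near_linear x n q m)" using x by blast
  qed
qed

text \<open>Vertical points compare \<open>q i\<close> with \<open>q j\<close>, so the approximate
  slopes form a Cauchy sequence. Its limit lies in \<open>V\<close>, which is closed.\<close>

lemma slope_limit:
  assumes x: "x \<in> LS S" and P: "\<And>n. \<exists>q\<in>slopes. \<exists>m. near_linear x n q m"
  shows "\<exists>v\<in>V. \<forall>e>0. \<exists>r>0. \<forall>y\<in>LS S. dd x y < r \<longrightarrow> norm (f y - f x - (snd y - snd x) *\<^sub>R v) \<le> e * dd x y"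
proof -
  obtain q m where q: "\<And>n. q n \<in> slopes" "\<And>n. near_linear x n (q n) (m n)" using P by metis
  have cmp: "norm (q i - q j) \<le> 2 / real (Suc i) + 2 / real (Suc j)" for i j
  proof -
    obtain y where y: "y \<in> LS S" "dd x y < min (1 / real (Suc (m i))) (1 / real (Suc (m j)))" "dd x y = \<bar>snd y - snd x\<bar>" "snd y \<noteq> snd x"
      using vertical_point[OF x, of "min (1 / real (Suc (m i))) (1 / real (Suc (m j)))"] by auto
    have "\<bar>snd y - snd x\<bar> * norm (q i - q j) = norm ((snd y - snd x) *\<^sub>R (q i - q j))" by simp
    also have "(snd y - snd x) *\<^sub>R (q i - q j) = (f y - f x - (snd y - snd x) *\<^sub>R q j) - (f y - f x - (snd y - snd x) *\<^sub>R q i)"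
      by (simp add: scaleR_diff_right)
    also have "norm \<dots> \<le> 2 / real (Suc j) * dd x y + 2 / real (Suc i) * dd x y"
      by (rule order_trans[OF norm_triangle_ineq4])
        (use q(2)[of i] q(2)[of j] y(1,2) in \<open>auto simp: near_linear_def intro!: add_mono\<close>)
    also have "\<dots> = \<bar>snd y - snd x\<bar> * (2 / real (Suc i) + 2 / real (Suc j))" unfolding y(3) by (simp add: algebra_simps)
    finally show ?thesis using y(4) by (simp add: mult_le_cancel_left)
  qed
  have lim0: "(\<lambda>n. 2 / real (Suc n)) \<longlonglongrightarrow> 0" using LIMSEQ_Suc[OF lim_const_over_n[of 2]] by simp
  have "Cauchy q"
  proof (rule CauchyI)
    fix e :: real assume "e > 0"
    then have "eventually (\<lambda>n. 2 / real (Suc n) < e / 2) sequentially" using lim0 by (intro order_tendstoD) auto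
    then obtain n0 where n0: "\<And>n. n \<ge> n0 \<Longrightarrow> 2 / real (Suc n) < e / 2" unfolding eventually_sequentially by blast
    have "norm (q i - q j) < e" if "i \<ge> n0" "j \<ge> n0" for i j using cmp[of i j] n0[OF that(1)] n0[OF that(2)] by linarith
    then show "\<exists>M. \<forall>m\<ge>M. \<forall>n\<ge>M. norm (q m - q n) < e" by blast
  qed
  then obtain v where v: "q \<longlonglongrightarrow> v" using Cauchy_convergent convergent_def by blast
  have "v \<in> V" by (rule closed_sequentially[OF V(1) _ v]) (use q(1) slopes(2) in blast)
  moreover have "\<exists>r>0. \<forall>y\<in>LS S. dd x y < r \<longrightarrow> norm (f y - f x - (snd y - snd x) *\<^sub>R v) \<le> e * dd x y" if e: "e > 0" for e
  proof -
    have "eventually (\<lambda>n. 2 / real (Suc n) < e / 2) sequentially" using lim0 e by (intro order_tendstoD) auto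
    moreover have "eventually (\<lambda>n. norm (q n - v) < e / 2) sequentially" using tendstoD[OF v, of "e / 2"] e by (simp add: dist_norm)
    ultimately have "eventually (\<lambda>n. 2 / real (Suc n) < e / 2 \<and> norm (q n - v) < e / 2) sequentially" by eventually_elim simp
    then obtain n where n: "2 / real (Suc n) < e / 2" "norm (q n - v) < e / 2" unfolding eventually_sequentially by blast
    have "norm (f y - f x - (snd y - snd x) *\<^sub>R v) \<le> e * dd x y" if y: "y \<in> LS S" "dd x y < 1 / real (Suc (m n))" for y
    proof -
      have "f y - f x - (snd y - snd x) *\<^sub>R v = (f y - f x - (snd y - snd x) *\<^sub>R q n) + (snd y - snd x) *\<^sub>R (q n - v)"
        by (simp add: scaleR_diff_right)
      also have "norm \<dots> \<le> 2 / real (Suc n) * dd x y + dd x y * (e / 2)"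
      proof (rule norm_triangle_mono)
        show "norm (f y - f x - (snd y - snd x) *\<^sub>R q n) \<le> 2 / real (Suc n) * dd x y" using q(2)[of n] y by (simp add: near_linear_def)
        show "norm ((snd y - snd x) *\<^sub>R (q n - v)) \<le> dd x y * (e / 2)"
          using dd_ge_abs[of x y] n(2) unfolding norm_scaleR by (intro mult_mono) auto
      qed
      also have "\<dots> \<le> e / 2 * dd x y + dd x y * (e / 2)" using n(1) dd_nonneg by (intro add_right_mono mult_right_mono) auto
      finally show ?thesis by (simp add: field_simps)
    qed
    then show ?thesis by (intro exI[of _ "1 / real (Suc (m n))"]) auto
  qed
  ultimately show ?thesis by blast
qed

end

section \<open>The height as a chart\<close>

definition height :: "(nat \<Rightarrow> nat \<times> real) \<Rightarrow> nat \<Rightarrow> real" where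
  "height z = (\<lambda>i. if i = 0 then snd (z 0) else 0)"

lemma height_Psi [simp]: "height (Psi x) i = (if i = 0 then snd x else 0)" by (simp add: height_def)

lemma Lipschitz_height: "Lipschitz_continuous_map (minf S) (euclidean_k 1) height"
  unfolding Lipschitz_continuous_map_def
proof (intro conjI exI[of _ 1] ballI)
  show "height \<in> mspace (minf S) \<rightarrow> mspace (euclidean_k 1)" by (auto simp: height_def)
  fix z z' assume "z \<in> mspace (minf S)" "z' \<in> mspace (minf S)"
  then obtain x y where x: "x \<in> LS S" "z = Psi x" "y \<in> LS S" "z' = Psi y" by (auto simp: mspace_minf)
  have "mdist (euclidean_k 1) (height z) (height z') = \<bar>snd x - snd y\<bar>"
    unfolding euclidean_k_def Metric_space.mdist_metric[OF Metric_space_euclidean_k] by (simp add: x L2_set_def)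
  then show "mdist (euclidean_k 1) (height z) (height z') \<le> 1 * mdist (minf S) z z'"
    using dd_ge_abs[of x y] mdist_minf[OF x(1,3)] x(2,4) by simp
qed

lemma smallo_minf:
  assumes "x \<in> LS S"
  shows "(\<lambda>z. norm (h z)) \<in> o[atin (mtopology_of (minf S)) (Psi x)](\<lambda>z. mdist (minf S) (Psi x) z) \<longleftrightarrow>
    (\<forall>e>0. \<exists>r>0. \<forall>y\<in>LS S. 0 < dd x y \<longrightarrow> dd x y < r \<longrightarrow> norm (h (Psi y)) \<le> e * dd x y)"
proof -
  interpret M: Metric_space "mspace (minf S)" "mdist (minf S)" by (rule Metric_space_mspace_mdist)
  have xm: "Psi x \<in> mspace (minf S)" using assms by (simp add: mspace_minf)
  have "eventually (\<lambda>z. norm (norm (h z)) \<le> e * norm (mdist (minf S) (Psi x) z)) (atin (mtopology_of (minf S)) (Psi x)) \<longleftrightarrow>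
      (\<exists>r>0. \<forall>y\<in>LS S. 0 < dd x y \<longrightarrow> dd x y < r \<longrightarrow> norm (h (Psi y)) \<le> e * dd x y)" for e
  proof -
    have "eventually (\<lambda>z. norm (norm (h z)) \<le> e * norm (mdist (minf S) (Psi x) z)) (atin (mtopology_of (minf S)) (Psi x)) \<longleftrightarrow>
        (\<exists>r>0. \<forall>z\<in>mspace (minf S). 0 < mdist (minf S) z (Psi x) \<longrightarrow> mdist (minf S) z (Psi x) < r \<longrightarrow>
          norm (h z) \<le> e * mdist (minf S) (Psi x) z)"
      unfolding mtopology_of_def M.eventually_atin_metric using xm by (auto simp: Ball_def)
    also have "\<dots> \<longleftrightarrow> (\<exists>r>0. \<forall>y\<in>LS S. 0 < dd x y \<longrightarrow> dd x y < r \<longrightarrow> norm (h (Psi y)) \<le> e * dd x y)"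
      unfolding mspace_minf ball_simps using assms by (simp add: mdist_minf dd_sym[of _ x])
    finally show ?thesis .
  qed
  then show ?thesis unfolding smallo_def by simp
qed

lemma euclidean_1: "u \<in> mspace (euclidean_k 1) \<Longrightarrow> u = (\<lambda>i. u 0 * (if i = 0 then 1 else 0))"
  by (auto simp: fun_eq_iff)

text \<open>A linear map in dimension 1 is determined by its value at the unit vector, and vertical
  points force this value to be \<open>v\<close>. The restriction to the carrier fixes the map as a
  function.\<close>

lemma chart_derivative_unique:
  fixes F :: "(nat \<Rightarrow> nat \<times> real) \<Rightarrow> 'v::banach"
  assumes x: "x \<in> LS S" and V: "subspace V" "v \<in> V"
    and v: "\<And>e. e > 0 \<Longrightarrow> \<exists>r>0. \<forall>y\<in>LS S. dd x y < r \<longrightarrow> norm (F (Psi y) - F (Psi x) - (snd y - snd x) *\<^sub>R v) \<le> e * dd x y"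
  shows "\<exists>!D. chart_derivative (minf S) 1 height V F (Psi x) D"
proof (rule ex1I)
  let ?K = "mspace (euclidean_k 1)" and ?e = "\<lambda>i::nat. if i = 0 then 1 else 0 :: real"
  define D where "D = restrict (\<lambda>u. u 0 *\<^sub>R v) ?K"
  have hK: "(\<lambda>i. height z i - height (Psi x) i) \<in> ?K" for z by (simp add: height_def)
  show "chart_derivative (minf S) 1 height V F (Psi x) D"
    unfolding chart_derivative_def
    using conjI ballI allI V subspace_scale smallo_minf[OF x] impI v hK mspace_euclidean_k exI by (fastforce simp: linear_k_def D_def scaleR_add_left)
  fix D' assume D': "chart_derivative (minf S) 1 height V F (Psi x) D'"
  then have lin: "D' \<in> ?K \<rightarrow>\<^sub>E V" "\<And>c u. u \<in> ?K \<Longrightarrow> D' (\<lambda>i. c * u i) = c *\<^sub>R D' u"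
    unfolding chart_derivative_def linear_k_def by blast+
  define w where "w = D' ?e"
  have eK: "?e \<in> ?K" by simp
  have D'u: "D' u = u 0 *\<^sub>R w" if "u \<in> ?K" for u
    using lin(2)[OF eK, of "u 0"] euclidean_1[OF that] unfolding w_def by simp
  have o: "\<forall>e>0. \<exists>r>0. \<forall>y\<in>LS S. 0 < dd x y \<longrightarrow> dd x y < r \<longrightarrow>
      norm (F (Psi y) - F (Psi x) - D' (\<lambda>i. height (Psi y) i - height (Psi x) i)) \<le> e * dd x y"
    using D' unfolding chart_derivative_def smallo_minf[OF x] by blast
  have "norm (v - w) \<le> e" if "e > 0" for e
  proof -
    have "e / 2 > 0" using that by simp
    then obtain r where r: "r > 0" "\<And>y. y \<in> LS S \<Longrightarrow> dd x y < r \<Longrightarrow> norm (F (Psi y) - F (Psi x) - (snd y - snd x) *\<^sub>R v) \<le> e / 2 * dd x y"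
      using v by blast
    obtain r' where r': "r' > 0" "\<And>y. y \<in> LS S \<Longrightarrow> 0 < dd x y \<Longrightarrow> dd x y < r' \<Longrightarrow>
        norm (F (Psi y) - F (Psi x) - D' (\<lambda>i. height (Psi y) i - height (Psi x) i)) \<le> e / 2 * dd x y"
      using o \<open>e / 2 > 0\<close> by meson
    obtain y where y: "y \<in> LS S" "dd x y < min r r'" "dd x y = \<bar>snd y - snd x\<bar>" "snd y \<noteq> snd x"
      using vertical_point[OF x, of "min r r'"] r(1) r'(1) by auto
    have Dy: "D' (\<lambda>i. height (Psi y) i - height (Psi x) i) = (snd y - snd x) *\<^sub>R w"
      using D'u[OF hK[of "Psi y"]] by simp
    have "\<bar>snd y - snd x\<bar> * norm (v - w) = norm ((snd y - snd x) *\<^sub>R (v - w))" by simp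
    also have "(snd y - snd x) *\<^sub>R (v - w) = (F (Psi y) - F (Psi x) - (snd y - snd x) *\<^sub>R w) - (F (Psi y) - F (Psi x) - (snd y - snd x) *\<^sub>R v)"
      by (simp add: scaleR_diff_right)
    also have "norm \<dots> \<le> e / 2 * dd x y + e / 2 * dd x y"
      by (rule order_trans[OF norm_triangle_ineq4]) (use r(2)[OF y(1)] r'(2)[OF y(1)] y(2-4) Dy in \<open>auto intro!: add_mono\<close>)
    also have "\<dots> = \<bar>snd y - snd x\<bar> * e" unfolding y(3) by simp
    finally show ?thesis using y(4) by (simp add: mult_le_cancel_left)
  qed
  then have "norm (v - w) \<le> 0" by (rule field_le_epsilon) simp
  then have "w = v" by simp
  show "D' = D"
  proof (rule PiE_ext[OF lin(1)])
    show "D \<in> ?K \<rightarrow>\<^sub>E V" unfolding D_def using V by (auto intro: subspace_scale)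
    show "D' u = D u" if "u \<in> ?K" for u using D'u[OF that] that \<open>w = v\<close> by (simp add: D_def del: mspace_euclidean_k)
  qed
qed

text \<open>The height alone is a chart of the whole space; it is repeated because charts are
  indexed by all natural numbers.\<close>

theorem RNP_structure_minf:
  "RNP_Lipschitz_differentiable_structure (minf S) (muinf S) (\<lambda>_. mspace (minf S)) (\<lambda>_. 1) (\<lambda>_. height)"
  unfolding RNP_Lipschitz_differentiable_structure_def
proof (intro conjI allI impI)
  have sp: "space (muinf S) = mspace (minf S)" by (simp add: muinf_def)
  show "sets (muinf S) = sets (borel_of_metric (minf S))" by simp
  show "mspace (minf S) \<in> sets (muinf S)" using sets.top[of "muinf S"] sp by simp
  show "AE x in muinf S. \<exists>\<alpha>::nat. x \<in> mspace (minf S)" by (rule AE_I2) (simp add: sp)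
  show "Lipschitz_continuous_map (minf S) (euclidean_k 1) height" by (rule Lipschitz_height)
  fix V :: "(nat \<Rightarrow> nat \<times> real) universal_banach set"
  assume V: "closed V \<and> subspace V \<and> RNP V"
  show "differentiable_in_charts (minf S) (muinf S) (\<lambda>_. mspace (minf S)) (\<lambda>_. 1) (\<lambda>_. height) V"
    unfolding differentiable_in_charts_def
  proof (intro allI impI)
    fix F :: "(nat \<Rightarrow> nat \<times> real) \<Rightarrow> (nat \<Rightarrow> nat \<times> real) universal_banach" and \<alpha> :: nat
    assume F: "Lipschitz_continuous_map (minf S) (submetric euclidean_metric V) F"
    then obtain L where L: "L > 0" "\<And>z z'. z \<in> mspace (minf S) \<Longrightarrow> z' \<in> mspace (minf S) \<Longrightarrow> dist (F z) (F z') \<le> L * mdist (minf S) z z'"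
      and FV: "\<And>z. z \<in> mspace (minf S) \<Longrightarrow> F z \<in> V"
      unfolding Lipschitz_continuous_map_pos by auto
    interpret lipschitz_into_RNP S V "\<lambda>x. F (Psi x)" L
    proof
      show "norm (F (Psi x) - F (Psi y)) \<le> L * dd x y" if "x \<in> LS S" "y \<in> LS S" for x y
        using L(2)[of "Psi x" "Psi y"] that mdist_minf[OF that] by (simp add: mspace_minf dist_norm)
    qed (use V FV L(1) in \<open>auto simp: mspace_minf\<close>)
    show "AE x in muinf S. x \<in> mspace (minf S) \<longrightarrow> (\<exists>!D. chart_derivative (minf S) 1 height V F x D)"
      using AE_muinf_near_linear
    proof eventually_elim
      case (elim z)
      then obtain x where x: "x \<in> LS S" "z = Psi x" and P: "\<And>n. \<exists>q\<in>slopes. \<exists>m. near_linear x n q m" by blast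
      obtain v where "v \<in> V" "\<forall>e>0. \<exists>r>0. \<forall>y\<in>LS S. dd x y < r \<longrightarrow> norm (F (Psi y) - F (Psi x) - (snd y - snd x) *\<^sub>R v) \<le> e * dd x y"
        using slope_limit[OF x(1) P] by blast
      then show ?case using chart_derivative_unique[OF x(1), of V v F] V unfolding x(2) by blast
    qed
  qed
qed

theorem theorem1p6:
  assumes "\<not> RNP (UNIV :: 'b::banach set)"
  shows "\<exists>(X :: nat \<Rightarrow> (nat \<times> real) metric_graph) \<pi> \<mu> \<mu>inf.
    admissible_inverse_system X \<pi> \<mu> \<and>
    inverse_limit_measure X \<pi> \<mu> \<mu>inf \<and>
    (\<exists>F. bilipschitz_embedding (inverse_limit_metric X \<pi>) (euclidean_metric :: 'b metric) F) \<and>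
    differentiation_nonembeddability_criterion (inverse_limit_metric X \<pi>) \<mu>inf \<and>
    (AE x in \<mu>inf. \<exists>T. tangent_cone (inverse_limit_metric X \<pi>) x T \<and>
                       (\<forall>k. \<not> bilipschitz_equivalent T (euclidean_k k)))"
proof -
  obtain u :: "nat \<Rightarrow> nat \<Rightarrow> 'b" and \<phi> L \<epsilon> S where
    u: "linear \<phi>" "\<And>v. \<bar>\<phi> v\<bar> \<le> norm v" "\<epsilon> > (0::real)" "infinite S"
    "\<And>i k. k < 4 ^ i \<Longrightarrow> \<phi> (u i k) = 1 / 4 ^ i" "\<And>i k. k < 4 ^ i \<Longrightarrow> norm (u i k) \<le> L / 4 ^ i"
    "\<And>i k. k < 4 ^ i \<Longrightarrow> u i k = (\<Sum>d<4. u (Suc i) (4 * k + d))"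
    "\<And>i k. i \<in> S \<Longrightarrow> k < 4 ^ i \<Longrightarrow> \<exists>\<psi> a. linear \<psi> \<and> (\<forall>v. \<bar>\<psi> v\<bar> \<le> norm v) \<and>
       (\<forall>n r. r < 4 ^ n \<longrightarrow> (a + \<epsilon>) / 4 ^ (Suc i + n) \<le> \<psi> (u (Suc i + n) ((4 * k + 1) * 4 ^ n + r))) \<and>
       (\<forall>n r. r < 4 ^ n \<longrightarrow> \<psi> (u (Suc i + n) ((4 * k + 2) * 4 ^ n + r)) \<le> a / 4 ^ (Suc i + n))"
    by (rule not_RNP_imp_separated_tree[OF assms]) blast
  interpret tree_curve u \<phi> L \<epsilon> S by (rule tree_curve.intro[OF u(1-3,5-8)])
  have m: "inverse_limit_metric (XG S) pj = minf S" by (simp add: minf_def)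
  have cone: "AE x in muinf S. \<exists>T. tangent_cone (minf S) x T \<and> (\<forall>k. \<not> bilipschitz_equivalent T (euclidean_k k))"
    by (rule AE_I2) (use non_euclidean_tangent_cone[OF u(4)] in \<open>simp add: muinf_def\<close>)
  \<comment> \<open>The total mass is positive, so tangent cones cannot be Euclidean almost
    everywhere and have a non-Euclidean one among them almost everywhere.\<close>
  interpret prob_space "muinf S" by (rule prob_space_muinf)
  have "differentiation_nonembeddability_criterion (minf S) (muinf S)"
    unfolding differentiation_nonembeddability_criterion_def
  proof (intro exI conjI notI)
    show "RNP_Lipschitz_differentiable_structure (minf S) (muinf S) (\<lambda>_. mspace (minf S)) (\<lambda>_. 1) (\<lambda>_. height)"
      by (rule RNP_structure_minf)
    assume "AE x in muinf S. \<forall>T. tangent_cone (minf S) x T \<longrightarrow>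
        (\<forall>\<alpha>::nat. x \<in> mspace (minf S) \<longrightarrow> bilipschitz_equivalent T (euclidean_k 1))"
    with cone AE_space[of "muinf S"] have "AE x in muinf S. False"
      by eventually_elim (auto simp: muinf_def)
    then show False by simp
  qed
  moreover have "bilipschitz_embedding (minf S) (euclidean_metric :: 'b metric) (\<lambda>z. emb (inv_into (LS S) Psi z))"
    unfolding bilipschitz_embedding_def
  proof (intro conjI exI[of _ "max (L + 1) (2 * (1 + L) / \<epsilon> + 1)"] ballI)
    define C where "C = max (L + 1) (2 * (1 + L) / \<epsilon> + 1)"
    show pos: "0 < max (L + 1) (2 * (1 + L) / \<epsilon> + 1)" using L_nonneg by simp
    fix z z' assume "z \<in> mspace (minf S)" "z' \<in> mspace (minf S)"
    then obtain x y where x: "x \<in> LS S" "z = Psi x" "y \<in> LS S" "z' = Psi y" by (auto simp: mspace_minf)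
    have inv: "inv_into (LS S) Psi (Psi a) = a" if "a \<in> LS S" for a
      by (rule inv_into_f_f[OF inj_onI[OF Psi_inj] that])
    have "norm (emb x - emb y) \<le> L * dd x y" by (rule emb_upper[OF x(1,3)])
    also have "\<dots> \<le> C * dd x y" using dd_nonneg by (intro mult_right_mono) (auto simp: C_def)
    finally have up: "norm (emb x - emb y) \<le> C * dd x y" .
    have "dd x y \<le> (2 * (1 + L) / \<epsilon> + 1) * norm (emb x - emb y)" by (rule emb_lower[OF x(1,3)])
    also have "\<dots> \<le> C * norm (emb x - emb y)" by (intro mult_right_mono) (auto simp: C_def)
    finally have "dd x y \<le> C * norm (emb x - emb y)" .
    moreover have "0 < C" unfolding C_def by (rule pos)
    ultimately have lower: "dd x y / C \<le> norm (emb x - emb y)" by (simp add: divide_le_eq mult.commute)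
    show "mdist (minf S) z z' / max (L + 1) (2 * (1 + L) / \<epsilon> + 1) \<le> mdist euclidean_metric (emb (inv_into (LS S) Psi z)) (emb (inv_into (LS S) Psi z'))"
      and "mdist euclidean_metric (emb (inv_into (LS S) Psi z)) (emb (inv_into (LS S) Psi z')) \<le> max (L + 1) (2 * (1 + L) / \<epsilon> + 1) * mdist (minf S) z z'"
      using up lower unfolding C_def[symmetric] x(2,4) inv[OF x(1)] inv[OF x(3)] mdist_minf[OF x(1,3)] by (simp_all add: dist_norm)
  qed simp
  ultimately show ?thesis
    using admissible_XG[of S] inverse_limit_measure_XG[of S] cone
    by (intro exI[of _ "XG S"] exI[of _ pj] exI[of _ "mui S"] exI[of _ "muinf S"]) (auto simp: m)
qed

end
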